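(* Let $\mathbb{K}$ be an algebraically closed field of characteristic zero. Let $X=\{f=0\}\subseteq\mathbb{K}^n$ be a rigid hypersurface given by a trinomial $f=T_0^{l_0}+T_1^{l_1}+T_2^{l_2}$ containing no linear term, let $\mathbb{H}$ be the quasitorus associated with $f$, and let $P(f)$ be the permutation group of $f$. Then, regarding $P(f)$ and $\mathbb{H}$ as subgroups of $\mathrm{Aut}(X)$ via their natural actions on $X$, the group $\mathrm{Aut}(X)$ is the semidirect product $$\mathrm{Aut}(X)=P(f)\ltimes\mathbb{H}$$ with $\mathbb{H}$ as the normal factor.
   Context: $\mathrm{Aut}(X)$ is the group of all algebraic automorphisms of $X$. An irreducible affine variety $X$ is rigid if it admits no nontrivial regular action of the additive group $(\mathbb{K},+)$. Trinomials: fix positive integers $n_0,n_1,n_2$, put $n=n_0+n_1+n_2$, and for each $i=0,1,2$ fix a tuple $l_i=(l_{i1},\dots,l_{in_i})\in\mathbb{Z}_{>0}^{n_i}$. Put $T_i^{l_i}:=T_{i1}^{l_{i1}}\cdots T_{in_i}^{l_{in_i}}\in\mathbb{K}[T_{ij};\ i=0,1,2,\ j=1,\dots,n_i]$. A trinomial is a polynomial $f=T_0^{l_0}+T_1^{l_1}+T_2^{l_2}$; its zero set $X$ in $\mathbb{K}^n$ is a trinomial hypersurface (an irreducible normal affine variety with $\mathbb{K}[X]=\mathbb{K}[T_{ij}]/(f)$). "No linear term" means $n_il_{i1}>1$ for $i=0,1,2$. The quasitorus $\mathbb{H}$: let $$L=\begin{bmatrix}-l_0&l_1&0\\-l_0&0&l_2\end{bmatrix}$$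 be the integral $2\times n$ matrix, $L^t$ its transpose, $K:=\mathbb{Z}^n/\mathrm{Im}(L^t)$, and $Q:\mathbb{Z}^n\to K$ the projection. With $e_{ij}$ the standard basis vectors of $\mathbb{Z}^n$, setting $\deg(T_{ij})=w_{ij}:=Q(e_{ij})$ defines a $K$-grading on $\mathbb{K}[T_{ij}]$ for which $f$ is homogeneous, hence a $K$-grading on $\mathbb{K}[X]$. The quasitorus $\mathbb{H}:=\mathrm{Spec}(\mathbb{K}[K])$ has character group $K$, and the grading defines an effective action of $\mathbb{H}$ on $X$. The permutation group $P(f)$ is the group of all permutations $\tau$ of the $n$ variables $T_{ij}$ such that the induced automorphism of $\mathbb{K}[T_{ij}]$ satisfies $\tau(f)=f$; it acts on $X$ by permuting coordinates. *)

theory Defs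
  imports
    "HOL-Algebra.Algebra"
    "HOL-Algebra.Algebraic_Closure_Type"
    "HOL-Combinatorics.Permutations"
    "HOL-Library.Poly_Mapping"
begin

section \<open>Polynomials in several variables\<close>

text \<open>
  Exponent vectors are finitely supported maps from variables to naturals, and polynomials are
  finitely supported maps from exponent vectors to coefficients; the ring structure is the
  convolution structure on \<open>\<Rightarrow>\<^sub>0\<close>. The polynomial ring in a finite set \<open>I\<close> of variables consists
  of those \<open>p\<close> with \<open>mp_vars p \<subseteq> I\<close>.
\<close>

type_synonym ('v, 'a) mp = "('v \<Rightarrow>\<^sub>0 nat) \<Rightarrow>\<^sub>0 'a"

definition mp_const :: "'a::comm_ring_1 \<Rightarrow> ('v, 'a) mp" where
  "mp_const c = Poly_Mapping.single 0 c"

definition mp_var :: "'v \<Rightarrow> ('v, 'a::comm_ring_1) mp" where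
  "mp_var v = Poly_Mapping.single (Poly_Mapping.single v 1) 1"

definition mp_vars :: "('v, 'a::comm_ring_1) mp \<Rightarrow> 'v set" where
  "mp_vars p = (\<Union>m\<in>Poly_Mapping.keys p. Poly_Mapping.keys m)"

definition mp_eval :: "('v \<Rightarrow> 'a) \<Rightarrow> ('v, 'a::comm_ring_1) mp \<Rightarrow> 'a" where
  "mp_eval x p = (\<Sum>m\<in>Poly_Mapping.keys p. Poly_Mapping.lookup p m *
     (\<Prod>v\<in>Poly_Mapping.keys m. x v ^ Poly_Mapping.lookup m v))"

definition mp_subst ::
  "('v \<Rightarrow> ('w, 'a) mp) \<Rightarrow> ('v, 'a::comm_ring_1) mp \<Rightarrow> ('w, 'a) mp" where
  "mp_subst \<sigma> p = (\<Sum>m\<in>Poly_Mapping.keys p. mp_const (Poly_Mapping.lookup p m) *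
     (\<Prod>v\<in>Poly_Mapping.keys m. \<sigma> v ^ Poly_Mapping.lookup m v))"


section \<open>Closed subsets of affine space\<close>

text \<open>
  A point of the affine space with coordinates indexed by \<open>I\<close> is an extensional function on \<open>I\<close>.
\<close>

definition zero_set :: "'v set \<Rightarrow> ('v, 'a::comm_ring_1) mp \<Rightarrow> ('v \<Rightarrow> 'a) set" where
  "zero_set I p = {x \<in> I \<rightarrow>\<^sub>E UNIV. mp_eval x p = 0}"

definition regular_function :: "'v set \<Rightarrow> ('v \<Rightarrow> 'a::comm_ring_1) set \<Rightarrow> (('v \<Rightarrow> 'a) \<Rightarrow> 'a) \<Rightarrow> bool"
  where
  "regular_function I Y g \<longleftrightarrow> (\<exists>p. mp_vars p \<subseteq> I \<and> (\<forall>x\<in>Y. g x = mp_eval x p))"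

definition regular_self_map ::
  "'v set \<Rightarrow> ('v \<Rightarrow> 'a::comm_ring_1) set \<Rightarrow> (('v \<Rightarrow> 'a) \<Rightarrow> ('v \<Rightarrow> 'a)) \<Rightarrow> bool" where
  "regular_self_map I Y \<phi> \<longleftrightarrow>
     \<phi> \<in> Y \<rightarrow> Y \<and> (\<forall>v\<in>I. regular_function I Y (\<lambda>x. \<phi> x v))"

definition Aut_var ::
  "'v set \<Rightarrow> ('v \<Rightarrow> 'a::comm_ring_1) set \<Rightarrow> (('v \<Rightarrow> 'a) \<Rightarrow> ('v \<Rightarrow> 'a)) monoid" where
  "Aut_var I Y = (BijGroup Y)
     \<lparr>carrier := {\<phi> \<in> Bij Y. regular_self_map I Y \<phi> \<and> regular_self_map I Y (inv_into Y \<phi>)}\<rparr>"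

text \<open>
  The product of the affine line with \<open>Y\<close> is embedded in the affine space with coordinates
  indexed by \<open>insert None (Some ` I)\<close>, the coordinate \<open>None\<close> being that of the line. A regular
  action of the additive group is a group action whose action map is a morphism on this product.
\<close>

definition regular_Ga_action ::
  "'v set \<Rightarrow> ('v \<Rightarrow> 'a::field) set \<Rightarrow> ('a \<Rightarrow> ('v \<Rightarrow> 'a) \<Rightarrow> ('v \<Rightarrow> 'a)) \<Rightarrow> bool" where
  "regular_Ga_action I Y \<alpha> \<longleftrightarrow>
     group_action (add_monoid ring_of_type_algebra) Y \<alpha> \<and>
     (\<forall>v\<in>I. regular_function (insert None (Some ` I))
        {case_option s x | s x. x \<in> Y} (\<lambda>z. \<alpha> (z None) (z \<circ> Some) v))"

definition rigid :: "'v set \<Rightarrow> ('v \<Rightarrow> 'a::field) set \<Rightarrow> bool" where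
  "rigid I Y \<longleftrightarrow> (\<forall>\<alpha>. regular_Ga_action I Y \<alpha> \<longrightarrow> (\<forall>s. \<forall>x\<in>Y. \<alpha> s x = x))"


section \<open>Trinomials\<close>

type_synonym idx = "nat \<times> nat"

definition tri_idx :: "(nat \<Rightarrow> nat) \<Rightarrow> idx set" where
  "tri_idx n = (SIGMA i:{0..2}. {1..n i})"

definition trinomial :: "(nat \<Rightarrow> nat) \<Rightarrow> (nat \<Rightarrow> nat \<Rightarrow> nat) \<Rightarrow> (idx, 'a::comm_ring_1) mp" where
  "trinomial n l = (\<Sum>i=0..2. \<Prod>j=1..n i. mp_var (i, j) ^ l i j)"

definition trinomial_hypersurface ::
  "(nat \<Rightarrow> nat) \<Rightarrow> (nat \<Rightarrow> nat \<Rightarrow> nat) \<Rightarrow> (idx \<Rightarrow> 'a::comm_ring_1) set" where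
  "trinomial_hypersurface n l = zero_set (tri_idx n) (trinomial n l)"


section \<open>The permutation group\<close>

definition perm_group :: "'v set \<Rightarrow> ('v, 'a::comm_ring_1) mp \<Rightarrow> ('v \<Rightarrow> 'v) monoid" where
  "perm_group I p =
     \<lparr>carrier = {\<tau>. \<tau> permutes I \<and> mp_subst (\<lambda>v. mp_var (\<tau> v)) p = p},
      monoid.mult = (\<circ>), one = id\<rparr>"

text \<open>
  The inverse makes this a left action: the coordinate of \<open>x\<close> at \<open>v\<close> becomes the coordinate of the
  image at \<open>\<tau> v\<close>.
\<close>

definition perm_action :: "('v \<Rightarrow> 'a) set \<Rightarrow> ('v \<Rightarrow> 'v) \<Rightarrow> ('v \<Rightarrow> 'a) \<Rightarrow> ('v \<Rightarrow> 'a)" where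
  "perm_action Y \<tau> = (\<lambda>x\<in>Y. x \<circ> inv_into UNIV \<tau>)"


section \<open>Group algebras and quasitori\<close>

definition group_algebra :: "('k, 'b) monoid_scheme \<Rightarrow> ('k \<Rightarrow>\<^sub>0 'a::comm_ring_1) ring" where
  "group_algebra G =
     \<lparr>carrier = {a. Poly_Mapping.keys a \<subseteq> carrier G},
      monoid.mult = \<lambda>a b. \<Sum>g\<in>Poly_Mapping.keys a. \<Sum>h\<in>Poly_Mapping.keys b.
        Poly_Mapping.single (g \<otimes>\<^bsub>G\<^esub> h) (Poly_Mapping.lookup a g * Poly_Mapping.lookup b h),
      one = Poly_Mapping.single \<one>\<^bsub>G\<^esub> 1,
      ring.zero = 0,
      ring.add = (+)\<rparr>"

definition group_char :: "'k \<Rightarrow> ('k \<Rightarrow>\<^sub>0 'a::comm_ring_1)" where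
  "group_char g = Poly_Mapping.single g 1"

text \<open>
  The points of the spectrum of the group algebra are its algebra homomorphisms to the ground
  field; the last condition is compatibility with the structure maps of the two algebras.
\<close>

definition quasitorus_points ::
  "('k, 'b) monoid_scheme \<Rightarrow> (('k \<Rightarrow>\<^sub>0 'a::field) \<Rightarrow> 'a) set" where
  "quasitorus_points G =
     {\<phi> \<in> ring_hom (group_algebra G) ring_of_type_algebra \<inter> extensional (carrier (group_algebra G)).
        \<forall>c. \<phi> (Poly_Mapping.single \<one>\<^bsub>G\<^esub> c) = c}"

text \<open>
  The group law comes from the Hopf algebra structure of the group algebra, in which every
  \<open>group_char g\<close> is group-like: the comultiplication sends it to its tensor square and the counit
  sends it to 1.
\<close>

definition quasitorus ::
  "('k, 'b) monoid_scheme \<Rightarrow> (('k \<Rightarrow>\<^sub>0 'a::field) \<Rightarrow> 'a) monoid" where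
  "quasitorus G =
     \<lparr>carrier = quasitorus_points G,
      monoid.mult = \<lambda>\<phi> \<psi>. \<lambda>a\<in>carrier (group_algebra G). \<Sum>g\<in>Poly_Mapping.keys a.
        Poly_Mapping.lookup a g * (\<phi> (group_char g) * \<psi> (group_char g)),
      one = \<lambda>a\<in>carrier (group_algebra G). \<Sum>g\<in>Poly_Mapping.keys a. Poly_Mapping.lookup a g\<rparr>"

text \<open>
  A grading of the coordinate ring by \<open>G\<close> in which the coordinate \<open>v\<close> has degree \<open>w v\<close> gives the
  diagonal action with weights \<open>w\<close>.
\<close>

definition quasitorus_action ::
  "'v set \<Rightarrow> ('v \<Rightarrow> 'a) set \<Rightarrow> ('v \<Rightarrow> 'k) \<Rightarrow> (('k \<Rightarrow>\<^sub>0 'a::field) \<Rightarrow> 'a) \<Rightarrow> ('v \<Rightarrow> 'a) \<Rightarrow> ('v \<Rightarrow> 'a)"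
  where
  "quasitorus_action I Y w \<phi> = (\<lambda>x\<in>Y. \<lambda>v\<in>I. \<phi> (group_char (w v)) * x v)"


section \<open>The grading group of a trinomial\<close>

text \<open>
  The matrix \<open>L\<close> has rows indexed by 1, 2 and columns indexed by \<open>tri_idx n\<close>.
\<close>

definition tri_matrix :: "(nat \<Rightarrow> nat \<Rightarrow> nat) \<Rightarrow> nat \<Rightarrow> idx \<Rightarrow> int" where
  "tri_matrix l r = (\<lambda>(i, j). if i = 0 then - int (l 0 j) else if i = r then int (l i j) else 0)"

definition tri_lattice_image :: "(nat \<Rightarrow> nat) \<Rightarrow> (nat \<Rightarrow> nat \<Rightarrow> nat) \<Rightarrow> (idx \<Rightarrow>\<^sub>0 int) set" where
  "tri_lattice_image n l =
     range (\<lambda>u :: nat \<Rightarrow> int. \<Sum>v\<in>tri_idx n. Poly_Mapping.single v (\<Sum>r=1..2. tri_matrix l r v * u r))"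

definition tri_class_group ::
  "(nat \<Rightarrow> nat) \<Rightarrow> (nat \<Rightarrow> nat \<Rightarrow> nat) \<Rightarrow> (idx \<Rightarrow>\<^sub>0 int) set monoid" where
  "tri_class_group n l = free_Abelian_group (tri_idx n) Mod tri_lattice_image n l"

definition tri_weight ::
  "(nat \<Rightarrow> nat) \<Rightarrow> (nat \<Rightarrow> nat \<Rightarrow> nat) \<Rightarrow> idx \<Rightarrow> (idx \<Rightarrow>\<^sub>0 int) set" where
  "tri_weight n l v = tri_lattice_image n l #>\<^bsub>free_Abelian_group (tri_idx n)\<^esub> frag_of v"


section \<open>Internal semidirect products\<close>

definition internal_semidirect :: "('g, 'b) monoid_scheme \<Rightarrow> 'g set \<Rightarrow> 'g set \<Rightarrow> bool" where
  "internal_semidirect G P N \<longleftrightarrow>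
     group G \<and> subgroup P G \<and> N \<lhd> G \<and> P <#>\<^bsub>G\<^esub> N = carrier G \<and> P \<inter> N = {\<one>\<^bsub>G\<^esub>}"

end

theory Submission
  imports Defs "HOL-Library.Function_Algebras"
begin

text \<open>
  The Euler derivation of a conjugated torus splits into homogeneous components for the original
  torus, and a component of extremal nonzero degree is locally nilpotent; it would integrate to an
  action of the additive group. Hence on a rigid \<open>Y\<close> any automorphic image of a one-parameter group
  \<open>t\<close> of the torus commutes with the torus. An automorphism commuting with the torus is monomial:
  the equation \<open>f \<circ> \<phi> = c f\<close> lifts to affine space, and it leaves only the freedom of linear
  substitutions preserving a Fermat form (quadratic ones would contradict rigidity). As the
  multiplicative group is divisible, the conjugate of \<open>t\<close> is then diagonal, so an arbitrary
  automorphism \<open>\<phi>\<close> sends coordinates to semi-invariants. Its linear part at the origin is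
  invertible and singles out a permutation of the coordinates matching weights; the permutation
  preserves the lattice of cocharacters and hence the trinomial. After composing with it, \<open>\<phi>\<close>
  commutes with the torus and is monomial.
\<close>


section \<open>Algebras with derivations and gradings\<close>

text \<open>Two groups act diagonally: \<open>torus\<close>, generated by one-parameter groups, and
  \<open>big_torus\<close>, the full quasitorus. Conjugation arguments reach only the former, since
  they run through integer gradings. Its weights fix exponents only up to rational multiples of the
  block exponents and need not isolate a variable whose block is a single power; roots of unity in
  \<open>big_torus\<close> restore the lost congruences. The coordinate ring is a set of functions
  on points, so facts about the ideal of \<open>Y\<close> are extracted from points as well:
  splitting a polynomial into characters at a generic point shows that one vanishing on
  \<open>Y\<close> has no linear part, and that one which also has the weight of the trinomial is a
  multiple of it. The former rests on the absence of linear terms and makes the linear part at the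
  origin well defined. Commutation holds because the Euler derivation of the conjugated group is
  left with degree 0 only, so every original weight space splits into its eigenvectors. Divisibility
  enters through \<open>N\<close>-th roots: each element of the conjugated one-parameter group is
  the \<open>N\<close>-th power of a monomial map, where \<open>N\<close> kills all permutations of
  the variables.\<close>

locale algebra_on = vector_space scale
  for scale :: "'k::field_char_0 \<Rightarrow> 'r::comm_ring \<Rightarrow> 'r" (infixr "*s" 75) +
  fixes R :: "'r set"
  assumes sub_R: "subspace R"
    and mult_R: "a \<in> R \<Longrightarrow> b \<in> R \<Longrightarrow> a * b \<in> R"
    and scale_mult: "(c *s a) * b = c *s (a * b)"
begin

lemma mult_scale: "a * (c *s b) = c *s (a * b)"
  using scale_mult[of c b a] by (simp add: mult.commute)

lemma R_add: "a \<in> R \<Longrightarrow> b \<in> R \<Longrightarrow> a + b \<in> R"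
  and R_scale: "a \<in> R \<Longrightarrow> c *s a \<in> R"
  and R_0: "0 \<in> R"
  and R_diff: "a \<in> R \<Longrightarrow> b \<in> R \<Longrightarrow> a - b \<in> R"
  and R_sum: "(\<And>i. i \<in> J \<Longrightarrow> g i \<in> R) \<Longrightarrow> sum g J \<in> R"
  using sub_R by (auto intro: subspace_add subspace_scale subspace_0 subspace_diff subspace_sum)

definition derivation :: "('r \<Rightarrow> 'r) \<Rightarrow> bool" where
  "derivation D \<longleftrightarrow> (\<forall>a\<in>R. D a \<in> R) \<and> (\<forall>a\<in>R. \<forall>b\<in>R. D (a + b) = D a + D b) \<and>
    (\<forall>c. \<forall>a\<in>R. D (c *s a) = c *s D a) \<and> (\<forall>a\<in>R. \<forall>b\<in>R. D (a * b) = D a * b + a * D b)"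

definition locally_nilpotent :: "('r \<Rightarrow> 'r) \<Rightarrow> bool" where
  "locally_nilpotent D \<longleftrightarrow> (\<forall>a\<in>R. \<exists>m. (D ^^ m) a = 0)"

lemma
  assumes "derivation D"
  shows der_R: "a \<in> R \<Longrightarrow> D a \<in> R"
    and der_add: "a \<in> R \<Longrightarrow> b \<in> R \<Longrightarrow> D (a + b) = D a + D b"
    and der_scale: "a \<in> R \<Longrightarrow> D (c *s a) = c *s D a"
    and der_mult: "a \<in> R \<Longrightarrow> b \<in> R \<Longrightarrow> D (a * b) = D a * b + a * D b"
  using assms by (auto simp: derivation_def)

lemma der_0: "derivation D \<Longrightarrow> D 0 = 0"
  using der_scale[of D 0 0] R_0 by simp

lemma der_sum: "derivation D \<Longrightarrow> (\<And>i. i \<in> J \<Longrightarrow> g i \<in> R) \<Longrightarrow> D (sum g J) = (\<Sum>i\<in>J. D (g i))"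
proof (induction J rule: infinite_finite_induct)
  case (insert x F)
  then show ?case by (simp add: der_add R_sum)
qed (auto simp: der_0)

lemma der_pow_R: "derivation D \<Longrightarrow> a \<in> R \<Longrightarrow> (D ^^ m) a \<in> R"
  by (induction m) (auto simp: der_R)

lemma der_pow_add: "derivation D \<Longrightarrow> a \<in> R \<Longrightarrow> b \<in> R \<Longrightarrow> (D ^^ m) (a + b) = (D ^^ m) a + (D ^^ m) b"
  by (induction m) (auto simp: der_add der_pow_R)

lemma der_pow_0: "derivation D \<Longrightarrow> (D ^^ m) 0 = 0"
  by (induction m) (auto simp: der_0)

lemma der_pow_ge: "derivation D \<Longrightarrow> (D ^^ m) a = 0 \<Longrightarrow> m \<le> k \<Longrightarrow> (D ^^ k) a = 0"
  by (metis der_pow_0 funpow_add le_Suc_ex add.commute comp_apply)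

text \<open>The iterated Leibniz rule. The induction step is Pascal's rule: one of the two sums is
  shifted by one index, and both are padded with a zero coefficient to the range up to
  \<open>Suc m\<close>.\<close>

lemma der_pow_mult:
  assumes D: "derivation D" and ab: "a \<in> R" "b \<in> R"
  shows "(D ^^ m) (a * b) = (\<Sum>i\<le>m. of_nat (m choose i) *s ((D ^^ i) a * (D ^^ (m - i)) b))"
proof (induction m)
  case (Suc m)
  let ?t = "\<lambda>i j. (D ^^ i) a * (D ^^ j) b"
  have R: "?t i j \<in> R" for i j using D ab by (simp add: der_pow_R mult_R)
  have "(D ^^ Suc m) (a * b) = D (\<Sum>i\<le>m. of_nat (m choose i) *s ?t i (m - i))"
    using Suc by simp
  also have "\<dots> = (\<Sum>i\<le>m. of_nat (m choose i) *s (?t (Suc i) (m - i) + ?t i (Suc (m - i))))"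
    using D R ab by (simp add: der_sum der_scale R_scale der_mult der_pow_R)
  also have "\<dots> = (\<Sum>i\<le>m. of_nat (m choose i) *s ?t (Suc i) (m - i)) + (\<Sum>i\<le>m. of_nat (m choose i) *s ?t i (Suc m - i))"
    by (simp add: scale_right_distrib sum.distrib Suc_diff_le)
  also have "(\<Sum>i\<le>m. of_nat (m choose i) *s ?t (Suc i) (m - i)) = (\<Sum>i\<in>{1..Suc m}. of_nat (m choose (i - 1)) *s ?t i (Suc m - i))"
    by (rule sum.reindex_bij_witness[of _ "\<lambda>i. i - 1" Suc]) auto
  also have "\<dots> = (\<Sum>i\<le>Suc m. of_nat (if i = 0 then 0 else m choose (i - 1)) *s ?t i (Suc m - i))"
    by (rule sum.mono_neutral_cong_left) auto
  also have "(\<Sum>i\<le>m. of_nat (m choose i) *s ?t i (Suc m - i)) = (\<Sum>i\<le>Suc m. of_nat (m choose i) *s ?t i (Suc m - i))"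
    by simp
  also have "(\<Sum>i\<le>Suc m. of_nat (if i = 0 then 0 else m choose (i - 1)) *s ?t i (Suc m - i)) + (\<Sum>i\<le>Suc m. of_nat (m choose i) *s ?t i (Suc m - i))
     = (\<Sum>i\<le>Suc m. of_nat (Suc m choose i) *s ?t i (Suc m - i))"
    unfolding sum.distrib[symmetric] scale_left_distrib[symmetric] of_nat_add[symmetric]
    by (rule sum.cong) (auto simp: gr0_conv_Suc split: nat.splits if_splits)
  finally show ?case .
qed auto

section \<open>Exponentials of locally nilpotent derivations\<close>

definition nil_order :: "('r \<Rightarrow> 'r) \<Rightarrow> 'r \<Rightarrow> nat" where
  "nil_order D a = (LEAST m. (D ^^ m) a = 0)"

definition exp_der :: "('r \<Rightarrow> 'r) \<Rightarrow> 'k \<Rightarrow> 'r \<Rightarrow> 'r" where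
  "exp_der D s a = (\<Sum>k<nil_order D a. (s ^ k / fact k) *s (D ^^ k) a)"

lemma exp_der_eq:
  assumes D: "derivation D" and N: "(D ^^ N) a = 0"
  shows "exp_der D s a = (\<Sum>k<N. (s ^ k / fact k) *s (D ^^ k) a)"
proof -
  have 1: "nil_order D a \<le> N" unfolding nil_order_def using N by (rule Least_le)
  have "(D ^^ nil_order D a) a = 0" unfolding nil_order_def using N by (rule LeastI)
  then have "(D ^^ k) a = 0" if "k \<ge> nil_order D a" for k using der_pow_ge[OF D] that by blast
  then show ?thesis unfolding exp_der_def using 1
    by (intro sum.mono_neutral_left) auto
qed

lemma exp_der_R: "derivation D \<Longrightarrow> a \<in> R \<Longrightarrow> exp_der D s a \<in> R"
  unfolding exp_der_def by (intro R_sum R_scale der_pow_R)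

context
  fixes D assumes D: "derivation D" and LN: "locally_nilpotent D"
begin

lemma lnE: assumes "a \<in> R" obtains m where "\<And>k. k \<ge> m \<Longrightarrow> (D ^^ k) a = 0"
  using LN assms D der_pow_ge unfolding locally_nilpotent_def by metis

lemma exp_der_add: assumes "a \<in> R" "b \<in> R" shows "exp_der D s (a + b) = exp_der D s a + exp_der D s b"
proof -
  obtain m1 m2 where m: "\<And>k. k \<ge> m1 \<Longrightarrow> (D ^^ k) a = 0" "\<And>k. k \<ge> m2 \<Longrightarrow> (D ^^ k) b = 0"
    using lnE assms by metis
  let ?N = "max m1 m2"
  have "(D ^^ ?N) a = 0" "(D ^^ ?N) b = 0" "(D ^^ ?N) (a+b) = 0" using m D assms by (auto simp: der_pow_add)
  then show ?thesis
    using D assms by (simp add: exp_der_eq[where N="?N"] der_pow_add scale_right_distrib sum.distrib)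
qed

text \<open>A Cauchy product: the double terms range over the triangle
  \<open>i + j < m1 + m2\<close>, and those outside the rectangle \<open>m1\<close> by
  \<open>m2\<close> vanish, which leaves the product of the two finite sums.\<close>

lemma exp_der_mult: assumes ab: "a \<in> R" "b \<in> R" shows "exp_der D s (a * b) = exp_der D s a * exp_der D s b"
proof -
  obtain m1 m2 where m: "\<And>k. k \<ge> m1 \<Longrightarrow> (D ^^ k) a = 0" "\<And>k. k \<ge> m2 \<Longrightarrow> (D ^^ k) b = 0"
    using lnE assms by metis
  let ?N = "m1 + m2"
  define t where "t = (\<lambda>(i,j). (s ^ (i + j) / (fact i * fact j)) *s ((D ^^ i) a * (D ^^ j) b))"
  have t0: "t (i, j) = 0" if "i \<ge> m1 \<or> j \<ge> m2" for i j
    using that m(1)[of i] m(2)[of j] by (auto simp del: funpow.simps simp: t_def)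
  have z: "(D ^^ ?N) (a * b) = 0"
    unfolding der_pow_mult[OF D ab]
  proof (rule sum.neutral, safe)
    fix i assume "i \<le> ?N"
    have "i \<ge> m1 \<or> ?N - i \<ge> m2" by auto
    then show "of_nat (?N choose i) *s ((D ^^ i) a * (D ^^ (?N - i)) b) = 0" using m by auto
  qed
  have "exp_der D s (a * b) = (\<Sum>k<?N. (s ^ k / fact k) *s (D ^^ k) (a * b))"
    by (rule exp_der_eq[OF D z])
  also have "\<dots> = (\<Sum>k<?N. \<Sum>i\<le>k. t (i, k - i))"
  proof (rule sum.cong[OF refl])
    fix k
    have *: "s ^ k * of_nat (k choose i) / fact k = s ^ k / (fact i * fact (k - i))" if "i \<le> k" for i
      using that by (simp add: binomial_fact field_simps)
    show "(s ^ k / fact k) *s (D ^^ k) (a * b) = (\<Sum>i\<le>k. t (i, k - i))"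
      unfolding der_pow_mult[OF D ab] scale_sum_right t_def
      by (rule sum.cong) (auto simp: *)
  qed
  also have "\<dots> = (\<Sum>(k,i)\<in>Sigma {..<?N} (\<lambda>k. {..k}). t (i, k - i))"
    by (subst sum.Sigma) auto
  also have "\<dots> = (\<Sum>p\<in>{p. fst p + snd p < ?N}. t p)"
    by (rule sum.reindex_bij_witness[of _ "\<lambda>(i,j). (i+j,i)" "\<lambda>(k,i). (i,k-i)"]) auto
  also have "\<dots> = (\<Sum>p\<in>{..<m1} \<times> {..<m2}. t p)"
  proof (rule sum.mono_neutral_right)
    have "{p. fst p + snd p < ?N} \<subseteq> {..<?N} \<times> {..<?N}" by auto
    then show "finite {p. fst p + snd p < ?N}" using finite_subset by blast
  qed (auto intro: t0)
  also have "\<dots> = (\<Sum>i<m1. \<Sum>j<m2. t (i,j))" by (simp add: sum.cartesian_product)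
  also have "\<dots> = (\<Sum>i<m1. (s ^ i / fact i) *s (D ^^ i) a) * (\<Sum>j<m2. (s ^ j / fact j) *s (D ^^ j) b)"
    unfolding sum_product t_def by (simp add: scale_mult mult_scale power_add mult.commute)
  also have "\<dots> = exp_der D s a * exp_der D s b"
    using m[of m1] m(2)[of m2] by (simp add: exp_der_eq[OF D])
  finally show ?thesis .
qed

text \<open>Here the square of double terms is cut down to the triangle \<open>i + k < m\<close>,
  whose diagonals are summed by the binomial theorem.\<close>

lemma exp_der_exp: assumes a: "a \<in> R" shows "exp_der D s (exp_der D t a) = exp_der D (s + t) a"
proof -
  obtain m where m: "\<And>k. k \<ge> m \<Longrightarrow> (D ^^ k) a = 0" using lnE assms by metis
  have pw: "(D ^^ i) (\<Sum>k<m. (t ^ k / fact k) *s (D ^^ k) a) = (\<Sum>k<m. (t ^ k / fact k) *s (D ^^ (i + k)) a)" for i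
  proof (induction i)
    case (Suc i)
    then show ?case using D a by (simp add: der_sum R_scale der_pow_R der_scale)
  qed simp
  have z: "(D ^^ m) (\<Sum>k<m. (t ^ k / fact k) *s (D ^^ k) a) = 0"
    unfolding pw using m by simp
  define q where "q = (\<lambda>(i,k). (s ^ i / fact i * (t ^ k / fact k)) *s (D ^^ (i + k)) a)"
  have q0: "q (i, k) = 0" if "i + k \<ge> m" for i k using that m by (auto simp: q_def)
  have "exp_der D s (exp_der D t a) = (\<Sum>i<m. \<Sum>k<m. q (i, k))"
    using m[of m] z by (simp add: exp_der_eq[OF D, where N=m] pw scale_sum_right q_def)
  also have "\<dots> = (\<Sum>p\<in>{..<m} \<times> {..<m}. q p)" by (simp add: sum.cartesian_product)
  also have "\<dots> = (\<Sum>p\<in>{p. fst p + snd p < m}. q p)"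
    by (rule sum.mono_neutral_right) (auto intro!: q0)
  also have "\<dots> = (\<Sum>(k,i)\<in>Sigma {..<m} (\<lambda>k. {..k}). q (i, k - i))"
    by (rule sum.reindex_bij_witness[of _  "\<lambda>(k,i). (i,k-i)" "\<lambda>(i,j). (i+j,i)"]) auto
  also have "\<dots> = (\<Sum>k<m. \<Sum>i\<le>k. q (i, k - i))" by (subst sum.Sigma) auto
  also have "\<dots> = (\<Sum>k<m. ((s + t) ^ k / fact k) *s (D ^^ k) a)"
  proof (rule sum.cong[OF refl])
    fix k
    have *: "s ^ i / fact i * (t ^ (k - i) / fact (k - i)) = of_nat (k choose i) * s ^ i * t ^ (k - i) / fact k" if "i \<le> k" for i
      using that by (simp add: binomial_fact field_simps)
    show "(\<Sum>i\<le>k. q (i, k - i)) = ((s + t) ^ k / fact k) *s (D ^^ k) a"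
      unfolding binomial_ring sum_divide_distrib scale_sum_left q_def
      using * by (intro sum.cong) auto
  qed
  also have "\<dots> = exp_der D (s + t) a" using m[of m] by (simp add: exp_der_eq[OF D])
  finally show ?thesis .
qed

lemma exp_der_zero: assumes "a \<in> R" shows "exp_der D 0 a = a"
proof -
  obtain m where m: "\<And>k. k \<ge> m \<Longrightarrow> (D ^^ k) a = 0" using lnE assms by metis
  have "exp_der D 0 a = (\<Sum>k<Suc m. (0 ^ k / fact k) *s (D ^^ k) a)"
    using m[of "Suc m"] by (intro exp_der_eq D) auto
  also have "\<dots> = (\<Sum>k\<in>{0}. (0 ^ k / fact k) *s (D ^^ k) a)"
    by (rule sum.mono_neutral_right) auto
  finally show ?thesis by simp
qed

end

section \<open>Gradings by the integers and Euler derivations\<close>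

definition grading :: "(int \<Rightarrow> 'r set) \<Rightarrow> bool" where
  "grading G \<longleftrightarrow> (\<forall>w. subspace (G w) \<and> G w \<subseteq> R) \<and>
    (\<forall>v w. \<forall>a\<in>G v. \<forall>b\<in>G w. a * b \<in> G (v + w)) \<and>
    (\<forall>a\<in>R. \<exists>h. finite {w. h w \<noteq> 0} \<and> (\<forall>w. h w \<in> G w) \<and> a = (\<Sum>w | h w \<noteq> 0. h w)) \<and>
    (\<forall>W h. finite W \<longrightarrow> (\<forall>w\<in>W. h w \<in> G w) \<longrightarrow> sum h W = 0 \<longrightarrow> (\<forall>w\<in>W. h w = 0))"

text \<open>For elements of \<open>R\<close> the choice is immaterial: by the independence clause of
  \<open>grading\<close> two homogeneous decompositions agree, which is what
  \<open>comp_unique\<close> exploits.\<close>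

definition comp :: "(int \<Rightarrow> 'r set) \<Rightarrow> 'r \<Rightarrow> int \<Rightarrow> 'r" where
  "comp G a = (SOME h. finite {w. h w \<noteq> 0} \<and> (\<forall>w. h w \<in> G w) \<and> a = (\<Sum>w | h w \<noteq> 0. h w))"

definition supp :: "(int \<Rightarrow> 'r set) \<Rightarrow> 'r \<Rightarrow> int set" where
  "supp G a = {w. comp G a w \<noteq> 0}"

text \<open>When the \<open>G w\<close> are the weight spaces of a one-parameter group, this is the
  derivation generating that group.\<close>

definition euler :: "(int \<Rightarrow> 'r set) \<Rightarrow> 'r \<Rightarrow> 'r" where
  "euler G a = (\<Sum>w\<in>supp G a. of_int w *s comp G a w)"

context
  fixes G assumes G: "grading G"
begin

lemma G_sub: "subspace (G w)" and G_R: "a \<in> G w \<Longrightarrow> a \<in> R"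
  and G_mult: "a \<in> G v \<Longrightarrow> b \<in> G w \<Longrightarrow> a * b \<in> G (v + w)"
  and G_indep: "finite W \<Longrightarrow> (\<And>w. w \<in> W \<Longrightarrow> h w \<in> G w) \<Longrightarrow> sum h W = 0 \<Longrightarrow> w \<in> W \<Longrightarrow> h w = 0"
proof -
  note G' = G[unfolded grading_def]
  show "subspace (G w)" using G'[THEN conjunct1] by blast
  show "a \<in> G w \<Longrightarrow> a \<in> R" using G'[THEN conjunct1] by blast
  show "a \<in> G v \<Longrightarrow> b \<in> G w \<Longrightarrow> a * b \<in> G (v + w)" using G'[THEN conjunct2, THEN conjunct1] by blast
  assume "finite W" "\<And>w. w \<in> W \<Longrightarrow> h w \<in> G w" "sum h W = 0" "w \<in> W"
  then show "h w = 0"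
    using G[unfolded grading_def, THEN conjunct2, THEN conjunct2, THEN conjunct2, rule_format, of W h w] by blast
qed

lemma G_0: "0 \<in> G w" using G_sub subspace_0 by blast

lemma
  assumes "a \<in> R"
  shows finite_supp: "finite (supp G a)" and comp_G: "comp G a w \<in> G w"
    and comp_sum: "(\<Sum>w\<in>supp G a. comp G a w) = a"
proof -
  have "\<exists>h. finite {w. h w \<noteq> 0} \<and> (\<forall>w. h w \<in> G w) \<and> a = (\<Sum>w | h w \<noteq> 0. h w)"
    using G[unfolded grading_def, THEN conjunct2, THEN conjunct2, THEN conjunct1] assms by (rule bspec)
  note * = someI_ex[OF this, folded comp_def, folded supp_def]
  show "finite (supp G a)" by (rule *[THEN conjunct1])
  show "comp G a w \<in> G w" by (rule *[THEN conjunct2, THEN conjunct1, THEN spec])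
  show "(\<Sum>w\<in>supp G a. comp G a w) = a" by (rule *[THEN conjunct2, THEN conjunct2, symmetric])
qed

lemma comp_R: "a \<in> R \<Longrightarrow> comp G a w \<in> R"
  using comp_G G_R by blast

lemma comp_sum':
  assumes "a \<in> R" "finite W" "supp G a \<subseteq> W" shows "(\<Sum>w\<in>W. comp G a w) = a"
proof -
  have "(\<Sum>w\<in>supp G a. comp G a w) = (\<Sum>w\<in>W. comp G a w)"
    using assms(2,3) by (intro sum.mono_neutral_left) (auto simp: supp_def)
  with comp_sum[OF assms(1)] show ?thesis by simp
qed

lemma comp_unique:
  assumes W: "finite W" and h: "\<And>w. w \<in> W \<Longrightarrow> h w \<in> G w" and a: "a = sum h W"
  shows "comp G a w = (if w \<in> W then h w else 0)"
proof -
  have aR: "a \<in> R" unfolding a using h G_R by (intro R_sum) blast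
  let ?h = "\<lambda>w. if w \<in> W then h w else 0"
  let ?U = "W \<union> supp G a"
  have U: "finite ?U" using W finite_supp[OF aR] by auto
  have hG: "?h v \<in> G v" for v using h G_0 by auto
  have "sum ?h ?U = sum h W" using U by (auto intro: sum.mono_neutral_cong_right)
  then have "(\<Sum>v\<in>?U. comp G a v - ?h v) = 0"
    using comp_sum'[OF aR U] a by (simp add: sum_subtractf)
  moreover have "comp G a v - ?h v \<in> G v" for v
    by (intro subspace_diff G_sub comp_G aR hG)
  ultimately have "v \<in> ?U \<Longrightarrow> comp G a v - ?h v = 0" for v
    using G_indep[OF U, of "\<lambda>v. comp G a v - ?h v"] by blast
  then show ?thesis by (cases "w \<in> ?U") (auto simp: supp_def)
qed

lemma comp_hom: "a \<in> G w \<Longrightarrow> comp G a v = (if v = w then a else 0)"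
  using comp_unique[of "{w}" "\<lambda>_. a" a v] by auto

lemma comp_add:
  assumes "a \<in> R" "b \<in> R" shows "comp G (a + b) w = comp G a w + comp G b w"
proof -
  let ?U = "supp G a \<union> supp G b"
  have U: "finite ?U" using assms finite_supp by auto
  have "comp G (a + b) w = (if w \<in> ?U then comp G a w + comp G b w else 0)"
    using assms U comp_sum'[OF assms(1) U] comp_sum'[OF assms(2) U]
    by (intro comp_unique) (auto simp: sum.distrib intro: subspace_add[OF G_sub] comp_G)
  then show ?thesis by (auto simp: supp_def)
qed

lemma comp_scale:
  assumes "a \<in> R" shows "comp G (c *s a) w = c *s comp G a w"
proof -
  have "comp G (c *s a) w = (if w \<in> supp G a then c *s comp G a w else 0)"
    using assms comp_sum[OF assms(1)] finite_supp[OF assms]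
    by (intro comp_unique) (auto simp: scale_sum_right[symmetric] intro: subspace_scale[OF G_sub] comp_G)
  then show ?thesis by (auto simp: supp_def)
qed

lemma comp_0: "comp G 0 w = 0" using comp_hom[OF G_0[of w], of w] by simp

lemma comp_diff: "a \<in> R \<Longrightarrow> b \<in> R \<Longrightarrow> comp G (a - b) w = comp G a w - comp G b w"
  using comp_add[of a "(-1) *s b" w] comp_scale[of b "-1" w] R_scale[of b "-1"] by simp

lemma comp_sum_fun: "(\<And>i. i \<in> J \<Longrightarrow> g i \<in> R) \<Longrightarrow> comp G (sum g J) w = (\<Sum>i\<in>J. comp G (g i) w)"
proof (induction J rule: infinite_finite_induct)
  case (insert x F)
  then show ?case by (simp add: comp_add R_sum)
qed (auto simp: comp_0)

lemma comp_eqI: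
  assumes "a \<in> R" "\<And>v. v \<noteq> w \<Longrightarrow> comp G a v = 0" shows "a \<in> G w"
proof -
  have "(\<Sum>v\<in>{w}. comp G a v) = a"
    using assms by (intro comp_sum') (auto simp: supp_def)
  then show ?thesis using comp_G[OF assms(1), of w] by simp
qed

lemma comp_mult_hom:
  assumes a: "a \<in> R" and b: "b \<in> G k" shows "comp G (a * b) (w + k) = comp G a w * b"
proof -
  let ?W = "(\<lambda>w. w + k) ` supp G a"
  have "comp G (a * b) (w + k) = (if w + k \<in> ?W then comp G a (w + k - k) * b else 0)"
  proof (rule comp_unique)
    show "finite ?W" using finite_supp a by auto
    show "comp G a (v - k) * b \<in> G v" if "v \<in> ?W" for v
      using G_mult[OF comp_G[OF a, of "v - k"] b] by simp
    show "a * b = (\<Sum>w\<in>?W. comp G a (w - k) * b)"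
      by (subst sum.reindex) (auto simp: inj_on_def sum_distrib_right[symmetric] comp_sum[OF a])
  qed
  then show ?thesis by (auto simp: supp_def)
qed

text \<open>Both sides expand into sums over pairs of homogeneous components, so an identity such as
  a Leibniz rule needs checking on homogeneous elements only.\<close>

lemma biadditive_eq:
  assumes P: "\<And>a a' b. a \<in> R \<Longrightarrow> a' \<in> R \<Longrightarrow> b \<in> R \<Longrightarrow> P (a + a') b = P a b + (P a' b :: 'r)"
    "\<And>a b b'. a \<in> R \<Longrightarrow> b \<in> R \<Longrightarrow> b' \<in> R \<Longrightarrow> P a (b + b') = P a b + P a b'"
    and Q: "\<And>a a' b. a \<in> R \<Longrightarrow> a' \<in> R \<Longrightarrow> b \<in> R \<Longrightarrow> Q (a + a') b = Q a b + Q a' b"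
    "\<And>a b b'. a \<in> R \<Longrightarrow> b \<in> R \<Longrightarrow> b' \<in> R \<Longrightarrow> Q a (b + b') = Q a b + Q a b'"
    and hom: "\<And>a b v w. a \<in> G v \<Longrightarrow> b \<in> G w \<Longrightarrow> P a b = Q a b"
    and ab: "a \<in> R" "b \<in> R"
  shows "P a b = Q a b"
proof -
  have z1: "P 0 b = 0" "Q 0 b = 0" if "b \<in> R" for b
    using P(1)[of 0 0 b] Q(1)[of 0 0 b] that R_0 by auto
  have z2: "P a 0 = 0" "Q a 0 = 0" if "a \<in> R" for a
    using P(2)[of a 0 0] Q(2)[of a 0 0] that R_0 by auto
  have s1: "P (sum g W) b = (\<Sum>w\<in>W. P (g w) b) \<and> Q (sum g W) b = (\<Sum>w\<in>W. Q (g w) b)"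
    if "\<And>w. g w \<in> R" "b \<in> R" for g and W :: "int set" and b
    by (induction W rule: infinite_finite_induct) (auto simp: z1 that P Q R_sum)
  have s2: "P a (sum g W) = (\<Sum>w\<in>W. P a (g w)) \<and> Q a (sum g W) = (\<Sum>w\<in>W. Q a (g w))"
    if "\<And>w. g w \<in> R" "a \<in> R" for g and W :: "int set" and a
    by (induction W rule: infinite_finite_induct) (auto simp: z2 that P Q R_sum)
  let ?a = "comp G a" and ?b = "comp G b"
  have R: "?a v \<in> R" "?b v \<in> R" "sum ?b W \<in> R" for v W
    using ab comp_R by (auto intro!: R_sum)
  have P': "P (sum ?a (supp G a)) (sum ?b (supp G b)) = (\<Sum>v\<in>supp G a. \<Sum>w\<in>supp G b. P (?a v) (?b w))"
    and Q': "Q (sum ?a (supp G a)) (sum ?b (supp G b)) = (\<Sum>v\<in>supp G a. \<Sum>w\<in>supp G b. Q (?a v) (?b w))"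
    using s1[of ?a "sum ?b (supp G b)"] s2[of ?b] R by auto
  have "(\<Sum>v\<in>supp G a. \<Sum>w\<in>supp G b. P (?a v) (?b w)) = (\<Sum>v\<in>supp G a. \<Sum>w\<in>supp G b. Q (?a v) (?b w))"
    using hom comp_G ab by (intro sum.cong refl) blast
  then show ?thesis using P' Q' unfolding comp_sum[OF ab(1)] comp_sum[OF ab(2)] by simp
qed

lemma euler_sum: "a \<in> R \<Longrightarrow> finite W \<Longrightarrow> supp G a \<subseteq> W \<Longrightarrow> euler G a = (\<Sum>w\<in>W. of_int w *s comp G a w)"
  unfolding euler_def by (rule sum.mono_neutral_left) (auto simp: supp_def)

lemma euler_hom: "a \<in> G w \<Longrightarrow> euler G a = of_int w *s a"
proof -
  assume a: "a \<in> G w"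
  have "supp G a \<subseteq> {w}" using comp_hom[OF a] by (auto simp: supp_def split: if_splits)
  then show ?thesis using euler_sum[of a "{w}"] comp_hom[OF a] G_R[OF a] by simp
qed

lemma comp_euler: "a \<in> R \<Longrightarrow> comp G (euler G a) w = of_int w *s comp G a w"
proof -
  assume a: "a \<in> R"
  have "comp G (euler G a) w = (if w \<in> supp G a then of_int w *s comp G a w else 0)"
    using a by (intro comp_unique) (auto simp: finite_supp euler_def intro: subspace_scale[OF G_sub] comp_G)
  then show ?thesis by (auto simp: supp_def)
qed

lemma euler_derivation: "derivation (euler G)"
  unfolding derivation_def
proof (intro conjI ballI allI)
  show R: "euler G a \<in> R" if "a \<in> R" for a
    unfolding euler_def using that by (intro R_sum R_scale comp_R)
  show add: "euler G (a + b) = euler G a + euler G b" if ab: "a \<in> R" "b \<in> R" for a b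
  proof -
    let ?U = "supp G a \<union> supp G b \<union> supp G (a + b)"
    have "finite ?U" using ab finite_supp R_add by auto
    then have "x \<in> {a, b, a + b} \<Longrightarrow> euler G x = (\<Sum>w\<in>?U. of_int w *s comp G x w)" for x
      by (intro euler_sum) (use ab R_add in auto)
    then show ?thesis
      using ab by (simp add: comp_add scale_right_distrib sum.distrib)
  qed
  show "euler G (c *s a) = c *s euler G a" if "a \<in> R" for a c
  proof -
    let ?U = "supp G a \<union> supp G (c *s a)"
    have "finite ?U" using that finite_supp R_scale by auto
    then have "x \<in> {a, c *s a} \<Longrightarrow> euler G x = (\<Sum>w\<in>?U. of_int w *s comp G x w)" for x
      by (intro euler_sum) (use that R_scale in auto)
    then show ?thesis
      using that by (simp add: comp_scale scale_sum_right mult.commute)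
  qed
  show "euler G (a * b) = euler G a * b + a * euler G b" if ab: "a \<in> R" "b \<in> R" for a b
    by (rule biadditive_eq[where P = "\<lambda>a b. euler G (a * b)" and Q = "\<lambda>a b. euler G a * b + a * euler G b", OF _ _ _ _ _ ab])
      (auto simp: distrib_left distrib_right add mult_R euler_hom euler_hom[OF G_mult] scale_mult mult_scale scale_left_distrib)
qed

section \<open>Homogeneous components of a derivation\<close>

definition der_comp :: "('r \<Rightarrow> 'r) \<Rightarrow> int \<Rightarrow> 'r \<Rightarrow> 'r" where
  "der_comp D i a = (\<Sum>k\<in>supp G a. comp G (D (comp G a k)) (k + i))"

context
  fixes D assumes D: "derivation D"
begin

lemma der_comp_sum:
  assumes a: "a \<in> R" and W: "finite W" "supp G a \<subseteq> W"
  shows "der_comp D i a = (\<Sum>k\<in>W. comp G (D (comp G a k)) (k + i))"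
  unfolding der_comp_def using W der_0[OF D]
  by (intro sum.mono_neutral_left) (auto simp: comp_0 supp_def)

lemma der_comp_hom: "a \<in> G k \<Longrightarrow> der_comp D i a = comp G (D a) (k + i)"
proof -
  assume a: "a \<in> G k"
  have "supp G a \<subseteq> {k}" using comp_hom[OF a] by (auto simp: supp_def split: if_splits)
  then show ?thesis using der_comp_sum[of a "{k}" i] comp_hom[OF a] G_R[OF a] by simp
qed

lemma der_comp_derivation: "derivation (der_comp D i)"
  unfolding derivation_def
proof (intro conjI ballI allI)
  show R: "der_comp D i a \<in> R" if "a \<in> R" for a
    unfolding der_comp_def using that by (intro R_sum comp_R der_R[OF D])
  show add: "der_comp D i (a + b) = der_comp D i a + der_comp D i b" if ab: "a \<in> R" "b \<in> R" for a b
  proof -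
    let ?U = "supp G a \<union> supp G b \<union> supp G (a + b)"
    have "finite ?U" using ab finite_supp R_add by auto
    then have "x \<in> {a, b, a + b} \<Longrightarrow> der_comp D i x = (\<Sum>k\<in>?U. comp G (D (comp G x k)) (k + i))" for x
      by (intro der_comp_sum) (use ab R_add in auto)
    then show ?thesis
      using ab comp_R D by (simp add: comp_add der_add der_R sum.distrib)
  qed
  show "der_comp D i (c *s a) = c *s der_comp D i a" if "a \<in> R" for a c
  proof -
    let ?U = "supp G a \<union> supp G (c *s a)"
    have "finite ?U" using that finite_supp R_scale by auto
    then have "x \<in> {a, c *s a} \<Longrightarrow> der_comp D i x = (\<Sum>k\<in>?U. comp G (D (comp G x k)) (k + i))" for x
      by (intro der_comp_sum) (use that R_scale in auto)
    then show ?thesis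
      using that D by (simp add: comp_scale scale_sum_right der_scale der_R comp_R)
  qed
  show "der_comp D i (a * b) = der_comp D i a * b + a * der_comp D i b" if ab: "a \<in> R" "b \<in> R" for a b
  proof (rule biadditive_eq[where P = "\<lambda>a b. der_comp D i (a * b)" and Q = "\<lambda>a b. der_comp D i a * b + a * der_comp D i b", OF _ _ _ _ _ ab])
    fix a b v w assume ab: "a \<in> G v" "b \<in> G w"
    have "der_comp D i (a * b) = comp G (D a * b + a * D b) (v + w + i)"
      using ab D by (simp add: der_comp_hom[OF G_mult] der_mult G_R)
    also have "\<dots> = comp G (D a * b) ((v + i) + w) + comp G (D b * a) ((w + i) + v)"
      using ab D by (simp add: comp_add mult_R der_R G_R mult.commute algebra_simps)
    also have "\<dots> = comp G (D a) (v + i) * b + comp G (D b) (w + i) * a"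
      using ab D by (simp only: comp_mult_hom der_R G_R)
    finally show "der_comp D i (a * b) = der_comp D i a * b + a * der_comp D i b"
      using ab by (simp add: der_comp_hom mult.commute)
  qed (auto simp: distrib_left distrib_right add mult_R)
qed

lemma comp_der: 
  assumes a: "a \<in> R" shows "comp G (D a) j = (\<Sum>k\<in>supp G a. der_comp D (j - k) (comp G a k))"
proof -
  have "comp G (D a) j = (\<Sum>k\<in>supp G a. comp G (D (comp G a k)) j)"
    by (subst comp_sum[OF a, symmetric], subst der_sum[OF D], use a comp_R in blast,
        subst comp_sum_fun, use a comp_R der_R[OF D] in blast) simp
  also have "\<dots> = (\<Sum>k\<in>supp G a. der_comp D (j - k) (comp G a k))"
    using a by (intro sum.cong) (auto simp: der_comp_hom[OF comp_G])
  finally show ?thesis .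
qed

lemma finite_der_comp: assumes "a \<in> R" shows "finite {i. der_comp D i a \<noteq> 0}"
proof (rule finite_subset)
  show "{i. der_comp D i a \<noteq> 0} \<subseteq> (\<Union>k\<in>supp G a. (\<lambda>j. j - k) ` supp G (D (comp G a k)))"
  proof
    fix i assume "i \<in> {i. der_comp D i a \<noteq> 0}"
    then obtain k where "k \<in> supp G a" "comp G (D (comp G a k)) (k + i) \<noteq> 0"
      unfolding der_comp_def by (auto elim: sum.not_neutral_contains_not_neutral)
    then show "i \<in> (\<Union>k\<in>supp G a. (\<lambda>j. j - k) ` supp G (D (comp G a k)))"
      by (auto simp: supp_def intro!: image_eqI[of _ _ "k + i"] bexI[of _ k])
  qed
qed (use assms finite_supp comp_R der_R[OF D] in auto)

end
end

text \<open>A monic polynomial in \<open>D\<close> with integer roots, kept in factored form so that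
  its leading graded part can be followed factor by factor.\<close>

primrec shifts :: "('r \<Rightarrow> 'r) \<Rightarrow> int list \<Rightarrow> 'r \<Rightarrow> 'r" where
  "shifts D [] a = a"
| "shifts D (c # cs) a = shifts D cs (D a - of_int c *s a)"

text \<open>The roots are the weights of the summands: subtracting \<open>c\<close> from the Euler
  derivation kills the part of weight \<open>c\<close> and scales that of weight \<open>w\<close> by
  \<open>w - c\<close>, so the induction continues with the rescaled parts.\<close>

lemma euler_annihilated:
  assumes A: "grading A" and "finite W" "\<And>w. w \<in> W \<Longrightarrow> h w \<in> A w"
  shows "\<exists>cs. shifts (euler A) cs (sum h W) = 0"
  using assms(2,3)
proof (induction W arbitrary: h)
  case empty
  then show ?case by (auto intro: exI[of _ "[]"])
next
  case (insert c W)
  have hR: "w \<in> insert c W \<Longrightarrow> h w \<in> R" for w using insert.prems G_R[OF A] by blast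
  have "\<exists>cs. shifts (euler A) cs (\<Sum>w\<in>W. of_int (w - c) *s h w) = 0"
    using insert.prems by (intro insert.IH) (auto intro: subspace_scale[OF G_sub[OF A]])
  then obtain cs where cs: "shifts (euler A) cs (\<Sum>w\<in>W. of_int (w - c) *s h w) = 0" ..
  have "euler A (sum h (insert c W)) = (\<Sum>w\<in>insert c W. of_int w *s h w)"
    using hR insert.prems by (subst der_sum[OF euler_derivation[OF A]]) (auto simp: euler_hom[OF A] intro!: sum.cong)
  then have "euler A (sum h (insert c W)) - of_int c *s sum h (insert c W) = (\<Sum>w\<in>insert c W. of_int (w - c) *s h w)"
    by (simp only: scale_sum_right sum_subtractf[symmetric] scale_left_diff_distrib[symmetric] of_int_diff)
  also have "\<dots> = (\<Sum>w\<in>W. of_int (w - c) *s h w)" using insert.hyps by simp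
  finally show ?case using cs by (auto intro!: exI[of _ "c # cs"])
qed

text \<open>If \<open>b > 0\<close> is the highest degree of a component of \<open>D\<close>, the scalar \<open>c\<close> does not contribute to the
  leading component of \<open>D - c\<close>. As a product of such operators kills a given element when \<open>D\<close> is an Euler
  derivation, the leading component of \<open>D\<close> is locally nilpotent.\<close>

lemma shifts_top:
  assumes G: "grading G" and D: "derivation D" and b: "b > 0"
    and top: "\<And>i a. i > b \<Longrightarrow> a \<in> R \<Longrightarrow> der_comp G D i a = 0"
  shows "x \<in> R \<Longrightarrow> (\<And>j. j > k \<Longrightarrow> comp G x j = 0) \<Longrightarrow>
    comp G (shifts D cs x) (k + b * int (length cs)) = (der_comp G D b ^^ length cs) (comp G x k)"
proof (induction cs arbitrary: x k)
  case (Cons c cs)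
  let ?y = "D x - of_int c *s x"
  have y: "?y \<in> R" using D Cons.prems by (simp add: R_diff R_scale der_R)
  have cy: "comp G ?y j = (\<Sum>l\<in>supp G x. der_comp G D (j - l) (comp G x l)) - of_int c *s comp G x j" for j
    using Cons.prems D by (simp add: comp_diff[OF G] comp_scale[OF G] der_R R_scale comp_der[OF G D])
  have le: "l \<in> supp G x \<Longrightarrow> l \<le> k" for l using Cons.prems(2)[of l] by (auto simp: supp_def not_less[symmetric])
  have "comp G ?y j = 0" if "j > k + b" for j
  proof -
    have "der_comp G D (j - l) (comp G x l) = 0" if "l \<in> supp G x" for l
      using le[OF that] \<open>j > k + b\<close> Cons.prems(1) by (intro top comp_R[OF G]) auto
    then show ?thesis unfolding cy using Cons.prems(2)[of j] that b by simp
  qed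
  moreover have "comp G ?y (k + b) = der_comp G D b (comp G x k)"
  proof -
    \<comment> \<open>A part of degree \<open>l < k\<close> reaches degree \<open>k + b\<close> only
      through a component of degree above \<open>b\<close>, and these vanish by
      \<open>top\<close>.\<close>
    have "der_comp G D (k + b - l) (comp G x l) = 0" if "l \<in> supp G x" "l \<noteq> k" for l
      using le[OF that(1)] that(2) Cons.prems(1) by (intro top comp_R[OF G]) auto
    then have "(\<Sum>l\<in>supp G x. der_comp G D (k + b - l) (comp G x l)) = (\<Sum>l\<in>{k}. der_comp G D (k + b - l) (comp G x l))"
      using finite_supp[OF G Cons.prems(1)] der_0[OF der_comp_derivation[OF G D]]
      by (intro sum.mono_neutral_cong) (auto simp: supp_def)
    then show ?thesis unfolding cy using Cons.prems(2)[of "k + b"] b by simp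
  qed
  ultimately have "comp G (shifts D cs ?y) ((k + b) + b * int (length cs)) = (der_comp G D b ^^ length cs) (der_comp G D b (comp G x k))"
    using Cons.IH[OF y, of "k + b"] by simp
  then show ?case by (simp add: algebra_simps funpow_swap1)
qed simp

text \<open>Applied to the components of a fixed derivation, this bounds the degrees that occur: a
  component nonzero anywhere is nonzero on a generator, and each generator meets only finitely
  many.\<close>

definition der_generating :: "'r set \<Rightarrow> bool" where
  "der_generating gens \<longleftrightarrow> (\<forall>D. derivation D \<longrightarrow> (\<forall>x\<in>gens. D x = 0) \<longrightarrow> (\<forall>a\<in>R. D a = 0))"

lemma euler_no_positive_comp:
  assumes A: "grading A" and G: "grading G"
    and gens: "finite gens" "gens \<subseteq> R" "der_generating gens"
    and rigid: "\<forall>D. derivation D \<longrightarrow> locally_nilpotent D \<longrightarrow> (\<forall>a\<in>R. D a = 0)"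
    and a: "a \<in> R" and i: "i > 0"
  shows "der_comp G (euler A) i a = 0"
proof (rule ccontr)
  assume nz: "der_comp G (euler A) i a \<noteq> 0"
  note D = euler_derivation[OF A]
  note dc = der_comp_derivation[OF G D]
  define S where "S = (\<Union>x\<in>gens. {i. der_comp G (euler A) i x \<noteq> 0})"
  have fS: "finite S" unfolding S_def using gens(1,2) finite_der_comp[OF G D] by auto
  have S: "j \<in> S" if "der_comp G (euler A) j a \<noteq> 0" "a \<in> R" for j a
    using gens(3)[unfolded der_generating_def, rule_format, OF dc, of j a] that unfolding S_def by auto
  have "i \<in> S" using S nz a by blast
  define b where "b = Max S"
  have b: "b > 0" using fS \<open>i \<in> S\<close> i unfolding b_def by (meson Max_ge less_le_trans)
  have bS: "b \<in> S" unfolding b_def using fS \<open>i \<in> S\<close> by (intro Max_in) auto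
  have top: "der_comp G (euler A) j x = 0" if "j > b" "x \<in> R" for j x
    using S[of j x] that fS Max_ge[of S j] unfolding b_def by (meson not_less)
  have hom: "\<exists>m. (der_comp G (euler A) b ^^ m) x = 0" if x: "x \<in> G k" for x k
  proof -
    have xR: "x \<in> R" using G_R[OF G] x by blast
    have "\<exists>cs. shifts (euler A) cs (sum (comp A x) (supp A x)) = 0"
      by (intro euler_annihilated A finite_supp comp_G xR)
    then obtain cs where cs: "shifts (euler A) cs x = 0" using comp_sum[OF A xR] by auto
    \<comment> \<open>The polynomial in the Euler derivation that kills \<open>x\<close> has, in the
      top degree, a power of the leading component applied to \<open>x\<close>; that power therefore
      vanishes.\<close>
    have "comp G (shifts (euler A) cs x) (k + b * int (length cs)) = (der_comp G (euler A) b ^^ length cs) (comp G x k)"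
      using x by (intro shifts_top G D b top xR) (auto simp: comp_hom[OF G])
    then show ?thesis using x unfolding cs by (auto simp: comp_0[OF G] comp_hom[OF G])
  qed
  have "locally_nilpotent (der_comp G (euler A) b)"
    unfolding locally_nilpotent_def
  proof
    fix x assume x: "x \<in> R"
    have "\<exists>m. (der_comp G (euler A) b ^^ m) (sum (comp G x) W) = 0" if "finite W" for W
      using that
    proof (induction W)
      case empty
      then show ?case by (auto intro: exI[of _ 0])
    next
      case (insert w W)
      obtain m1 m2 where m: "(der_comp G (euler A) b ^^ m1) (sum (comp G x) W) = 0" "(der_comp G (euler A) b ^^ m2) (comp G x w) = 0"
        using insert hom[OF comp_G[OF G x]] by blast
      have "(der_comp G (euler A) b ^^ max m1 m2) (comp G x w + sum (comp G x) W) = 0"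
        using der_pow_ge[OF dc m(1), of "max m1 m2"] der_pow_ge[OF dc m(2), of "max m1 m2"] comp_R[OF G x]
        by (subst der_pow_add[OF dc]) (auto simp: R_sum)
      then show ?case using insert by auto
    qed
    then show "\<exists>m. (der_comp G (euler A) b ^^ m) x = 0"
      using comp_sum[OF G x] finite_supp[OF G x] by metis
  qed
  then have "der_comp G (euler A) b x = 0" if "x \<in> R" for x using rigid dc that by blast
  then show False using bS gens(2) unfolding S_def by auto
qed

text \<open>Reversing degrees turns negative components into positive ones, so the one-sided
  \<open>euler_no_positive_comp\<close> covers both signs.\<close>

lemma grading_uminus: assumes "grading G" shows "grading (\<lambda>w. G (- w))"
proof -
  have fin: "finite {w. h (- w) \<noteq> 0}" and sm: "(\<Sum>w | h (-w) \<noteq> 0. h (-w)) = (\<Sum>w | h w \<noteq> 0. h w)" if "finite {w. h w \<noteq> 0}" for h :: "int \<Rightarrow> 'r"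
  proof -
    have "{w. h (- w) \<noteq> 0} = uminus ` {w. h w \<noteq> 0}" by (force simp: image_iff)
    then show "finite {w. h (- w) \<noteq> 0}" using that by simp
    show "(\<Sum>w | h (-w) \<noteq> 0. h (-w)) = (\<Sum>w | h w \<noteq> 0. h w)"
      by (rule sum.reindex_bij_witness[of _ uminus uminus]) auto
  qed
  show ?thesis unfolding grading_def
  proof (intro conjI allI ballI impI)
    show "subspace (G (- w))" "G (- w) \<subseteq> R" for w using G_sub G_R assms by auto
    show "a * b \<in> G (- (v + w))" if "a \<in> G (- v)" "b \<in> G (- w)" for a b v w
      using G_mult[OF assms that] by simp
    show "\<exists>h. finite {w. h w \<noteq> 0} \<and> (\<forall>w. h w \<in> G (- w)) \<and> a = (\<Sum>w | h w \<noteq> 0. h w)" if "a \<in> R" for a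
      using finite_supp[OF assms that] comp_G[OF assms that] comp_sum[OF assms that] fin sm
      by (intro exI[of _ "\<lambda>w. comp G a (- w)"]) (auto simp: supp_def)
    show "h w = 0" if "finite W" "\<forall>w\<in>W. h w \<in> G (- w)" "sum h W = 0" "w \<in> W" for W h w
    proof -
      have "sum (\<lambda>w. h (- w)) (uminus ` W) = 0"
        using that by (subst sum.reindex) (auto simp: inj_on_def o_def)
      moreover have "h (- v) \<in> G v" if "v \<in> uminus ` W" for v using that \<open>\<forall>w\<in>W. h w \<in> G (- w)\<close> by auto
      ultimately show ?thesis using G_indep[OF assms, of "uminus ` W" "\<lambda>w. h (- w)" "- w"] that by auto
    qed
  qed
qed

text \<open>\<open>euler A\<close> has no component of nonzero degree, hence preserves every
  \<open>G k\<close>. The \<open>A\<close>-components of an element are eigenvectors of it for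
  different eigenvalues and so stay in \<open>G k\<close>.\<close>

lemma rigid_gradings_compatible:
  assumes A: "grading A" and G: "grading G"
    and gens: "finite gens" "gens \<subseteq> R" "der_generating gens"
    and rigid: "\<forall>D. derivation D \<longrightarrow> locally_nilpotent D \<longrightarrow> (\<forall>a\<in>R. D a = 0)"
    and a: "a \<in> G k"
  shows "comp A a w \<in> G k"
proof -
  note D = euler_derivation[OF A]
  have EG: "euler A x \<in> G j" if x: "x \<in> G j" for x j
  proof (rule comp_eqI[OF G])
    show "euler A x \<in> R" using der_R[OF D] G_R[OF G x] by blast
    fix v assume "v \<noteq> j"
    show "comp G (euler A x) v = 0"
    proof (cases "v > j")
      case True
      then show ?thesis
        using euler_no_positive_comp[OF A G gens rigid G_R[OF G x], of "v - j"] der_comp_hom[OF G D x, of "v - j"] by simp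
    next
      case False
      let ?G = "\<lambda>w. G (- w)"
      note G' = grading_uminus[OF G]
      have x': "x \<in> ?G (- j)" using x by simp
      have "comp ?G (euler A x) (- v) = 0"
        using False \<open>v \<noteq> j\<close> euler_no_positive_comp[OF A G' gens rigid G_R[OF G x], of "j - v"]
          der_comp_hom[OF G' D x', of "j - v"] by simp
      moreover have "comp ?G (euler A x) (- v) = comp G (euler A x) v"
      proof -
        note R = \<open>euler A x \<in> R\<close>
        have "comp G (euler A x) v = (if v \<in> uminus ` supp ?G (euler A x) then comp ?G (euler A x) (- v) else 0)"
          using finite_supp[OF G' R] comp_G[OF G' R] comp_sum[OF G' R]
          by (intro comp_unique[OF G]) (auto simp: sum.reindex inj_on_def o_def)
        then show ?thesis by (force simp: supp_def image_iff)
      qed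
      ultimately show ?thesis by simp
    qed
  qed
  have aR: "a \<in> R" using G_R[OF G a] .
  define U where "U = supp A a"
  have Ec: "euler A (comp G x j) = comp G (euler A x) j" if x: "x \<in> R" for x j
  proof -
    have "comp G (euler A x) j = comp G (\<Sum>i\<in>supp G x. euler A (comp G x i)) j"
      by (subst comp_sum[OF G x, symmetric], subst der_sum[OF D]) (use x comp_R[OF G] in auto)
    also have "\<dots> = (if j \<in> supp G x then euler A (comp G x j) else 0)"
      using comp_unique[OF G finite_supp[OF G x] EG[OF comp_G[OF G x]] refl] by simp
    finally show ?thesis using der_0[OF D] by (auto simp: supp_def)
  qed
  show ?thesis
  proof (rule comp_eqI[OF G comp_R[OF A aR]])
    fix v assume v: "v \<noteq> k"
    \<comment> \<open>The projection to degree \<open>v\<close> commutes with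
      \<open>euler A\<close>, so it keeps \<open>A\<close>-weights. The projected parts add up to
      the degree \<open>v\<close> component of \<open>a\<close>, which is 0, and independence of
      weights kills each of them.\<close>
    let ?b = "\<lambda>w. comp G (comp A a w) v"
    have bR: "?b w \<in> R" for w using comp_R[OF G comp_R[OF A aR]] .
    have bA: "?b w \<in> A w" for w
    proof (rule comp_eqI[OF A bR])
      fix u assume u: "u \<noteq> w"
      have "euler A (?b w) = of_int w *s ?b w"
        using Ec[OF comp_R[OF A aR]] euler_hom[OF A comp_G[OF A aR]] comp_scale[OF G comp_R[OF A aR]] by simp
      then have "of_int u *s comp A (?b w) u = of_int w *s comp A (?b w) u"
        using comp_euler[OF A bR, of w u] comp_scale[OF A bR, of "of_int w" w u] by metis
      then have "w = u \<or> comp A (?b w) u = 0" by auto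
      with u show "comp A (?b w) u = 0" by blast
    qed
    have "(\<Sum>w\<in>U. ?b w) = comp G a v"
      unfolding U_def by (subst (3) comp_sum[OF A aR, symmetric], subst comp_sum_fun[OF G]) (use comp_R[OF A aR] in auto)
    also have "\<dots> = 0" using comp_hom[OF G a] v by simp
    finally have "w \<in> U \<Longrightarrow> ?b w = 0" for w
      using G_indep[OF A, of U ?b w] bA finite_supp[OF A aR] unfolding U_def by blast
    then show "?b w = 0" by (cases "w \<in> U") (auto simp: U_def supp_def comp_0[OF G])
  qed
qed

end


section \<open>Polynomials and regular functions\<close>

definition pm_monom :: "('v \<Rightarrow> 'c) \<Rightarrow> ('v \<Rightarrow>\<^sub>0 nat) \<Rightarrow> 'c::comm_ring_1" where
  "pm_monom x m = (\<Prod>v\<in>Poly_Mapping.keys m. x v ^ Poly_Mapping.lookup m v)"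

lemma pm_monom_superset:
  assumes "finite S" "Poly_Mapping.keys m \<subseteq> S"
  shows "pm_monom x m = (\<Prod>v\<in>S. x v ^ Poly_Mapping.lookup m v)"
  unfolding pm_monom_def using assms
  by (intro prod.mono_neutral_left) (auto simp: in_keys_iff)

lemma pm_monom_zero [simp]: "pm_monom x 0 = 1"
  by (simp add: pm_monom_def)

lemma pm_monom_single [simp]: "pm_monom x (Poly_Mapping.single v k) = x v ^ k"
  by (cases "k = 0") (auto simp: pm_monom_def)

lemma pm_monom_add: "pm_monom x (m + m') = pm_monom x m * pm_monom x m'"
proof -
  let ?S = "Poly_Mapping.keys m \<union> Poly_Mapping.keys m'"
  have "Poly_Mapping.keys (m + m') \<subseteq> ?S" by (rule Poly_Mapping.keys_add)
  then show ?thesis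
    by (simp add: pm_monom_superset[where S="?S"] lookup_add power_add prod.distrib)
qed

lemma poly_mapping_sum_singles:
  fixes p :: "'b \<Rightarrow>\<^sub>0 'c::comm_monoid_add"
  shows "p = (\<Sum>m\<in>Poly_Mapping.keys p. Poly_Mapping.single m (Poly_Mapping.lookup p m))"
proof (rule poly_mapping_eqI)
  fix k
  show "Poly_Mapping.lookup p k = Poly_Mapping.lookup (\<Sum>m\<in>Poly_Mapping.keys p. Poly_Mapping.single m (Poly_Mapping.lookup p m)) k"
    by (cases "k \<in> Poly_Mapping.keys p") (auto simp: lookup_sum lookup_single when_def in_keys_iff)
qed

text \<open>Evaluation is the case of the identity on coefficients, substitution the case of
  \<open>mp_const\<close>; the homomorphism laws are proved once for both.\<close>

definition poly_hom :: "('a \<Rightarrow> 'c) \<Rightarrow> ('v \<Rightarrow> 'c) \<Rightarrow> ('v, 'a::comm_ring_1) mp \<Rightarrow> 'c::comm_ring_1" where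
  "poly_hom \<kappa> x p = (\<Sum>m\<in>Poly_Mapping.keys p. \<kappa> (Poly_Mapping.lookup p m) * pm_monom x m)"

locale coeff_hom =
  fixes \<kappa> :: "'a::comm_ring_1 \<Rightarrow> 'c::comm_ring_1"
  assumes \<kappa>: "\<kappa> 0 = 0" "\<kappa> 1 = 1" "\<kappa> (a + b) = \<kappa> a + \<kappa> b" "\<kappa> (a * b) = \<kappa> a * \<kappa> b"
begin

lemma poly_hom_superset:
  assumes "finite S" "Poly_Mapping.keys p \<subseteq> S"
  shows "poly_hom \<kappa> x p = (\<Sum>m\<in>S. \<kappa> (Poly_Mapping.lookup p m) * pm_monom x m)"
  unfolding poly_hom_def using assms \<kappa>(1)
  by (intro sum.mono_neutral_left) (auto simp: in_keys_iff)

lemma poly_hom_add: "poly_hom \<kappa> x (p + q) = poly_hom \<kappa> x p + poly_hom \<kappa> x q"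
proof -
  let ?S = "Poly_Mapping.keys p \<union> Poly_Mapping.keys q"
  have "Poly_Mapping.keys (p + q) \<subseteq> ?S" by (rule Poly_Mapping.keys_add)
  then show ?thesis
    by (simp add: poly_hom_superset[where S="?S"] lookup_add \<kappa> distrib_right sum.distrib)
qed

lemma poly_hom_single: "poly_hom \<kappa> x (Poly_Mapping.single m c) = \<kappa> c * pm_monom x m"
  by (subst poly_hom_superset[of "{m}"]) auto

lemma poly_hom_0: "poly_hom \<kappa> x 0 = 0" by (simp add: poly_hom_def)

lemma poly_hom_sum: "poly_hom \<kappa> x (sum g S) = (\<Sum>i\<in>S. poly_hom \<kappa> x (g i))"
  by (induction S rule: infinite_finite_induct) (auto simp: poly_hom_0 poly_hom_add)

lemma poly_hom_mult: "poly_hom \<kappa> x (p * q) = poly_hom \<kappa> x p * poly_hom \<kappa> x q"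
proof -
  have "p * q = (\<Sum>m\<in>Poly_Mapping.keys p. \<Sum>m'\<in>Poly_Mapping.keys q.
      Poly_Mapping.single (m + m') (Poly_Mapping.lookup p m * Poly_Mapping.lookup q m'))"
    by (subst (1) poly_mapping_sum_singles[of p], subst (1) poly_mapping_sum_singles[of q])
      (simp add: sum_product mult_single)
  then have "poly_hom \<kappa> x (p * q) = (\<Sum>m\<in>Poly_Mapping.keys p. \<Sum>m'\<in>Poly_Mapping.keys q.
      \<kappa> (Poly_Mapping.lookup p m) * pm_monom x m * (\<kappa> (Poly_Mapping.lookup q m') * pm_monom x m'))"
    by (simp add: poly_hom_sum poly_hom_single \<kappa> pm_monom_add mult_ac)
  then show ?thesis by (simp add: poly_hom_def sum_product)
qed

lemma poly_hom_const: "poly_hom \<kappa> x (mp_const c) = \<kappa> c"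
  by (simp add: mp_const_def poly_hom_single)

lemma poly_hom_var: "poly_hom \<kappa> x (mp_var v) = x v"
  by (simp add: mp_var_def poly_hom_single \<kappa>)

lemma poly_hom_1: "poly_hom \<kappa> x 1 = 1"
  using poly_hom_single[of x 0 1] \<kappa> by simp

lemma poly_hom_power: "poly_hom \<kappa> x (p ^ k) = poly_hom \<kappa> x p ^ k"
  by (induction k) (auto simp: poly_hom_1 poly_hom_mult)

lemma poly_hom_prod: "poly_hom \<kappa> x (prod g S) = (\<Prod>i\<in>S. poly_hom \<kappa> x (g i))"
  by (induction S rule: infinite_finite_induct) (auto simp: poly_hom_1 poly_hom_mult)

end

lemma mp_eval_poly_hom: "mp_eval x = poly_hom (\<lambda>c. c) x"
  by (simp add: fun_eq_iff mp_eval_def poly_hom_def pm_monom_def)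

lemma mp_subst_poly_hom: "mp_subst \<sigma> = poly_hom mp_const \<sigma>"
  by (simp add: fun_eq_iff mp_subst_def poly_hom_def pm_monom_def)

interpretation eval: coeff_hom "\<lambda>c. c" by standard auto

interpretation subst: coeff_hom mp_const
  by standard (auto simp: mp_const_def single_add mult_single)

lemmas mp_eval_simps = eval.poly_hom_0[folded mp_eval_poly_hom] eval.poly_hom_1[folded mp_eval_poly_hom]
  eval.poly_hom_add[folded mp_eval_poly_hom] eval.poly_hom_mult[folded mp_eval_poly_hom]
  eval.poly_hom_const[folded mp_eval_poly_hom] eval.poly_hom_var[folded mp_eval_poly_hom]
  eval.poly_hom_power[folded mp_eval_poly_hom] eval.poly_hom_sum[folded mp_eval_poly_hom]
  eval.poly_hom_prod[folded mp_eval_poly_hom]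

lemmas mp_subst_simps = subst.poly_hom_0[folded mp_subst_poly_hom] subst.poly_hom_1[folded mp_subst_poly_hom]
  subst.poly_hom_add[folded mp_subst_poly_hom] subst.poly_hom_mult[folded mp_subst_poly_hom]
  subst.poly_hom_const[folded mp_subst_poly_hom] subst.poly_hom_var[folded mp_subst_poly_hom]
  subst.poly_hom_power[folded mp_subst_poly_hom] subst.poly_hom_sum[folded mp_subst_poly_hom]
  subst.poly_hom_prod[folded mp_subst_poly_hom]

lemma mp_eval_eq: "mp_eval x p = (\<Sum>m\<in>Poly_Mapping.keys p. Poly_Mapping.lookup p m * pm_monom x m)"
  by (simp add: mp_eval_def pm_monom_def)

lemma mp_eval_subst: "mp_eval x (mp_subst \<sigma> p) = mp_eval (\<lambda>v. mp_eval x (\<sigma> v)) p"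
  unfolding mp_subst_def by (simp add: mp_eval_simps mp_eval_def[of "\<lambda>v. mp_eval x (\<sigma> v)"])

lemma pm_monom_cong: "(\<And>v. v \<in> Poly_Mapping.keys m \<Longrightarrow> x v = y v) \<Longrightarrow> pm_monom x m = pm_monom y m"
  by (auto simp: pm_monom_def intro: prod.cong)

lemma mp_vars_add: "mp_vars p \<subseteq> I \<Longrightarrow> mp_vars q \<subseteq> I \<Longrightarrow> mp_vars (p + q) \<subseteq> I"
  using Poly_Mapping.keys_add[of p q] unfolding mp_vars_def by blast

lemma mp_vars_mult:
  assumes "mp_vars p \<subseteq> I" "mp_vars q \<subseteq> I" shows "mp_vars (p * q) \<subseteq> I"
proof
  fix v assume "v \<in> mp_vars (p * q)"
  then obtain m where m: "m \<in> Poly_Mapping.keys (p * q)" "v \<in> Poly_Mapping.keys m" by (auto simp: mp_vars_def)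
  then obtain a b where "m = a + b" "a \<in> Poly_Mapping.keys p" "b \<in> Poly_Mapping.keys q"
    using Poly_Mapping.keys_mult[of p q] by blast
  then show "v \<in> I" using m(2) Poly_Mapping.keys_add[of a b] assms unfolding mp_vars_def by blast
qed

lemma mp_vars_single: "Poly_Mapping.keys m \<subseteq> I \<Longrightarrow> mp_vars (Poly_Mapping.single m c) \<subseteq> I"
  by (auto simp: mp_vars_def split: if_splits)

lemma mp_vars_const: "mp_vars (mp_const c) \<subseteq> I"
  unfolding mp_const_def by (rule mp_vars_single) auto

lemma mp_vars_var: "v \<in> I \<Longrightarrow> mp_vars (mp_var v) \<subseteq> I"
  unfolding mp_var_def by (rule mp_vars_single) auto

lemma mp_vars_0: "mp_vars 0 \<subseteq> I" and mp_vars_1: "mp_vars 1 \<subseteq> I"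
  by (auto simp: mp_vars_def)

lemma mp_vars_sum: "(\<And>i. i \<in> S \<Longrightarrow> mp_vars (g i) \<subseteq> I) \<Longrightarrow> mp_vars (sum g S) \<subseteq> I"
proof (induction S rule: infinite_finite_induct)
  case (insert x F)
  then show ?case by (simp add: mp_vars_add)
qed (simp_all add: mp_vars_0)

lemma mp_vars_prod: "(\<And>i. i \<in> S \<Longrightarrow> mp_vars (g i) \<subseteq> I) \<Longrightarrow> mp_vars (prod g S) \<subseteq> I"
proof (induction S rule: infinite_finite_induct)
  case (insert x F)
  then show ?case by (simp add: mp_vars_mult)
qed (simp_all add: mp_vars_1)

lemma mp_vars_power: "mp_vars p \<subseteq> I \<Longrightarrow> mp_vars (p ^ k) \<subseteq> I"
  by (induction k) (simp_all add: mp_vars_1 mp_vars_mult)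

text \<open>Every polynomial is a sum of constants times products of variable powers. The predicate
  is strengthened by the bound on the variables, which \<open>add\<close> and \<open>mult\<close>
  may assume of both operands.\<close>

lemma mp_induct [consumes 1, case_names const var add mult]:
  assumes p: "mp_vars p \<subseteq> I"
    and c: "\<And>c. P (mp_const c)" and v: "\<And>v. v \<in> I \<Longrightarrow> P (mp_var v)"
    and add: "\<And>p q. mp_vars p \<subseteq> I \<Longrightarrow> mp_vars q \<subseteq> I \<Longrightarrow> P p \<Longrightarrow> P q \<Longrightarrow> P (p + q)"
    and mult: "\<And>p q. mp_vars p \<subseteq> I \<Longrightarrow> mp_vars q \<subseteq> I \<Longrightarrow> P p \<Longrightarrow> P q \<Longrightarrow> P (p * q)"
  shows "P p"
proof -
  define Q where "Q = (\<lambda>p. mp_vars p \<subseteq> I \<and> P p)"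
  have Q: "Q (mp_const c)" "v \<in> I \<Longrightarrow> Q (mp_var v)" "Q p \<Longrightarrow> Q q \<Longrightarrow> Q (p + q)" "Q p \<Longrightarrow> Q q \<Longrightarrow> Q (p * q)" for c v p q
    unfolding Q_def using c v add mult by (simp_all add: mp_vars_const mp_vars_var mp_vars_add mp_vars_mult)
  have Q0: "Q 0" "Q 1" using Q(1)[of 0] Q(1)[of 1] by (auto simp: mp_const_def)
  have pw: "Q p \<Longrightarrow> Q (p ^ k)" for p k by (induction k) (auto intro: Q Q0)
  have Qm: "Q (Poly_Mapping.single m c)" if m: "Poly_Mapping.keys m \<subseteq> I" for m c
  proof -
    have "Q (\<Prod>v\<in>S. mp_var v ^ Poly_Mapping.lookup m v)" if "S \<subseteq> I" for S
      using that by (induction S rule: infinite_finite_induct) (auto intro: Q Q0 pw)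
    moreover have "(\<Prod>v\<in>S. mp_var v ^ Poly_Mapping.lookup m v :: ('a,'b) mp) = Poly_Mapping.single (\<Sum>v\<in>S. Poly_Mapping.single v (Poly_Mapping.lookup m v)) 1" for S
    proof (induction S rule: infinite_finite_induct)
      case (insert x F)
      have "(mp_var x :: ('a,'b) mp) ^ k = Poly_Mapping.single (Poly_Mapping.single x k) 1" for k
        by (induction k) (auto simp: mp_var_def mult_single single_add[symmetric])
      then show ?case using insert by (simp add: mult_single)
    qed auto
    ultimately have "Q (Poly_Mapping.single m 1)"
      using m poly_mapping_sum_singles[of m] by metis
    then have "Q (mp_const c * Poly_Mapping.single m 1)" by (intro Q)
    then show ?thesis by (simp add: mp_const_def mult_single)
  qed
  have "Q (\<Sum>m\<in>S. Poly_Mapping.single m (Poly_Mapping.lookup p m))" if "S \<subseteq> Poly_Mapping.keys p" for S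
    using that p by (induction S rule: infinite_finite_induct) (auto intro!: Q Q0 Qm simp: mp_vars_def)
  then show "P p" using poly_mapping_sum_singles[of p] unfolding Q_def by (metis order_refl)
qed

lemma regular_functionI: "mp_vars p \<subseteq> I \<Longrightarrow> (\<And>x. x \<in> Y \<Longrightarrow> g x = mp_eval x p) \<Longrightarrow> regular_function I Y g"
  by (auto simp: regular_function_def)

lemma regular_function_cong: "(\<And>x. x \<in> Y \<Longrightarrow> g x = h x) \<Longrightarrow> regular_function I Y g \<longleftrightarrow> regular_function I Y h"
  by (auto simp: regular_function_def)

lemma regular_const: "regular_function I Y (\<lambda>_. c)"
  by (rule regular_functionI[of "mp_const c"]) (simp_all add: mp_vars_const mp_eval_simps)

lemma regular_coord: "v \<in> I \<Longrightarrow> regular_function I Y (\<lambda>x. x v)"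
  by (rule regular_functionI[of "mp_var v"]) (simp_all add: mp_vars_var mp_eval_simps)

lemma regular_add: "regular_function I Y g \<Longrightarrow> regular_function I Y h \<Longrightarrow> regular_function I Y (\<lambda>x. g x + h x)"
  unfolding regular_function_def by (metis mp_vars_add mp_eval_simps(3))

lemma regular_mult: "regular_function I Y g \<Longrightarrow> regular_function I Y h \<Longrightarrow> regular_function I Y (\<lambda>x. g x * h x)"
  unfolding regular_function_def by (metis mp_vars_mult mp_eval_simps(4))

lemma regular_sum: "(\<And>i. i \<in> S \<Longrightarrow> regular_function I Y (g i)) \<Longrightarrow> regular_function I Y (\<lambda>x. \<Sum>i\<in>S. g i x)"
  by (induction S rule: infinite_finite_induct) (auto intro: regular_const regular_add)

lemma regular_prod: "(\<And>i. i \<in> S \<Longrightarrow> regular_function I Y (g i)) \<Longrightarrow> regular_function I Y (\<lambda>x. \<Prod>i\<in>S. g i x)"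
  by (induction S rule: infinite_finite_induct) (auto intro: regular_const regular_mult)

lemma regular_power: "regular_function I Y g \<Longrightarrow> regular_function I Y (\<lambda>x. g x ^ k)"
  by (induction k) (auto intro: regular_const regular_mult)

lemma regular_monom: "Poly_Mapping.keys m \<subseteq> I \<Longrightarrow> (\<And>v. v \<in> I \<Longrightarrow> regular_function J Z (\<phi> v)) \<Longrightarrow> regular_function J Z (\<lambda>x. pm_monom (\<lambda>v. \<phi> v x) m)"
  unfolding pm_monom_def by (intro regular_prod regular_power) blast

lemma regular_comp:
  assumes "regular_function I Y g" "\<And>v. v \<in> I \<Longrightarrow> regular_function J Z (\<lambda>x. \<phi> x v)" "\<phi> \<in> Z \<rightarrow> Y"
  shows "regular_function J Z (\<lambda>x. g (\<phi> x))"
proof -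
  obtain p where p: "mp_vars p \<subseteq> I" "\<And>x. x \<in> Y \<Longrightarrow> g x = mp_eval x p"
    using assms(1) by (auto simp: regular_function_def)
  have "regular_function J Z (\<lambda>x. mp_eval (\<phi> x) p)"
    unfolding mp_eval_eq
  proof (intro regular_sum regular_mult regular_const)
    fix m assume "m \<in> Poly_Mapping.keys p"
    then have "Poly_Mapping.keys m \<subseteq> I" using p(1) by (auto simp: mp_vars_def)
    then show "regular_function J Z (\<lambda>x. pm_monom (\<phi> x) m)"
      using regular_monom[of m I J Z "\<lambda>v x. \<phi> x v"] assms(2) by simp
  qed
  moreover have "regular_function J Z (\<lambda>x. g (\<phi> x)) \<longleftrightarrow> regular_function J Z (\<lambda>x. mp_eval (\<phi> x) p)"
    using p(2) assms(3) by (intro regular_function_cong) auto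
  ultimately show ?thesis by simp
qed

lemma fun_sum_apply: "(sum g S) x = (\<Sum>i\<in>S. g i x)"
  by (induction S rule: infinite_finite_induct) auto

section \<open>Coordinate rings as sets of functions\<close>

definition fscale :: "'a::comm_ring_1 \<Rightarrow> ('p \<Rightarrow> 'a) \<Rightarrow> ('p \<Rightarrow> 'a)" where
  "fscale c g = (\<lambda>x. c * g x)"

definition on :: "'p set \<Rightarrow> ('p \<Rightarrow> 'a::zero) \<Rightarrow> ('p \<Rightarrow> 'a)" where
  "on Y g = (\<lambda>x. if x \<in> Y then g x else 0)"

lemma on_apply [simp]: "x \<in> Y \<Longrightarrow> on Y g x = g x" "x \<notin> Y \<Longrightarrow> on Y g x = 0"
  by (auto simp: on_def)

text \<open>Regular functions are extended by 0 outside of \<open>Y\<close>, so that equality on \<open>Y\<close> is equality and the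
  pointwise operations of the function type apply; the unit is \<open>on Y (\<lambda>_. 1)\<close>.\<close>

definition coord_ring :: "'v set \<Rightarrow> ('v \<Rightarrow> 'a::comm_ring_1) set \<Rightarrow> (('v \<Rightarrow> 'a) \<Rightarrow> 'a) set" where
  "coord_ring I Y = {g. regular_function I Y g \<and> (\<forall>x. x \<notin> Y \<longrightarrow> g x = 0)}"

lemma on_coord_ring_iff: "on Y g \<in> coord_ring I Y \<longleftrightarrow> regular_function I Y g"
  using regular_function_cong[of Y "on Y g" g I] by (auto simp: coord_ring_def)

lemma coord_ring_regular: "g \<in> coord_ring I Y \<Longrightarrow> regular_function I Y g"
  by (simp add: coord_ring_def)

lemma coord_ring_eqI: "g \<in> coord_ring I Y \<Longrightarrow> h \<in> coord_ring I Y \<Longrightarrow> (\<And>x. x \<in> Y \<Longrightarrow> g x = h x) \<Longrightarrow> g = h"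
  unfolding coord_ring_def by (auto simp: fun_eq_iff) metis

interpretation fs: vector_space "fscale :: 'a::field \<Rightarrow> _"
  by standard (auto simp: fscale_def fun_eq_iff algebra_simps)

lemma algebra_on_coord_ring: "algebra_on fscale (coord_ring I (Y :: ('v \<Rightarrow> 'a::field_char_0) set))"
proof
  show "fs.subspace (coord_ring I Y)"
    unfolding fs.subspace_def coord_ring_def
    using regular_const[of I Y 0] regular_add[of I Y] regular_mult[OF regular_const, of I Y]
    by (auto simp: fscale_def zero_fun_def plus_fun_def)
qed (use regular_mult[of I Y] in \<open>auto simp: coord_ring_def times_fun_def fscale_def fun_eq_iff\<close>)

lemma coord_ring_induct [consumes 1, case_names const coord add mult]:
  assumes g: "g \<in> coord_ring I Y"
    and c: "\<And>c. P (on Y (\<lambda>_. c))" and v: "\<And>v. v \<in> I \<Longrightarrow> P (on Y (\<lambda>x. x v))"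
    and add: "\<And>g h. g \<in> coord_ring I Y \<Longrightarrow> h \<in> coord_ring I Y \<Longrightarrow> P g \<Longrightarrow> P h \<Longrightarrow> P (g + h)"
    and mult: "\<And>g h. g \<in> coord_ring I Y \<Longrightarrow> h \<in> coord_ring I Y \<Longrightarrow> P g \<Longrightarrow> P h \<Longrightarrow> P (g * h)"
  shows "P g"
proof -
  obtain p where p: "mp_vars p \<subseteq> I" "\<And>x. x \<in> Y \<Longrightarrow> g x = mp_eval x p"
    using g by (auto simp: coord_ring_def regular_function_def)
  have R: "on Y (\<lambda>x. mp_eval x p) \<in> coord_ring I Y" if "mp_vars p \<subseteq> I" for p
    unfolding on_coord_ring_iff using that by (rule regular_functionI) simp
  have "P (on Y (\<lambda>x. mp_eval x p))"
    using p(1)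
  proof (induction rule: mp_induct)
    case (const c) then show ?case using c by (simp add: mp_eval_simps)
  next
    case (var w) then show ?case using v by (simp add: mp_eval_simps)
  next
    case (add p q)
    have "on Y (\<lambda>x. mp_eval x (p + q)) = on Y (\<lambda>x. mp_eval x p) + on Y (\<lambda>x. mp_eval x q)"
      by (auto simp: on_def mp_eval_simps)
    then show ?case using assms(4)[OF R R] add by (simp only:)
  next
    case (mult p q)
    have "on Y (\<lambda>x. mp_eval x (p * q)) = on Y (\<lambda>x. mp_eval x p) * on Y (\<lambda>x. mp_eval x q)"
      by (auto simp: on_def mp_eval_simps)
    then show ?case using assms(5)[OF R R] mult by (simp only:)
  qed
  moreover have "on Y (\<lambda>x. mp_eval x p) = g"
    using p(2) g by (auto simp: on_def coord_ring_def fun_eq_iff)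
  ultimately show ?thesis by simp
qed


section \<open>Actions of the additive group\<close>

text \<open>A polynomial that is constant as a function on an infinite field has no higher
  coefficients. Applied to orbits fixed by a flow, this kills the derivation generating the
  flow.\<close>

lemma poly_fun_const:
  fixes c :: "nat \<Rightarrow> 'a::field_char_0"
  assumes "\<And>s. (\<Sum>k<N. s ^ k * c k) = d" "0 < k" "k < N"
  shows "c k = 0"
proof -
  define p where "p = (\<Sum>k<N. monom (c k) k) - [:d:]"
  have "poly p s = 0" for s using assms(1)[of s] by (simp add: p_def poly_sum poly_monom mult.commute)
  then have "p = 0" using poly_all_0_iff_0 by blast
  moreover have "coeff p k = c k"
    using assms(2,3) by (auto simp: p_def coeff_sum coeff_pCons split: nat.splits)
  ultimately show ?thesis by simp
qed

lemma zero_set_iff: "x \<in> zero_set I f \<longleftrightarrow> x \<in> I \<rightarrow>\<^sub>E UNIV \<and> mp_eval x f = 0"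
  by (simp add: zero_set_def)

lemma const_R: "on Y (\<lambda>_. c) \<in> coord_ring I Y"
  by (simp add: on_coord_ring_iff regular_const)

lemma coord_R: "v \<in> I \<Longrightarrow> on Y (\<lambda>x. x v) \<in> coord_ring I Y"
  by (simp add: on_coord_ring_iff regular_coord)

lemma on_1_mult: "g \<in> coord_ring I Y \<Longrightarrow> on Y (\<lambda>_. 1) * g = g"
  by (auto simp: on_def fun_eq_iff coord_ring_def)

text \<open>The unit of the ring is the function 1 on \<open>Y\<close>; the Leibniz rule for its
  square shows that its derivative equals twice itself, and linearity does the rest.\<close>

lemma der_const:
  fixes Y :: "('v \<Rightarrow> 'a::field_char_0) set"
  assumes D: "algebra_on.derivation fscale (coord_ring I Y) D"
  shows "D (on Y (\<lambda>_. c)) = 0"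
proof -
  interpret R: algebra_on fscale "coord_ring I Y" by (rule algebra_on_coord_ring)
  have "D (on Y (\<lambda>_. 1) * on Y (\<lambda>_. 1)) = D (on Y (\<lambda>_. 1)) + D (on Y (\<lambda>_. 1))"
    by (subst R.der_mult[OF D const_R const_R])
      (use on_1_mult[OF R.der_R[OF D const_R]] in \<open>simp only: mult.commute[of "D _"]\<close>)
  then have 1: "D (on Y (\<lambda>_. 1)) = 0" by (simp only: on_1_mult[OF const_R] add_cancel_right_right)
  have "on Y (\<lambda>_. c) = fscale c (on Y (\<lambda>_. 1))" by (auto simp: on_def fscale_def fun_eq_iff)
  then show ?thesis using R.der_scale[OF D const_R, of c 1] 1 by simp
qed

lemma der_generating_coord:
  fixes Y :: "('v \<Rightarrow> 'a::field_char_0) set"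
  shows "algebra_on.der_generating fscale (coord_ring I Y) ((\<lambda>v. on Y (\<lambda>x. x v)) ` I)"
proof -
  interpret R: algebra_on fscale "coord_ring I Y" by (rule algebra_on_coord_ring)
  show ?thesis unfolding R.der_generating_def
  proof (intro allI impI)
    fix D assume D: "R.derivation D" and z: "\<forall>x\<in>(\<lambda>v. on Y (\<lambda>x. x v)) ` I. D x = 0"
    have c: "D (on Y (\<lambda>_. c)) = 0" for c by (rule der_const[OF D])
    have v: "D (on Y (\<lambda>x. x v)) = 0" if "v \<in> I" for v using z that by blast
    have a: "D (g + h) = 0" if "g \<in> coord_ring I Y" "h \<in> coord_ring I Y" "D g = 0" "D h = 0" for g h
      using R.der_add[OF D that(1,2)] that(3,4) by (simp only: add_0_left)
    have m: "D (g * h) = 0" if "g \<in> coord_ring I Y" "h \<in> coord_ring I Y" "D g = 0" "D h = 0" for g h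
      using R.der_mult[OF D that(1,2)] that(3,4) by (simp only: mult_zero_left mult_zero_right add_0_left)
    show "\<forall>g\<in>coord_ring I Y. D g = 0"
      using coord_ring_induct[where P = "\<lambda>g. D g = 0", OF _ c v a m] by blast

  qed
qed

text \<open>Elements of \<open>BijGroup\<close> are extensional functions, hence the first
  assumption; invertibility comes from the action of \<open>- s\<close>.\<close>

lemma group_action_add:
  fixes \<alpha> :: "'a::comm_ring_1 \<Rightarrow> 'p \<Rightarrow> 'p"
  assumes ext: "\<And>s. \<alpha> s \<in> extensional E" and mem: "\<And>s x. x \<in> E \<Longrightarrow> \<alpha> s x \<in> E"
    and add: "\<And>s t x. x \<in> E \<Longrightarrow> \<alpha> s (\<alpha> t x) = \<alpha> (s + t) x" and zero: "\<And>x. x \<in> E \<Longrightarrow> \<alpha> 0 x = x"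
  shows "group_action (add_monoid (ring_of_type_algebra :: 'a ring)) E \<alpha>"
proof -
  have bij: "\<alpha> s \<in> Bij E" for s
  proof -
    have "bij_betw (\<alpha> s) E E"
      by (rule bij_betw_byWitness[of _ "\<alpha> (- s)"]) (auto simp: add zero mem)
    then show ?thesis using ext by (simp add: Bij_def)
  qed
  interpret ring "ring_of_type_algebra :: 'a ring" by (rule ring_from_type_algebra)
  have "\<alpha> \<in> hom (add_monoid (ring_of_type_algebra :: 'a ring)) (BijGroup E)"
    by (rule homI) (auto simp: bij BijGroup_def ring_of_type_algebra_def compose_def add restrict_def
        fun_eq_iff extensional_arb[OF ext])
  then show ?thesis
    unfolding group_action_def group_hom_def group_hom_axioms_def
    using add.is_group group_BijGroup by blast
qed

section \<open>The flow of a locally nilpotent derivation\<close>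

locale lnd =
  fixes I :: "'v set" and f :: "('v, 'a::field_char_0) mp" and Y and D
  assumes f: "mp_vars f \<subseteq> I" and Y: "Y = zero_set I f"
    and D: "algebra_on.derivation fscale (coord_ring I Y) D"
    and LN: "algebra_on.locally_nilpotent (coord_ring I Y) D"
begin

interpretation R: algebra_on fscale "coord_ring I Y" by (rule algebra_on_coord_ring)

abbreviation ex :: "'a \<Rightarrow> (('v \<Rightarrow> 'a) \<Rightarrow> 'a) \<Rightarrow> (('v \<Rightarrow> 'a) \<Rightarrow> 'a)" where
  "ex \<equiv> algebra_on.exp_der fscale D"

definition flow :: "'a \<Rightarrow> ('v \<Rightarrow> 'a) \<Rightarrow> ('v \<Rightarrow> 'a)" where
  "flow s = (\<lambda>x\<in>Y. \<lambda>v\<in>I. ex s (on Y (\<lambda>x. x v)) x)"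

lemma ex_const: "ex s (on Y (\<lambda>_. c)) = on Y (\<lambda>_. c)"
  by (subst R.exp_der_eq[OF D, of 1]) (simp_all add: der_const[OF D] fscale_def)

text \<open>\<open>ex s\<close> is multiplicative and additive and fixes constants, so it is enough
  to know it on coordinates. Applied to \<open>f\<close> itself this shows that the flow stays on
  \<open>Y\<close>.\<close>

lemma ex_poly:
  assumes "mp_vars p \<subseteq> I" "x \<in> Y"
  shows "mp_eval (flow s x) p = ex s (on Y (\<lambda>x. mp_eval x p)) x"
  using assms(1)
proof (induction rule: mp_induct)
  case (const c)
  then show ?case using assms(2) by (simp add: mp_eval_simps ex_const)
next
  case (var v)
  then show ?case using assms(2) by (simp add: mp_eval_simps flow_def)
next
  case (add p q)
  have R: "on Y (\<lambda>x. mp_eval x p) \<in> coord_ring I Y" "on Y (\<lambda>x. mp_eval x q) \<in> coord_ring I Y"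
    using add by (auto simp: on_coord_ring_iff intro: regular_functionI)
  have "on Y (\<lambda>x. mp_eval x (p + q)) = on Y (\<lambda>x. mp_eval x p) + on Y (\<lambda>x. mp_eval x q)"
    by (auto simp: on_def mp_eval_simps)
  then have "ex s (on Y (\<lambda>x. mp_eval x (p + q))) = ex s (on Y (\<lambda>x. mp_eval x p)) + ex s (on Y (\<lambda>x. mp_eval x q))"
    using R.exp_der_add[OF D LN R] by (simp only:)
  then show ?case using add by (simp add: mp_eval_simps)
next
  case (mult p q)
  have R: "on Y (\<lambda>x. mp_eval x p) \<in> coord_ring I Y" "on Y (\<lambda>x. mp_eval x q) \<in> coord_ring I Y"
    using mult by (auto simp: on_coord_ring_iff intro: regular_functionI)
  have "on Y (\<lambda>x. mp_eval x (p * q)) = on Y (\<lambda>x. mp_eval x p) * on Y (\<lambda>x. mp_eval x q)"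
    by (auto simp: on_def mp_eval_simps)
  then have "ex s (on Y (\<lambda>x. mp_eval x (p * q))) = ex s (on Y (\<lambda>x. mp_eval x p)) * ex s (on Y (\<lambda>x. mp_eval x q))"
    using R.exp_der_mult[OF D LN R] by (simp only:)
  then show ?case using mult by (simp add: mp_eval_simps)
qed

lemma flow_mem: assumes "x \<in> Y" shows "flow s x \<in> Y"
proof -
  have "on Y (\<lambda>x. mp_eval x f) = on Y (\<lambda>_. 0)"
    using Y by (auto simp: on_def fun_eq_iff zero_set_iff)
  then have "mp_eval (flow s x) f = 0"
    using ex_poly[OF f assms, of s] ex_const[of s 0] assms by simp
  moreover have "flow s x \<in> I \<rightarrow>\<^sub>E UNIV" using assms by (auto simp: flow_def)
  ultimately show ?thesis using Y by (simp add: zero_set_iff)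
qed

lemma ex_flow:
  assumes g: "g \<in> coord_ring I Y" and x: "x \<in> Y" shows "g (flow s x) = ex s g x"
proof -
  obtain p where p: "mp_vars p \<subseteq> I" "\<And>x. x \<in> Y \<Longrightarrow> g x = mp_eval x p"
    using g by (auto simp: coord_ring_def regular_function_def)
  have "on Y (\<lambda>x. mp_eval x p) = g"
    using p(2) g by (auto simp: on_def coord_ring_def fun_eq_iff)
  then show ?thesis using ex_poly[OF p(1) x, of s] p(2)[OF flow_mem[OF x]] by simp
qed

lemma flow_flow: assumes "x \<in> Y" shows "flow s (flow t x) = flow (s + t) x"
proof (rule extensionalityI[of _ I])
  show "flow s (flow t x) \<in> extensional I" "flow (s + t) x \<in> extensional I"
    using assms flow_mem[OF assms, of t] by (auto simp: flow_def)
  fix v assume v: "v \<in> I"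
  have "flow s (flow t x) v = ex s (on Y (\<lambda>x. x v)) (flow t x)"
    using flow_mem[OF assms] v by (simp add: flow_def)
  also have "\<dots> = ex t (ex s (on Y (\<lambda>x. x v))) x"
    by (rule ex_flow[OF R.exp_der_R[OF D coord_R[OF v]] assms])
  also have "\<dots> = flow (s + t) x v"
    using R.exp_der_exp[OF D LN coord_R[OF v], of t s] v assms by (simp add: flow_def add.commute)
  finally show "flow s (flow t x) v = flow (s + t) x v" .
qed

lemma flow_0: assumes "x \<in> Y" shows "flow 0 x = x"
proof (rule extensionalityI[of _ I])
  show "flow 0 x \<in> extensional I" "x \<in> extensional I"
    using flow_mem[OF assms] assms unfolding Y zero_set_iff PiE_def by auto
qed (use assms R.exp_der_zero[OF D LN coord_R] in \<open>simp add: flow_def\<close>)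

lemma regular_flow: "regular_Ga_action I Y flow"
  unfolding regular_Ga_action_def
proof (intro conjI ballI)
  show "group_action (add_monoid ring_of_type_algebra) Y flow"
    by (rule group_action_add) (auto simp: flow_mem flow_flow flow_0, simp add: flow_def)
  fix v assume v: "v \<in> I"
  let ?J = "insert None (Some ` I)" and ?Z = "{case_option s x |s x. x \<in> Y}"
  let ?c = "on Y (\<lambda>x. x v)"
  \<comment> \<open>The number of terms depends on the coordinate only, not on the point, so the
    flow is polynomial in time and space jointly.\<close>
  let ?N = "algebra_on.nil_order D ?c"
  have *: "flow (z None) (z \<circ> Some) v = (\<Sum>k<?N. (1 / fact k) * z None ^ k * (D ^^ k) ?c (z \<circ> Some))" if z: "z \<in> ?Z" for z
  proof -
    obtain s x where z: "z = case_option s x" "x \<in> Y" using z by auto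
    have zs: "z \<circ> Some = x" using z by auto
    show ?thesis unfolding zs using z v by (simp add: flow_def R.exp_der_def fscale_def fun_sum_apply)
  qed
  have "regular_function ?J ?Z (\<lambda>z. \<Sum>k<?N. (1 / fact k) * z None ^ k * (D ^^ k) ?c (z \<circ> Some))"
  proof (intro regular_sum regular_mult regular_const regular_power regular_coord)
    fix k
    show "regular_function ?J ?Z (\<lambda>z. (D ^^ k) ?c (z \<circ> Some))"
    proof (rule regular_comp[of I Y "(D ^^ k) ?c"])
      show "regular_function I Y ((D ^^ k) ?c)"
        by (rule coord_ring_regular[OF R.der_pow_R[OF D coord_R[OF v]]])
      show "regular_function ?J ?Z (\<lambda>x. (x \<circ> Some) w)" if "w \<in> I" for w
        using that regular_coord[of "Some w" ?J ?Z] by simp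
    qed (auto simp: o_def)
  qed simp
  then obtain p where p: "mp_vars p \<subseteq> ?J"
    "\<And>z. z \<in> ?Z \<Longrightarrow> (\<Sum>k<?N. (1 / fact k) * z None ^ k * (D ^^ k) ?c (z \<circ> Some)) = mp_eval z p"
    unfolding regular_function_def by blast
  show "regular_function ?J ?Z (\<lambda>z. flow (z None) (z \<circ> Some) v)"
    by (rule regular_functionI[OF p(1)]) (simp only: * p(2))
qed

lemma rigid_imp_zero:
  assumes "rigid I Y" "g \<in> coord_ring I Y" shows "D g = 0"
proof -
  have "D x = 0" if x: "x \<in> (\<lambda>v. on Y (\<lambda>x. x v)) ` I" for x
  proof -
    obtain v where v: "v \<in> I" "x = on Y (\<lambda>x. x v)" using x by blast
    let ?c = "on Y (\<lambda>x. x v)"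
    obtain m where m: "(D ^^ m) ?c = 0" using LN coord_R[OF v(1)] unfolding R.locally_nilpotent_def by blast
    \<comment> \<open>The bound is raised so that index 1, the coefficient carrying
      \<open>D\<close>, lies below it.\<close>
    have m: "(D ^^ (m + 2)) ?c = 0" by (rule R.der_pow_ge[OF D m]) simp
    have "D ?c x = 0" if x: "x \<in> Y" for x
    proof -
      have fl: "flow s x = x" for s using assms(1) regular_flow x unfolding rigid_def by blast
      have "(\<Sum>k<m+2. s ^ k * ((D ^^ k) ?c x / fact k)) = x v" for s
      proof -
        have "x v = ex s ?c x" using fl[of s, THEN fun_cong, of v] x v(1) by (simp add: flow_def)
        then show ?thesis by (simp add: R.exp_der_eq[OF D m] fscale_def fun_sum_apply)
      qed
      from poly_fun_const[OF this, of 1] show ?thesis by simp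
    qed
    moreover have "D ?c x = 0" if "x \<notin> Y" for x
      using R.der_R[OF D coord_R[OF v(1)]] that by (simp add: coord_ring_def)
    ultimately show ?thesis unfolding v(2) by (auto simp: fun_eq_iff)
  qed
  then show ?thesis
    using der_generating_coord[of I Y] D assms(2) unfolding R.der_generating_def by blast
qed

end

lemma rigid_no_lnd:
  fixes f :: "('v, 'a::field_char_0) mp"
  assumes "mp_vars f \<subseteq> I" "Y = zero_set I f" "rigid I Y"
  shows "\<forall>D. algebra_on.derivation fscale (coord_ring I Y) D \<longrightarrow>
    algebra_on.locally_nilpotent (coord_ring I Y) D \<longrightarrow> (\<forall>a\<in>coord_ring I Y. D a = 0)"
  using lnd.rigid_imp_zero[OF lnd.intro] assms by blast


section \<open>Weight spaces of one-parameter groups\<close>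

text \<open>Dedekind's independence of characters, for a set closed under an operation. Subtracting
  \<open>\<chi> j g0\<close> times the relation from its translate by \<open>g0\<close> removes the
  character \<open>j\<close>.\<close>

lemma characters_independent:
  fixes \<chi> :: "'i \<Rightarrow> 'g \<Rightarrow> 'a::field"
  assumes "finite J" and e: "e \<in> G" "\<And>i. i \<in> J \<Longrightarrow> \<chi> i e = 1"
    and op: "\<And>g h. g \<in> G \<Longrightarrow> h \<in> G \<Longrightarrow> m g h \<in> G"
    and hom: "\<And>i g h. i \<in> J \<Longrightarrow> g \<in> G \<Longrightarrow> h \<in> G \<Longrightarrow> \<chi> i (m g h) = \<chi> i g * \<chi> i h"
    and dist: "\<And>i j. i \<in> J \<Longrightarrow> j \<in> J \<Longrightarrow> i \<noteq> j \<Longrightarrow> \<exists>g\<in>G. \<chi> i g \<noteq> \<chi> j g"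
    and z: "\<And>g. g \<in> G \<Longrightarrow> (\<Sum>i\<in>J. c i * \<chi> i g) = 0"
    and i: "i \<in> J"
  shows "c i = 0"
  using assms(1) e(2) hom dist z i
proof (induction J arbitrary: c i)
  case (insert j J)
  have J: "c i = 0" if i: "i \<in> J" for i
  proof -
    have "i \<noteq> j" using insert.hyps i by auto
    then obtain g0 where g0: "g0 \<in> G" "\<chi> i g0 \<noteq> \<chi> j g0"
      using insert.prems(3)[of i j] i by auto
    have "(\<Sum>i\<in>J. c i * (\<chi> i g0 - \<chi> j g0) * \<chi> i g) = 0" if g: "g \<in> G" for g
    proof -
      have "(\<Sum>i\<in>insert j J. c i * (\<chi> i g0 - \<chi> j g0) * \<chi> i g) = (\<Sum>i\<in>insert j J. c i * \<chi> i (m g0 g)) - \<chi> j g0 * (\<Sum>i\<in>insert j J. c i * \<chi> i g)"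
        unfolding sum_distrib_left sum_subtractf[symmetric]
        by (rule sum.cong) (auto simp: insert.prems(2) g g0 algebra_simps)
      also have "\<dots> = 0" using insert.prems(4)[OF op[OF g0(1) g]] insert.prems(4)[OF g] by (simp only: mult_zero_right diff_zero)
      finally show ?thesis using insert.hyps by simp
    qed
    then have "c i * (\<chi> i g0 - \<chi> j g0) = 0"
    proof (intro insert.IH[where c = "\<lambda>i. c i * (\<chi> i g0 - \<chi> j g0)"])
      show "\<chi> i (m g h) = \<chi> i g * \<chi> i h" if "i \<in> J" "g \<in> G" "h \<in> G" for i g h
        using insert.prems(2)[of i g h] that by blast
      show "\<exists>g\<in>G. \<chi> i g \<noteq> \<chi> j g" if "i \<in> J" "j \<in> J" "i \<noteq> j" for i j
        using insert.prems(3)[of i j] that by blast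
    qed (use insert.prems(1) i in auto)
    then show ?thesis using g0 by simp
  qed
  then have "(\<Sum>i\<in>insert j J. c i * \<chi> i e) = c j * \<chi> j e" using insert.hyps by simp
  then have "c j = 0" using insert.prems(1)[of j] insert.prems(4)[OF e(1)] by simp
  then show ?case using J insert.prems(5) by auto
qed simp

text \<open>In characteristic 0 the element 2 has infinite order, so the value of a one-parameter
  group at 2 already determines its weights.\<close>

lemma power_int_2_inj:
  assumes "(2 :: 'a::field_char_0) powi v = 2 powi w" shows "v = w"
proof -
  have *: False if "(2::'a) powi v = 2 powi w" "v < w" for v w
  proof -
    have "(2::'a) powi (w - v) = 1" using that by (simp add: power_int_diff)
    then have "(2::'a) ^ nat (w - v) = 1" using that by (simp add: power_int_def)
    then have "of_nat (2 ^ nat (w - v)) = (of_nat 1 :: 'a)" by simp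
    then have "(2::nat) ^ nat (w - v) = 1" unfolding of_nat_eq_iff .
    then show False using that by simp
  qed
  show ?thesis using *[OF assms] *[OF assms[symmetric]] by (cases v w rule: linorder_cases) auto
qed

lemma laurent_zero:
  fixes c :: "int \<Rightarrow> 'a::field_char_0"
  assumes "finite W" "\<And>s. s \<noteq> 0 \<Longrightarrow> (\<Sum>w\<in>W. c w * s powi w) = 0" "w \<in> W"
  shows "c w = 0"
proof (rule characters_independent[where G = "{s::'a. s \<noteq> 0}" and e = 1 and m = "(*)" and \<chi> = "\<lambda>w s. s powi w" and J = W and c = c])
  show "\<exists>g\<in>{s::'a. s \<noteq> 0}. g powi i \<noteq> g powi j" if "i \<noteq> j" for i j
    using power_int_2_inj[of i j] that by (intro bexI[of _ 2]) auto
qed (use assms in \<open>auto simp: power_int_mult_distrib\<close>)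

section \<open>One-parameter groups of diagonal maps and their weights\<close>

definition diag :: "'v set \<Rightarrow> ('v \<Rightarrow> 'a) \<Rightarrow> ('v \<Rightarrow> 'a::comm_ring_1) \<Rightarrow> ('v \<Rightarrow> 'a)" where
  "diag I t x = (\<lambda>v\<in>I. t v * x v)"

definition pairing :: "'v set \<Rightarrow> ('v \<Rightarrow> int) \<Rightarrow> ('v \<Rightarrow>\<^sub>0 nat) \<Rightarrow> int" where
  "pairing I u m = (\<Sum>v\<in>I. u v * int (Poly_Mapping.lookup m v))"

abbreviation cochar :: "('v \<Rightarrow> int) \<Rightarrow> 'a::field \<Rightarrow> 'v \<Rightarrow> 'a" where
  "cochar u s \<equiv> (\<lambda>v. s powi u v)"

lemma pm_monom_diag:
  assumes "Poly_Mapping.keys m \<subseteq> I"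
  shows "pm_monom (diag I t x) m = pm_monom t m * pm_monom x m"
  unfolding pm_monom_def prod.distrib[symmetric]
  using assms by (intro prod.cong) (auto simp: diag_def power_mult_distrib)

lemma pm_monom_cochar:
  assumes I: "finite I" "Poly_Mapping.keys m \<subseteq> I" and s: "s \<noteq> 0"
  shows "pm_monom (cochar u s) m = s powi pairing I u m"
proof -
  have "(\<Prod>v\<in>A. (s powi u v) ^ Poly_Mapping.lookup m v) = s powi (\<Sum>v\<in>A. u v * int (Poly_Mapping.lookup m v))" for A
  proof (induction A rule: infinite_finite_induct)
    case (insert x F)
    then show ?case using s by (simp add: power_int_add power_int_mult)
  qed auto
  then show ?thesis unfolding pm_monom_superset[OF I] pairing_def by simp
qed

definition pull :: "'p set \<Rightarrow> ('p \<Rightarrow> 'p) \<Rightarrow> ('p \<Rightarrow> 'a::zero) \<Rightarrow> ('p \<Rightarrow> 'a)" where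
  "pull Y \<phi> g = on Y (\<lambda>x. g (\<phi> x))"

definition weight_space :: "'v set \<Rightarrow> ('v \<Rightarrow> 'a::field) set \<Rightarrow> ('v \<Rightarrow> int) \<Rightarrow> int \<Rightarrow> (('v \<Rightarrow> 'a) \<Rightarrow> 'a) set" where
  "weight_space I Y u w = {g \<in> coord_ring I Y. \<forall>s x. s \<noteq> 0 \<longrightarrow> x \<in> Y \<longrightarrow> g (diag I (cochar u s) x) = s powi w * g x}"

lemma weight_spaceD:
  "g \<in> weight_space I Y u w \<Longrightarrow> s \<noteq> 0 \<Longrightarrow> x \<in> Y \<Longrightarrow> g (diag I (cochar u s) x) = s powi w * g x"
  by (simp add: weight_space_def)

text \<open>Transport of structure along an algebra automorphism; it turns the weight grading of a
  one-parameter group into that of a conjugate.\<close>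

lemma (in algebra_on) grading_image:
  assumes G: "grading G" and F: "bij_betw F R R"
    and add: "\<And>a b. a \<in> R \<Longrightarrow> b \<in> R \<Longrightarrow> F (a + b) = F a + F b"
    and scale: "\<And>c a. a \<in> R \<Longrightarrow> F (c *s a) = c *s F a"
    and mult: "\<And>a b. a \<in> R \<Longrightarrow> b \<in> R \<Longrightarrow> F (a * b) = F a * F b"
  shows "grading (\<lambda>w. F ` G w)"
    and "a \<in> R \<Longrightarrow> comp (\<lambda>w. F ` G w) (F a) w = F (comp G a w)"
proof -
  have F0: "F 0 = 0" using add[of 0 0] R_0 by simp
  have Fsum: "(\<And>i. i \<in> J \<Longrightarrow> g i \<in> R) \<Longrightarrow> F (sum g J) = (\<Sum>i\<in>J. F (g i))" for g :: "int \<Rightarrow> 'r" and J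
    by (induction J rule: infinite_finite_induct) (auto simp: F0 add R_sum)
  have FR: "a \<in> R \<Longrightarrow> F a \<in> R" for a using F by (auto simp: bij_betw_def)
  have inj: "inj_on F R" using F by (simp add: bij_betw_def)
  have F0iff: "a \<in> R \<Longrightarrow> F a = 0 \<longleftrightarrow> a = 0" for a using inj_onD[OF inj, of a 0] F0 R_0 by auto
  note GR = G_R[OF G]
  have GF: "grading (\<lambda>w. F ` G w)" unfolding grading_def
  proof (intro conjI allI ballI impI)
    show "subspace (F ` G w)" for w
      unfolding subspace_def
    proof (intro conjI ballI allI)
      show "0 \<in> F ` G w" using G_0[OF G] F0 by (metis imageI)
      show "x + y \<in> F ` G w" if xy: "x \<in> F ` G w" "y \<in> F ` G w" for x y
      proof -
        obtain a b where "a \<in> G w" "b \<in> G w" "x = F a" "y = F b" using xy by blast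
        then show ?thesis using add[of a b] GR subspace_add[OF G_sub[OF G], of a w b] by (metis imageI)
      qed
      show "c *s x \<in> F ` G w" if x: "x \<in> F ` G w" for c x
      proof -
        obtain a where "a \<in> G w" "x = F a" using x by blast
        then show ?thesis using scale[of a c] GR subspace_scale[OF G_sub[OF G], of a w c] by (metis imageI)
      qed
    qed
    show "F ` G w \<subseteq> R" for w using FR GR by blast
    show "a * b \<in> F ` G (v + w)" if ab: "a \<in> F ` G v" "b \<in> F ` G w" for a b v w
    proof -
      obtain c d where cd: "c \<in> G v" "d \<in> G w" "a = F c" "b = F d" using ab by blast
      then show ?thesis using mult[of c d] GR G_mult[OF G cd(1,2)] by (metis imageI)
    qed
    show "\<exists>h. finite {w. h w \<noteq> 0} \<and> (\<forall>w. h w \<in> F ` G w) \<and> a = (\<Sum>w | h w \<noteq> 0. h w)" if a: "a \<in> R" for a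
    proof -
      obtain b where b: "b \<in> R" "a = F b" using F a by (auto simp: bij_betw_def)
      have eq: "{w. F (comp G b w) \<noteq> 0} = supp G b"
        using F0iff comp_R[OF G b(1)] by (auto simp: supp_def)
      have "a = F (\<Sum>w\<in>supp G b. comp G b w)" using comp_sum[OF G b(1)] b(2) by simp
      also have "\<dots> = (\<Sum>w\<in>supp G b. F (comp G b w))" using comp_R[OF G b(1)] by (intro Fsum)
      finally show ?thesis
        using finite_supp[OF G b(1)] comp_G[OF G b(1)] eq by (intro exI[of _ "\<lambda>w. F (comp G b w)"]) auto
    qed
    show "h w = 0" if h: "finite W" "\<forall>w\<in>W. h w \<in> F ` G w" "sum h W = 0" "w \<in> W" for W h w
    proof -
      have "\<forall>w\<in>W. \<exists>a. a \<in> G w \<and> h w = F a" using h(2) by blast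
      then obtain k where k: "\<And>w. w \<in> W \<Longrightarrow> k w \<in> G w \<and> h w = F (k w)" by metis
      have "F (sum k W) = 0" using Fsum[of W k] k h(3) GR by (metis (mono_tags, lifting) sum.cong)
      moreover have "sum k W \<in> R" using k GR by (intro R_sum) blast
      ultimately have "sum k W = 0" using F0iff by blast
      then have "k w = 0" using G_indep[OF G h(1), of k w] k h(4) by blast
      then show ?thesis using k[OF h(4)] F0 by simp
    qed
  qed
  then show "grading (\<lambda>w. F ` G w)" .
  assume a: "a \<in> R"
  have "F a = F (\<Sum>w\<in>supp G a. comp G a w)" using comp_sum[OF G a] by simp
  also have "\<dots> = (\<Sum>w\<in>supp G a. F (comp G a w))" using comp_R[OF G a] by (intro Fsum)
  finally have "comp (\<lambda>w. F ` G w) (F a) w = (if w \<in> supp G a then F (comp G a w) else 0)"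
    using finite_supp[OF G a] comp_G[OF G a] by (intro comp_unique[OF GF]) auto
  then show "comp (\<lambda>w. F ` G w) (F a) w = F (comp G a w)" using F0 by (auto simp: supp_def)
qed

text \<open>A function splits by collecting the monomials of a representing polynomial according to
  their pairing with \<open>u\<close>; parts of distinct weight are independent because a Laurent
  polynomial vanishing at all nonzero points is zero.\<close>

lemma grading_weight_space:
  fixes Y :: "('v \<Rightarrow> 'a::field_char_0) set"
  assumes I: "finite I" and st: "\<And>s x. s \<noteq> 0 \<Longrightarrow> x \<in> Y \<Longrightarrow> diag I (cochar u s) x \<in> Y"
  shows "algebra_on.grading fscale (coord_ring I Y) (weight_space I Y u)"
proof -
  interpret R: algebra_on fscale "coord_ring I Y" by (rule algebra_on_coord_ring)
  show ?thesis unfolding R.grading_def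
  proof (intro conjI allI ballI impI)
    show "fs.subspace (weight_space I Y u w)" for w
      unfolding fs.subspace_def weight_space_def
      using R.R_0 R.R_add R.R_scale by (auto simp: algebra_simps fscale_def zero_fun_def plus_fun_def)
    show "weight_space I Y u w \<subseteq> coord_ring I Y" for w by (auto simp: weight_space_def)
    show "a * b \<in> weight_space I Y u (v + w)" if "a \<in> weight_space I Y u v" "b \<in> weight_space I Y u w" for a b v w
      using that R.mult_R unfolding weight_space_def by (auto simp: power_int_add mult_ac times_fun_def)
  next
    fix g :: "('v \<Rightarrow> 'a) \<Rightarrow> 'a" assume g: "g \<in> coord_ring I Y"
    obtain p where p: "mp_vars p \<subseteq> I" "\<And>x. x \<in> Y \<Longrightarrow> g x = mp_eval x p"
      using g by (auto simp: coord_ring_def regular_function_def)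
    let ?K = "Poly_Mapping.keys p"
    have kI: "m \<in> ?K \<Longrightarrow> Poly_Mapping.keys m \<subseteq> I" for m using p(1) by (auto simp: mp_vars_def)
    define h where "h = (\<lambda>w. on Y (\<lambda>x. \<Sum>m | m \<in> ?K \<and> pairing I u m = w. Poly_Mapping.lookup p m * pm_monom x m))"
    have hG: "h w \<in> weight_space I Y u w" for w
    proof -
      have "h w \<in> coord_ring I Y" unfolding h_def on_coord_ring_iff
      proof (intro regular_sum regular_mult regular_const)
        fix m assume "m \<in> {m \<in> ?K. pairing I u m = w}"
        then have "Poly_Mapping.keys m \<subseteq> I" using kI by simp
        then show "regular_function I Y (\<lambda>x. pm_monom x m)"
          by (rule regular_monom[of m I I Y "\<lambda>v x. x v"]) (rule regular_coord)
      qed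
      moreover have "h w (diag I (cochar u s) x) = s powi w * h w x" if "s \<noteq> 0" "x \<in> Y" for s x
        using that st kI unfolding h_def
        by (auto simp: sum_distrib_left pm_monom_diag pm_monom_cochar[OF I] intro!: sum.cong)
      ultimately show ?thesis by (simp add: weight_space_def)
    qed
    have h0: "h w = 0" if "w \<notin> pairing I u ` ?K" for w
    proof -
      have *: "{m. m \<in> ?K \<and> pairing I u m = w} = {}" using that by auto
      show ?thesis unfolding h_def * by (simp add: on_def fun_eq_iff)
    qed
    have sub: "{w. h w \<noteq> 0} \<subseteq> pairing I u ` ?K" using h0 by blast
    have fin: "finite {w. h w \<noteq> 0}" by (rule finite_subset[OF sub]) simp
    have "(\<Sum>w | h w \<noteq> 0. h w) = (\<Sum>w\<in>pairing I u ` ?K. h w)"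
      using sub by (intro sum.mono_neutral_left) auto
    moreover have "(\<Sum>w\<in>pairing I u ` ?K. h w) x = g x" if "x \<in> Y" for x
      using that unfolding fun_sum_apply h_def by (simp add: p(2) mp_eval_eq sum.image_gen[of ?K _ "pairing I u"])
    moreover have "(\<Sum>w\<in>pairing I u ` ?K. h w) x = g x" if "x \<notin> Y" for x
      using that g unfolding fun_sum_apply h_def by (simp add: coord_ring_def)
    ultimately have "g = (\<Sum>w | h w \<noteq> 0. h w)" by (intro ext) metis
    then show "\<exists>h. finite {w. h w \<noteq> 0} \<and> (\<forall>w. h w \<in> weight_space I Y u w) \<and> g = (\<Sum>w | h w \<noteq> 0. h w)"
      using fin hG by blast
  next
    fix W h w assume W: "finite W" "\<forall>w\<in>W. h w \<in> weight_space I Y u w" "sum h W = 0" and w: "w \<in> W"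
    have "h w x = 0" if x: "x \<in> Y" for x
    proof (rule laurent_zero[OF W(1) _ w])
      fix s :: 'a assume s: "s \<noteq> 0"
      have "(\<Sum>w\<in>W. h w x * s powi w) = (\<Sum>w\<in>W. h w (diag I (cochar u s) x))"
        using W(2) s x by (intro sum.cong) (auto simp: weight_space_def)
      also have "\<dots> = (sum h W) (diag I (cochar u s) x)" by (simp add: fun_sum_apply)
      finally show "(\<Sum>w\<in>W. h w x * s powi w) = 0" using W(3) by simp
    qed
    moreover have "h w x = 0" if "x \<notin> Y" for x using W(2) w that by (auto simp: weight_space_def coord_ring_def)
    ultimately show "h w = 0" by (auto simp: fun_eq_iff)
  qed
qed

lemma pull_R:
  assumes "regular_self_map I Y \<phi>" "g \<in> coord_ring I Y" shows "pull Y \<phi> g \<in> coord_ring I Y"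
  unfolding pull_def on_coord_ring_iff
  by (rule regular_comp[OF coord_ring_regular[OF assms(2)]]) (use assms(1) in \<open>auto simp: regular_self_map_def\<close>)

text \<open>A function of weight \<open>w\<close> for the conjugated group is the pullback along
  \<open>\<psi>\<close> of one of weight \<open>w\<close> for the original. By compatibility of the
  two gradings these parts of \<open>g\<close> have weight \<open>k\<close>, and the conjugated map
  merely scales each of them by \<open>s powi w\<close>.\<close>

lemma rigid_conj_weight_space:
  fixes f :: "('v, 'a::field_char_0) mp"
  assumes I: "finite I" and f: "mp_vars f \<subseteq> I" "Y = zero_set I f" "rigid I Y"
    and st: "\<And>s x. s \<noteq> 0 \<Longrightarrow> x \<in> Y \<Longrightarrow> diag I (cochar u s) x \<in> Y"
      "\<And>s x. s \<noteq> 0 \<Longrightarrow> x \<in> Y \<Longrightarrow> diag I (cochar v s) x \<in> Y"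
    and \<phi>: "regular_self_map I Y \<phi>" "regular_self_map I Y \<psi>"
      "\<And>x. x \<in> Y \<Longrightarrow> \<psi> (\<phi> x) = x" "\<And>x. x \<in> Y \<Longrightarrow> \<phi> (\<psi> x) = x"
    and g: "g \<in> weight_space I Y v k" and s: "s \<noteq> 0"
  shows "pull Y (\<lambda>x. \<phi> (diag I (cochar u s) (\<psi> x))) g \<in> weight_space I Y v k"
proof -
  interpret R: algebra_on fscale "coord_ring I Y" by (rule algebra_on_coord_ring)
  have mem: "x \<in> Y \<Longrightarrow> \<phi> x \<in> Y" "x \<in> Y \<Longrightarrow> \<psi> x \<in> Y" for x using \<phi>(1,2) by (auto simp: regular_self_map_def)
  note Gu = grading_weight_space[OF I st(1)] and Gv = grading_weight_space[OF I st(2)]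
  let ?F = "pull Y \<psi>"
  have bij: "bij_betw ?F (coord_ring I Y) (coord_ring I Y)"
    by (rule bij_betw_byWitness[of _ "pull Y \<phi>"])
      (use \<phi> mem in \<open>auto simp: pull_R intro!: coord_ring_eqI[of _ I Y] pull_R, auto simp: pull_def\<close>)
  have lin: "?F (a + b) = ?F a + ?F b" "?F (fscale c a) = fscale c (?F a)" "?F (a * b) = ?F a * ?F b" for a b c
    by (auto simp: pull_def on_def fscale_def fun_eq_iff)
  note A = R.grading_image[OF Gu bij lin(1,2,3)]
  let ?A = "\<lambda>w. ?F ` weight_space I Y u w"
  have gR: "g \<in> coord_ring I Y" using g by (simp add: weight_space_def)
  have cmp: "R.comp ?A g w \<in> weight_space I Y v k" for w
    by (rule R.rigid_gradings_compatible[OF A(1) Gv _ _ der_generating_coord rigid_no_lnd[OF f] g])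
      (use I coord_R in \<open>auto simp: st\<close>)
  have "pull Y (\<lambda>x. \<phi> (diag I (cochar u s) (\<psi> x))) g = (\<Sum>w\<in>R.supp ?A g. fscale (s powi w) (R.comp ?A g w))"
  proof (rule ext)
    fix x
    show "pull Y (\<lambda>x. \<phi> (diag I (cochar u s) (\<psi> x))) g x = (\<Sum>w\<in>R.supp ?A g. fscale (s powi w) (R.comp ?A g w)) x"
    proof (cases "x \<in> Y")
      case x: True
      let ?y = "\<phi> (diag I (cochar u s) (\<psi> x))"
      have y: "?y \<in> Y" using x mem st s by blast
      have "g ?y = (\<Sum>w\<in>R.supp ?A g. R.comp ?A g w) ?y" by (rule fun_cong[OF R.comp_sum[OF A(1) gR, symmetric]])
      also have "\<dots> = (\<Sum>w\<in>R.supp ?A g. s powi w * R.comp ?A g w x)"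
        unfolding fun_sum_apply
      proof (rule sum.cong[OF refl])
        fix w
        obtain h where h: "h \<in> weight_space I Y u w" "R.comp ?A g w = ?F h"
          using R.comp_G[OF A(1) gR, of w] by blast
        have c: "R.comp ?A g w z = h (\<psi> z)" if "z \<in> Y" for z
          using that by (simp only: h(2) pull_def on_apply)
        have "\<psi> ?y = diag I (cochar u s) (\<psi> x)" by (rule \<phi>(3)[OF st(1)[OF s mem(2)[OF x]]])
        moreover have "h (diag I (cochar u s) (\<psi> x)) = s powi w * h (\<psi> x)"
          by (rule weight_spaceD[OF h(1) s mem(2)[OF x]])
        ultimately show "R.comp ?A g w ?y = s powi w * R.comp ?A g w x"
          by (simp only: c[OF x] c[OF y])
      qed
      finally show ?thesis using x by (simp add: pull_def fun_sum_apply fscale_def)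
    next
      case False
      then show ?thesis using cmp by (auto simp: pull_def fun_sum_apply fscale_def weight_space_def coord_ring_def)
    qed
  qed
  also have "\<dots> \<in> weight_space I Y v k"
    using cmp by (intro fs.subspace_sum fs.subspace_scale R.G_sub[OF Gv] st(2))
  finally show ?thesis .
qed


section \<open>Tori acting on trinomial hypersurfaces\<close>

text \<open>With \<open>d\<close> the gcd and \<open>l = d * q\<close>, take a root \<open>w\<close>
  of the sum of the powers below \<open>q\<close>, which is not 1 in characteristic 0, and a
  \<open>d\<close>-th root \<open>z\<close> of \<open>w\<close>. If \<open>z ^ k\<close> were 1,
  Bezout would give \<open>z ^ d = 1\<close>.\<close>

lemma root_of_unity_not_root:
  fixes k l :: nat
  assumes "\<not> l dvd k" "l > 0"
  shows "\<exists>z::'a::{alg_closed_field,field_char_0}. z ^ l = 1 \<and> z ^ k \<noteq> 1"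
proof -
  define d where "d = gcd k l"
  have d: "d > 0" "d dvd l" "d \<noteq> l" using assms gcd_dvd1[of k l] unfolding d_def by (simp, simp, metis)
  then obtain q where q: "l = d * q" by auto
  have q2: "q \<ge> 2" using q d assms(2) by (cases q; cases "q - 1") auto
  have "\<exists>w::'a. (\<Sum>i\<le>q-1. (\<lambda>_. 1) i * w ^ i) = 0"
    by (rule alg_closed) (use q2 in auto)
  then obtain w :: 'a where w: "(\<Sum>i<q. w ^ i) = 0" using q2 by (auto simp: lessThan_Suc_atMost[symmetric])
  have w1: "w \<noteq> 1"
  proof
    assume "w = 1"
    then have "of_nat q = (0::'a)" using w by simp
    then show False using q2 by simp
  qed
  have wq: "w ^ q = 1" using power_diff_1_eq[of w q] w by simp
  obtain z :: 'a where z: "z ^ d = w" using nth_root_exists d(1) by blast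
  have "z ^ l = 1" unfolding q power_mult z by (rule wq)
  moreover have "z ^ k \<noteq> 1"
  proof
    assume k: "z ^ k = 1"
    then have "k \<noteq> 0" using assms by (metis dvd_0_right)
    then obtain a b where "k * a = l * b + d" unfolding d_def using bezout_nat by blast
    then have "z ^ (k * a) = z ^ (l * b) * z ^ d" by (simp add: power_add)
    then have "z ^ d = 1" using k \<open>z ^ l = 1\<close> by (simp add: power_mult)
    then show False using w1 z by simp
  qed
  ultimately show ?thesis by blast
qed

text \<open>The monomials are characters of \<open>G\<close>. Along the orbit of the single point
  \<open>x\<close> the value of \<open>P\<close> is a combination of these characters, and
  independence leaves only those equal to \<open>\<chi>\<close>.\<close>

lemma isotypic:
  fixes P :: "('v, 'a::field) mp"
  assumes P: "mp_vars P \<subseteq> I" and one: "(\<lambda>_. 1) \<in> G" and mult: "\<And>s t. s \<in> G \<Longrightarrow> t \<in> G \<Longrightarrow> (\<lambda>v. s v * t v) \<in> G"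
    and \<chi>: "\<chi> (\<lambda>_. 1) = 1" "\<And>s t. s \<in> G \<Longrightarrow> t \<in> G \<Longrightarrow> \<chi> (\<lambda>v. s v * t v) = \<chi> s * \<chi> t"
    and semi: "\<And>t. t \<in> G \<Longrightarrow> mp_eval (diag I t x) P = \<chi> t * mp_eval x P"
  shows "mp_eval x P = (\<Sum>m | m \<in> Poly_Mapping.keys P \<and> (\<forall>t\<in>G. pm_monom t m = \<chi> t). Poly_Mapping.lookup P m * pm_monom x m)"
proof -
  let ?K = "Poly_Mapping.keys P"
  define ch where "ch m = restrict (\<lambda>t. pm_monom t m) G" for m :: "'v \<Rightarrow>\<^sub>0 nat"
  define \<chi>' where "\<chi>' = restrict \<chi> G"
  define J where "J = insert \<chi>' (ch ` ?K)"
  \<comment> \<open>The total contribution of the character \<open>k\<close>, minus the whole value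
    for \<open>k = \<chi>'\<close>. Independence is applied to these coefficients and read off at
    \<open>\<chi>'\<close>; the restriction of characters to \<open>G\<close> makes those that agree
    there equal.\<close>
  define c where "c k = (\<Sum>m | m \<in> ?K \<and> ch m = k. Poly_Mapping.lookup P m * pm_monom x m) - (if k = \<chi>' then mp_eval x P else 0)" for k
  have kI: "m \<in> ?K \<Longrightarrow> Poly_Mapping.keys m \<subseteq> I" for m using P by (auto simp: mp_vars_def)
  have J: "finite J" by (simp add: J_def)
  have pm: "pm_monom (\<lambda>v. s v * t v) m = pm_monom s m * pm_monom t m" for s t :: "'v \<Rightarrow> 'a" and m
    by (simp add: pm_monom_def power_mult_distrib prod.distrib)
  have pm1: "pm_monom (\<lambda>_. 1 :: 'a) m = 1" for m :: "'v \<Rightarrow>\<^sub>0 nat" by (simp add: pm_monom_def)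
  have "c \<chi>' = 0"
  proof (rule characters_independent[where G = G and e = "\<lambda>_. 1" and m = "\<lambda>s t v. s v * t v" and \<chi> = "\<lambda>k. k" and J = J and c = c])
    show "k (\<lambda>_. 1) = 1" if "k \<in> J" for k
      using that one \<chi>(1) pm1 by (auto simp: J_def \<chi>'_def ch_def)
    show "k (\<lambda>v. s v * t v) = k s * k t" if "k \<in> J" "s \<in> G" "t \<in> G" for k s t
      using that mult \<chi>(2) pm by (auto simp: J_def \<chi>'_def ch_def)
    show "\<exists>g\<in>G. k g \<noteq> k' g" if "k \<in> J" "k' \<in> J" "k \<noteq> k'" for k k'
    proof (rule ccontr)
      assume "\<not> (\<exists>g\<in>G. k g \<noteq> k' g)"
      moreover have "k \<in> extensional G" "k' \<in> extensional G"
        using that by (auto simp: J_def \<chi>'_def ch_def)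
      ultimately have "k = k'" by (intro extensionalityI[of k G k']) auto
      then show False using that by simp
    qed
    show "(\<Sum>k\<in>J. c k * k t) = 0" if t: "t \<in> G" for t
    proof -
      have "(\<Sum>k\<in>J. (\<Sum>m | m \<in> ?K \<and> ch m = k. Poly_Mapping.lookup P m * pm_monom x m) * k t)
        = (\<Sum>k\<in>J. \<Sum>m | m \<in> ?K \<and> ch m = k. Poly_Mapping.lookup P m * pm_monom (diag I t x) m)"
        unfolding sum_distrib_right using t kI
        by (intro sum.cong refl) (auto simp: pm_monom_diag ch_def)
      also have "\<dots> = mp_eval (diag I t x) P"
        unfolding mp_eval_eq by (rule sum.group) (auto simp: J_def)
      finally have "(\<Sum>k\<in>J. (\<Sum>m | m \<in> ?K \<and> ch m = k. Poly_Mapping.lookup P m * pm_monom x m) * k t) = \<chi> t * mp_eval x P"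
        using semi[OF t] by simp
      moreover have "(\<Sum>k\<in>J. (if k = \<chi>' then mp_eval x P else 0) * k t) = \<chi> t * mp_eval x P"
      proof -
        have "(\<Sum>k\<in>J. (if k = \<chi>' then mp_eval x P else 0) * k t) = (\<Sum>k\<in>J. if k = \<chi>' then mp_eval x P * k t else 0)"
          by (rule sum.cong) auto
        also have "\<dots> = mp_eval x P * \<chi>' t" using J by (simp add: J_def)
        finally show ?thesis using t by (simp add: \<chi>'_def)
      qed
      ultimately show ?thesis by (simp add: c_def left_diff_distrib sum_subtractf)
    qed
  qed (use J one mult in \<open>auto simp: J_def\<close>)
  then have "mp_eval x P = (\<Sum>m | m \<in> ?K \<and> ch m = \<chi>'. Poly_Mapping.lookup P m * pm_monom x m)"
    by (simp add: c_def)
  also have "{m. m \<in> ?K \<and> ch m = \<chi>'} = {m. m \<in> ?K \<and> (\<forall>t\<in>G. pm_monom t m = \<chi> t)}"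
    by (auto simp: ch_def \<chi>'_def restrict_def fun_eq_iff)
  finally show ?thesis .
qed

section \<open>Block monomials, cocharacters and the two tori\<close>

definition bm :: "(nat \<Rightarrow> nat) \<Rightarrow> (nat \<Rightarrow> nat \<Rightarrow> nat) \<Rightarrow> nat \<Rightarrow> (idx \<Rightarrow> 'a) \<Rightarrow> 'a::comm_ring_1" where
  "bm n l i x = (\<Prod>j=1..n i. x (i, j) ^ l i j)"

lemma in_tri_idx: "(i, j) \<in> tri_idx n \<longleftrightarrow> i \<le> 2 \<and> 1 \<le> j \<and> j \<le> n i"
  by (auto simp: tri_idx_def)

lemma finite_tri_idx: "finite (tri_idx n)" by (simp add: tri_idx_def)

lemma sum_tri_idx: "(\<Sum>v\<in>tri_idx n. g v) = (\<Sum>i\<le>2. \<Sum>j=1..n i. g (i, j))"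
  by (simp add: tri_idx_def sum.Sigma atMost_atLeast0)

lemma le2_cases: "(i::nat) \<le> 2 \<longleftrightarrow> i = 0 \<or> i = 1 \<or> i = 2" by auto

lemma sum_le2: "(\<Sum>i\<le>2. g i) = g 0 + g 1 + (g (2::nat) :: 'b::comm_monoid_add)"
  by (simp add: numeral_2_eq_2)

lemma mp_eval_trinomial: "mp_eval x (trinomial n l) = (\<Sum>i\<le>2. bm n l i x)"
  by (simp add: trinomial_def mp_eval_simps bm_def atMost_atLeast0)

lemma mp_vars_trinomial: "mp_vars (trinomial n l) \<subseteq> tri_idx n"
  unfolding trinomial_def by (intro mp_vars_sum mp_vars_prod mp_vars_power mp_vars_var) (auto simp: in_tri_idx)

lemma bm_diag: "i \<le> 2 \<Longrightarrow> bm n l i (diag (tri_idx n) t x) = bm n l i t * bm n l i x"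
  unfolding bm_def prod.distrib[symmetric]
  by (intro prod.cong) (auto simp: diag_def in_tri_idx power_mult_distrib)

lemma bm_mult: "bm n l i (\<lambda>v. s v * t v) = bm n l i s * bm n l i t"
  by (simp add: bm_def power_mult_distrib prod.distrib)

lemma bm_1 [simp]: "bm n l i (\<lambda>_. 1) = 1"
  by (simp add: bm_def)

definition block_exp :: "(nat \<Rightarrow> nat) \<Rightarrow> (nat \<Rightarrow> nat \<Rightarrow> nat) \<Rightarrow> nat \<Rightarrow> (idx \<Rightarrow>\<^sub>0 nat)" where
  "block_exp n l i = (\<Sum>j=1..n i. Poly_Mapping.single (i, j) (l i j))"

lemma lookup_block_exp: "Poly_Mapping.lookup (block_exp n l i) (i', j) = (if i' = i \<and> 1 \<le> j \<and> j \<le> n i then l i j else 0)"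
  unfolding block_exp_def lookup_sum lookup_single when_def
  by (cases "i' = i") (auto simp: sum.delta)

lemma pm_monom_block_exp: "pm_monom x (block_exp n l i) = bm n l i x"
proof -
  have "pm_monom x (\<Sum>j\<in>A. Poly_Mapping.single (i, j) (l i j)) = (\<Prod>j\<in>A. x (i, j) ^ l i j)" for A
    by (induction A rule: infinite_finite_induct) (auto simp: pm_monom_add)
  then show ?thesis by (simp add: block_exp_def bm_def)
qed

text \<open>The kernel of the matrix \<open>L\<close> on integer vectors; values of \<open>u\<close>
  outside the index set are free.\<close>

definition cochars :: "(nat \<Rightarrow> nat) \<Rightarrow> (nat \<Rightarrow> nat \<Rightarrow> nat) \<Rightarrow> (idx \<Rightarrow> int) set" where
  "cochars n l = {u. \<forall>i\<in>{1,2}. (\<Sum>j=1..n i. u (i, j) * int (l i j)) = (\<Sum>j=1..n 0. u (0, j) * int (l 0 j))}"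

text \<open>The quasitorus seen through its action: \<open>big_torus_iff\<close> identifies these
  vectors with the characters that are trivial on the image of the transpose of
  \<open>L\<close>.\<close>

definition big_torus :: "(nat \<Rightarrow> nat) \<Rightarrow> (nat \<Rightarrow> nat \<Rightarrow> nat) \<Rightarrow> (idx \<Rightarrow> 'a::field) set" where
  "big_torus n l = {t. (\<forall>v\<in>tri_idx n. t v \<noteq> 0) \<and> bm n l 1 t = bm n l 0 t \<and> bm n l 2 t = bm n l 0 t}"

inductive_set torus :: "(nat \<Rightarrow> nat) \<Rightarrow> (nat \<Rightarrow> nat \<Rightarrow> nat) \<Rightarrow> (idx \<Rightarrow> 'a::field) set" for n l where
  one: "(\<lambda>_. 1) \<in> torus n l"
| step: "t \<in> torus n l \<Longrightarrow> u \<in> cochars n l \<Longrightarrow> s \<noteq> 0 \<Longrightarrow> (\<lambda>v. s powi u v * t v) \<in> torus n l"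

lemma torus_mult: "s \<in> torus n l \<Longrightarrow> t \<in> torus n l \<Longrightarrow> (\<lambda>v. s v * t v) \<in> torus n l"
  by (induction rule: torus.induct) (auto simp: mult.assoc intro: torus.intros)

lemma cochar_torus: "u \<in> cochars n l \<Longrightarrow> s \<noteq> 0 \<Longrightarrow> cochar u s \<in> torus n l"
  using torus.step[OF torus.one] by simp

lemma bm_cochar:
  assumes "s \<noteq> 0"
  shows "bm n l i (cochar u s) = s powi (\<Sum>j=1..n i. u (i, j) * int (l i j))"
proof -
  have "(\<Prod>j\<in>A. (s powi u (i, j)) ^ l i j) = s powi (\<Sum>j\<in>A. u (i, j) * int (l i j))" for A
    by (induction A rule: infinite_finite_induct) (use assms in \<open>auto simp: power_int_add power_int_mult\<close>)
  then show ?thesis by (simp add: bm_def)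
qed

lemma cochar_big_torus: "u \<in> cochars n l \<Longrightarrow> s \<noteq> 0 \<Longrightarrow> cochar u s \<in> big_torus n l"
  by (auto simp: big_torus_def bm_cochar cochars_def)

lemma big_torus_one: "(\<lambda>_. 1) \<in> big_torus n l"
  by (simp add: big_torus_def)

lemma big_torus_mult: "s \<in> big_torus n l \<Longrightarrow> t \<in> big_torus n l \<Longrightarrow> (\<lambda>v. s v * t v) \<in> big_torus n l"
  by (simp add: big_torus_def bm_mult)

lemma torus_subset: "torus n l \<subseteq> big_torus n l"
proof
  fix t :: "idx \<Rightarrow> 'a" assume "t \<in> torus n l"
  then show "t \<in> big_torus n l"
    by induction (auto intro: big_torus_one big_torus_mult cochar_big_torus)
qed

lemma cochars_if:
  assumes "(cochar u (2::'a::field_char_0)) \<in> big_torus n l" shows "u \<in> cochars n l"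
  using assms by (auto simp: big_torus_def bm_cochar cochars_def dest: power_int_2_inj)


section \<open>Weights of monomials\<close>

locale trinomial_data =
  fixes n :: "nat \<Rightarrow> nat" and l :: "nat \<Rightarrow> nat \<Rightarrow> nat"
    and Y :: "(idx \<Rightarrow> 'a::{alg_closed_field, field_char_0}) set"
  assumes Y_def: "Y = trinomial_hypersurface n l"
    and blocks: "i \<le> 2 \<Longrightarrow> n i > 0"
    and exps: "(i, j) \<in> tri_idx n \<Longrightarrow> l i j > 0"
    and no_linear: "i \<le> 2 \<Longrightarrow> n i * l i 1 > 1"
begin

abbreviation I :: "idx set" where "I \<equiv> tri_idx n"
abbreviation b :: "nat \<Rightarrow> (idx \<Rightarrow> 'a) \<Rightarrow> 'a" where "b \<equiv> bm n l"
abbreviation H :: "(idx \<Rightarrow> 'a) set" where "H \<equiv> big_torus n l"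
abbreviation T :: "(idx \<Rightarrow> 'a) set" where "T \<equiv> torus n l"
abbreviation C :: "(idx \<Rightarrow> int) set" where "C \<equiv> cochars n l"
abbreviation e :: "idx \<Rightarrow> (idx \<Rightarrow>\<^sub>0 nat)" where "e v \<equiv> Poly_Mapping.single v 1"

lemma Y_zero_set: "Y = zero_set I (trinomial n l)"
  by (simp add: Y_def trinomial_hypersurface_def)

lemma Y_iff: "x \<in> Y \<longleftrightarrow> x \<in> extensional I \<and> b 0 x + b 1 x + b 2 x = 0"
  unfolding Y_zero_set zero_set_def mp_eval_trinomial sum_le2 PiE_def by auto

lemma exps1: "i \<le> 2 \<Longrightarrow> l i 1 > 0"
  using exps[of i 1] blocks[of i] by (auto simp: in_tri_idx)

lemma diag_Y: assumes "t \<in> H" "x \<in> Y" shows "diag I t x \<in> Y"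
proof -
  have "b 0 t * (b 0 x + b 1 x + b 2 x) = 0" using assms(2) by (simp add: Y_iff)
  moreover have "diag I t x \<in> extensional I" by (simp add: diag_def)
  ultimately show ?thesis using assms(1) by (simp add: Y_iff bm_diag big_torus_def algebra_simps)
qed

lemma cochar_Y: "u \<in> C \<Longrightarrow> s \<noteq> 0 \<Longrightarrow> x \<in> Y \<Longrightarrow> diag I (cochar u s) x \<in> Y"
  using diag_Y cochar_big_torus by blast

lemma bm_point:
  assumes "i \<le> 2" "x (i, 1) ^ l i 1 = c" "\<And>j. 2 \<le> j \<Longrightarrow> j \<le> n i \<Longrightarrow> x (i, j) = 1"
  shows "b i x = c"
proof -
  have "b i x = (\<Prod>j\<in>{1}. x (i, j) ^ l i j)"
    unfolding bm_def using assms(3) blocks[OF assms(1)]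
    by (intro prod.mono_neutral_right) (auto simp: not_less_eq_eq numeral_2_eq_2)
  then show ?thesis using assms(2) by simp
qed

text \<open>The three block values can be prescribed freely subject to sum 0: put an
  \<open>l i 1\<close>-th root into the first variable of each block and 1 into the others.\<close>

lemma point_exists:
  fixes c :: "nat \<Rightarrow> 'a"
  assumes "c 0 + c 1 + c 2 = 0"
  obtains x where "x \<in> Y" "\<And>i. i \<le> 2 \<Longrightarrow> b i x = c i" "\<And>i j. (i, j) \<in> I \<Longrightarrow> c i \<noteq> 0 \<Longrightarrow> x (i, j) \<noteq> 0"
proof -
  define r where "r i = (SOME z. z ^ l i 1 = c i)" for i
  have r: "r i ^ l i 1 = c i" if "i \<le> 2" for i
    unfolding r_def using nth_root_exists[OF exps1[OF that], of "c i"] by (rule someI_ex)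
  define x where "x = (\<lambda>(i, j)\<in>I. if j = 1 then r i else 1)"
  have x: "x (i, j) = (if j = 1 then r i else 1)" if "(i, j) \<in> I" for i j using that by (simp add: x_def)
  have bx: "b i x = c i" if "i \<le> 2" for i
    by (rule bm_point[OF that]) (use that blocks[OF that] r in \<open>auto simp: x in_tri_idx\<close>)
  show thesis
  proof (rule that)
    show "x \<in> Y" using bx assms by (auto simp: Y_iff x_def)
    show "x (i, j) \<noteq> 0" if "(i, j) \<in> I" "c i \<noteq> 0" for i j
      using that r[of i] exps1[of i] by (auto simp: x in_tri_idx zero_power)
  qed (rule bx)
qed

lemma generic_point: obtains x where "x \<in> Y" "\<And>v. v \<in> I \<Longrightarrow> x v \<noteq> 0"
  using point_exists[of "\<lambda>i. if i = 2 then -2 else 1"] by (auto split: if_splits) (metis surj_pair zero_neq_neg_numeral zero_neq_one)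

text \<open>Points of \<open>Y\<close> that vanish at exactly one coordinate tell coordinates apart
  up to scalars; they make the permutation in a monomial map unique.\<close>

lemma separating_point:
  assumes "v \<in> I" obtains x where "x \<in> Y" "x v = 0" "\<And>w. w \<in> I \<Longrightarrow> w \<noteq> v \<Longrightarrow> x w \<noteq> 0"
proof -
  obtain i j where v: "v = (i, j)" by (cases v)
  have i: "i \<le> 2" using assms v by (auto simp: in_tri_idx)
  obtain k :: nat where k: "k \<le> 2" "k \<noteq> i"
    by (metis zero_le zero_neq_one one_le_numeral)
  define c :: "nat \<Rightarrow> 'a" where "c i' = (if i' = i then 0 else if i' = k then 1 else -1)" for i'
  have "c 0 + c 1 + c 2 = 0" using i k(1,2) unfolding le2_cases by (auto simp: c_def)
  then obtain x where x: "x \<in> Y" "\<And>i'. i' \<le> 2 \<Longrightarrow> b i' x = c i'"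
      "\<And>i' j. (i', j) \<in> I \<Longrightarrow> c i' \<noteq> 0 \<Longrightarrow> x (i', j) \<noteq> 0"
    by (rule point_exists) blast
  \<comment> \<open>Block \<open>i\<close> has value 0 as soon as \<open>v\<close> vanishes, so its
    other variables may be reset to 1 without leaving \<open>Y\<close>.\<close>
  define y where "y = (\<lambda>w. if w \<in> I \<and> fst w = i then if w = v then 0 else 1 else x w)"
  have yi: "b i y = 0"
    unfolding bm_def using assms v exps[of i j]
    by (intro prod_zero) (auto simp: y_def in_tri_idx intro!: bexI[of _ j])
  have yb: "b i' y = b i' x" if "i' \<noteq> i" for i' using that by (simp add: bm_def y_def)
  show thesis
  proof (rule that)
    have "b i' y = b i' x" if "i' \<le> 2" for i' using yi yb x(2)[OF i] by (cases "i' = i") (auto simp: c_def)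
    then show "y \<in> Y" using x(1) by (auto simp: Y_iff y_def extensional_def)
    show "y v = 0" using assms v by (simp add: y_def)
    show "y w \<noteq> 0" if "w \<in> I" "w \<noteq> v" for w
      using that x(3)[of "fst w" "snd w"] by (auto simp: y_def c_def split: if_splits)
  qed
qed

text \<open>Points with block values 1, -1, 0 and 1, 0, -1 force the scaling factors of the three
  blocks to agree. This is how vectors arising from automorphisms are recognised as elements of the
  quasitorus.\<close>

lemma diag_Y_imp_big_torus:
  assumes t: "\<And>v. v \<in> I \<Longrightarrow> t v \<noteq> 0" and Yt: "\<And>x. x \<in> Y \<Longrightarrow> diag I t x \<in> Y"
  shows "t \<in> H"
proof -
  have *: "b 0 t * c 0 + b 1 t * c 1 + b 2 t * c 2 = 0" if c: "c 0 + c 1 + c 2 = 0" for c :: "nat \<Rightarrow> 'a"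
  proof -
    obtain x where x: "x \<in> Y" "\<And>i. i \<le> 2 \<Longrightarrow> b i x = c i" using point_exists[OF c] by metis
    show ?thesis using Yt[OF x(1)] x(2) by (simp add: Y_iff bm_diag)
  qed
  have "b 0 t = b 1 t" "b 0 t = b 2 t"
    using *[of "\<lambda>i. if i = 0 then 1 else if i = 1 then -1 else 0"] *[of "\<lambda>i. if i = 0 then 1 else if i = 2 then -1 else 0"] by auto
  then show ?thesis using t by (simp add: big_torus_def)
qed

text \<open>Rationally, the orthogonal complement of the cocharacters is the row space of the matrix \<open>L\<close>.\<close>

lemma cochars_orthogonal:
  fixes d :: "idx \<Rightarrow> int"
  assumes d: "\<And>u. u \<in> C \<Longrightarrow> (\<Sum>v\<in>I. u v * d v) = 0"
  obtains q :: "nat \<Rightarrow> rat" where "\<And>i j. (i, j) \<in> I \<Longrightarrow> of_int (d (i, j)) = q i * of_nat (l i j)" "q 0 + q 1 + q 2 = 0"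
proof -
  define q where "q i = (of_int (d (i, 1)) / of_nat (l i 1) :: rat)" for i
  have one: "(i, 1) \<in> I" if "i \<le> 2" for i using blocks[OF that] that by (auto simp: in_tri_idx)
  show thesis
  proof (rule that[of q])
    fix i j assume ij: "(i, j) \<in> I"
    then have i: "i \<le> 2" by (auto simp: in_tri_idx)
    show "of_int (d (i, j)) = q i * of_nat (l i j)"
    proof (cases "j = 1")
      case True
      then show ?thesis using exps1[OF i] by (simp add: q_def)
    next
      case False
      \<comment> \<open>Two variables of one block with exponents exchanged: all block sums are 0.
        Orthogonality to it makes \<open>d\<close> proportional to \<open>l\<close> inside the
        block.\<close>
      define u where "u v = (if v = (i, 1) then int (l i j) else if v = (i, j) then - int (l i 1) else 0)" for v
      have "(\<Sum>k=1..n i'. u (i', k) * int (l i' k)) = 0" for i'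
      proof (cases "i' = i")
        case True
        have "(\<Sum>k=1..n i'. u (i', k) * int (l i' k)) = (\<Sum>k\<in>{1, j}. u (i', k) * int (l i' k))"
          using ij True one[OF i] by (intro sum.mono_neutral_right) (auto simp: u_def in_tri_idx)
        also have "\<dots> = 0" using True False by (simp add: u_def)
        finally show ?thesis .
      qed (simp add: u_def)
      then have "u \<in> C" by (simp add: cochars_def)
      then have "(\<Sum>v\<in>I. u v * d v) = 0" by (rule d)
      also have "(\<Sum>v\<in>I. u v * d v) = (\<Sum>v\<in>{(i, 1), (i, j)}. u v * d v)"
        using ij one[OF i] by (intro sum.mono_neutral_right) (auto simp: u_def finite_tri_idx)
      also have "\<dots> = int (l i j) * d (i, 1) - int (l i 1) * d (i, j)" using False by (simp add: u_def)
      finally have "int (l i 1) * d (i, j) = int (l i j) * d (i, 1)" by simp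
      then have "(of_int (int (l i 1) * d (i, j)) :: rat) = of_int (int (l i j) * d (i, 1))" by simp
      then show ?thesis using exps1[OF i] by (simp add: q_def field_simps)
    qed
  next
    \<comment> \<open>Weights on the first variables with all block sums equal to
      \<open>l 0 1 * l 1 1 * l 2 1\<close>; this cocharacter gives the relation between the three
      factors \<open>q i\<close>.\<close>
    define c where "c i = (if i = 0 then l 1 1 * l 2 1 else if i = 1 then l 0 1 * l 2 1 else l 0 1 * l 1 1)" for i :: nat
    define u where "u v = (if snd v = 1 then int (c (fst v)) else 0)" for v :: idx
    have s: "(\<Sum>k=1..n i. u (i, k) * g k) = int (c i) * g 1" if "i \<le> 2" for i and g :: "nat \<Rightarrow> int"
    proof -
      have "(\<Sum>k=1..n i. u (i, k) * g k) = (\<Sum>k\<in>{1}. u (i, k) * g k)"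
        using blocks[OF that] by (intro sum.mono_neutral_right) (auto simp: u_def)
      then show ?thesis by (simp add: u_def)
    qed
    have "(\<Sum>j=1..n i. u (i, j) * int (l i j)) = int (c i) * int (l i 1)" if "i \<le> 2" for i
      by (rule s[OF that, of "\<lambda>j. int (l i j)"])
    from this[of 0] this[of 1] this[of 2] have "u \<in> C" unfolding cochars_def by (simp add: c_def)
    then have "(\<Sum>v\<in>I. u v * d v) = 0" by (rule d)
    then have "int (c 0) * d (0, 1) + int (c 1) * d (1, 1) + int (c 2) * d (2, 1) = 0"
      unfolding sum_tri_idx sum_le2
      using s[of 0 "\<lambda>j. d (0, j)"] s[of 1 "\<lambda>j. d (1, j)"] s[of 2 "\<lambda>j. d (2, j)"] by simp
    then have "(of_int (int (c 0) * d (0, 1) + int (c 1) * d (1, 1) + int (c 2) * d (2, 1)) :: rat) = 0" by simp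
    then have "of_nat (l 1 1 * l 2 1) * of_int (d (0, 1)) + of_nat (l 0 1 * l 2 1) * of_int (d (1, 1))
      + of_nat (l 0 1 * l 1 1) * of_int (d (2, 1)) = (0::rat)" by (simp add: c_def)
    moreover have "of_int (d (i, 1)) = q i * of_nat (l i 1)" if "i \<le> 2" for i
      using exps1[OF that] by (simp add: q_def)
    ultimately have "of_nat (l 1 1 * l 2 1) * (q 0 * of_nat (l 0 1)) + of_nat (l 0 1 * l 2 1) * (q 1 * of_nat (l 1 1))
      + of_nat (l 0 1 * l 1 1) * (q 2 * of_nat (l 2 1)) = 0" by simp
    then have "of_nat (l 0 1 * l 1 1 * l 2 1) * (q 0 + q 1 + q 2) = 0" by (simp add: algebra_simps)
    then show "q 0 + q 1 + q 2 = 0"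
      using exps1[of 0] exps1[of 1] exps1[of 2] by simp
  qed
qed

definition same_weight :: "(idx \<Rightarrow>\<^sub>0 nat) \<Rightarrow> (idx \<Rightarrow>\<^sub>0 nat) \<Rightarrow> bool" where
  "same_weight m m' \<longleftrightarrow> (\<forall>u\<in>C. pairing I u m = pairing I u m')"

lemma same_weightE:
  assumes "same_weight m m'"
  obtains q :: "nat \<Rightarrow> rat" where
    "\<And>i j. (i, j) \<in> I \<Longrightarrow> of_nat (Poly_Mapping.lookup m (i, j)) = of_nat (Poly_Mapping.lookup m' (i, j)) + q i * of_nat (l i j)"
    "q 0 + q 1 + q 2 = 0"
proof -
  have "(\<Sum>v\<in>I. u v * (int (Poly_Mapping.lookup m v) - int (Poly_Mapping.lookup m' v))) = 0" if "u \<in> C" for u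
    using assms that by (simp add: same_weight_def pairing_def right_diff_distrib sum_subtractf)
  then show thesis
  proof (rule cochars_orthogonal[where d = "\<lambda>v. int (Poly_Mapping.lookup m v) - int (Poly_Mapping.lookup m' v)"])
    fix q :: "nat \<Rightarrow> rat"
    assume q: "\<And>i j. (i, j) \<in> I \<Longrightarrow> of_int (int (Poly_Mapping.lookup m (i, j)) - int (Poly_Mapping.lookup m' (i, j))) = q i * of_nat (l i j)" "q 0 + q 1 + q 2 = 0"
    show thesis
    proof (rule that[OF _ q(2)])
      show "of_nat (Poly_Mapping.lookup m (i, j)) = of_nat (Poly_Mapping.lookup m' (i, j)) + q i * of_nat (l i j)" if "(i, j) \<in> I" for i j
        using q(1)[OF that] by simp
    qed
  qed
qed

lemma same_weight_if_torus:
  assumes "Poly_Mapping.keys m \<subseteq> I" "Poly_Mapping.keys m' \<subseteq> I" "\<And>t. t \<in> T \<Longrightarrow> pm_monom t m = pm_monom t m'"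
  shows "same_weight m m'"
  unfolding same_weight_def
proof
  fix u assume "u \<in> C"
  then have "pm_monom (cochar u (2::'a)) m = pm_monom (cochar u 2) m'" by (intro assms(3) cochar_torus) auto
  then show "pairing I u m = pairing I u m'"
    using assms(1,2) by (intro power_int_2_inj[where 'a='a]) (simp add: pm_monom_cochar[OF finite_tri_idx assms(1)] pm_monom_cochar[OF finite_tri_idx assms(2)])
qed

lemma keys_e: "v \<in> I \<Longrightarrow> Poly_Mapping.keys (e v) \<subseteq> I" by simp

lemma eq_eI:
  assumes m: "Poly_Mapping.keys m \<subseteq> I" and w: "\<And>i j. (i, j) \<in> I \<Longrightarrow> Poly_Mapping.lookup m (i, j) = (if (i, j) = v then 1 else 0)" and v: "v \<in> I"
  shows "m = e v"
proof (rule poly_mapping_eqI)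
  fix k
  show "Poly_Mapping.lookup m k = Poly_Mapping.lookup (e v) k"
  proof (cases "k \<in> I")
    case True
    then show ?thesis using w[of "fst k" "snd k"] by (simp add: lookup_single when_def)
  next
    case False
    then have "k \<notin> Poly_Mapping.keys m" "k \<noteq> v" using m v by auto
    then show ?thesis by (simp add: lookup_single in_keys_iff)
  qed
qed

lemma third_index:
  assumes "i \<le> (2::nat)" "k \<le> 2" "k \<noteq> i"
  obtains k' where "k' \<le> 2" "k' \<noteq> i" "k' \<noteq> k" "\<And>i'. i' \<le> 2 \<Longrightarrow> i' = i \<or> i' = k \<or> i' = k'"
    "\<And>q::nat \<Rightarrow> 'b::comm_monoid_add. q 0 + q 1 + q 2 = q i + q k + q k'"
proof -
  define k' where "k' = 3 - i - k"
  have k': "k' \<le> 2" "k' \<noteq> i" "k' \<noteq> k" and all: "\<And>i'. i' \<le> 2 \<Longrightarrow> i' = i \<or> i' = k \<or> i' = k'"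
    using assms unfolding k'_def by arith+
  have "q 0 + q 1 + q 2 = q i + q k + q k'" for q :: "nat \<Rightarrow> 'b"
  proof -
    have "{..2} = {i, k, k'}" using all k' assms by auto
    then have "sum q {..2} = sum q {i, k, k'}" by simp
    then show ?thesis using k'(2,3) assms(3) by (simp add: sum_le2 add.assoc)
  qed
  then show thesis using that k' all by blast
qed

text \<open>The exponents of \<open>m\<close> are those of the variable plus multiples
  \<open>q k\<close> of the block exponents, with \<open>q\<close> summing to 0. Nonnegativity gives
  \<open>q k \<ge> 0\<close> for the other blocks; so either \<open>q\<close> vanishes, or
  \<open>q i < 0\<close>, which forces block \<open>i\<close> to be a single variable with
  \<open>q i = - 1 / l i 1\<close>. In another single-variable block of exponent at most
  \<open>l i 1\<close>, the variable then has degree at most 1 in \<open>m\<close>, with equality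
  only for a mere exchange of variables.\<close>

lemma same_weight_e:
  assumes m: "Poly_Mapping.keys m \<subseteq> I" and v: "(i, j) \<in> I" and sw: "same_weight m (e (i, j))"
  shows "m = e (i, j) \<or> (n i = 1 \<and> Poly_Mapping.lookup m (i, j) = 0 \<and>
    (\<forall>k. k \<noteq> i \<longrightarrow> (k, 1) \<in> I \<longrightarrow> n k = 1 \<longrightarrow> l k 1 \<le> l i 1 \<longrightarrow>
        Poly_Mapping.lookup m (k, 1) = 0 \<or> (m = e (k, 1) \<and> l k 1 = l i 1)))"
proof -
  obtain q :: "nat \<Rightarrow> rat" where q: "\<And>i' j'. (i', j') \<in> I \<Longrightarrow> of_nat (Poly_Mapping.lookup m (i', j')) = of_nat (Poly_Mapping.lookup (e (i, j)) (i', j')) + q i' * of_nat (l i' j')" "q 0 + q 1 + q 2 = 0"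
    using same_weightE[OF sw] by metis
  have i: "i \<le> 2" using v by (simp add: in_tri_idx)
  have one: "(k, 1) \<in> I" if "k \<le> 2" for k using blocks[OF that] that by (auto simp: in_tri_idx)
  have pos: "(0::rat) < of_nat (l i' j')" if "(i', j') \<in> I" for i' j' using exps[OF that] by simp
  have nonneg: "q k \<ge> 0" if "k \<le> 2" "k \<noteq> i" for k
  proof -
    have "q k * of_nat (l k 1) = of_nat (Poly_Mapping.lookup m (k, 1))" using q(1)[OF one[OF that(1)]] that by (simp add: lookup_single)
    then have "q k * of_nat (l k 1) \<ge> 0" by simp
    then show ?thesis using pos[OF one[OF that(1)]] by (simp add: zero_le_mult_iff)
  qed
  have all0: "m = e (i, j)" if qi: "q i \<ge> 0"
  proof (rule eq_eI[OF m _ v])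
    fix i' j' assume ij: "(i', j') \<in> I"
    have "q k \<ge> 0" if "k \<le> 2" for k using qi nonneg[OF that] by (cases "k = i") auto
    from this[of 0] this[of 1] this[of 2] have "q 0 \<ge> 0" "q 1 \<ge> 0" "q 2 \<ge> 0" by simp_all
    then have "q 0 = 0" "q 1 = 0" "q 2 = 0" using q(2) by linarith+
    then have "q i' = 0" using ij by (auto simp: in_tri_idx le2_cases)
    then have "(of_nat (Poly_Mapping.lookup m (i', j')) :: rat) = of_nat (Poly_Mapping.lookup (e (i, j)) (i', j'))" using q(1)[OF ij] by simp
    then show "Poly_Mapping.lookup m (i', j') = (if (i', j') = (i, j) then 1 else 0)" by (simp add: lookup_single when_def)
  qed
  show ?thesis
  proof (cases "q i \<ge> 0")
    case True
    then show ?thesis using all0 by blast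
  next
    case False
    have "n i = 1"
    proof (rule ccontr)
      assume "n i \<noteq> 1"
      then obtain k where k: "(i, k) \<in> I" "k \<noteq> j"
        using blocks[OF i] v i by (cases "j = 1") (auto simp: in_tri_idx intro: that[of 1] that[of 2])
      then have "q i * of_nat (l i k) = of_nat (Poly_Mapping.lookup m (i, k))" using q(1)[OF k(1)] by (simp add: lookup_single)
      then have "q i * of_nat (l i k) \<ge> 0" by simp
      then show False using pos[OF k(1)] False by (simp add: zero_le_mult_iff)
    qed
    then have j: "j = 1" using v by (simp add: in_tri_idx)
    have mi: "(of_nat (Poly_Mapping.lookup m (i, j)) :: rat) = 1 + q i * of_nat (l i 1)" using q(1)[OF v] j by (simp add: lookup_single)
    have "q i * of_nat (l i 1) < 0" using False pos[OF v] j by (simp add: mult_neg_pos)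
    then have "(of_nat (Poly_Mapping.lookup m (i, j)) :: rat) < of_nat 1" using mi by simp
    then have m0: "Poly_Mapping.lookup m (i, j) = 0" unfolding of_nat_less_iff by simp
    then have qi: "q i * of_nat (l i 1) = -1" using mi by simp
    have "Poly_Mapping.lookup m (k, 1) = 0 \<or> (m = e (k, 1) \<and> l k 1 = l i 1)"
      if k: "k \<noteq> i" "(k, 1) \<in> I" "n k = 1" "l k 1 \<le> l i 1" for k
    proof (rule disjCI)
      assume nz: "\<not> (m = e (k, 1) \<and> l k 1 = l i 1)"
      have k2: "k \<le> 2" using k by (simp add: in_tri_idx)
      obtain k' where k': "k' \<le> 2" "k' \<noteq> i" "k' \<noteq> k" "\<And>i'. i' \<le> 2 \<Longrightarrow> i' = i \<or> i' = k \<or> i' = k'"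
          "\<And>q::nat \<Rightarrow> rat. q 0 + q 1 + q 2 = q i + q k + q k'"
        using third_index[OF i k2 k(1)] by metis
      have qs: "q k = - q i - q k'" using k'(5)[of q] q(2) by linarith
      have mk: "(of_nat (Poly_Mapping.lookup m (k, 1)) :: rat) = q k * of_nat (l k 1)" using q(1)[OF k(2)] k(1) by (simp add: lookup_single)
      \<comment> \<open>The left side is the exponent of \<open>(k, 1)\<close> in \<open>m\<close>.
        It is at most 1, and being 1 forces \<open>q k' = 0\<close> and equal block
        exponents.\<close>
      have "q k * of_nat (l k 1) \<le> q k * of_nat (l i 1)" using k(4) nonneg[OF k2 k(1)] by (intro mult_left_mono) auto
      also have "\<dots> = 1 - q k' * of_nat (l i 1)" unfolding qs using qi by (simp add: algebra_simps)
      finally have le: "q k * of_nat (l k 1) \<le> 1 - q k' * of_nat (l i 1)" .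
      show "Poly_Mapping.lookup m (k, 1) = 0"
      proof (rule ccontr)
        assume "Poly_Mapping.lookup m (k, 1) \<noteq> 0"
        then have ge: "q k * of_nat (l k 1) \<ge> 1" unfolding mk[symmetric] by simp
        have "q k' * of_nat (l i 1) \<ge> 0" using nonneg[OF k'(1,2)] by simp
        then have "q k' * of_nat (l i 1) = 0" and one': "q k * of_nat (l k 1) = 1" using le ge by linarith+
        then have qk': "q k' = 0" using exps1[OF i] by simp
        then have "q k * of_nat (l i 1) = 1" using qs qi by simp
        then have "q k * (of_nat (l k 1) - of_nat (l i 1)) = 0" using one' by (simp add: right_diff_distrib)
        moreover have "q k \<noteq> 0" using one' by auto
        ultimately have "l k 1 = l i 1" by simp
        moreover have "m = e (k, 1)"
        proof (rule eq_eI[OF m _ k(2)])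
          fix i' j' assume ij: "(i', j') \<in> I"
          then consider "i' = i" | "i' = k" | "i' = k'" using k'(4) by (auto simp: in_tri_idx)
          then show "Poly_Mapping.lookup m (i', j') = (if (i', j') = (k, 1) then 1 else 0)"
          proof cases
            case 1
            then have "j' = 1" using ij \<open>n i = 1\<close> by (simp add: in_tri_idx)
            then show ?thesis using 1 m0 j k(1) by simp
          next
            case 2
            then have "j' = 1" using ij k(3) by (simp add: in_tri_idx)
            then show ?thesis using 2 mk one' by simp
          next
            case 3
            then have "(of_nat (Poly_Mapping.lookup m (i', j')) :: rat) = 0" using q(1)[OF ij] qk' k'(2) by (simp add: lookup_single)
            then show ?thesis using 3 k'(3) by simp
          qed
        qed
        ultimately show False using nz by blast
      qed
    qed
    then show ?thesis using \<open>n i = 1\<close> m0 by blast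
  qed
qed

lemma keys_block_exp: "i \<le> 2 \<Longrightarrow> Poly_Mapping.keys (block_exp n l i) \<subseteq> I"
  by (auto simp: in_keys_iff lookup_block_exp in_tri_idx split: if_splits)

text \<open>A monomial of the weight of the trinomial has an exponent vector that is a convex
  combination of the three block exponents, with barycentric coordinates \<open>p\<close>; they are
  nonnegative because exponents are.\<close>

lemma same_weight_block_exp:
  assumes sw: "same_weight m (block_exp n l 0)"
  obtains p :: "nat \<Rightarrow> rat" where "\<And>i j. (i, j) \<in> I \<Longrightarrow> of_nat (Poly_Mapping.lookup m (i, j)) = p i * of_nat (l i j)"
    "p 0 + p 1 + p 2 = 1" "\<And>i. i \<le> 2 \<Longrightarrow> 0 \<le> p i"
proof -
  obtain q :: "nat \<Rightarrow> rat" where q: "\<And>i' j'. (i', j') \<in> I \<Longrightarrow> of_nat (Poly_Mapping.lookup m (i', j')) = of_nat (Poly_Mapping.lookup (block_exp n l 0) (i', j')) + q i' * of_nat (l i' j')" "q 0 + q 1 + q 2 = 0"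
    using same_weightE[OF sw] by metis
  define p where "p i = q i + (if i = 0 then 1 else 0)" for i
  have p: "of_nat (Poly_Mapping.lookup m (i, j)) = p i * of_nat (l i j)" if "(i, j) \<in> I" for i j
    using q(1)[OF that] that by (auto simp: lookup_block_exp p_def in_tri_idx algebra_simps)
  show thesis
  proof (rule that[OF p])
    show "p 0 + p 1 + p 2 = 1" using q(2) by (simp add: p_def)
    show "0 \<le> p i" if "i \<le> 2" for i
    proof -
      have "(i, 1) \<in> I" using blocks[OF that] that by (auto simp: in_tri_idx)
      then have "p i * of_nat (l i 1) \<ge> 0" using p[of i 1] by (metis of_nat_0_le_iff)
      then show ?thesis using exps1[OF that] by (simp add: zero_le_mult_iff)
    qed
  qed
qed


section \<open>Polynomials vanishing on the hypersurface\<close>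


lemma single_coord_big_torus:
  assumes "i \<le> 2" "z ^ l i 1 = 1" shows "(\<lambda>v. if v = (i, 1) then z else 1) \<in> H"
proof -
  have z: "z \<noteq> 0" using assms exps1[OF assms(1)] by (auto simp: zero_power)
  have "b k (\<lambda>v. if v = (i, 1) then z else 1) = 1" if "k \<le> 2" for k
    by (rule bm_point[OF that]) (use assms in auto)
  then show ?thesis using z by (auto simp: big_torus_def)
qed

lemma pm_monom_single_coord:
  assumes "finite (Poly_Mapping.keys m)"
  shows "pm_monom (\<lambda>v. if v = w then z else 1) m = (z :: 'a) ^ Poly_Mapping.lookup m w"
proof -
  have "pm_monom (\<lambda>v. if v = w then z else 1) m = (\<Prod>v\<in>insert w (Poly_Mapping.keys m). (if v = w then z else 1) ^ Poly_Mapping.lookup m v)"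
    by (rule pm_monom_superset) auto
  also have "\<dots> = (\<Prod>v\<in>{w}. (if v = w then z else 1) ^ Poly_Mapping.lookup m v)"
    by (rule prod.mono_neutral_right) auto
  finally show ?thesis by simp
qed

text \<open>Roots of unity placed at the first variable of a block lie in \<open>H\<close>; they
  detect a congruence modulo \<open>l i 1\<close> that cocharacters cannot see.\<close>

lemma same_char_lookup_dvd:
  assumes "i \<le> 2" and eq: "\<And>t. t \<in> H \<Longrightarrow> pm_monom t m = pm_monom t m'"
  shows "int (l i 1) dvd int (Poly_Mapping.lookup m (i, 1)) - int (Poly_Mapping.lookup m' (i, 1))"
proof -
  define a where "a = Poly_Mapping.lookup m (i, 1)"
  define c where "c = Poly_Mapping.lookup m' (i, 1)"
  have pw: "z ^ a = z ^ c" if z: "z ^ l i 1 = 1" for z :: 'a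
    using eq[OF single_coord_big_torus[OF assms(1) z]] by (simp add: pm_monom_single_coord a_def c_def)
  have "int (l i 1) dvd int a - int c" if "c \<le> a" "\<And>z::'a. z ^ l i 1 = 1 \<Longrightarrow> z ^ a = z ^ c" for a c
  proof (rule ccontr)
    assume "\<not> ?thesis"
    then have "\<not> l i 1 dvd a - c" using that(1) by (metis int_dvd_int_iff of_nat_diff)
    then obtain z :: 'a where z: "z ^ l i 1 = 1" "z ^ (a - c) \<noteq> 1"
      using root_of_unity_not_root exps1[OF assms(1)] by blast
    have "z \<noteq> 0" using z(1) exps1[OF assms(1)] by (auto simp: zero_power)
    moreover have "z ^ (a - c) * z ^ c = z ^ c" using that(2)[OF z(1)] that(1) by (simp flip: power_add)
    ultimately show False using z(2) by simp
  qed
  from this[of c a] this[of a c] pw show ?thesis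
    unfolding a_def[symmetric] c_def[symmetric] by (cases "c \<le> a") (auto simp: dvd_diff_commute)
qed

text \<open>The weight alone leaves one alternative, a single-variable block with exponent 0 in
  place of 1. The congruence modulo \<open>l i 1\<close> would then make \<open>l i 1\<close> divide
  1, against the absence of linear terms.\<close>

lemma same_char_e:
  assumes m: "Poly_Mapping.keys m \<subseteq> I" and v: "v \<in> I" and eq: "\<And>t. t \<in> H \<Longrightarrow> pm_monom t m = t v"
  shows "m = e v"
proof -
  obtain i j where ij: "v = (i, j)" by (cases v)
  have eq': "pm_monom t m = pm_monom t (e v)" if "t \<in> H" for t using eq[OF that] by simp
  have sw: "same_weight m (e (i, j))"
    using same_weight_if_torus[OF m keys_e[OF v]] eq' torus_subset ij by blast
  show ?thesis
  proof (rule ccontr)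
    assume "m \<noteq> e v"
    with same_weight_e[OF m v[unfolded ij] sw] ij have n1: "n i = 1" and l0: "Poly_Mapping.lookup m (i, j) = 0" by auto
    have i: "i \<le> 2" and j: "j = 1" using v ij n1 by (auto simp: in_tri_idx)
    have "int (l i 1) dvd int 0 - int 1"
      using same_char_lookup_dvd[OF i eq'] l0 ij j by simp
    then show False using no_linear[OF i] n1 by simp
  qed
qed

text \<open>A polynomial vanishing on \<open>Y\<close> is semi-invariant along orbits in
  \<open>Y\<close> for every character. For the character of the variable \<open>v\<close> only the
  monomial \<open>v\<close> survives at a generic point, so its coefficient is 0.\<close>

lemma vanishing_linear_part:
  assumes P: "mp_vars P \<subseteq> I" and z: "\<And>x. x \<in> Y \<Longrightarrow> mp_eval x P = 0" and v: "v \<in> I"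
  shows "Poly_Mapping.lookup P (e v) = 0"
proof -
  obtain x where x: "x \<in> Y" "\<And>v. v \<in> I \<Longrightarrow> x v \<noteq> 0" using generic_point by metis
  have "mp_eval x P = (\<Sum>m | m \<in> Poly_Mapping.keys P \<and> (\<forall>t\<in>H. pm_monom t m = t v). Poly_Mapping.lookup P m * pm_monom x m)"
    by (rule isotypic[where \<chi> = "\<lambda>t. t v", OF P big_torus_one big_torus_mult]) (use z x(1) diag_Y in auto)
  also have "\<dots> = (\<Sum>m\<in>{e v}. Poly_Mapping.lookup P m * pm_monom x m)"
  proof (rule sum.mono_neutral_left)
    show "{m. m \<in> Poly_Mapping.keys P \<and> (\<forall>t\<in>H. pm_monom t m = t v)} \<subseteq> {e v}"
      using same_char_e[OF _ v] P unfolding mp_vars_def by blast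
  qed (auto simp: in_keys_iff)
  finally show ?thesis using z[OF x(1)] x(2)[OF v] by simp
qed

text \<open>After discarding monomials of other weights, the exponents are convex combinations of
  the three block exponents. Those other than the vertices are alone in their character and drop out
  as in the linear case; the vertices contribute a combination of block values that vanishes
  whenever these sum to 0, so their coefficients agree.\<close>

lemma vanishing_semi_invariant:
  assumes P: "mp_vars P \<subseteq> I" and z: "\<And>x. x \<in> Y \<Longrightarrow> mp_eval x P = 0"
    and semi: "\<And>t x. t \<in> T \<Longrightarrow> x \<in> extensional I \<Longrightarrow> mp_eval (diag I t x) P = b 0 t * mp_eval x P"
  obtains c where "\<And>x. x \<in> extensional I \<Longrightarrow> mp_eval x P = c * (b 0 x + b 1 x + b 2 x)"
proof -
  define K where "K = {m \<in> Poly_Mapping.keys P. \<forall>t\<in>T. pm_monom t m = b 0 t}"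
  define Q where "Q = (\<Sum>m\<in>K. Poly_Mapping.single m (Poly_Mapping.lookup P m))"
  let ?\<beta> = "block_exp n l"
  have K: "finite K" "K \<subseteq> Poly_Mapping.keys P" by (auto simp: K_def)
  have KI: "m \<in> K \<Longrightarrow> Poly_Mapping.keys m \<subseteq> I" for m using K P by (auto simp: mp_vars_def)
  have sw: "same_weight m (?\<beta> 0)" if "m \<in> K" for m
    using that by (intro same_weight_if_torus KI keys_block_exp) (auto simp: K_def pm_monom_block_exp)
  have lQ: "Poly_Mapping.lookup Q m = (if m \<in> K then Poly_Mapping.lookup P m else 0)" for m
    unfolding Q_def lookup_sum lookup_single when_def using K(1) by (simp add: sum.delta)
  have kQ: "Poly_Mapping.keys Q = K" using K(2) by (auto simp: in_keys_iff lQ split: if_splits)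
  have QP: "mp_eval x P = mp_eval x Q" if "x \<in> extensional I" for x
  proof -
    have "mp_eval x P = (\<Sum>m | m \<in> Poly_Mapping.keys P \<and> (\<forall>t\<in>T. pm_monom t m = b 0 t). Poly_Mapping.lookup P m * pm_monom x m)"
      by (rule isotypic[OF P torus.one torus_mult]) (use that semi in \<open>auto simp: bm_mult\<close>)
    then show ?thesis unfolding mp_eval_eq[of x Q] kQ K_def[symmetric] using lQ by (simp add: K_def)
  qed
  have Qv: "mp_vars Q \<subseteq> I" using KI by (auto simp: mp_vars_def kQ)
  have vert: "Poly_Mapping.lookup Q m = 0" if m: "m \<in> K" "\<forall>i\<le>2. m \<noteq> ?\<beta> i" for m
  proof -
    obtain p :: "nat \<Rightarrow> rat" where p: "\<And>i j. (i, j) \<in> I \<Longrightarrow> of_nat (Poly_Mapping.lookup m (i, j)) = p i * of_nat (l i j)"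
      "p 0 + p 1 + p 2 = 1" "\<And>i. i \<le> 2 \<Longrightarrow> 0 \<le> p i"
      using same_weight_block_exp[OF sw[OF m(1)]] by metis
    have one: "(i, 1) \<in> I" if "i \<le> 2" for i using blocks[OF that] that by (auto simp: in_tri_idx)
    have eqI: "m = m'" if "m' \<in> K" "\<And>i j. (i, j) \<in> I \<Longrightarrow> Poly_Mapping.lookup m (i, j) = Poly_Mapping.lookup m' (i, j)" for m'
    proof (rule poly_mapping_eqI)
      fix v show "Poly_Mapping.lookup m v = Poly_Mapping.lookup m' v"
      proof (cases "v \<in> I")
        case True
        then show ?thesis using that(2)[of "fst v" "snd v"] by simp
      next
        case False
        then have "v \<notin> Poly_Mapping.keys m" "v \<notin> Poly_Mapping.keys m'" using KI[OF m(1)] KI[OF that(1)] by auto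
        then show ?thesis by (simp add: in_keys_iff)
      qed
    qed
    have plt: "p i < 1" if i: "i \<le> 2" for i
    proof (rule ccontr)
      assume "\<not> p i < 1"
      then have "p i \<ge> 1" by simp
      have p01: "p i = 1 \<and> (\<forall>k\<le>2. k \<noteq> i \<longrightarrow> p k = 0)"
      proof -
        have "p 0 \<ge> 0" "p 1 \<ge> 0" "p 2 \<ge> 0" using p(3) by auto
        then show ?thesis using \<open>p i \<ge> 1\<close> p(2) i unfolding le2_cases by (elim disjE) auto
      qed
      have "m = ?\<beta> i"
      proof (rule poly_mapping_eqI)
        fix v show "Poly_Mapping.lookup m v = Poly_Mapping.lookup (?\<beta> i) v"
        proof (cases "v \<in> I")
          case True
          obtain i' j where v: "v = (i', j)" by (cases v)
          have "(of_nat (Poly_Mapping.lookup m (i', j)) :: rat) = of_nat (if i' = i then l i' j else 0)"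
            using p(1)[of i' j] True v p01 by (auto simp: in_tri_idx)
          then have "Poly_Mapping.lookup m (i', j) = (if i' = i then l i' j else 0)" unfolding of_nat_eq_iff .
          then show ?thesis using True v by (auto simp: lookup_block_exp in_tri_idx)
        next
          case False
          then have "v \<notin> Poly_Mapping.keys m" "v \<notin> Poly_Mapping.keys (?\<beta> i)" using KI[OF m(1)] keys_block_exp[OF i] by auto
          then show ?thesis by (simp add: in_keys_iff)
        qed
      qed
      then show False using m(2) i by blast
    qed
    have uniq: "m' = m" if m': "m' \<in> K" "\<And>t. t \<in> H \<Longrightarrow> pm_monom t m' = pm_monom t m" for m'
    proof -
      obtain p' :: "nat \<Rightarrow> rat" where p': "\<And>i j. (i, j) \<in> I \<Longrightarrow> of_nat (Poly_Mapping.lookup m' (i, j)) = p' i * of_nat (l i j)"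
        "p' 0 + p' 1 + p' 2 = 1" "\<And>i. i \<le> 2 \<Longrightarrow> 0 \<le> p' i"
        using same_weight_block_exp[OF sw[OF m'(1)]] by metis
      have "p' i \<ge> p i" if i: "i \<le> 2" for i
      proof -
        obtain k :: int where k: "int (Poly_Mapping.lookup m' (i, 1)) - int (Poly_Mapping.lookup m (i, 1)) = int (l i 1) * k"
          using same_char_lookup_dvd[OF i m'(2)] by (auto simp: dvd_def)
        have "(of_int (int (Poly_Mapping.lookup m' (i, 1)) - int (Poly_Mapping.lookup m (i, 1))) :: rat) = of_int (int (l i 1) * k)"
          using k by simp
        then have "(p' i - p i) * of_nat (l i 1) = of_int k * of_nat (l i 1)"
          using p(1)[OF one[OF i]] p'(1)[OF one[OF i]] by (simp add: algebra_simps)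
        then have "p' i - p i = of_int k" using exps1[OF i] by simp
        \<comment> \<open>As \<open>p i < 1\<close> away from the vertices and \<open>p' i\<close>
          is nonnegative, the integer difference cannot be negative; equal sums then force
          equality.\<close>
        moreover have "p' i - p i > -1" using plt[OF i] p'(3)[OF i] by linarith
        ultimately have "(of_int k :: rat) > of_int (-1)" by simp
        then have "k \<ge> 0" unfolding of_int_less_iff by simp
        then show ?thesis using \<open>p' i - p i = of_int k\<close> by simp
      qed
      from this[of 0] this[of 1] this[of 2] have "p' 0 = p 0" "p' 1 = p 1" "p' 2 = p 2"
        using p(2) p'(2) by simp_all
      then have pp: "p' i = p i" if "i \<le> 2" for i using that unfolding le2_cases by auto
      have "m = m'"
      proof (rule eqI[OF m'(1)])
        fix i j assume ij: "(i, j) \<in> I"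
        have "(of_nat (Poly_Mapping.lookup m (i, j)) :: rat) = of_nat (Poly_Mapping.lookup m' (i, j))"
          using p(1)[OF ij] p'(1)[OF ij] pp[of i] ij by (simp add: in_tri_idx)
        then show "Poly_Mapping.lookup m (i, j) = Poly_Mapping.lookup m' (i, j)" by simp
      qed
      then show ?thesis by simp
    qed
    obtain x where x: "x \<in> Y" "\<And>v. v \<in> I \<Longrightarrow> x v \<noteq> 0" using generic_point by metis
    have xe: "y \<in> extensional I" if "y \<in> Y" for y using that by (simp add: Y_iff)
    have pm: "pm_monom (\<lambda>v. s v * t v) m = pm_monom s m * pm_monom t m" for s t :: "idx \<Rightarrow> 'a"
      by (simp add: pm_monom_def power_mult_distrib prod.distrib)
    have "mp_eval x Q = (\<Sum>m' | m' \<in> Poly_Mapping.keys Q \<and> (\<forall>t\<in>H. pm_monom t m' = pm_monom t m). Poly_Mapping.lookup Q m' * pm_monom x m')"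
    proof (rule isotypic[where \<chi> = "\<lambda>t. pm_monom t m", OF Qv big_torus_one big_torus_mult])
      show "mp_eval (diag I t x) Q = pm_monom t m * mp_eval x Q" if "t \<in> H" for t
        using QP[OF xe[OF x(1)]] QP[OF xe[OF diag_Y[OF that x(1)]]] z[OF x(1)] z[OF diag_Y[OF that x(1)]] by simp
    qed (auto simp: pm, simp add: pm_monom_def)
    also have "\<dots> = (\<Sum>m'\<in>{m}. Poly_Mapping.lookup Q m' * pm_monom x m')"
      using uniq by (intro sum.mono_neutral_left) (auto simp: kQ lQ)
    finally have "Poly_Mapping.lookup Q m * pm_monom x m = 0"
      using QP[OF xe[OF x(1)]] z[OF x(1)] by simp
    moreover have "pm_monom x m \<noteq> 0" using x(2) KI[OF m(1)] by (auto simp: pm_monom_def)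
    ultimately show ?thesis by simp
  qed
  define q where "q i = Poly_Mapping.lookup Q (?\<beta> i)" for i
  have inj: "?\<beta> i \<noteq> ?\<beta> k" if "i \<noteq> k" "i \<le> 2" "k \<le> 2" for i k
  proof
    assume "?\<beta> i = ?\<beta> k"
    then have "Poly_Mapping.lookup (?\<beta> i) (i, 1) = Poly_Mapping.lookup (?\<beta> k) (i, 1)" by simp
    then show False using that blocks[of i] exps1[of i] by (simp add: lookup_block_exp)
  qed
  have Qx: "mp_eval x Q = q 0 * b 0 x + q 1 * b 1 x + q 2 * b 2 x" for x
  proof -
    have "mp_eval x Q = (\<Sum>m\<in>?\<beta> ` {..2}. Poly_Mapping.lookup Q m * pm_monom x m)"
      unfolding mp_eval_eq
    proof (rule sum.mono_neutral_cong)
      show "Poly_Mapping.lookup Q m * pm_monom x m = 0" if "m \<in> Poly_Mapping.keys Q - ?\<beta> ` {..2}" for m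
        using vert[of m] that by (auto simp: kQ)
    qed (auto simp: in_keys_iff)
    also have "\<dots> = (\<Sum>i\<le>2. q i * b i x)"
      by (subst sum.reindex) (use inj in \<open>auto simp: inj_on_def q_def pm_monom_block_exp\<close>)
    finally show ?thesis by (simp add: sum_le2)
  qed
  have q0: "q 0 * c 0 + q 1 * c 1 + q 2 * c 2 = 0" if c: "c 0 + c 1 + c 2 = 0" for c :: "nat \<Rightarrow> 'a"
  proof -
    obtain x where x: "x \<in> Y" "\<And>i. i \<le> 2 \<Longrightarrow> b i x = c i" using point_exists[OF c] by metis
    have "mp_eval x Q = 0" using QP[of x] z[OF x(1)] x(1) by (simp add: Y_iff)
    then show ?thesis unfolding Qx using x(2) by simp
  qed
  have "q 1 = q 0" "q 2 = q 0"
    using q0[of "\<lambda>i. if i = 0 then 1 else if i = 1 then -1 else 0"] q0[of "\<lambda>i. if i = 0 then 1 else if i = 2 then -1 else 0"] by auto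
  then show thesis using that[of "q 0"] QP Qx by (simp add: algebra_simps)
qed

end


section \<open>Linear parts and Fermat forms\<close>

lemma mp_vars_subst:
  assumes "mp_vars p \<subseteq> I" "\<And>v. v \<in> I \<Longrightarrow> mp_vars (\<sigma> v) \<subseteq> J" shows "mp_vars (mp_subst \<sigma> p) \<subseteq> J"
  unfolding mp_subst_def
proof (intro mp_vars_sum mp_vars_mult mp_vars_prod mp_vars_power mp_vars_const)
  fix m v assume "m \<in> Poly_Mapping.keys p" "v \<in> Poly_Mapping.keys m"
  then have "v \<in> I" using assms(1) by (auto simp: mp_vars_def)
  then show "mp_vars (\<sigma> v) \<subseteq> J" by (rule assms(2))
qed

text \<open>A nonzero term of the Leibniz expansion of the determinant, without determinants: among the
  columns \<open>k\<close> where the row \<open>a\<close> is nonzero there is one whose unit vector is not in the span of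
  the other rows.\<close>

lemma independent_rows_transversal:
  fixes M :: "'i \<Rightarrow> 'k \<Rightarrow> 'a::field"
  assumes "finite A" "finite J"
    and "\<And>c. (\<And>k. k \<in> J \<Longrightarrow> (\<Sum>w\<in>A. c w * M w k) = 0) \<Longrightarrow> (\<forall>w\<in>A. c w = 0)"
  shows "\<exists>\<sigma>. inj_on \<sigma> A \<and> (\<forall>w\<in>A. \<sigma> w \<in> J \<and> M w (\<sigma> w) \<noteq> 0)"
  using assms
proof (induction A arbitrary: J)
  case (insert a A)
  have indA: "\<forall>w\<in>A. c w = 0" if c: "\<And>k. k \<in> J \<Longrightarrow> (\<Sum>w\<in>A. c w * M w k) = 0" for c
  proof -
    have "(\<Sum>w\<in>insert a A. (c(a := 0)) w * M w k) = (\<Sum>w\<in>A. c w * M w k)" for k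
      using insert.hyps by (simp, intro sum.cong) auto
    then have "\<forall>w\<in>insert a A. (c(a := 0)) w = 0" using insert.prems(2)[of "c(a := 0)"] c by simp
    then show ?thesis using insert.hyps by (auto split: if_splits)
  qed
  have "\<exists>k\<in>J. M a k \<noteq> 0 \<and> (\<forall>c. (\<forall>k'\<in>J - {k}. (\<Sum>w\<in>A. c w * M w k') = 0) \<longrightarrow> (\<forall>w\<in>A. c w = 0))"
  proof (rule ccontr)
    define J' where "J' = {k \<in> J. M a k \<noteq> 0}"
    assume "\<not> ?thesis"
    then have "\<forall>k\<in>J'. \<exists>c. (\<forall>k'\<in>J - {k}. (\<Sum>w\<in>A. c w * M w k') = 0) \<and> \<not> (\<forall>w\<in>A. c w = 0)"
      unfolding J'_def by blast
    from bchoice[OF this] obtain c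
      where c0: "\<forall>k\<in>J'. (\<forall>k'\<in>J - {k}. (\<Sum>w\<in>A. c k w * M w k') = 0) \<and> \<not> (\<forall>w\<in>A. c k w = 0)"
      by (rule exE)
    have c: "(\<Sum>w\<in>A. c k w * M w k') = 0" if "k \<in> J'" "k' \<in> J - {k}" for k k'
      by (rule bspec[OF conjunct1[OF bspec[OF c0 that(1)]] that(2)])
    have c2: "\<not> (\<forall>w\<in>A. c k w = 0)" if "k \<in> J'" for k
      by (rule conjunct2[OF bspec[OF c0 that]])
    define s where "s k = (\<Sum>w\<in>A. c k w * M w k)" for k
    have s: "s k \<noteq> 0" if "k \<in> J'" for k
    proof
      assume "s k = 0"
      then have "(\<Sum>w\<in>A. c k w * M w k') = 0" if "k' \<in> J" for k'
        using c[OF \<open>k \<in> J'\<close>, of k'] that by (cases "k' = k") (auto simp: s_def)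
      then show False using indA[of "c k"] c2[OF that] by blast
    qed
    \<comment> \<open>The relation \<open>c k\<close> produces \<open>s k\<close> in column
      \<open>k\<close> and 0 in the other columns, so this combination would express row
      \<open>a\<close> through the other rows.\<close>
    define d where "d w = (if w = a then -1 else \<Sum>k\<in>J'. M a k / s k * c k w)" for w
    have "(\<Sum>w\<in>insert a A. d w * M w k') = 0" if k': "k' \<in> J" for k'
    proof -
      have fin: "finite J'" using insert.prems(1) by (simp add: J'_def)
      have "(\<Sum>w\<in>A. d w * M w k') = (\<Sum>w\<in>A. \<Sum>k\<in>J'. M a k / s k * (c k w * M w k'))"
        using insert.hyps(2) by (intro sum.cong) (auto simp: d_def sum_distrib_right mult.assoc)
      also have "\<dots> = (\<Sum>k\<in>J'. M a k / s k * (\<Sum>w\<in>A. c k w * M w k'))"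
        by (subst sum.swap) (simp add: sum_distrib_left)
      also have "\<dots> = (\<Sum>k\<in>J'. if k = k' then M a k' else 0)"
        using c k' s by (intro sum.cong) (auto simp: s_def)
      also have "\<dots> = M a k'" using fin k' by (simp add: J'_def)
      finally show ?thesis using insert.hyps by (simp add: d_def)
    qed
    then have "d a = 0" using insert.prems(2)[of d] by blast
    then show False by (simp add: d_def)
  qed
  then obtain k where k: "k \<in> J" "M a k \<noteq> 0"
    "\<And>c. (\<forall>k'\<in>J - {k}. (\<Sum>w\<in>A. c w * M w k') = 0) \<Longrightarrow> (\<forall>w\<in>A. c w = 0)" by blast
  obtain \<sigma> where \<sigma>: "inj_on \<sigma> A" "\<forall>w\<in>A. \<sigma> w \<in> J - {k} \<and> M w (\<sigma> w) \<noteq> 0"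
    using insert.IH[of "J - {k}"] insert.prems(1) k(3) by blast
  have "inj_on (\<sigma>(a := k)) (insert a A)" using \<sigma> insert.hyps by (auto simp: inj_on_def)
  moreover have "\<forall>w\<in>insert a A. (\<sigma>(a := k)) w \<in> J \<and> M w ((\<sigma>(a := k)) w) \<noteq> 0"
    using \<sigma> k insert.hyps by auto
  ultimately show ?case by blast
qed auto

lemma invertible_transversal:
  fixes M :: "'i \<Rightarrow> 'i \<Rightarrow> 'a::field"
  assumes fin: "finite J" and inv: "\<And>v w. v \<in> J \<Longrightarrow> w \<in> J \<Longrightarrow> (\<Sum>k\<in>J. M v k * N k w) = (if v = w then 1 else 0)"
  obtains \<sigma> where "\<sigma> permutes J" "\<And>v. v \<in> J \<Longrightarrow> M v (\<sigma> v) \<noteq> 0"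
proof -
  have ind: "\<forall>w\<in>J. c w = 0" if c: "\<And>k. k \<in> J \<Longrightarrow> (\<Sum>w\<in>J. c w * M w k) = 0" for c
  proof
    fix v assume v: "v \<in> J"
    have "c v = (\<Sum>w\<in>J. c w * (\<Sum>k\<in>J. M w k * N k v))"
      using v fin inv by (simp add: sum.delta' if_distrib[of "(*) _"] cong: if_cong)
    also have "\<dots> = (\<Sum>k\<in>J. (\<Sum>w\<in>J. c w * M w k) * N k v)"
      unfolding sum_distrib_left sum_distrib_right by (subst sum.swap) (simp add: mult.assoc)
    also have "\<dots> = 0" using c by simp
    finally show "c v = 0" .
  qed
  obtain \<sigma> where \<sigma>: "inj_on \<sigma> J" "\<forall>w\<in>J. \<sigma> w \<in> J \<and> M w (\<sigma> w) \<noteq> 0"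
    using independent_rows_transversal[OF fin fin, of M] ind by blast
  define \<tau> where "\<tau> v = (if v \<in> J then \<sigma> v else v)" for v
  have "inj_on \<tau> J" "\<tau> ` J \<subseteq> J" using \<sigma> by (auto simp: \<tau>_def inj_on_def)
  then have "bij_betw \<tau> J J" using fin by (simp add: bij_betw_def endo_inj_surj)
  then have "\<tau> permutes J" by (rule bij_imp_permutes) (simp add: \<tau>_def)
  then show thesis using that[of \<tau>] \<sigma> by (simp add: \<tau>_def)
qed

lemma pderiv_sum: "pderiv (sum g B) = (\<Sum>v\<in>B. pderiv (g v))"
  by (induction B rule: infinite_finite_induct) (auto simp: pderiv_add)

text \<open>The two sides are polynomials in \<open>s\<close> with equal values, hence equal;
  differentiate and divide by \<open>Suc k\<close>, which is nonzero in characteristic 0. The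
  constant \<open>r\<close> disappears.\<close>

lemma derivative_identity:
  fixes c :: "'i \<Rightarrow> 'a::field_char_0"
  assumes "\<And>s. (\<Sum>v\<in>B. c v * (g v + m v * s) ^ Suc k) = d * s ^ Suc k + r"
  shows "(\<Sum>v\<in>B. c v * m v * (g v + m v * s) ^ k) = d * s ^ k"
proof -
  define p where "p = (\<Sum>v\<in>B. smult (c v) ([:g v, m v:] ^ Suc k)) - (smult d ([:0, 1:] ^ Suc k) + [:r:])"
  have "poly p s = (\<Sum>v\<in>B. c v * (g v + m v * s) ^ Suc k) - (d * s ^ Suc k + r)" for s
    by (simp add: p_def poly_sum mult.commute del: power_Suc)
  then have "poly p s = 0" for s using assms[of s] by simp
  then have "p = 0" using poly_all_0_iff_0 by blast
  then have "poly (pderiv p) s = 0" by simp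
  moreover have "pderiv p = (\<Sum>v\<in>B. smult (c v) (smult (of_nat (Suc k)) ([:g v, m v:] ^ k) * [:m v:])) - smult d (smult (of_nat (Suc k)) ([:0, 1:] ^ k))"
    by (simp add: p_def pderiv_diff pderiv_add pderiv_sum pderiv_smult pderiv_power_Suc pderiv_pCons del: power_Suc)
  ultimately have "of_nat (Suc k) * ((\<Sum>v\<in>B. c v * m v * (g v + m v * s) ^ k) - d * s ^ k) = 0"
    by (simp add: poly_sum sum_distrib_left algebra_simps del: of_nat_Suc)
  then show ?thesis by (simp del: of_nat_Suc)
qed

text \<open>Differentiating in two variables \<open>i \<noteq> j\<close> gives \<open>\<Sum>\<^sub>v M v i * M v j * g\<^sub>v ^ (a - 2) = 0\<close>; as the affine
  substitution \<open>g\<close> is surjective, no row of \<open>M\<close> has two nonzero entries.\<close>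

lemma fermat_form_monomial:
  fixes M :: "'i \<Rightarrow> 'i \<Rightarrow> 'a::field_char_0"
  assumes B: "finite B" and a: "a \<ge> 2" "a = 2 \<Longrightarrow> \<forall>i\<in>B. \<forall>j\<in>B. i = j"
    and inv: "\<And>v w. v \<in> B \<Longrightarrow> w \<in> B \<Longrightarrow> (\<Sum>k\<in>B. M v k * N k w) = (if v = w then 1 else 0)"
    and F: "\<And>y. (\<Sum>v\<in>B. ((\<Sum>k\<in>B. M v k * y k) + p v) ^ a) = d * (\<Sum>k\<in>B. y k ^ a) + r"
    and v: "v \<in> B"
  shows "p v = 0 \<and> (\<exists>i\<in>B. M v i \<noteq> 0 \<and> (\<forall>k\<in>B. k \<noteq> i \<longrightarrow> M v k = 0))"
proof -
  define g where "g v y = (\<Sum>k\<in>B. M v k * y k) + p v" for v y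
  obtain a' where a': "a = Suc a'" "a' \<ge> 1" using a(1) by (cases a) auto
  have g_upd: "g v (y(i := s)) = g v (y(i := 0)) + M v i * s" if "i \<in> B" for v y i s
  proof -
    have "(\<Sum>k\<in>B. M v k * (y(i := s)) k) = M v i * s + (\<Sum>k\<in>B - {i}. M v k * y k)" for s
      using B that by (subst sum.remove[OF B that]) (auto intro!: sum.cong)
    then show ?thesis by (simp add: g_def algebra_simps)
  qed
  have 1: "(\<Sum>v\<in>B. M v i * g v y ^ a') = d * y i ^ a'" if i: "i \<in> B" for i y
  proof -
    have "(\<Sum>v\<in>B. 1 * (g v (y(i := 0)) + M v i * s) ^ Suc a') = d * s ^ Suc a' + (d * (\<Sum>k\<in>B - {i}. y k ^ a) + r)" for s
    proof -
      have "(\<Sum>k\<in>B. (y(i := s)) k ^ a) = s ^ a + (\<Sum>k\<in>B - {i}. y k ^ a)"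
        using B i by (subst sum.remove[OF B i]) (auto intro!: sum.cong)
      then show ?thesis
        using F[of "y(i := s)"] unfolding g_def[symmetric] a'(1)[symmetric] g_upd[OF i, of _ y s] by (simp add: algebra_simps)
    qed
    from derivative_identity[OF this, of "y i"] show ?thesis
      using g_upd[OF i, of _ y "y i"] by simp
  qed
  have 2: "M v0 i * M v0 j = 0" if ij: "i \<in> B" "j \<in> B" "i \<noteq> j" and v0: "v0 \<in> B" for i j v0
  proof -
    have "a \<noteq> 2" using a(2) ij by blast
    then obtain a'' where a'': "a' = Suc a''" "a'' \<ge> 1" using a(1) a' by (cases a') auto
    \<comment> \<open>The mixed second derivative; its right-hand side is 0 because
      \<open>d * y i ^ a'\<close> does not involve \<open>y j\<close>.\<close>
    have 3: "(\<Sum>v\<in>B. M v i * M v j * g v y ^ a'') = 0" for y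
    proof -
      have "(\<Sum>v\<in>B. M v i * (g v (y(j := 0)) + M v j * s) ^ Suc a'') = 0 * s ^ Suc a'' + d * y i ^ a'" for s
        using 1[OF ij(1), of "y(j := s)"] ij(3) unfolding a''(1) g_upd[OF ij(2), of _ y s] by simp
      from derivative_identity[OF this, of "y j"] show ?thesis
        using g_upd[OF ij(2), of _ y "y j"] by simp
    qed
    \<comment> \<open>The preimage of the unit vector at \<open>v0\<close> under the affine
      substitution. As \<open>a''\<close> is positive, it isolates a single summand of the mixed
      derivative.\<close>
    define y where "y k = (\<Sum>w\<in>B. N k w * ((if w = v0 then 1 else 0) - p w))" for k
    have gy: "g v y = (if v = v0 then 1 else 0)" if "v \<in> B" for v
    proof -
      have "(\<Sum>k\<in>B. M v k * y k) = (\<Sum>w\<in>B. (\<Sum>k\<in>B. M v k * N k w) * ((if w = v0 then 1 else 0) - p w))"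
        unfolding y_def sum_distrib_left sum_distrib_right by (subst sum.swap) (simp add: mult.assoc)
      also have "\<dots> = (\<Sum>w\<in>B. if w = v then (if v = v0 then 1 else 0) - p v else 0)"
        using inv[OF that] by (intro sum.cong) auto
      also have "\<dots> = (if v = v0 then 1 else 0) - p v" using B that by simp
      finally show ?thesis by (simp add: g_def)
    qed
    have "(\<Sum>v\<in>B. M v i * M v j * g v y ^ a'') = (\<Sum>v\<in>B. if v = v0 then M v0 i * M v0 j else 0)"
      using gy a''(2) by (intro sum.cong) (auto simp: zero_power)
    then show ?thesis using 3[of y] B v0 by simp
  qed
  have row: "\<exists>i\<in>B. M v i \<noteq> 0 \<and> (\<forall>k\<in>B. k \<noteq> i \<longrightarrow> M v k = 0)" if v: "v \<in> B" for v
  proof -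
    have "(\<Sum>k\<in>B. M v k * N k v) \<noteq> 0" using inv[OF v v] by simp
    then obtain i where i: "i \<in> B" "M v i \<noteq> 0" by (auto elim!: sum.not_neutral_contains_not_neutral)
    then show ?thesis using 2[OF _ _ _ v] by (intro bexI[of _ i]) auto
  qed
  obtain i where i: "i \<in> B" "M v i \<noteq> 0" "\<And>k. k \<in> B \<Longrightarrow> k \<noteq> i \<Longrightarrow> M v k = 0" using row[OF v] by blast
  \<comment> \<open>Two rows with their only entry in the same column would contradict the right
    inverse \<open>N\<close>.\<close>
  have "M w i = 0" if w: "w \<in> B" "w \<noteq> v" for w
  proof (rule ccontr)
    assume nz: "M w i \<noteq> 0"
    have s: "(\<Sum>k\<in>B. M u k * N k w) = M u i * N i w" if "u \<in> B" "M u i \<noteq> 0" for u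
    proof -
      have "M u k = 0" if "k \<in> B" "k \<noteq> i" for k using 2[OF i(1) that(1) _ \<open>u \<in> B\<close>] that(2) \<open>M u i \<noteq> 0\<close> by auto
      then have "(\<Sum>k\<in>B. M u k * N k w) = (\<Sum>k\<in>{i}. M u k * N k w)" using B i(1) by (intro sum.mono_neutral_right) auto
      then show ?thesis by simp
    qed
    show False using s[OF v i(2)] s[OF w(1) nz] inv[OF v w(1)] inv[OF w(1) w(1)] w(2) i(2) by auto
  qed
  then have "(\<Sum>w\<in>B. M w i * g w (\<lambda>_. 0) ^ a') = (\<Sum>w\<in>{v}. M w i * g w (\<lambda>_. 0) ^ a')"
    using B v by (intro sum.mono_neutral_right) auto
  \<comment> \<open>At the zero argument the substitution takes the value \<open>p\<close>, so the
    first derivative shows that no translation is possible.\<close>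
  then have "M v i * p v ^ a' = d * 0 ^ a'" using 1[OF i(1), of "\<lambda>_. 0"] by (simp add: g_def)
  then have "p v = 0" using i(2) a'(2) by (simp add: zero_power)
  then show ?thesis using i by blast
qed

context trinomial_data begin

section \<open>The linear part at the origin\<close>

definition origin :: "idx \<Rightarrow> 'a" where "origin = (\<lambda>v\<in>I. 0)"

lemma bm_zero: "i \<le> 2 \<Longrightarrow> b i origin = 0"
  unfolding bm_def using blocks[of i] exps[of i 1]
  by (intro prod_zero bexI[of _ 1]) (auto simp: origin_def in_tri_idx)

lemma origin_Y: "origin \<in> Y"
  by (simp add: Y_iff bm_zero, simp add: origin_def)

lemma mp_eval_origin: assumes "mp_vars P \<subseteq> I" shows "mp_eval origin P = Poly_Mapping.lookup P 0"
proof -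
  have "pm_monom origin m = 0" if m: "m \<in> Poly_Mapping.keys P" "m \<noteq> 0" for m
  proof -
    obtain v where v: "v \<in> Poly_Mapping.keys m" using m(2) by (metis keys_eq_empty equals0I)
    then have "v \<in> I" using m(1) assms by (auto simp: mp_vars_def)
    then show ?thesis unfolding pm_monom_def using v
      by (intro prod_zero bexI[of _ v]) (auto simp: origin_def zero_power in_keys_iff)
  qed
  then have "mp_eval origin P = (\<Sum>m\<in>{0}. Poly_Mapping.lookup P m * pm_monom origin m)"
    unfolding mp_eval_eq by (intro sum.mono_neutral_cong) (auto simp: in_keys_iff)
  then show ?thesis by simp
qed

lemma e_nonzero: "e v \<noteq> 0" by (metis lookup_single_eq lookup_zero zero_neq_one)

lemma lookup_mult_single:
  fixes P Q :: "(idx, 'a) mp"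
  shows "Poly_Mapping.lookup (P * Q) (e v) = Poly_Mapping.lookup P 0 * Poly_Mapping.lookup Q (e v) + Poly_Mapping.lookup P (e v) * Poly_Mapping.lookup Q 0"
proof -
  let ?K = "Poly_Mapping.keys P" and ?L = "Poly_Mapping.keys Q"
  let ?p = "Poly_Mapping.lookup P" and ?q = "Poly_Mapping.lookup Q"
  have PQ: "P * Q = (\<Sum>m\<in>?K. \<Sum>m'\<in>?L. Poly_Mapping.single (m + m') (?p m * ?q m'))"
    by (subst (1) poly_mapping_sum_singles[of P], subst (1) poly_mapping_sum_singles[of Q])
      (simp add: sum_product mult_single)
  have e0: "e v \<noteq> 0" by (metis lookup_single_eq lookup_zero zero_neq_one)
  have split: "m + m' = e v \<longleftrightarrow> (m = 0 \<and> m' = e v) \<or> (m = e v \<and> m' = 0)" for m m' :: "idx \<Rightarrow>\<^sub>0 nat"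
  proof
    assume s: "m + m' = e v"
    have l: "Poly_Mapping.lookup m w + Poly_Mapping.lookup m' w = (if w = v then 1 else 0)" for w
      using arg_cong[OF s, of "\<lambda>m. Poly_Mapping.lookup m w"] by (simp add: lookup_add lookup_single when_def)
    show "(m = 0 \<and> m' = e v) \<or> (m = e v \<and> m' = 0)"
    proof (cases "Poly_Mapping.lookup m v = 0")
      case True
      have "Poly_Mapping.lookup m w = 0" for w using l[of w] True by (cases "w = v") auto
      then have "m = 0" by (intro poly_mapping_eqI) simp
      then show ?thesis using s by simp
    next
      case False
      have "Poly_Mapping.lookup m' w = 0" for w using l[of w] l[of v] False by (cases "w = v") auto
      then have "m' = 0" by (intro poly_mapping_eqI) simp
      then show ?thesis using s by simp
    qed
  qed auto
  have "Poly_Mapping.lookup (P * Q) (e v) = (\<Sum>(m, m')\<in>?K \<times> ?L. if m + m' = e v then ?p m * ?q m' else 0)"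
    unfolding PQ lookup_sum sum.cartesian_product
    by (intro sum.cong) (auto simp: lookup_single when_def)
  also have "\<dots> = (\<Sum>(m, m')\<in>{(0, e v), (e v, 0)}. ?p m * ?q m')"
  proof (rule sum.mono_neutral_cong)
    show "(case x of (m, m') \<Rightarrow> if m + m' = e v then ?p m * ?q m' else 0) = 0" if "x \<in> ?K \<times> ?L - {(0, e v), (e v, 0)}" for x
      using that split by (cases x) auto
    show "(case x of (m, m') \<Rightarrow> ?p m * ?q m') = 0" if "x \<in> {(0, e v), (e v, 0)} - ?K \<times> ?L" for x
      using that by (auto simp: in_keys_iff)
  qed auto
  also have "\<dots> = ?p 0 * ?q (e v) + ?p (e v) * ?q 0" using e0 by simp
  finally show ?thesis .
qed

text \<open>A partial derivative at the origin, independent of the representing polynomial by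
  \<open>vanishing_linear_part\<close>: the tangent space of \<open>Y\<close> there is the whole
  affine space.\<close>

definition lin :: "idx \<Rightarrow> ((idx \<Rightarrow> 'a) \<Rightarrow> 'a) \<Rightarrow> 'a" where
  "lin v g = Poly_Mapping.lookup (SOME P. mp_vars P \<subseteq> I \<and> (\<forall>x\<in>Y. g x = mp_eval x P)) (e v)"

lemma lin_eq:
  assumes P: "mp_vars P \<subseteq> I" "\<And>x. x \<in> Y \<Longrightarrow> g x = mp_eval x P" and v: "v \<in> I"
  shows "lin v g = Poly_Mapping.lookup P (e v)"
proof -
  define Q where "Q = (SOME P. mp_vars P \<subseteq> I \<and> (\<forall>x\<in>Y. g x = mp_eval x P))"
  have "mp_vars Q \<subseteq> I \<and> (\<forall>x\<in>Y. g x = mp_eval x Q)"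
    unfolding Q_def by (rule someI[of _ P]) (use P in blast)
  then have Q: "mp_vars Q \<subseteq> I" "\<forall>x\<in>Y. g x = mp_eval x Q" by blast+
  define N where "N = Q + mp_const (-1) * P"
  have "Poly_Mapping.lookup N (e v) = 0"
  proof (rule vanishing_linear_part[OF _ _ v])
    show "mp_vars N \<subseteq> I" unfolding N_def by (intro mp_vars_add mp_vars_mult mp_vars_const Q P)
    show "mp_eval x N = 0" if "x \<in> Y" for x using P(2)[OF that] Q(2) that by (simp add: N_def mp_eval_simps)
  qed
  moreover have "Poly_Mapping.lookup (mp_const (-1) * P) (e v) = - Poly_Mapping.lookup P (e v)"
    unfolding lookup_mult_single using e_nonzero[of v] by (auto simp: mp_const_def lookup_single when_def)
  ultimately show ?thesis unfolding lin_def Q_def[symmetric] by (simp add: N_def lookup_add)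
qed

lemma lin_cong:
  assumes "\<And>x. x \<in> Y \<Longrightarrow> g x = h x" shows "lin v g = lin v h"
proof -
  have "(\<forall>x\<in>Y. g x = mp_eval x P) = (\<forall>x\<in>Y. h x = mp_eval x P)" for P using assms by auto
  then show ?thesis by (simp add: lin_def)
qed

lemma lin_coord: assumes "v \<in> I" "w \<in> I" shows "lin v (\<lambda>x. x w) = (if v = w then 1 else 0)"
proof -
  have "lin v (\<lambda>x. x w) = Poly_Mapping.lookup (mp_var w) (e v)"
    by (rule lin_eq[OF mp_vars_var[OF assms(2)] _ assms(1)]) (simp add: mp_eval_simps)
  moreover have "e w = e v \<longleftrightarrow> w = v" by (metis lookup_single_eq lookup_single_not_eq zero_neq_one)
  ultimately show ?thesis by (auto simp: mp_var_def lookup_single when_def)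
qed

lemma lin_const: assumes "v \<in> I" shows "lin v (\<lambda>x. c) = 0"
proof -
  have "lin v (\<lambda>x. c) = Poly_Mapping.lookup (mp_const c) (e v)"
    by (rule lin_eq[OF mp_vars_const _ assms]) (simp add: mp_eval_simps)
  then show ?thesis using e_nonzero[of v] by (auto simp: mp_const_def lookup_single when_def)
qed

lemma lin_add:
  assumes "regular_function I Y g" "regular_function I Y h" "v \<in> I"
  shows "lin v (\<lambda>x. g x + h x) = lin v g + lin v h"
proof -
  obtain P Q where P: "mp_vars P \<subseteq> I" "\<And>x. x \<in> Y \<Longrightarrow> g x = mp_eval x P"
    and Q: "mp_vars Q \<subseteq> I" "\<And>x. x \<in> Y \<Longrightarrow> h x = mp_eval x Q"
    using assms by (auto simp: regular_function_def)
  show ?thesis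
    using lin_eq[OF P assms(3)] lin_eq[OF Q assms(3)] lin_eq[OF mp_vars_add[OF P(1) Q(1)] _ assms(3), of "\<lambda>x. g x + h x"] P(2) Q(2)
    by (simp add: mp_eval_simps lookup_add)
qed

lemma lin_mult:
  assumes "regular_function I Y g" "regular_function I Y h" "v \<in> I"
  shows "lin v (\<lambda>x. g x * h x) = g origin * lin v h + lin v g * h origin"
proof -
  obtain P Q where P: "mp_vars P \<subseteq> I" "\<And>x. x \<in> Y \<Longrightarrow> g x = mp_eval x P"
    and Q: "mp_vars Q \<subseteq> I" "\<And>x. x \<in> Y \<Longrightarrow> h x = mp_eval x Q"
    using assms by (auto simp: regular_function_def)
  show ?thesis
    using lin_eq[OF P assms(3)] lin_eq[OF Q assms(3)] lin_eq[OF mp_vars_mult[OF P(1) Q(1)] _ assms(3), of "\<lambda>x. g x * h x"] P(2) Q(2)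
      P(2)[OF origin_Y] Q(2)[OF origin_Y] mp_eval_origin[OF P(1)] mp_eval_origin[OF Q(1)]
      lookup_mult_single[of P Q v]
    by (simp add: mp_eval_simps)
qed

lemma lin_scale: "regular_function I Y g \<Longrightarrow> v \<in> I \<Longrightarrow> lin v (\<lambda>x. c * g x) = c * lin v g"
  using lin_mult[OF regular_const, of g v c] lin_const by simp

text \<open>The chain rule, by structural induction on a polynomial representing \<open>g\<close>;
  the product case uses that \<open>\<phi>\<close> fixes the base point.\<close>

lemma lin_comp:
  assumes g: "regular_function I Y g" and \<phi>: "regular_self_map I Y \<phi>" "\<phi> origin = origin" and v: "v \<in> I"
  shows "lin v (\<lambda>x. g (\<phi> x)) = (\<Sum>w\<in>I. lin w g * lin v (\<lambda>x. \<phi> x w))"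
proof -
  have \<phi>Y: "\<phi> \<in> Y \<rightarrow> Y" and \<phi>r: "\<And>w. w \<in> I \<Longrightarrow> regular_function I Y (\<lambda>x. \<phi> x w)"
    using \<phi>(1) by (auto simp: regular_self_map_def)
  have rc: "regular_function I Y (\<lambda>x. mp_eval (\<phi> x) P)" "regular_function I Y (\<lambda>x. mp_eval x P)" if "mp_vars P \<subseteq> I" for P
  proof -
    show r: "regular_function I Y (\<lambda>x. mp_eval x P)" by (rule regular_functionI[OF that refl])
    show "regular_function I Y (\<lambda>x. mp_eval (\<phi> x) P)" by (rule regular_comp[OF r \<phi>r \<phi>Y])
  qed
  have main: "lin v (\<lambda>x. mp_eval (\<phi> x) P) = (\<Sum>w\<in>I. lin w (\<lambda>x. mp_eval x P) * lin v (\<lambda>x. \<phi> x w))" if "mp_vars P \<subseteq> I" for P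
    using that
  proof (induction rule: mp_induct)
    case (const c)
    then show ?case using v by (simp add: mp_eval_simps lin_const)
  next
    case (var w)
    have "(\<Sum>k\<in>I. lin k (\<lambda>x. x w) * lin v (\<lambda>x. \<phi> x k)) = (\<Sum>k\<in>I. if k = w then lin v (\<lambda>x. \<phi> x w) else 0)"
      using var by (intro sum.cong) (auto simp: lin_coord)
    then show ?case using var by (simp add: mp_eval_simps finite_tri_idx)
  next
    case (add P Q)
    show ?case unfolding mp_eval_simps
      using add v by (simp add: lin_add rc distrib_right sum.distrib)
  next
    case (mult P Q)
    show ?case unfolding mp_eval_simps
      using mult v \<phi>(2) by (simp add: lin_mult rc sum.distrib sum_distrib_left algebra_simps)
  qed
  obtain P where P: "mp_vars P \<subseteq> I" "\<And>x. x \<in> Y \<Longrightarrow> g x = mp_eval x P" using g by (auto simp: regular_function_def)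
  have "lin v (\<lambda>x. g (\<phi> x)) = lin v (\<lambda>x. mp_eval (\<phi> x) P)" using P(2) \<phi>Y by (intro lin_cong) auto
  also have "\<dots> = (\<Sum>w\<in>I. lin w g * lin v (\<lambda>x. \<phi> x w))"
    unfolding main[OF P(1)] using P(2) by (intro sum.cong refl arg_cong2[where f = "(*)"] lin_cong) auto
  finally show ?thesis .
qed

lemma diag_regular: assumes "t \<in> H" shows "regular_self_map I Y (diag I t)"
  unfolding regular_self_map_def
proof (intro conjI ballI)
  show "diag I t \<in> Y \<rightarrow> Y" using diag_Y[OF assms] by auto
  show "regular_function I Y (\<lambda>x. diag I t x v)" if "v \<in> I" for v
    using that by (simp add: diag_def regular_mult regular_const regular_coord)
qed

text \<open>The chain rule along the diagonal map multiplies the derivative in direction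
  \<open>v\<close> by \<open>t v\<close>, so a nonzero linear coefficient identifies the
  eigenvalue.\<close>

lemma lin_semi_invariant:
  assumes g: "regular_function I Y g" and t: "t \<in> H" and v: "v \<in> I"
    and semi: "\<And>x. x \<in> Y \<Longrightarrow> g (diag I t x) = c * g x" and nz: "lin v g \<noteq> 0"
  shows "c = t v"
proof -
  have "diag I t origin = origin" by (auto simp: diag_def origin_def)
  then have "lin v (\<lambda>x. g (diag I t x)) = (\<Sum>w\<in>I. lin w g * lin v (\<lambda>x. diag I t x w))"
    by (rule lin_comp[OF g diag_regular[OF t] _ v])
  also have "\<dots> = (\<Sum>w\<in>I. if w = v then t v * lin v g else 0)"
    using v by (intro sum.cong refl) (simp add: diag_def lin_scale regular_coord lin_coord)
  also have "\<dots> = t v * lin v g" using v by (simp add: finite_tri_idx)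
  finally have "t v * lin v g = lin v (\<lambda>x. c * g x)" using lin_cong[OF semi] by simp
  also have "\<dots> = c * lin v g" by (rule lin_scale[OF g v])
  finally show ?thesis using nz by simp
qed

lemma lin_inverse:
  assumes "regular_self_map I Y \<phi>" "regular_self_map I Y \<psi>" "\<psi> origin = origin" "\<And>x. x \<in> Y \<Longrightarrow> \<phi> (\<psi> x) = x"
    and "v \<in> I" "w \<in> I"
  shows "(\<Sum>k\<in>I. lin k (\<lambda>x. \<phi> x v) * lin w (\<lambda>x. \<psi> x k)) = (if v = w then 1 else 0)"
proof -
  have "(\<Sum>k\<in>I. lin k (\<lambda>x. \<phi> x v) * lin w (\<lambda>x. \<psi> x k)) = lin w (\<lambda>x. \<phi> (\<psi> x) v)"
    using assms by (intro lin_comp[symmetric]) (auto simp: regular_self_map_def)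
  also have "\<dots> = lin w (\<lambda>x. x v)" using assms by (intro lin_cong) simp
  finally show ?thesis using assms by (simp add: lin_coord)
qed


section \<open>The centralizer of the torus\<close>


text \<open>One variable is chosen in every block, \<open>v\<close> in its own, and given weight
  \<open>L\<close> divided by its exponent, where \<open>L\<close> is the product of the three
  exponents; all block sums are then \<open>L\<close>.\<close>

lemma nonneg_cochar:
  assumes "v \<in> I"
  obtains u where "u \<in> C" "\<And>w. u w \<ge> 0" "u v > 0"
proof -
  define c where "c i = (if i = fst v then snd v else 1)" for i
  have cI: "(i, c i) \<in> I" if "i \<le> 2" for i
    using that assms blocks[OF that] by (cases v) (auto simp: c_def in_tri_idx)
  define L where "L = l 0 (c 0) * l 1 (c 1) * l 2 (c 2)"
  define u where "u w = (if snd w = c (fst w) then int (L div l (fst w) (snd w)) else 0)" for w :: idx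
  have Lpos: "L > 0" using exps[OF cI] by (simp add: L_def)
  have dvd: "l i (c i) dvd L" if "i \<le> 2" for i
    using that unfolding le2_cases by (auto simp: L_def)
  have s: "(\<Sum>j=1..n i. u (i, j) * int (l i j)) = int L" if i: "i \<le> 2" for i
  proof -
    have "(\<Sum>j=1..n i. u (i, j) * int (l i j)) = (\<Sum>j\<in>{c i}. u (i, j) * int (l i j))"
      using cI[OF i] by (intro sum.mono_neutral_right) (auto simp: u_def in_tri_idx)
    also have "\<dots> = int (L div l i (c i) * l i (c i))" by (simp add: u_def)
    finally show ?thesis using dvd[OF i] by simp
  qed
  show thesis
  proof (rule that)
    show "u \<in> C" unfolding cochars_def using s by simp
    show "u w \<ge> 0" for w by (simp add: u_def)
    have i: "fst v \<le> 2" using assms by (cases v) (simp add: in_tri_idx)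
    have "L div l (fst v) (c (fst v)) > 0"
      using dvd[OF i] Lpos exps[OF cI[OF i]] by (simp add: div_greater_zero_iff dvd_imp_le)
    then show "u v > 0" by (simp add: u_def c_def)
  qed
qed

lemma torus_separates_origin:
  assumes "v \<in> I" obtains t where "t \<in> T" "t v \<noteq> 1"
proof -
  obtain u where u: "u \<in> C" "u v > 0" using nonneg_cochar[OF assms] by metis
  have "(2::'a) powi u v \<noteq> 2 powi 0" using power_int_2_inj[of "u v" 0] u(2) by auto
  then show thesis using that[OF cochar_torus[OF u(1), of 2]] by simp
qed

lemma diag_origin: "diag I t origin = origin"
  by (auto simp: diag_def origin_def)

lemma torus_map_origin:
  assumes "\<phi> \<in> Y \<rightarrow> Y" "\<And>t x v. t \<in> T \<Longrightarrow> x \<in> Y \<Longrightarrow> v \<in> I \<Longrightarrow> \<phi> (diag I t x) v = t v * \<phi> x v"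
  shows "\<phi> origin = origin"
proof (rule extensionalityI[of _ I])
  show "\<phi> origin \<in> extensional I" using assms(1) origin_Y by (auto simp: Y_iff)
  show "origin \<in> extensional I" by (simp add: origin_def)
  fix v assume v: "v \<in> I"
  obtain t where t: "t \<in> T" "t v \<noteq> 1" using torus_separates_origin[OF v] by metis
  have "\<phi> origin v = t v * \<phi> origin v" using assms(2)[OF t(1) origin_Y v] by (simp add: diag_origin)
  then show "\<phi> origin v = origin v" using t(2) v by (simp add: origin_def)
qed

text \<open>Coordinates in blocks with several variables can only be scaled, since no other monomial
  has their weight. Blocks that are powers of one variable are treated together for each exponent
  \<open>a\<close>, by induction on \<open>a\<close>, and \<open>fermat_form_monomial\<close>
  applies; \<open>quad\<close> excludes several squares, where a Fermat form has symmetries that are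
  not monomial.\<close>

lemma torus_centralizer_monomial:
  assumes quad: "\<And>i k. i \<le> 2 \<Longrightarrow> k \<le> 2 \<Longrightarrow> n i = 1 \<Longrightarrow> n k = 1 \<Longrightarrow> l i 1 = 2 \<Longrightarrow> l k 1 = 2 \<Longrightarrow> i = k"
    and \<phi>: "regular_self_map I Y \<phi>" "\<And>t x v. t \<in> T \<Longrightarrow> x \<in> Y \<Longrightarrow> v \<in> I \<Longrightarrow> \<phi> (diag I t x) v = t v * \<phi> x v"
    and \<psi>: "regular_self_map I Y \<psi>" "\<And>x. x \<in> Y \<Longrightarrow> \<phi> (\<psi> x) = x" "\<And>x. x \<in> Y \<Longrightarrow> \<psi> (\<phi> x) = x"
  obtains \<rho> c where "\<rho> permutes I" "\<And>v. v \<in> I \<Longrightarrow> c v \<noteq> 0" "\<And>v x. v \<in> I \<Longrightarrow> x \<in> Y \<Longrightarrow> \<phi> x v = c v * x (\<rho> v)"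
proof -
  have \<phi>Y: "\<phi> \<in> Y \<rightarrow> Y" using \<phi>(1) by (simp add: regular_self_map_def)
  have \<phi>0: "\<phi> origin = origin" by (rule torus_map_origin[OF \<phi>Y \<phi>(2)])
  have \<psi>0: "\<psi> origin = origin" using \<psi>(3)[OF origin_Y] \<phi>0 by simp
  let ?J = "\<lambda>v k. lin k (\<lambda>x. \<phi> x v)" and ?N = "\<lambda>k w. lin w (\<lambda>x. \<psi> x k)"
  have JN: "(\<Sum>k\<in>I. ?J v k * ?N k w) = (if v = w then 1 else 0)" if "v \<in> I" "w \<in> I" for v w
    by (rule lin_inverse[OF \<phi>(1) \<psi>(1) \<psi>0 \<psi>(2) that])
  have "\<forall>v\<in>I. \<exists>P. mp_vars P \<subseteq> I \<and> (\<forall>x\<in>Y. \<phi> x v = mp_eval x P)"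
    using \<phi>(1) unfolding regular_self_map_def regular_function_def by blast
  from bchoice[OF this] obtain P where P: "\<And>v. v \<in> I \<Longrightarrow> mp_vars (P v) \<subseteq> I" "\<And>v x. v \<in> I \<Longrightarrow> x \<in> Y \<Longrightarrow> \<phi> x v = mp_eval x (P v)"
    by blast
  \<comment> \<open>Discarding the monomials of the wrong weight does not change the functions on
    \<open>Y\<close> but makes the equivariance hold on all of affine space, as
    \<open>vanishing_semi_invariant\<close> needs.\<close>
  define K where "K v = {m \<in> Poly_Mapping.keys (P v). \<forall>t\<in>T. pm_monom t m = t v}" for v
  define Q where "Q v = (\<Sum>m\<in>K v. Poly_Mapping.single m (Poly_Mapping.lookup (P v) m))" for v
  have finK: "finite (K v)" for v by (simp add: K_def)
  have lQ: "Poly_Mapping.lookup (Q v) m = (if m \<in> K v then Poly_Mapping.lookup (P v) m else 0)" for m v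
    unfolding Q_def lookup_sum lookup_single when_def using finK by (simp add: sum.delta)
  have kQ: "Poly_Mapping.keys (Q v) = K v" for v by (auto simp: in_keys_iff lQ K_def split: if_splits)
  have KI: "Poly_Mapping.keys m \<subseteq> I" if "v \<in> I" "m \<in> K v" for m v using P(1)[OF that(1)] that(2) by (auto simp: K_def mp_vars_def)
  have Qv: "mp_vars (Q v) \<subseteq> I" if "v \<in> I" for v using KI[OF that] by (auto simp: mp_vars_def kQ)
  define G where "G x v = mp_eval x (Q v)" for x v
  have Gsum: "G x v = (\<Sum>m\<in>K v. Poly_Mapping.lookup (Q v) m * pm_monom x m)" for x v
    by (simp add: G_def mp_eval_eq kQ)
  have G: "\<phi> x v = G x v" if "v \<in> I" "x \<in> Y" for x v
  proof -
    have "mp_eval x (P v) = (\<Sum>m | m \<in> Poly_Mapping.keys (P v) \<and> (\<forall>t\<in>T. pm_monom t m = t v). Poly_Mapping.lookup (P v) m * pm_monom x m)"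
    proof (rule isotypic[where \<chi> = "\<lambda>t. t v", OF P(1)[OF that(1)] torus.one torus_mult])
      fix t assume t: "t \<in> T"
      then have "diag I t x \<in> Y" using diag_Y torus_subset that(2) by blast
      then show "mp_eval (diag I t x) (P v) = t v * mp_eval x (P v)"
        using \<phi>(2)[OF t that(2,1)] P(2)[OF that(1)] that(2) by simp
    qed auto
    then show ?thesis unfolding Gsum K_def[symmetric] using P(2)[OF that] lQ by (simp add: K_def)
  qed
  have Gdiag: "G (diag I t x) v = t v * G x v" if "t \<in> T" "v \<in> I" for t x v
  proof -
    have "pm_monom (diag I t x) m = t v * pm_monom x m" if "m \<in> K v" for m
      using KI[OF \<open>v \<in> I\<close> that] that \<open>t \<in> T\<close> by (simp add: pm_monom_diag K_def)
    then show ?thesis unfolding Gsum by (simp add: sum_distrib_left mult_ac)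
  qed
  have J: "?J v k = Poly_Mapping.lookup (Q v) (e k)" if "v \<in> I" "k \<in> I" for v k
    by (rule lin_eq[OF Qv[OF that(1)] _ that(2)]) (use G that in \<open>simp add: G_def\<close>)
  have sw: "same_weight m (e v)" if "v \<in> I" "m \<in> K v" for v m
    using that by (intro same_weight_if_torus KI keys_e) (auto simp: K_def)
  have bcong: "b i x = b i y" if "\<And>v. v \<in> I \<Longrightarrow> x v = y v" "i \<le> 2" for i and x y :: "idx \<Rightarrow> 'a"
    unfolding bm_def using that by (intro prod.cong) (auto simp: in_tri_idx)
  define F where "F = mp_subst Q (trinomial n l)"
  have Fx: "mp_eval x F = b 0 (G x) + b 1 (G x) + b 2 (G x)" for x
    by (simp add: F_def mp_eval_subst mp_eval_trinomial sum_le2 G_def[abs_def])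
  have main: "\<exists>c. \<forall>x\<in>extensional I. mp_eval x F = c * (b 0 x + b 1 x + b 2 x)"
  proof (rule vanishing_semi_invariant[of F])
    show "mp_vars F \<subseteq> I" unfolding F_def by (rule mp_vars_subst[OF mp_vars_trinomial Qv])
    show "mp_eval x F = 0" if "x \<in> Y" for x
    proof -
      have "b i (G x) = b i (\<phi> x)" if "i \<le> 2" for i using G \<open>x \<in> Y\<close> that by (intro bcong) auto
      then show ?thesis using \<phi>Y that by (auto simp: Fx Y_iff Pi_iff)
    qed
    show "mp_eval (diag I t x) F = b 0 t * mp_eval x F" if "t \<in> T" for t x
    proof -
      have "b i (G (diag I t x)) = b i t * b i (G x)" if "i \<le> 2" for i
        using Gdiag[OF \<open>t \<in> T\<close>, of _ x] bcong[of "G (diag I t x)" "\<lambda>v. t v * G x v" i] that by (simp add: bm_mult)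
      moreover have "b 1 t = b 0 t" "b 2 t = b 0 t" using \<open>t \<in> T\<close> torus_subset by (auto simp: big_torus_def)
      ultimately show ?thesis by (simp add: Fx algebra_simps)
    qed
  qed blast
  then obtain d where d: "\<And>x. x \<in> extensional I \<Longrightarrow> b 0 (G x) + b 1 (G x) + b 2 (G x) = d * (b 0 x + b 1 x + b 2 x)"
    unfolding Fx by blast
  have d': "(\<Sum>i\<le>2. b i (G x)) = d * (\<Sum>i\<le>2. b i x)" if "x \<in> extensional I" for x
    using d[OF that] by (simp add: sum_le2)
  have one: "(i, 1) \<in> I" if "i \<le> 2" for i using blocks[OF that] that by (auto simp: in_tri_idx)
  have b1: "b i x = x (i, 1) ^ l i 1" if "n i = 1" for i x using that by (simp add: bm_def)
  \<comment> \<open>With several variables in the block, \<open>e v\<close> is the only monomial of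
    its weight, and its coefficient is nonzero because the linear part is invertible.\<close>
  have single: "\<phi> x v = ?J v v * x v \<and> ?J v v \<noteq> 0 \<and> (\<forall>x. G x v = ?J v v * x v)" if x: "x \<in> Y" and v: "v \<in> I" "n (fst v) \<noteq> 1" for x v
  proof -
    have K: "K v \<subseteq> {e v}" using same_weight_e[of _ "fst v" "snd v"] KI[OF v(1)] sw[OF v(1)] v by auto
    have Gx: "G x v = ?J v v * x v" for x
    proof -
      have "G x v = (\<Sum>m\<in>{e v}. Poly_Mapping.lookup (Q v) m * pm_monom x m)"
        unfolding Gsum using K by (intro sum.mono_neutral_left) (auto simp: lQ)
      then show ?thesis using J[OF v(1) v(1)] by simp
    qed
    have ev: "e k = e v \<longleftrightarrow> k = v" for k by (metis lookup_single_eq lookup_single_not_eq zero_neq_one)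
    have "(\<Sum>k\<in>I. ?J v k * ?N k v) = (\<Sum>k\<in>{v}. ?J v k * ?N k v)"
      using v(1) K ev by (intro sum.mono_neutral_right) (auto simp: J lQ finite_tri_idx)
    then have "?J v v \<noteq> 0" using JN[OF v(1) v(1)] by auto
    then show ?thesis using Gx G[OF v(1) x] by simp
  qed
  define B where "B a = {i. i \<le> 2 \<and> n i = 1 \<and> l i 1 = a}" for a
  \<comment> \<open>With the blocks of smaller exponent already settled, restricting to the variables of exponent \<open>a\<close>
    turns the equation of \<open>F\<close> into one between Fermat forms, up to a constant.\<close>
  have fermat: "\<forall>i\<in>B a. \<exists>k\<in>B a. \<exists>c. c \<noteq> 0 \<and> (\<forall>x. x \<in> extensional I \<longrightarrow> G x (i, 1) = c * x (k, 1))" for a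
  proof (induction a rule: less_induct)
    case (less a)
    have finB: "finite (B a)" by (rule finite_subset[of _ "{..2}"]) (auto simp: B_def)
    have B2: "i \<le> 2" "n i = 1" "l i 1 = a" "(i, 1) \<in> I" if "i \<in> B a" for i using that one by (auto simp: B_def)
    have Km: "(\<exists>k\<in>B a. m = e (k, 1)) \<or> (\<forall>k\<in>B a. Poly_Mapping.lookup m (k, 1) = 0)" if i: "i \<in> B a" "m \<in> K (i, 1)" for i m
      using same_weight_e[OF KI[OF B2(4)[OF i(1)] i(2)] B2(4)[OF i(1)] sw[OF B2(4)[OF i(1)] i(2)]] i(1)
      by (metis B2(2,3,4) order_refl)
    \<comment> \<open>Different variables of equal weight lie in single-variable blocks of equal
      exponent: \<open>same_weight_e\<close> is applied at the one whose exponent is not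
      smaller.\<close>
    have Jz: "?J (i, 1) v = 0" if i: "i \<in> B a" and v: "v \<in> I" "v \<notin> (\<lambda>k. (k, 1)) ` B a" for i v
    proof (rule ccontr)
      assume "?J (i, 1) v \<noteq> 0"
      then have ev: "e v \<in> K (i, 1)" using J[OF B2(4)[OF i] v(1)] by (auto simp: lQ split: if_splits)
      obtain k j where vkj: "v = (k, j)" by (cases v)
      have vi: "v \<noteq> (i, 1)" using v(2) i by auto
      have eq: "e v \<noteq> e (i, 1)" using vi by (metis lookup_single_eq lookup_single_not_eq zero_neq_one)
      note s1 = sw[OF B2(4)[OF i] ev]
      have s2: "same_weight (e (i, 1)) (e (k, j))" using s1 vkj by (simp add: same_weight_def)
      have kj: "(k, j) \<in> I" using v(1) vkj by simp
      have nk: "n k = 1" using same_weight_e[OF keys_e[OF B2(4)[OF i]] kj s2] eq vkj by metis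
      then have j: "j = 1" using kj by (simp add: in_tri_idx)
      have ki: "k \<noteq> i" using vi vkj j by auto
      have "l k 1 = a"
      proof (cases "l k 1 \<le> l i 1")
        case True
        then have "Poly_Mapping.lookup (e v) (k, 1) = 0 \<or> l k 1 = l i 1"
          using same_weight_e[OF keys_e[OF v(1)] B2(4)[OF i] s1] eq ki kj j nk by blast
        then show ?thesis using vkj j B2(3)[OF i] by simp
      next
        case False
        then have "l i 1 \<le> l k 1" by simp
        then have "Poly_Mapping.lookup (e (i, 1)) (i, 1) = 0 \<or> l i 1 = l k 1"
          using same_weight_e[OF keys_e[OF B2(4)[OF i]] kj s2] eq ki vkj j nk B2(2,4)[OF i] by metis
        then show ?thesis using B2(3)[OF i] by simp
      qed
      then have "k \<in> B a" using nk kj by (auto simp: B_def in_tri_idx)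
      then show False using v(2) vkj j by auto
    qed
    \<comment> \<open>By \<open>Jz\<close> the rows in \<open>B a\<close> vanish outside these
      columns, so the submatrix inherits a right inverse.\<close>
    have inv: "(\<Sum>k\<in>B a. ?J (i, 1) (k, 1) * ?N (k, 1) (w, 1)) = (if i = w then 1 else 0)" if iw: "i \<in> B a" "w \<in> B a" for i w
    proof -
      have "(\<Sum>k\<in>I. ?J (i, 1) k * ?N k (w, 1)) = (\<Sum>k\<in>(\<lambda>k. (k, 1)) ` B a. ?J (i, 1) k * ?N k (w, 1))"
        using Jz[OF iw(1)] B2(4) by (intro sum.mono_neutral_right) (auto simp: finite_tri_idx)
      then show ?thesis using JN[OF B2(4)[OF iw(1)] B2(4)[OF iw(2)]] by (simp add: sum.reindex inj_on_def)
    qed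
    show ?case
    proof
      fix i0 assume i0: "i0 \<in> B a"
      have a2: "a \<ge> 2" using no_linear[OF B2(1)[OF i0]] B2(2,3)[OF i0] by simp
      define X' where "X' z y = (\<lambda>v. if snd v = 1 \<and> fst v \<in> B a then y (fst v) else z v)" for z :: "idx \<Rightarrow> 'a" and y
      have fm: "G (X' z (\<lambda>_. 0)) (i0, 1) = 0 \<and> (\<exists>k\<in>B a. ?J (i0, 1) (k, 1) \<noteq> 0 \<and> (\<forall>k'\<in>B a. k' \<noteq> k \<longrightarrow> ?J (i0, 1) (k', 1) = 0))"
        and Glin: "\<And>y i. i \<in> B a \<Longrightarrow> G (X' z y) (i, 1) = (\<Sum>k\<in>B a. ?J (i, 1) (k, 1) * y k) + G (X' z (\<lambda>_. 0)) (i, 1)"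
        if z: "z \<in> extensional I" for z
      proof -
        have Xe: "X' z y \<in> extensional I" for y using z B2(4) by (auto simp: X'_def extensional_def)
        show Glin: "G (X' z y) (i, 1) = (\<Sum>k\<in>B a. ?J (i, 1) (k, 1) * y k) + G (X' z (\<lambda>_. 0)) (i, 1)" if i: "i \<in> B a" for i y
        proof -
          let ?E = "(\<lambda>k. e (k, 1)) ` B a"
          have inj: "inj_on (\<lambda>k. e (k, 1::nat)) (B a)"
            by (rule inj_onI) (metis lookup_single_eq lookup_single_not_eq zero_neq_one prod.inject)
          have "G (X' z y) (i, 1) - G (X' z (\<lambda>_. 0)) (i, 1)
              = (\<Sum>m\<in>K (i, 1). Poly_Mapping.lookup (Q (i, 1)) m * (pm_monom (X' z y) m - pm_monom (X' z (\<lambda>_. 0)) m))"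
            unfolding Gsum by (simp add: sum_subtractf right_diff_distrib)
          also have "\<dots> = (\<Sum>m\<in>?E. Poly_Mapping.lookup (Q (i, 1)) m * (pm_monom (X' z y) m - pm_monom (X' z (\<lambda>_. 0)) m))"
          proof (rule sum.mono_neutral_cong[OF finite_imageI[OF finB] finK])
            show "Poly_Mapping.lookup (Q (i, 1)) m * (pm_monom (X' z y) m - pm_monom (X' z (\<lambda>_. 0)) m) = 0"
              if m: "m \<in> K (i, 1) - ?E" for m
            proof -
              have "\<forall>k\<in>B a. Poly_Mapping.lookup m (k, 1) = 0" using Km[OF i, of m] m by blast
              then have "pm_monom (X' z y) m = pm_monom (X' z (\<lambda>_. 0)) m"
                by (intro pm_monom_cong) (auto simp: X'_def in_keys_iff)
              then show ?thesis by simp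
            qed
          qed (auto simp: lQ)
          also have "\<dots> = (\<Sum>k\<in>B a. ?J (i, 1) (k, 1) * y k)"
            by (subst sum.reindex[OF inj]) (use B2(4) i in \<open>auto simp: X'_def J intro!: sum.cong\<close>)
          finally show ?thesis by (simp add: algebra_simps)
        qed
        \<comment> \<open>The other block values do not depend on \<open>y\<close>: for several
          variables by \<open>single\<close>, for a smaller exponent by the induction hypothesis,
          for a larger one because \<open>same_weight_e\<close> keeps the variables of
          \<open>B a\<close> out.\<close>
        have rest: "b i (G (X' z y)) = b i (G (X' z (\<lambda>_. 0)))" if i: "i \<le> 2" "i \<notin> B a" for i y
        proof (cases "n i = 1")
          case False
          have "G (X' z y) v = G (X' z (\<lambda>_. 0)) v" if "v \<in> I" "fst v = i" for v
            using single[OF origin_Y that(1)] that False i by (simp add: X'_def)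
          then show ?thesis unfolding bm_def using i by (intro prod.cong) (auto simp: in_tri_idx)
        next
          case True
          have "G (X' z y) (i, 1) = G (X' z (\<lambda>_. 0)) (i, 1)"
          proof (cases "l i 1 < a")
            case lt: True
            have "i \<in> B (l i 1)" using i True by (simp add: B_def)
            then obtain k c where k: "k \<in> B (l i 1)" "\<And>x. x \<in> extensional I \<Longrightarrow> G x (i, 1) = c * x (k, 1)"
              using less[OF lt] by blast
            then have "k \<notin> B a" using lt by (auto simp: B_def)
            then have "X' z y' (k, 1) = z (k, 1)" for y' by (simp add: X'_def)
            then show ?thesis using k(2)[OF Xe[of y]] k(2)[OF Xe[of "\<lambda>_. 0"]] by simp
          next
            case False
            then have gt: "a < l i 1" using i True by (auto simp: B_def)
            have "pm_monom (X' z y) m = pm_monom (X' z (\<lambda>_. 0)) m" if m: "m \<in> K (i, 1)" for m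
            proof (rule pm_monom_cong)
              fix v assume v: "v \<in> Poly_Mapping.keys m"
              have "v \<noteq> (k, 1)" if k: "k \<in> B a" for k
              proof -
                have "k \<noteq> i" using k i by auto
                then have "Poly_Mapping.lookup m (k, 1) = 0"
                  using same_weight_e[OF KI[OF one[OF i(1)] m] one[OF i(1)] sw[OF one[OF i(1)] m]] gt B2(2,3,4)[OF k]
                  by (metis lookup_single_not_eq nat_less_le prod.inject)
                then show ?thesis using v by (auto simp: in_keys_iff)
              qed
              then show "X' z y v = X' z (\<lambda>_. 0) v" by (cases v) (auto simp: X'_def)
            qed
            then show ?thesis unfolding Gsum by simp
          qed
          then show ?thesis using b1[OF True] by simp
        qed
        have restx: "b i (X' z y) = b i z" if i: "i \<le> 2" "i \<notin> B a" for i y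
          unfolding bm_def using i by (intro prod.cong) (auto simp: X'_def)
        define R where "R = (\<Sum>i\<in>{..2} - B a. b i (G (X' z (\<lambda>_. 0))))"
        define R' where "R' = (\<Sum>i\<in>{..2} - B a. b i z)"
        have sub: "B a \<subseteq> {..2}" by (auto simp: B_def)
        have Fer: "(\<Sum>i\<in>B a. ((\<Sum>k\<in>B a. ?J (i, 1) (k, 1) * y k) + G (X' z (\<lambda>_. 0)) (i, 1)) ^ a)
            = d * (\<Sum>k\<in>B a. y k ^ a) + (d * R' - R)" for y
        proof -
          have "(\<Sum>i\<le>2. b i (G (X' z y))) = (\<Sum>i\<in>B a. G (X' z y) (i, 1) ^ a) + R"
          proof -
            have "(\<Sum>i\<in>{..2} - B a. b i (G (X' z y))) = R"
              unfolding R_def by (rule sum.cong[OF refl], rule rest) auto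
            moreover have "(\<Sum>i\<in>B a. b i (G (X' z y))) = (\<Sum>i\<in>B a. G (X' z y) (i, 1) ^ a)"
              by (rule sum.cong) (use B2(2,3) b1 in auto)
            ultimately show ?thesis unfolding sum.subset_diff[OF sub finite_atMost] by (simp only: add.commute)
          qed
          moreover have "(\<Sum>i\<le>2. b i (X' z y)) = (\<Sum>i\<in>B a. y i ^ a) + R'"
          proof -
            have "(\<Sum>i\<in>{..2} - B a. b i (X' z y)) = R'"
              unfolding R'_def by (rule sum.cong[OF refl], rule restx) auto
            moreover have "b i (X' z y) = y i ^ a" if "i \<in> B a" for i
              using b1[OF B2(2)[OF that], of "X' z y"] B2(3)[OF that] that by (simp add: X'_def)
            then have "(\<Sum>i\<in>B a. b i (X' z y)) = (\<Sum>i\<in>B a. y i ^ a)" by (intro sum.cong) auto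
            ultimately show ?thesis unfolding sum.subset_diff[OF sub finite_atMost] by (simp only: add.commute)
          qed
          ultimately have "(\<Sum>i\<in>B a. G (X' z y) (i, 1) ^ a) + R = d * ((\<Sum>i\<in>B a. y i ^ a) + R')"
            using d'[OF Xe[of y]] by simp
          moreover have "(\<Sum>i\<in>B a. G (X' z y) (i, 1) ^ a)
              = (\<Sum>i\<in>B a. ((\<Sum>k\<in>B a. ?J (i, 1) (k, 1) * y k) + G (X' z (\<lambda>_. 0)) (i, 1)) ^ a)"
            by (rule sum.cong[OF refl]) (simp only: Glin[of _ y])
          ultimately show ?thesis by (simp only: distrib_left eq_diff_eq add_diff_eq)
        qed
        show "G (X' z (\<lambda>_. 0)) (i0, 1) = 0 \<and> (\<exists>k\<in>B a. ?J (i0, 1) (k, 1) \<noteq> 0 \<and> (\<forall>k'\<in>B a. k' \<noteq> k \<longrightarrow> ?J (i0, 1) (k', 1) = 0))"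
        proof (rule fermat_form_monomial[OF finB a2 _ inv Fer i0])
          show "\<forall>i\<in>B a. \<forall>j\<in>B a. i = j" if "a = 2" using quad that by (auto simp: B_def)
        qed
      qed
      \<comment> \<open>The matrix does not depend on \<open>z\<close>, so the column
        \<open>k\<close> may be found at any point; the vanishing of the constant term is then used
        at \<open>x\<close>.\<close>
      have "origin \<in> extensional I" by (simp add: origin_def)
      from fm[OF this] obtain k where k: "k \<in> B a" "?J (i0, 1) (k, 1) \<noteq> 0" "\<And>k'. k' \<in> B a \<Longrightarrow> k' \<noteq> k \<Longrightarrow> ?J (i0, 1) (k', 1) = 0" by blast
      have "G x (i0, 1) = ?J (i0, 1) (k, 1) * x (k, 1)" if x: "x \<in> extensional I" for x
      proof -
        have "X' x (\<lambda>i. x (i, 1)) = x" by (auto simp: X'_def)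
        then have "G x (i0, 1) = (\<Sum>k\<in>B a. ?J (i0, 1) (k, 1) * x (k, 1))"
          using Glin[OF x i0, of "\<lambda>i. x (i, 1)"] fm[OF x] by simp
        also have "\<dots> = (\<Sum>k\<in>{k}. ?J (i0, 1) (k, 1) * x (k, 1))"
          using k finB by (intro sum.mono_neutral_right) auto
        finally show ?thesis by simp
      qed
      then show "\<exists>k\<in>B a. \<exists>c. c \<noteq> 0 \<and> (\<forall>x. x \<in> extensional I \<longrightarrow> G x (i0, 1) = c * x (k, 1))"
        using k(1,2) by blast
    qed
  qed
  have all: "\<exists>k c. k \<in> I \<and> c \<noteq> 0 \<and> (\<forall>x\<in>Y. \<phi> x v = c * x k)" if v: "v \<in> I" for v
  proof (cases "n (fst v) = 1")
    case False
    then show ?thesis using single[OF _ v] v origin_Y by blast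
  next
    case True
    then obtain i where vi: "v = (i, 1)" "i \<le> 2" "n i = 1" using v by (cases v) (auto simp: in_tri_idx)
    then have "i \<in> B (l i 1)" by (simp add: B_def)
    then obtain k c where k: "k \<in> B (l i 1)" "c \<noteq> 0" "\<And>x. x \<in> extensional I \<Longrightarrow> G x (i, 1) = c * x (k, 1)"
      using fermat by blast
    have "(k, 1) \<in> I" using k(1) one by (auto simp: B_def)
    moreover have "\<phi> x v = c * x (k, 1)" if "x \<in> Y" for x using G[OF v that] k(3)[of x] that vi(1) by (simp add: Y_iff)
    ultimately show ?thesis using k(2) by blast
  qed
  have "\<forall>v\<in>I. \<exists>kc. fst kc \<in> I \<and> snd kc \<noteq> 0 \<and> (\<forall>x\<in>Y. \<phi> x v = snd kc * x (fst kc))" using all by force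
  from bchoice[OF this] obtain kc where kc: "\<And>v. v \<in> I \<Longrightarrow> fst (kc v) \<in> I \<and> snd (kc v) \<noteq> 0 \<and> (\<forall>x\<in>Y. \<phi> x v = snd (kc v) * x (fst (kc v)))"
    by blast
  define \<rho> where "\<rho> v = (if v \<in> I then fst (kc v) else v)" for v
  have "inj_on \<rho> I"
  proof (rule inj_onI, rule ccontr)
    fix v w assume vw: "v \<in> I" "w \<in> I" "\<rho> v = \<rho> w" "v \<noteq> w"
    obtain x where x: "x \<in> Y" "x v = 0" "x w \<noteq> 0" using separating_point[OF vw(1)] vw by metis
    have \<psi>x: "\<psi> x \<in> Y" using \<psi>(1) x(1) by (auto simp: regular_self_map_def)
    have "x v = snd (kc v) * \<psi> x (fst (kc v))" "x w = snd (kc w) * \<psi> x (fst (kc w))"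
      using kc[OF vw(1)] kc[OF vw(2)] \<psi>x \<psi>(2)[OF x(1)] by metis+
    then show False using vw x kc[OF vw(1)] kc[OF vw(2)] by (auto simp: \<rho>_def)
  qed
  moreover have "\<rho> ` I \<subseteq> I" using kc by (auto simp: \<rho>_def)
  ultimately have "bij_betw \<rho> I I" by (simp add: bij_betw_def endo_inj_surj finite_tri_idx)
  then have "\<rho> permutes I" by (rule bij_imp_permutes) (simp add: \<rho>_def)
  then show thesis
    using that[of \<rho> "\<lambda>v. snd (kc v)"] kc by (simp add: \<rho>_def)
qed


section \<open>Quadratic blocks\<close>


text \<open>Two quadratic blocks with a single variable each give \<open>uv + w\<^sub>1 ^ k w' = 0\<close>, on which
  \<open>w\<^sub>1 \<mapsto> w\<^sub>1 + s u\<close> extends to an action of the additive group fixing \<open>u\<close>.\<close>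

lemma rigid_quadratic_blocks:
  assumes rigid: "rigid I Y"
    and ik: "i \<le> 2" "k \<le> 2" "n i = 1" "n k = 1" "l i 1 = 2" "l k 1 = 2"
  shows "i = k"
proof (rule ccontr)
  assume neq: "i \<noteq> k"
  obtain h where h: "h \<le> 2" "h \<noteq> i" "h \<noteq> k" "\<And>i'. i' \<le> 2 \<Longrightarrow> i' = i \<or> i' = k \<or> i' = h"
      "\<And>q::nat \<Rightarrow> 'a. q 0 + q 1 + q 2 = q i + q k + q h"
    using third_index[OF ik(1,2)] neq by metis
  \<comment> \<open>A square root of -1 splits the two squares into the product
    \<open>u x * v x\<close> of the linear forms below.\<close>
  obtain \<iota> :: 'a where \<iota>: "\<iota> ^ 2 = -1" using nth_root_exists[of 2 "-1"] by auto
  have \<iota>2: "\<iota> * \<iota> = -1" using \<iota> by (simp add: power2_eq_square)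
  have one: "(i', 1) \<in> I" if "i' \<le> 2" for i' using blocks[OF that] that by (auto simp: in_tri_idx)
  define N where "N = l h 1"
  have N: "N > 0" using exps1[OF h(1)] by (simp add: N_def)
  let ?y = "(i, 1::nat)" and ?z = "(k, 1::nat)" and ?w = "(h, 1::nat)"
  define w' where "w' x = (\<Prod>j=2..n h. x (h, j) ^ l h j)" for x :: "idx \<Rightarrow> 'a"
  define u where "u x = x ?y + \<iota> * x ?z" for x :: "idx \<Rightarrow> 'a"
  define v where "v x = x ?y - \<iota> * x ?z" for x :: "idx \<Rightarrow> 'a"
  \<comment> \<open>The quotient of \<open>w' x * ((x ?w + s * u x) ^ N - x ?w ^ N)\<close> by
    \<open>u x\<close> with the division carried out, so that it stays polynomial where
    \<open>u\<close> vanishes.\<close>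
  define q where "q s x = w' x * (\<Sum>j\<in>{1..N}. of_nat (N choose j) * s ^ j * x ?w ^ (N - j) * u x ^ (j - 1))" for s and x :: "idx \<Rightarrow> 'a"
  have bh: "b h x = x ?w ^ N * w' x" for x
  proof -
    have "{1..n h} = insert 1 {2..n h}" using blocks[OF h(1)] by auto
    then show ?thesis by (simp add: bm_def w'_def N_def)
  qed
  have Yuv: "x \<in> Y \<longleftrightarrow> x \<in> extensional I \<and> u x * v x + x ?w ^ N * w' x = 0" for x
  proof -
    have "b i x = x ?y ^ 2" and "b k x = x ?z ^ 2" using ik by (simp_all add: bm_def)
    then have "b 0 x + b 1 x + b 2 x = u x * v x + x ?w ^ N * w' x"
    proof -
      have "u x * v x = x ?y ^ 2 - \<iota> ^ 2 * x ?z ^ 2"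
        by (simp add: u_def v_def power2_eq_square algebra_simps)
      then have "u x * v x = x ?y ^ 2 + x ?z ^ 2" unfolding \<iota> by simp
      then show ?thesis
        using h(5)[of "\<lambda>i. b i x"] \<open>b i x = x ?y ^ 2\<close> \<open>b k x = x ?z ^ 2\<close> by (simp only: bh)
    qed
    then show ?thesis by (simp add: Y_iff)
  qed
  have uq: "u x * q s x = w' x * ((x ?w + s * u x) ^ N - x ?w ^ N)" for s x
  proof -
    have "(x ?w + s * u x) ^ N = (\<Sum>j\<le>N. of_nat (N choose j) * (s * u x) ^ j * x ?w ^ (N - j))"
      by (subst add.commute) (rule binomial_ring)
    also have "\<dots> = x ?w ^ N + (\<Sum>j\<in>{1..N}. of_nat (N choose j) * (s * u x) ^ j * x ?w ^ (N - j))"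
      by (simp add: atMost_atLeast0 sum.atLeast_Suc_atMost)
    finally have "(x ?w + s * u x) ^ N - x ?w ^ N = (\<Sum>j\<in>{1..N}. of_nat (N choose j) * (s * u x) ^ j * x ?w ^ (N - j))" by simp
    also have "\<dots> = u x * (\<Sum>j\<in>{1..N}. of_nat (N choose j) * s ^ j * x ?w ^ (N - j) * u x ^ (j - 1))"
      unfolding sum_distrib_left
    proof (rule sum.cong)
      fix j assume "j \<in> {1..N}"
      then have "u x ^ j = u x * u x ^ (j - 1)" by (cases j) auto
      then show "of_nat (N choose j) * (s * u x) ^ j * x ?w ^ (N - j) = u x * (of_nat (N choose j) * s ^ j * x ?w ^ (N - j) * u x ^ (j - 1))"
        by (simp add: power_mult_distrib)
    qed simp
    finally show ?thesis by (simp add: q_def)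
  qed
  have q0: "q s x = w' x * (of_nat N * s * x ?w ^ (N - 1))" if "u x = 0" for s x
  proof -
    have "(\<Sum>j\<in>{1..N}. of_nat (N choose j) * s ^ j * x ?w ^ (N - j) * u x ^ (j - 1)) = (\<Sum>j\<in>{1}. of_nat (N choose j) * s ^ j * x ?w ^ (N - j) * u x ^ (j - 1))"
      using that N by (intro sum.mono_neutral_right) (auto simp: zero_power)
    then show ?thesis by (simp add: q_def)
  qed
  \<comment> \<open>The factors 1/2 and \<open>1 / (2 * \<iota>)\<close> leave \<open>u\<close>
    unchanged and lower \<open>v\<close> by \<open>q s x\<close>, which compensates the change of
    \<open>x ?w ^ N * w' x\<close> in the equation.\<close>
  define \<alpha> where "\<alpha> s = (\<lambda>x\<in>Y. x(?w := x ?w + s * u x, ?y := x ?y - q s x / 2, ?z := x ?z + q s x / (2 * \<iota>)))" for s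
  have dist: "?w \<noteq> ?y" "?w \<noteq> ?z" "?y \<noteq> ?z" using h neq by auto
  have i0: "\<iota> \<noteq> 0" using \<iota> by auto
  have a: "u (\<alpha> s x) = u x" "v (\<alpha> s x) = v x - q s x" "\<alpha> s x ?w = x ?w + s * u x" "w' (\<alpha> s x) = w' x" if "x \<in> Y" for s x
  proof -
    have st: "\<alpha> s x = x(?w := x ?w + s * u x, ?y := x ?y - q s x / 2, ?z := x ?z + q s x / (2 * \<iota>))"
      using that by (simp add: \<alpha>_def)
    have c: "\<alpha> s x ?y = x ?y - q s x / 2" "\<alpha> s x ?z = x ?z + q s x / (2 * \<iota>)" and w: "\<alpha> s x ?w = x ?w + s * u x"
      using dist by (simp_all add: st)
    show "\<alpha> s x ?w = x ?w + s * u x" by (rule w)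
    have "\<iota> * (q s x / (2 * \<iota>)) = q s x / 2" using i0 by simp
    then have \<iota>z: "\<iota> * (x ?z + q s x / (2 * \<iota>)) = \<iota> * x ?z + q s x / 2" by (simp only: distrib_left)
    show "u (\<alpha> s x) = u x" unfolding u_def c \<iota>z by simp
    have "q s x = q s x / 2 + q s x / 2" by simp
    then show "v (\<alpha> s x) = v x - q s x" unfolding v_def c \<iota>z by (simp only: diff_diff_eq diff_diff_eq2 add_diff_eq) (simp add: algebra_simps)
    show "w' (\<alpha> s x) = w' x" unfolding w'_def using h(2,3) by (intro prod.cong) (auto simp: st)
  qed
  have \<alpha>Y: "\<alpha> s x \<in> Y" if x: "x \<in> Y" for s x
  proof -
    have "\<alpha> s x \<in> extensional I" using x one ik(1,2) h(1) by (auto simp: \<alpha>_def Y_iff extensional_def)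
    moreover have "u x * (v x - q s x) + (x ?w + s * u x) ^ N * w' x = 0"
    proof -
      have "u x * (v x - q s x) + (x ?w + s * u x) ^ N * w' x
          = (u x * v x + x ?w ^ N * w' x) + (w' x * ((x ?w + s * u x) ^ N - x ?w ^ N) - u x * q s x)"
        by (simp only: right_diff_distrib mult.commute[of "w' x"]) simp
      then show ?thesis using x uq[of x s] by (simp add: Yuv)
    qed
    ultimately show ?thesis using a[OF x] by (simp add: Yuv)
  qed
  \<comment> \<open>The cocycle law that makes \<open>\<alpha>\<close> additive in the parameter. It
    follows by cancelling \<open>u\<close> where it is nonzero, and from the linear term
    \<open>q0\<close> elsewhere.\<close>
  have qadd: "q s (\<alpha> t x) + q t x = q (s + t) x" if x: "x \<in> Y" for s t x
  proof (cases "u x = 0")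
    case True
    then show ?thesis using a[OF x, of t] q0[of x] q0[of "\<alpha> t x"] by (simp add: algebra_simps)
  next
    case False
    have "u x * (q s (\<alpha> t x) + q t x) = u x * q (s + t) x"
    proof -
      have 1: "u x * q s (\<alpha> t x) = w' x * ((x ?w + t * u x + s * u x) ^ N - (x ?w + t * u x) ^ N)"
        using uq[of "\<alpha> t x" s] a[OF x, of t] by simp
      have 2: "x ?w + t * u x + s * u x = x ?w + (s + t) * u x" by (simp add: algebra_simps)
      show ?thesis unfolding distrib_left 1 uq 2 by (simp only: right_diff_distrib) simp
    qed
    then show ?thesis using False by simp
  qed
  have \<alpha>\<alpha>: "\<alpha> s (\<alpha> t x) = \<alpha> (s + t) x" if x: "x \<in> Y" for s t x
  proof
    fix m
    have val: "\<alpha> r y ?y = y ?y - q r y / 2" "\<alpha> r y ?z = y ?z + q r y / (2 * \<iota>)"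
      "m \<notin> {?w, ?y, ?z} \<Longrightarrow> \<alpha> r y m = y m" if "y \<in> Y" for r y
      using that dist by (simp_all add: \<alpha>_def)
    note q = qadd[OF x, of s t, symmetric]
    consider "m = ?w" | "m = ?y" | "m = ?z" | "m \<notin> {?w, ?y, ?z}" by blast
    then show "\<alpha> s (\<alpha> t x) m = \<alpha> (s + t) x m"
    proof cases
      case 1
      then show ?thesis by (simp only: a(1,3)[OF x] a(3)[OF \<alpha>Y[OF x]]) (simp add: algebra_simps)
    next
      case 2
      then show ?thesis by (simp only: val(1)[OF x] val(1)[OF \<alpha>Y[OF x]] q add_divide_distrib) simp
    next
      case 3
      then show ?thesis by (simp only: val(2)[OF x] val(2)[OF \<alpha>Y[OF x]] q add_divide_distrib) simp
    next
      case 4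
      then show ?thesis by (simp only: val(3)[OF x 4] val(3)[OF \<alpha>Y[OF x] 4])
    qed
  qed
  have q_zero: "q 0 x = 0" for x by (auto simp: q_def zero_power intro!: sum.neutral)
  have \<alpha>0: "\<alpha> 0 x = x" if "x \<in> Y" for x using that by (simp add: \<alpha>_def q_zero)
  have act: "group_action (add_monoid ring_of_type_algebra) Y \<alpha>"
    by (rule group_action_add) (auto simp: \<alpha>Y \<alpha>\<alpha> \<alpha>0, simp add: \<alpha>_def)
  have "regular_Ga_action I Y \<alpha>"
    unfolding regular_Ga_action_def
  proof (intro conjI ballI act)
    fix m assume m: "m \<in> I"
    let ?J = "insert None (Some ` I)" and ?Z = "{case_option s x |s x. x \<in> Y}"
    have c: "regular_function ?J ?Z (\<lambda>p. p (Some m))" if "m \<in> I" for m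
      using that by (intro regular_coord) auto
    have n: "regular_function ?J ?Z (\<lambda>p. p None)" by (intro regular_coord) auto
    have ru: "regular_function ?J ?Z (\<lambda>p. u (p \<circ> Some))"
      unfolding u_def o_def using one ik by (intro regular_add regular_mult regular_const c)
    have rw: "regular_function ?J ?Z (\<lambda>p. w' (p \<circ> Some))"
      unfolding w'_def o_def using h(1) by (intro regular_prod regular_power c) (auto simp: in_tri_idx)
    have rq: "regular_function ?J ?Z (\<lambda>p. q (p None) (p \<circ> Some))"
      unfolding q_def using one[OF h(1)] by (intro regular_mult regular_sum regular_power regular_const n rw ru) (simp add: c)
    define A where "A p = (if m = ?z then p (Some ?z) + q (p None) (p \<circ> Some) * (1 / (2 * \<iota>))
        else if m = ?y then p (Some ?y) + q (p None) (p \<circ> Some) * (- 1 / 2)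
        else if m = ?w then p (Some ?w) + p None * u (p \<circ> Some) else p (Some m))" for p
    have f: "regular_function ?J ?Z (\<lambda>p. p (Some ?z) + q (p None) (p \<circ> Some) * (1 / (2 * \<iota>)))"
      "regular_function ?J ?Z (\<lambda>p. p (Some ?y) + q (p None) (p \<circ> Some) * (- 1 / 2))"
      "regular_function ?J ?Z (\<lambda>p. p (Some ?w) + p None * u (p \<circ> Some))"
      "regular_function ?J ?Z (\<lambda>p. p (Some m))"
      using one ik h(1) m by (intro regular_add regular_mult regular_const c n ru rq; simp)+
    have rA: "regular_function ?J ?Z A"
    proof -
      consider "m = ?z" | "m \<noteq> ?z" "m = ?y" | "m \<noteq> ?z" "m \<noteq> ?y" "m = ?w" | "m \<noteq> ?z" "m \<noteq> ?y" "m \<noteq> ?w" by blast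
      then show ?thesis
      proof cases
        case 1
        then have "A = (\<lambda>p. p (Some ?z) + q (p None) (p \<circ> Some) * (1 / (2 * \<iota>)))" by (simp only: A_def fun_eq_iff) simp
        then show ?thesis using f(1) by (simp only:)
      next
        case 2
        then have "A = (\<lambda>p. p (Some ?y) + q (p None) (p \<circ> Some) * (- 1 / 2))" by (simp only: A_def fun_eq_iff) simp
        then show ?thesis using f(2) by (simp only:)
      next
        case 3
        then have "A = (\<lambda>p. p (Some ?w) + p None * u (p \<circ> Some))" by (simp only: A_def fun_eq_iff) simp
        then show ?thesis using f(3) by (simp only:)
      next
        case 4
        then have "A = (\<lambda>p. p (Some m))" by (simp only: A_def fun_eq_iff) simp
        then show ?thesis using f(4) by (simp only:)
      qed
    qed
    have \<alpha>A: "\<alpha> (p None) (p \<circ> Some) m = A p" if p: "p \<in> ?Z" for p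
    proof -
      obtain s x where "p = case_option s x" "x \<in> Y" using p by auto
      then have "p \<circ> Some \<in> Y" by (auto simp: o_def)
      then show ?thesis using dist by (auto simp: \<alpha>_def A_def)
    qed
    obtain P where P: "mp_vars P \<subseteq> ?J" "\<And>p. p \<in> ?Z \<Longrightarrow> A p = mp_eval p P"
      using rA unfolding regular_function_def by blast
    show "regular_function ?J ?Z (\<lambda>p. \<alpha> (p None) (p \<circ> Some) m)"
      by (rule regular_functionI[OF P(1)]) (simp only: \<alpha>A P(2))
  qed
  then have triv: "\<alpha> s x = x" if "x \<in> Y" for s x using rigid that unfolding rigid_def by blast
  \<comment> \<open>Block values 1, 0, -1 make \<open>u x\<close> nonzero, and there the action
    moves the coordinate \<open>?w\<close>.\<close>
  define c :: "nat \<Rightarrow> 'a" where "c i' = (if i' = i then 1 else if i' = k then 0 else -1)" for i'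
  have "c 0 + c 1 + c 2 = 0" using h(5)[of c] neq h(2,3) by (simp add: c_def)
  then obtain x where x: "x \<in> Y" "\<And>i'. i' \<le> 2 \<Longrightarrow> b i' x = c i'" by (rule point_exists) blast
  have "x ?y ^ 2 = 1" "x ?z ^ 2 = 0" using x(2)[OF ik(1)] x(2)[OF ik(2)] ik neq by (simp_all add: bm_def c_def)
  then have "u x \<noteq> 0" by (auto simp: u_def)
  moreover have "x ?w + 1 * u x = x ?w" using a(3)[OF x(1), of 1] triv[OF x(1), of 1] by simp
  ultimately show False by simp
qed

end


section \<open>Permutations of the coordinates\<close>

abbreviation inv_fun :: "('v \<Rightarrow> 'v) \<Rightarrow> 'v \<Rightarrow> 'v" where "inv_fun \<equiv> inv_into UNIV"

lemma mp_subst_subst: "mp_subst \<sigma> (mp_subst \<tau> p) = mp_subst (\<lambda>v. mp_subst \<sigma> (\<tau> v)) p"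
  unfolding mp_subst_def[of \<tau>] by (simp add: mp_subst_simps mp_subst_def[of "\<lambda>v. mp_subst \<sigma> (\<tau> v)"])

lemma mp_subst_var: "mp_subst mp_var p = p"
proof -
  have "mp_vars p \<subseteq> UNIV" by simp
  then show ?thesis by (induction rule: mp_induct) (simp_all add: mp_subst_simps)
qed

text \<open>By pigeonhole every permutation has a period at most the number \<open>M\<close> of
  permutations, and \<open>fact M\<close> is a multiple of all such periods. The \<open>N\<close>-th
  power of a monomial map thus loses its permutation part.\<close>

lemma permutes_common_order:
  assumes "finite A" obtains N where "N > 0" "\<And>p. p permutes A \<Longrightarrow> p ^^ N = id"
proof -
  define M where "M = card {p. p permutes A}"
  have fin: "finite {p. p permutes A}" using assms by (rule finite_permutations)
  have "p ^^ fact M = id" if p: "p permutes A" for p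
  proof -
    have pw: "p ^^ k permutes A" for k
    proof (induction k)
      case (Suc k)
      then show ?case using permutes_compose[OF Suc p] by (simp add: o_def)
    qed (simp add: permutes_id[unfolded id_def] id_def)
    have "\<not> inj_on (\<lambda>k. p ^^ k) {..M}"
    proof
      assume "inj_on (\<lambda>k. p ^^ k) {..M}"
      then have "card {..M} \<le> M" unfolding M_def by (rule card_inj_on_le) (use pw fin in auto)
      then show False by simp
    qed
    then obtain i j where ij: "i < j" "j \<le> M" "p ^^ i = p ^^ j"
      unfolding inj_on_def by (metis atMost_iff linorder_neqE_nat)
    have pp: "p ^^ i \<circ> p ^^ (j - i) = p ^^ i" using funpow_add[of i "j - i" p] ij by simp
    have inj: "inj (p ^^ i)" using pw permutes_inj by blast
    have "(p ^^ (j - i)) x = x" for x using fun_cong[OF pp, of x] injD[OF inj] by (simp add: o_def)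
    then have d: "p ^^ (j - i) = id" by (simp add: fun_eq_iff)
    have "j - i dvd fact M" using ij by (intro dvd_fact) auto
    then obtain q where "fact M = (j - i) * q" by auto
    then show ?thesis using d by (simp add: funpow_mult[symmetric])
  qed
  then show thesis using that[of "fact M"] by simp
qed

context trinomial_data begin

abbreviation (input) lv :: "idx \<Rightarrow> nat" where "lv v \<equiv> l (fst v) (snd v)"

lemma bm_prod: "i \<le> 2 \<Longrightarrow> bm n l i x = (\<Prod>v | v \<in> I \<and> fst v = i. x v ^ lv v)"
  unfolding bm_def by (rule prod.reindex_bij_witness[of _ snd "\<lambda>j. (i, j)"]) (auto simp: in_tri_idx)

lemma cochars_iff: "u \<in> C \<longleftrightarrow> (\<forall>i\<le>2. \<forall>k\<le>2. (\<Sum>v | v \<in> I \<and> fst v = i. u v * int (lv v)) = (\<Sum>v | v \<in> I \<and> fst v = k. u v * int (lv v)))"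
proof -
  have s: "(\<Sum>j=1..n i. u (i, j) * int (l i j)) = (\<Sum>v | v \<in> I \<and> fst v = i. u v * int (lv v))" if "i \<le> 2" for i
    by (rule sum.reindex_bij_witness[of _ snd "\<lambda>j. (i, j)"]) (use that in \<open>auto simp: in_tri_idx\<close>)
  show ?thesis unfolding cochars_def using s[of 0] s[of 1] s[of 2] by (auto simp: le2_cases)
qed

definition Perm :: "(idx \<Rightarrow> idx) set" where
  "Perm = {\<tau>. \<tau> permutes I \<and> mp_subst (\<lambda>v. mp_var (\<tau> v)) (trinomial n l) = (trinomial n l :: (idx, 'a) mp)}"

lemma Perm_id: "id \<in> Perm"
  by (simp add: Perm_def permutes_id mp_subst_var)

lemma Perm_comp: "\<sigma> \<in> Perm \<Longrightarrow> \<tau> \<in> Perm \<Longrightarrow> \<sigma> \<circ> \<tau> \<in> Perm"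
proof -
  assume st: "\<sigma> \<in> Perm" "\<tau> \<in> Perm"
  have "mp_subst (\<lambda>v. mp_var ((\<sigma> \<circ> \<tau>) v)) (trinomial n l :: (idx, 'a) mp) = mp_subst (\<lambda>v. mp_var (\<sigma> v)) (mp_subst (\<lambda>v. mp_var (\<tau> v)) (trinomial n l))"
    unfolding mp_subst_subst by (simp add: mp_subst_simps)
  then show ?thesis using st by (simp add: Perm_def permutes_compose)
qed

lemma Perm_inv: assumes "\<tau> \<in> Perm" shows "inv_fun \<tau> \<in> Perm"
proof -
  have p: "\<tau> permutes I" using assms by (simp add: Perm_def)
  have "mp_subst (\<lambda>v. mp_var (inv_fun \<tau> v)) (trinomial n l :: (idx, 'a) mp) = mp_subst (\<lambda>v. mp_var (inv_fun \<tau> v)) (mp_subst (\<lambda>v. mp_var (\<tau> v)) (trinomial n l))"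
    using assms by (simp add: Perm_def)
  also have "\<dots> = trinomial n l"
    unfolding mp_subst_subst using permutes_inverses[OF p] by (simp add: mp_subst_simps mp_subst_var)
  finally show ?thesis using p by (simp add: Perm_def permutes_inv)
qed

lemma Perm_permutes: "\<tau> \<in> Perm \<Longrightarrow> \<tau> permutes I"
  by (simp add: Perm_def)

lemma Perm_Y: assumes "\<tau> \<in> Perm" "x \<in> Y" shows "x \<circ> \<tau> \<in> Y"
proof -
  have "mp_eval (x \<circ> \<tau>) (trinomial n l) = mp_eval x (mp_subst (\<lambda>v. mp_var (\<tau> v)) (trinomial n l))"
    by (simp add: mp_eval_subst mp_eval_simps o_def)
  also have "\<dots> = mp_eval x (trinomial n l)" using assms(1) by (simp add: Perm_def)
  also have "\<dots> = 0" using assms(2) by (simp add: Y_iff mp_eval_trinomial sum_le2)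
  finally have "b 0 (x \<circ> \<tau>) + b 1 (x \<circ> \<tau>) + b 2 (x \<circ> \<tau>) = 0" by (simp add: mp_eval_trinomial sum_le2)
  moreover have "x \<circ> \<tau> \<in> extensional I"
    using assms permutes_not_in[OF Perm_permutes[OF assms(1)]] by (auto simp: Y_iff extensional_def)
  ultimately show ?thesis by (simp add: Y_iff)
qed

text \<open>Such a permutation maps blocks to blocks and scales all exponents by a common factor, which is
  1 because the sum of all exponents is invariant.\<close>

lemma Perm_if_cochars:
  assumes p: "\<tau> permutes I" and u: "\<And>u. u \<in> C \<Longrightarrow> (\<lambda>v. u (inv_fun \<tau> v)) \<in> C"
  shows "\<tau> \<in> Perm"
proof -
  have one: "(i, 1) \<in> I" if "i \<le> 2" for i using blocks[OF that] that by (auto simp: in_tri_idx)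
  have lpos: "lv v > 0" if "v \<in> I" for v using that exps by (cases v) auto
  have \<tau>I: "\<tau> v \<in> I \<longleftrightarrow> v \<in> I" for v using permutes_in_image[OF p] .
  have le2: "fst v \<le> 2" if "v \<in> I" for v using that by (cases v) (simp add: in_tri_idx)
  have fin: "finite {v. v \<in> I \<and> fst v = i}" for i by (rule finite_subset[OF _ finite_tri_idx]) auto
  have inv\<tau>: "inv_fun \<tau> (\<tau> v) = v" "\<tau> (inv_fun \<tau> v) = v" for v using permutes_inverses[OF p] by auto
  have same: "fst (\<tau> v) = fst (\<tau> w) \<and> lv (\<tau> v) * lv w = lv (\<tau> w) * lv v"
    if vw: "v \<in> I" "w \<in> I" "fst v = fst w" "v \<noteq> w" for v w
  proof -
    \<comment> \<open>A cocharacter on two variables of one block: if their images lay in different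
      blocks, the third block would have sum 0 and the block of \<open>\<tau> v\<close> would
      not.\<close>
    define U where "U x = (if x = v then int (lv w) else if x = w then - int (lv v) else 0)" for x
    have "(\<Sum>x | x \<in> I \<and> fst x = i. U x * int (lv x)) = 0" if "i \<le> 2" for i
    proof (cases "i = fst v")
      case True
      have "(\<Sum>x | x \<in> I \<and> fst x = i. U x * int (lv x)) = (\<Sum>x\<in>{v, w}. U x * int (lv x))"
        using True vw fin by (intro sum.mono_neutral_right) (auto simp: U_def)
      then show ?thesis using vw(4) by (simp add: U_def)
    next
      case False
      then show ?thesis using vw by (intro sum.neutral) (auto simp: U_def)
    qed
    then have "U \<in> C" by (auto simp: cochars_iff)
    then have UC: "(\<lambda>x. U (inv_fun \<tau> x)) \<in> C" by (rule u)
    have Uinv: "U (inv_fun \<tau> x) = (if x = \<tau> v then int (lv w) else if x = \<tau> w then - int (lv v) else 0)" for x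
    proof -
      have "inv_fun \<tau> x = y \<longleftrightarrow> x = \<tau> y" for y using inv\<tau> by metis
      then show ?thesis by (simp add: U_def)
    qed
    have ne: "\<tau> v \<noteq> \<tau> w" using vw(4) inv\<tau>(1) by metis
    define S where "S i = (\<Sum>x | x \<in> I \<and> fst x = i. U (inv_fun \<tau> x) * int (lv x))" for i
    have SS: "S i = S k" if "i \<le> 2" "k \<le> 2" for i k using UC that unfolding cochars_iff S_def by blast
    have fv: "fst (\<tau> v) \<le> 2" "fst (\<tau> w) \<le> 2" using le2 \<tau>I vw by auto
    have f: "fst (\<tau> v) = fst (\<tau> w)"
    proof (rule ccontr)
      assume d: "fst (\<tau> v) \<noteq> fst (\<tau> w)"
      obtain k where k: "k \<le> 2" "k \<noteq> fst (\<tau> v)" "k \<noteq> fst (\<tau> w)" using third_index[OF fv(2,1) d] by metis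
      have "S k = 0" unfolding S_def
      proof (intro sum.neutral ballI)
        fix x assume "x \<in> {x \<in> I. fst x = k}"
        then have "x \<noteq> \<tau> v" "x \<noteq> \<tau> w" using k by auto
        then show "U (inv_fun \<tau> x) * int (lv x) = 0" by (simp add: Uinv)
      qed
      moreover have "S (fst (\<tau> v)) = (\<Sum>x\<in>{\<tau> v}. U (inv_fun \<tau> x) * int (lv x))"
        unfolding S_def using d \<tau>I vw fin by (intro sum.mono_neutral_right) (auto simp: Uinv)
      ultimately have "int (lv w) * int (lv (\<tau> v)) = 0" using SS[OF k(1) fv(1)] by (simp add: Uinv)
      then show False using lpos[of w] lpos[of "\<tau> v"] \<tau>I vw by simp
    qed
    obtain k where k: "k \<le> 2" "k \<noteq> fst (\<tau> v)" using that[of 0] that[of 1] by (metis zero_le one_le_numeral zero_neq_one)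
    have "S k = 0" unfolding S_def
      proof (intro sum.neutral ballI)
        fix x assume "x \<in> {x \<in> I. fst x = k}"
        then have "x \<noteq> \<tau> v" "x \<noteq> \<tau> w" using k f by auto
        then show "U (inv_fun \<tau> x) * int (lv x) = 0" by (simp add: Uinv)
      qed
    moreover have "S (fst (\<tau> v)) = (\<Sum>x\<in>{\<tau> v, \<tau> w}. U (inv_fun \<tau> x) * int (lv x))"
      unfolding S_def using f \<tau>I vw fin by (intro sum.mono_neutral_right) (auto simp: Uinv)
    ultimately have "int (lv w) * int (lv (\<tau> v)) - int (lv v) * int (lv (\<tau> w)) = 0"
      using SS[OF k(1) fv(1)] ne by (simp add: Uinv)
    then have "int (lv (\<tau> v) * lv w) = int (lv (\<tau> w) * lv v)" by (simp add: mult.commute)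
    then show ?thesis using f by (simp only: of_nat_eq_iff)
  qed
  define \<pi> where "\<pi> i = fst (\<tau> (i, 1))" for i
  have \<pi>: "fst (\<tau> v) = \<pi> (fst v)" if "v \<in> I" for v
    using same[OF that one[OF le2[OF that]]] unfolding \<pi>_def by (cases "v = (fst v, 1)") auto
  have \<pi>2: "\<pi> i \<le> 2" if "i \<le> 2" for i using le2[of "\<tau> (i, 1)"] \<tau>I one[OF that] by (auto simp: \<pi>_def)
  have "{..2} \<subseteq> \<pi> ` {..2}"
  proof
    fix i :: nat assume "i \<in> {..2}"
    then have "(i, 1) \<in> I" using one by simp
    then have "inv_fun \<tau> (i, 1) \<in> I" using \<tau>I[of "inv_fun \<tau> (i, 1)"] inv\<tau> by simp
    then show "i \<in> \<pi> ` {..2}" using \<pi>[of "inv_fun \<tau> (i, 1)"] le2 inv\<tau> by (intro image_eqI[of _ _ "fst (inv_fun \<tau> (i, 1))"]) auto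
  qed
  then have surj: "\<pi> ` {..2} = {..2}" using \<pi>2 by auto
  then have inj: "inj_on \<pi> {..2}" by (intro eq_card_imp_inj_on) auto
  \<comment> \<open>As \<open>c i * l i 1\<close> is the same for all blocks, weights
    \<open>c i\<close> on the first variables form a cocharacter; its image compares the exponents
    of the \<open>\<tau> (i, 1)\<close> across blocks.\<close>
  define c where "c i = (if i = 0 then l 1 1 * l 2 1 else if i = 1 then l 0 1 * l 2 1 else l 0 1 * l 1 1)" for i :: nat
  define L where "L = l 0 1 * l 1 1 * l 2 1"
  have cL: "c i * l i 1 = L" if "i \<le> 2" for i using that unfolding le2_cases by (auto simp: c_def L_def)
  have eqs: "c i * lv (\<tau> (i, 1)) = c k * lv (\<tau> (k, 1))" if "i \<le> 2" "k \<le> 2" for i k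
  proof -
    define U where "U x = (if snd x = 1 then int (c (fst x)) else 0)" for x :: idx
    have "(\<Sum>x | x \<in> I \<and> fst x = i. U x * int (lv x)) = int L" if "i \<le> 2" for i
    proof -
      have "(\<Sum>x | x \<in> I \<and> fst x = i. U x * int (lv x)) = (\<Sum>x\<in>{(i, 1)}. U x * int (lv x))"
        using one[OF that] fin by (intro sum.mono_neutral_right) (auto simp: U_def)
      then show ?thesis using cL[OF that] by (simp add: U_def flip: of_nat_mult)
    qed
    then have "U \<in> C" by (auto simp: cochars_iff)
    then have UC: "(\<lambda>x. U (inv_fun \<tau> x)) \<in> C" by (rule u)
    have "(\<Sum>x | x \<in> I \<and> fst x = \<pi> i. U (inv_fun \<tau> x) * int (lv x)) = int (c i * lv (\<tau> (i, 1)))" if i: "i \<le> 2" for i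
    proof -
      have z: "U (inv_fun \<tau> x) = 0" if x: "x \<in> I" "fst x = \<pi> i" "x \<noteq> \<tau> (i, 1)" for x
      proof -
        have y: "inv_fun \<tau> x \<in> I" using \<tau>I[of "inv_fun \<tau> x"] inv\<tau> x(1) by simp
        have "\<pi> (fst (inv_fun \<tau> x)) = \<pi> i" using \<pi>[OF y] inv\<tau> x(2) by simp
        then have "fst (inv_fun \<tau> x) = i" using inj le2[OF y] i by (auto dest: inj_onD)
        moreover have "inv_fun \<tau> x \<noteq> (i, 1)" using x(3) inv\<tau> by metis
        ultimately show ?thesis by (auto simp: U_def prod_eq_iff)
      qed
      have "(\<Sum>x | x \<in> I \<and> fst x = \<pi> i. U (inv_fun \<tau> x) * int (lv x)) = (\<Sum>x\<in>{\<tau> (i, 1)}. U (inv_fun \<tau> x) * int (lv x))"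
        using z \<tau>I one[OF i] fin by (intro sum.mono_neutral_right) (auto simp: \<pi>_def)
      then show ?thesis by (simp add: inv\<tau> U_def)
    qed
    note S = this
    have "(\<Sum>x | x \<in> I \<and> fst x = \<pi> i. U (inv_fun \<tau> x) * int (lv x)) = (\<Sum>x | x \<in> I \<and> fst x = \<pi> k. U (inv_fun \<tau> x) * int (lv x))"
      using UC \<pi>2 that unfolding cochars_iff by blast
    then have "int (c i * lv (\<tau> (i, 1))) = int (c k * lv (\<tau> (k, 1)))"
      unfolding S[OF that(1)] S[OF that(2)] .
    then show ?thesis by (simp only: of_nat_eq_iff)
  qed
  define r where "r = (of_nat (c 0 * lv (\<tau> (0, 1))) / of_nat L :: rat)"
  have Lpos: "L > 0" using exps1[of 0] exps1[of 1] exps1[of 2] by (simp add: L_def)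
  have ratio: "of_nat (lv (\<tau> v)) = r * of_nat (lv v)" if v: "v \<in> I" for v
  proof -
    let ?i = "fst v"
    have i: "?i \<le> 2" using le2[OF v] .
    have 1: "of_nat (lv (\<tau> (?i, 1))) = r * of_nat (l ?i 1)"
    proof -
      have "c ?i * lv (\<tau> (?i, 1)) = c 0 * lv (\<tau> (0, 1))" using eqs[OF i, of 0] by simp
      moreover have "r * of_nat L = of_nat (c 0 * lv (\<tau> (0, 1)))" using Lpos by (simp add: r_def)
      ultimately have "r * of_nat L = of_nat (c ?i) * of_nat (lv (\<tau> (?i, 1)))" by (simp only: of_nat_mult[symmetric])
      moreover have "of_nat (c ?i) * of_nat (l ?i 1) = (of_nat L :: rat)" unfolding of_nat_mult[symmetric] cL[OF i] ..
      then have "of_nat (c ?i) * (r * of_nat (l ?i 1)) = r * of_nat L" by (simp only: mult.left_commute[of _ r])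
      ultimately have "of_nat (c ?i) * (r * of_nat (l ?i 1)) = of_nat (c ?i) * of_nat (lv (\<tau> (?i, 1)))" by (simp only:)
      moreover have "c ?i \<noteq> 0" using cL[OF i] Lpos by (metis mult_zero_left less_not_refl)
      ultimately show ?thesis by simp
    qed
    show ?thesis
    proof (cases "v = (?i, 1)")
      case True
      then show ?thesis using 1 by (metis fst_conv snd_conv)
    next
      case False
      then have "lv (\<tau> v) * l ?i 1 = lv (\<tau> (?i, 1)) * lv v" using same[OF v one[OF i]] by auto
      then have "of_nat (lv (\<tau> v)) * of_nat (l ?i 1) = (of_nat (lv (\<tau> (?i, 1))) * of_nat (lv v) :: rat)" by (metis of_nat_mult)
      then have "of_nat (lv (\<tau> v)) * of_nat (l ?i 1) = (r * of_nat (lv v)) * of_nat (l ?i 1)" unfolding 1 by (simp add: mult_ac)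
      then show ?thesis using exps1[OF i] by simp
    qed
  qed
  have "(\<Sum>v\<in>I. lv (\<tau> v)) = (\<Sum>v\<in>I. lv v)" using sum.permute[OF p, of lv] by (simp add: o_def)
  then have "(\<Sum>v\<in>I. of_nat (lv (\<tau> v)) :: rat) = (\<Sum>v\<in>I. of_nat (lv v))" by (metis of_nat_sum)
  then have "r * (\<Sum>v\<in>I. of_nat (lv v)) = (\<Sum>v\<in>I. of_nat (lv v) :: rat)" using ratio by (simp add: sum_distrib_left)
  moreover have "(\<Sum>v\<in>I. of_nat (lv v) :: rat) > 0" using lpos one[of 0] by (intro sum_pos finite_tri_idx) auto
  ultimately have "r = 1" by simp
  then have lv\<tau>: "lv (\<tau> v) = lv v" if "v \<in> I" for v using ratio[OF that] by simp
  \<comment> \<open>Block monomials are evaluated here at vectors of polynomials, so that invariance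
    of the trinomial comes out as an identity of polynomials.\<close>
  have blk: "bm n l i (\<lambda>v. x (\<tau> v)) = bm n l (\<pi> i) x" if i: "i \<le> 2" for i and x :: "idx \<Rightarrow> (idx, 'a) mp"
    unfolding bm_prod[OF i] bm_prod[OF \<pi>2[OF i]]
  proof (rule prod.reindex_bij_witness[of _ "inv_fun \<tau>" \<tau>])
    fix w assume w: "w \<in> {v \<in> I. fst v = \<pi> i}"
    have y: "inv_fun \<tau> w \<in> I" using \<tau>I[of "inv_fun \<tau> w"] inv\<tau> w by simp
    have "\<pi> (fst (inv_fun \<tau> w)) = \<pi> i" using \<pi>[OF y] inv\<tau> w by simp
    then show "inv_fun \<tau> w \<in> {v \<in> I. fst v = i}" using inj le2[OF y] i y by (auto dest: inj_onD)
  qed (use \<tau>I \<pi> lv\<tau> inv\<tau> in auto)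
  have "mp_subst (\<lambda>v. mp_var (\<tau> v)) (trinomial n l) = (\<Sum>i\<le>2. bm n l i (\<lambda>v. mp_var (\<tau> v)) :: (idx, 'a) mp)"
    by (simp add: trinomial_def bm_def mp_subst_simps atMost_atLeast0)
  also have "\<dots> = (\<Sum>i\<le>2. bm n l (\<pi> i) mp_var)" by (intro sum.cong) (auto simp: blk)
  also have "\<dots> = (\<Sum>i\<le>2. bm n l i mp_var)"
    using sum.reindex[OF inj, of "\<lambda>i. bm n l i (mp_var :: idx \<Rightarrow> (idx, 'a) mp)"] surj by simp
  also have "\<dots> = trinomial n l" by (simp add: trinomial_def bm_def atMost_atLeast0)
  finally show ?thesis using p by (simp add: Perm_def)
qed

end


section \<open>Automorphisms are monomial\<close>

lemma regular_self_map_comp: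
  assumes "regular_self_map I Y \<phi>" "regular_self_map I Y \<psi>" shows "regular_self_map I Y (\<lambda>x. \<phi> (\<psi> x))"
proof -
  have Y: "\<phi> \<in> Y \<rightarrow> Y" "\<psi> \<in> Y \<rightarrow> Y"
    and r: "v \<in> I \<Longrightarrow> regular_function I Y (\<lambda>x. \<phi> x v)" "v \<in> I \<Longrightarrow> regular_function I Y (\<lambda>x. \<psi> x v)" for v
    using assms by (simp_all add: regular_self_map_def)
  show ?thesis
    unfolding regular_self_map_def
  proof (intro conjI ballI)
    show "(\<lambda>x. \<phi> (\<psi> x)) \<in> Y \<rightarrow> Y" using Y by (simp add: Pi_iff)
    show "regular_function I Y (\<lambda>x. \<phi> (\<psi> x) v)" if "v \<in> I" for v
      by (rule regular_comp[OF r(1)[OF that] r(2) Y(2)])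
  qed
qed

context trinomial_data begin

lemma diag_diag: "diag I s (diag I t x) = diag I (\<lambda>v. s v * t v) x"
  by (auto simp: diag_def mult.assoc)

lemma diag_1: "x \<in> Y \<Longrightarrow> diag I (\<lambda>_. 1) x = x"
  by (auto simp: diag_def Y_iff extensional_def fun_eq_iff)

lemma torus_semi_invariant:
  assumes g: "\<And>u s x. u \<in> C \<Longrightarrow> s \<noteq> 0 \<Longrightarrow> x \<in> Y \<Longrightarrow> g (diag I (cochar u s) x) = s powi (u v) * (g x :: 'a)"
    and t: "t \<in> T" and x: "x \<in> Y"
  shows "g (diag I t x) = t v * g x"
  using t
proof (induction)
  case one
  then show ?case using diag_1[OF x] by simp
next
  case (step t u s)
  have "diag I t x \<in> Y" using step(1) torus_subset diag_Y x by blast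
  then have "g (diag I (cochar u s) (diag I t x)) = s powi (u v) * (t v * g x)" using g step by simp
  then show ?case unfolding diag_diag by simp
qed

lemma Perm_regular: assumes "\<tau> \<in> Perm" shows "regular_self_map I Y (\<lambda>x. x \<circ> \<tau>)"
  unfolding regular_self_map_def
  using Perm_Y[OF assms] permutes_in_image[OF Perm_permutes[OF assms]] by (auto intro: regular_coord)

lemma automorphism_monomial:
  assumes rigid: "rigid I Y"
    and \<phi>: "regular_self_map I Y \<phi>" and \<psi>: "regular_self_map I Y \<psi>"
    and inv: "\<And>x. x \<in> Y \<Longrightarrow> \<phi> (\<psi> x) = x" "\<And>x. x \<in> Y \<Longrightarrow> \<psi> (\<phi> x) = x"
  obtains \<kappa> c where "\<kappa> \<in> Perm" "\<And>v. v \<in> I \<Longrightarrow> c v \<noteq> 0" "\<And>v x. v \<in> I \<Longrightarrow> x \<in> Y \<Longrightarrow> \<phi> x v = c v * x (\<kappa> v)"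
proof -
  note quad = rigid_quadratic_blocks[OF rigid]
  have \<phi>Y: "x \<in> Y \<Longrightarrow> \<phi> x \<in> Y" and \<psi>Y: "x \<in> Y \<Longrightarrow> \<psi> x \<in> Y" for x using \<phi> \<psi> by (auto simp: regular_self_map_def)
  define \<chi> where "\<chi> u s x = \<phi> (diag I (cochar u s) (\<psi> x))" for u and s :: 'a and x
  have \<chi>reg: "regular_self_map I Y (\<chi> u s)" if "u \<in> C" "s \<noteq> 0" for u s
    unfolding \<chi>_def using that
    by (intro regular_self_map_comp[OF \<phi>] regular_self_map_comp[OF diag_regular \<psi>] cochar_big_torus)
  have \<chi>Y: "\<chi> u s x \<in> Y" if "u \<in> C" "s \<noteq> 0" "x \<in> Y" for u s x
    unfolding \<chi>_def using that by (intro \<phi>Y cochar_Y \<psi>Y)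
  have \<chi>mult: "\<chi> u s (\<chi> u r x) = \<chi> u (s * r) x" if "u \<in> C" "s \<noteq> 0" "r \<noteq> 0" "x \<in> Y" for u s r x
    unfolding \<chi>_def using that by (simp add: inv cochar_Y \<psi>Y diag_diag power_int_mult_distrib)
  have \<chi>1: "\<chi> u 1 x = x" if "x \<in> Y" for u x
    unfolding \<chi>_def using that by (simp add: diag_1 \<psi>Y inv)
  \<comment> \<open>The coordinate \<open>v\<close> is a weight vector for every cocharacter
    \<open>u'\<close>, and by rigidity its pullback along the conjugate keeps that weight.\<close>
  have comm: "\<chi> u s (diag I t x) v = t v * \<chi> u s x v" if us: "u \<in> C" "s \<noteq> 0" and t: "t \<in> T" and x: "x \<in> Y" and v: "v \<in> I" for u s t x v
  proof (rule torus_semi_invariant[OF _ t x])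
    fix u' r x assume u': "u' \<in> C" "r \<noteq> (0::'a)" "x \<in> Y"
    have cw: "on Y (\<lambda>x. x v) \<in> weight_space I Y u' (u' v)"
      unfolding weight_space_def using coord_R[OF v] cochar_Y[OF u'(1)] v by (auto simp: diag_def)
    have "pull Y (\<lambda>x. \<phi> (diag I (cochar u s) (\<psi> x))) (on Y (\<lambda>x. x v)) \<in> weight_space I Y u' (u' v)"
      by (rule rigid_conj_weight_space[OF finite_tri_idx mp_vars_trinomial Y_zero_set rigid cochar_Y cochar_Y \<phi> \<psi> inv(2,1) cw us(2)])
        (use us u' in auto)
    from weight_spaceD[OF this u'(2,3)]
    show "\<chi> u s (diag I (cochar u' r) x) v = r powi u' v * \<chi> u s x v"
      using \<chi>Y[OF us] cochar_Y[OF u'(1,2,3)] u'(3) by (simp add: pull_def \<chi>_def)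
  qed
  obtain N where N: "N > 0" "\<And>p. p permutes I \<Longrightarrow> p ^^ N = id" using permutes_common_order[OF finite_tri_idx[of n]] by metis
  have diagonal: "\<exists>c. \<forall>x\<in>Y. \<chi> u s x v = c * x v" if us: "u \<in> C" "s \<noteq> 0" and v: "v \<in> I" for u s v
  proof -
    \<comment> \<open>The map at \<open>s\<close> is the \<open>N\<close>-th iterate of the monomial
      map at \<open>r\<close>, so its permutation part is trivial.\<close>
    obtain r where r: "r ^ N = s" using nth_root_exists N(1) by blast
    have r0: "r \<noteq> 0" using r us(2) N(1) by (auto simp: zero_power)
    obtain \<rho> c where \<rho>: "\<rho> permutes I" "\<And>v. v \<in> I \<Longrightarrow> c v \<noteq> 0" "\<And>v x. v \<in> I \<Longrightarrow> x \<in> Y \<Longrightarrow> \<chi> u r x v = c v * x (\<rho> v)"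
    proof (rule torus_centralizer_monomial[OF quad \<chi>reg[OF us(1) r0] comm[OF us(1) r0] \<chi>reg[OF us(1), of "inverse r"]])
      show "\<chi> u r (\<chi> u (inverse r) x) = x" "\<chi> u (inverse r) (\<chi> u r x) = x" if "x \<in> Y" for x
        using that us(1) r0 \<chi>mult[of u r "inverse r" x] \<chi>mult[of u "inverse r" r x] \<chi>1 by auto
    qed (use r0 in auto)
    have "\<exists>d. \<forall>x\<in>Y. \<chi> u (r ^ k) x w = d * x ((\<rho> ^^ k) w)" if "w \<in> I" for k w
      using that
    proof (induction k arbitrary: w)
      case 0
      then show ?case using \<chi>1 by (auto intro: exI[of _ 1])
    next
      case (Suc k)
      have "\<rho> w \<in> I" using permutes_in_image[OF \<rho>(1)] Suc.prems by blast
      then obtain d where d: "\<forall>x\<in>Y. \<chi> u (r ^ k) x (\<rho> w) = d * x ((\<rho> ^^ k) (\<rho> w))" using Suc.IH by blast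
      have "\<chi> u (r ^ Suc k) x w = c w * d * x ((\<rho> ^^ Suc k) w)" if x: "x \<in> Y" for x
      proof -
        have rk: "r ^ k \<noteq> 0" using r0 by simp
        have "\<chi> u (r ^ Suc k) x w = \<chi> u r (\<chi> u (r ^ k) x) w" using \<chi>mult[OF us(1) r0 rk x] by simp
        also have "\<dots> = c w * \<chi> u (r ^ k) x (\<rho> w)" by (rule \<rho>(3)[OF Suc.prems \<chi>Y[OF us(1) rk x]])
        also have "\<dots> = c w * d * x ((\<rho> ^^ k) (\<rho> w))" using d x by simp
        finally show ?thesis by (simp add: funpow_swap1)
      qed
      then show ?case by blast
    qed
    from this[OF v, of N] show ?thesis using r N(2)[OF \<rho>(1)] by simp
  qed
  have eig: "\<exists>c. \<forall>y\<in>Y. \<phi> (diag I (cochar u s) y) v = c * \<phi> y v" if us: "u \<in> C" "s \<noteq> 0" and v: "v \<in> I" for u s v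
  proof -
    obtain c where c: "\<forall>x\<in>Y. \<chi> u s x v = c * x v" using diagonal[OF us v] by blast
    have "\<phi> (diag I (cochar u s) y) v = c * \<phi> y v" if "y \<in> Y" for y
      using bspec[OF c \<phi>Y[OF that]] inv(2)[OF that] by (simp add: \<chi>_def)
    then show ?thesis by blast
  qed
  have \<phi>reg: "regular_function I Y (\<lambda>x. \<phi> x v)" if "v \<in> I" for v using \<phi> that by (simp add: regular_self_map_def)
  have \<phi>0: "\<phi> origin = origin"
  proof (rule extensionalityI[of _ I])
    show "\<phi> origin \<in> extensional I" using \<phi>Y[OF origin_Y] by (simp add: Y_iff)
    show "origin \<in> extensional I" by (simp add: origin_def)
    fix v assume v: "v \<in> I"
    \<comment> \<open>Otherwise the eigenvalue on this coordinate is 1 for the whole torus. As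
      nonnegative cocharacters leave only the constant monomial in weight 0, the coordinate would be
      constant on \<open>Y\<close>, contrary to the surjectivity of \<open>\<phi>\<close>.\<close>
    have "\<phi> origin v = 0"
    proof (rule ccontr)
      assume nz: "\<phi> origin v \<noteq> 0"
      have inv1: "\<phi> (diag I (cochar u s) y) v = \<phi> y v" if us: "u \<in> C" "s \<noteq> 0" and y: "y \<in> Y" for u s y
      proof -
        obtain c where c: "\<forall>y\<in>Y. \<phi> (diag I (cochar u s) y) v = c * \<phi> y v" using eig[OF us v] by blast
        have "\<phi> origin v = c * \<phi> origin v" using bspec[OF c origin_Y] by (simp add: diag_origin)
        then show ?thesis using c y nz by simp
      qed
      have inv2: "\<phi> (diag I t y) v = \<phi> y v" if "t \<in> T" "y \<in> Y" for t y
        using that(1)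
      proof (induction)
        case one
        then show ?case using diag_1[OF that(2)] by simp
      next
        case (step t u s)
        have "diag I t y \<in> Y" using step(1) torus_subset diag_Y that(2) by blast
        then have "\<phi> (diag I (cochar u s) (diag I t y)) v = \<phi> y v" using inv1 step by simp
        then show ?case unfolding diag_diag .
      qed
      obtain P where P: "mp_vars P \<subseteq> I" "\<And>x. x \<in> Y \<Longrightarrow> \<phi> x v = mp_eval x P" using \<phi>reg[OF v] by (auto simp: regular_function_def)
      have const: "\<phi> y v = Poly_Mapping.lookup P 0" if y: "y \<in> Y" for y
      proof -
        have "mp_eval y P = (\<Sum>m | m \<in> Poly_Mapping.keys P \<and> (\<forall>t\<in>T. pm_monom t m = 1). Poly_Mapping.lookup P m * pm_monom y m)"
        proof (rule isotypic[where \<chi> = "\<lambda>_. 1", OF P(1) torus.one torus_mult])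
          show "mp_eval (diag I t y) P = 1 * mp_eval y P" if "t \<in> T" for t
          proof -
            have "t \<in> H" using torus_subset that by blast
            then have "diag I t y \<in> Y" using diag_Y y by blast
            then show ?thesis using inv2[OF that y] P(2)[OF y] P(2)[of "diag I t y"] by simp
          qed
        qed auto
        also have "\<dots> = (\<Sum>m\<in>{0}. Poly_Mapping.lookup P m * pm_monom y m)"
        proof (rule sum.mono_neutral_left)
          show "{m. m \<in> Poly_Mapping.keys P \<and> (\<forall>t\<in>T. pm_monom t m = 1)} \<subseteq> {0}"
          proof
            fix m assume m: "m \<in> {m. m \<in> Poly_Mapping.keys P \<and> (\<forall>t\<in>T. pm_monom t m = 1)}"
            have mI: "Poly_Mapping.keys m \<subseteq> I" using P(1) m by (auto simp: mp_vars_def)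
            have "same_weight m 0" by (rule same_weight_if_torus[OF mI]) (use m in auto)
            then have pz: "(\<Sum>w\<in>I. u w * int (Poly_Mapping.lookup m w)) = 0" if "u \<in> C" for u
              using that by (simp add: same_weight_def pairing_def)
            have "Poly_Mapping.lookup m w = 0" if w: "w \<in> I" for w
            proof -
              obtain u where u: "u \<in> C" "\<And>w. u w \<ge> 0" "u w > 0" using nonneg_cochar[OF w] by metis
              have "\<forall>k\<in>I. u k * int (Poly_Mapping.lookup m k) = 0"
                using pz[OF u(1)] u(2) sum_nonneg_eq_0_iff[OF finite_tri_idx, of n "\<lambda>k. u k * int (Poly_Mapping.lookup m k)"] by simp
              then show ?thesis using w u(3) by force
            qed
            then have "w \<notin> Poly_Mapping.keys m" for w using mI by (cases "w \<in> I") (auto simp: in_keys_iff simp del: split_paired_All)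
            then have "Poly_Mapping.keys m = {}" by blast
            then show "m \<in> {0}" by simp
          qed
        qed (auto simp: in_keys_iff)
        finally show ?thesis using P(2)[OF y] by simp
      qed
      obtain x where x: "x \<in> Y" "\<And>v. v \<in> I \<Longrightarrow> x v \<noteq> 0" using generic_point by metis
      have "x v = origin v" using const[OF \<psi>Y[OF x(1)]] const[OF \<psi>Y[OF origin_Y]] inv(1)[OF x(1)] inv(1)[OF origin_Y] by simp
      then show False using x(2)[OF v] v by (simp add: origin_def)
    qed
    then show "\<phi> origin v = origin v" using v by (simp add: origin_def)
  qed
  have \<psi>0: "\<psi> origin = origin" using inv(2)[OF origin_Y] \<phi>0 by simp
  obtain \<sigma> where \<sigma>: "\<sigma> permutes I" "\<And>v. v \<in> I \<Longrightarrow> lin (\<sigma> v) (\<lambda>x. \<phi> x v) \<noteq> 0"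
    using invertible_transversal[OF finite_tri_idx lin_inverse[OF \<phi> \<psi> \<psi>0 inv(1)]] by metis
  have \<sigma>I: "\<sigma> v \<in> I \<longleftrightarrow> v \<in> I" for v using permutes_in_image[OF \<sigma>(1)] .
  \<comment> \<open>The nonzero linear coefficient at \<open>\<sigma> v\<close> identifies the so
    far unknown eigenvalue as the weight of the coordinate \<open>\<sigma> v\<close>.\<close>
  have wt: "\<phi> (diag I (cochar u s) y) v = s powi u (\<sigma> v) * \<phi> y v" if us: "u \<in> C" "s \<noteq> 0" and v: "v \<in> I" and y: "y \<in> Y" for u s v y
  proof -
    obtain c where c: "\<forall>y\<in>Y. \<phi> (diag I (cochar u s) y) v = c * \<phi> y v" using eig[OF us v] by blast
    have "c = cochar u s (\<sigma> v)"
      by (rule lin_semi_invariant[OF \<phi>reg[OF v] cochar_big_torus[OF us] _ _ \<sigma>(2)[OF v]]) (use c \<sigma>I v in auto)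
    then show ?thesis using c y by simp
  qed
  \<comment> \<open>The diagonal map of the permuted cocharacter is a conjugate of one preserving
    \<open>Y\<close>, so it preserves \<open>Y\<close> too; its value at 2 is enough.\<close>
  have \<sigma>C: "(\<lambda>v. u (\<sigma> v)) \<in> C" if u: "u \<in> C" for u
  proof (rule cochars_if[where 'a = 'a], rule diag_Y_imp_big_torus)
    fix x assume x: "x \<in> Y"
    have "diag I (cochar (\<lambda>v. u (\<sigma> v)) 2) x = \<phi> (diag I (cochar u 2) (\<psi> x))"
    proof (rule extensionalityI[of _ I])
      show "\<phi> (diag I (cochar u 2) (\<psi> x)) \<in> extensional I"
        using \<phi>Y[OF cochar_Y[OF u _ \<psi>Y[OF x]], of 2] by (simp add: Y_iff)
      show "diag I (cochar (\<lambda>v. u (\<sigma> v)) 2) x v = \<phi> (diag I (cochar u 2) (\<psi> x)) v" if "v \<in> I" for v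
        using wt[OF u _ that \<psi>Y[OF x], of 2] inv(1)[OF x] that by (simp add: diag_def)
    qed (simp add: diag_def)
    then show "diag I (cochar (\<lambda>v. u (\<sigma> v)) 2) x \<in> Y" using \<phi>Y[OF cochar_Y[OF u _ \<psi>Y[OF x]], of 2] by simp
  qed simp
  define \<tau> where "\<tau> = inv_fun \<sigma>"
  have \<tau>p: "\<tau> permutes I" unfolding \<tau>_def by (rule permutes_inv[OF \<sigma>(1)])
  have i\<tau>: "inv_fun \<tau> = \<sigma>" unfolding \<tau>_def by (rule permutes_inv_inv[OF \<sigma>(1)])
  have \<tau>P: "\<tau> \<in> Perm" by (rule Perm_if_cochars[OF \<tau>p]) (simp add: i\<tau> \<sigma>C)
  have \<sigma>P: "\<sigma> \<in> Perm" using Perm_inv[OF \<tau>P] i\<tau> by simp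
  have \<sigma>\<tau>: "\<sigma> (\<tau> v) = v" "\<tau> (\<sigma> v) = v" for v using permutes_inverses[OF \<sigma>(1)] by (simp_all add: \<tau>_def)
  have \<tau>I: "\<tau> v \<in> I \<longleftrightarrow> v \<in> I" for v using permutes_in_image[OF \<tau>p] .
  \<comment> \<open>Composing with the inverse permutation gives each coordinate its own weight
    back, so the result commutes with the torus.\<close>
  define \<phi>' where "\<phi>' x = \<phi> x \<circ> \<tau>" for x
  define \<psi>' where "\<psi>' x = \<psi> (x \<circ> \<sigma>)" for x
  have r: "regular_self_map I Y \<phi>'" "regular_self_map I Y \<psi>'"
    unfolding \<phi>'_def[abs_def] \<psi>'_def[abs_def]
    by (rule regular_self_map_comp[OF Perm_regular[OF \<tau>P] \<phi>], rule regular_self_map_comp[OF \<psi> Perm_regular[OF \<sigma>P]])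
  have co: "x \<circ> \<sigma> \<circ> \<tau> = x" "x \<circ> \<tau> \<circ> \<sigma> = x" for x :: "idx \<Rightarrow> 'a" using \<sigma>\<tau> by auto
  have i': "\<phi>' (\<psi>' x) = x" "\<psi>' (\<phi>' x) = x" if "x \<in> Y" for x
    unfolding \<phi>'_def \<psi>'_def using inv(1)[OF Perm_Y[OF \<sigma>P that]] inv(2)[OF that] by (simp_all add: co)
  have comm': "\<phi>' (diag I t x) v = t v * \<phi>' x v" if "t \<in> T" "x \<in> Y" "v \<in> I" for t x v
    by (rule torus_semi_invariant[OF _ that(1,2)]) (use wt \<tau>I that(3) \<sigma>\<tau> in \<open>simp add: \<phi>'_def\<close>)
  obtain \<rho> c where \<rho>: "\<rho> permutes I" "\<And>v. v \<in> I \<Longrightarrow> c v \<noteq> 0" "\<And>v x. v \<in> I \<Longrightarrow> x \<in> Y \<Longrightarrow> \<phi>' x v = c v * x (\<rho> v)"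
  proof (rule torus_centralizer_monomial[of \<phi>' \<psi>', OF _ r(1) _ r(2)])
    show "i = k" if "i \<le> 2" "k \<le> 2" "n i = 1" "n k = 1" "l i 1 = 2" "l k 1 = 2" for i k by (rule quad[OF that])
    show "\<phi>' (diag I t x) v = t v * \<phi>' x v" if "t \<in> T" "x \<in> Y" "v \<in> I" for t x v by (rule comm'[OF that])
  qed (use i' in auto)
  have \<rho>I: "\<rho> v \<in> I \<longleftrightarrow> v \<in> I" for v using permutes_in_image[OF \<rho>(1)] .
  \<comment> \<open>Commutation at a point without zero coordinates shows that the remaining
    permutation fixes every cocharacter on \<open>I\<close>; hence it preserves the trinomial as
    well.\<close>
  have u\<rho>: "u (\<rho> v) = u v" if u: "u \<in> C" and v: "v \<in> I" for u v
  proof -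
    obtain x where x: "x \<in> Y" "\<And>v. v \<in> I \<Longrightarrow> x v \<noteq> 0" using generic_point by metis
    have "\<phi>' (diag I (cochar u 2) x) v = 2 powi u v * (c v * x (\<rho> v))"
      using comm'[OF cochar_torus[OF u, of 2] x(1) v] \<rho>(3)[OF v x(1)] by simp
    moreover have "\<phi>' (diag I (cochar u 2) x) v = c v * (2 powi u (\<rho> v) * x (\<rho> v))"
      using \<rho>(3)[OF v cochar_Y[OF u _ x(1)], of 2] \<rho>I v by (simp add: diag_def)
    ultimately have "(2::'a) powi u (\<rho> v) = 2 powi u v" using \<rho>(2)[OF v] x(2) \<rho>I v by auto
    then show ?thesis by (rule power_int_2_inj)
  qed
  have \<rho>P: "\<rho> \<in> Perm"
  proof (rule Perm_if_cochars[OF \<rho>(1)])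
    fix u assume u: "u \<in> C"
    have ui: "u (inv_fun \<rho> v) = u v" if v: "v \<in> I" for v
    proof -
      have "\<rho> (inv_fun \<rho> v) = v" by (rule permutes_inverses(1)[OF \<rho>(1)])
      then show ?thesis using u\<rho>[OF u, of "inv_fun \<rho> v"] \<rho>I[of "inv_fun \<rho> v"] v by metis
    qed
    have "(\<Sum>v | v \<in> I \<and> fst v = i. u (inv_fun \<rho> v) * int (lv v)) = (\<Sum>v | v \<in> I \<and> fst v = i. u v * int (lv v))" for i
    proof (rule sum.cong[OF refl])
      fix v assume "v \<in> {v. v \<in> I \<and> fst v = i}"
      then have "v \<in> I" by simp
      then show "u (inv_fun \<rho> v) * int (lv v) = u v * int (lv v)" by (simp only: ui)
    qed
    then show "(\<lambda>v. u (inv_fun \<rho> v)) \<in> C" using u unfolding cochars_iff by (simp only:)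
  qed
  show thesis
  proof (rule that[of "\<rho> \<circ> \<sigma>" "\<lambda>v. c (\<sigma> v)"])
    show "\<rho> \<circ> \<sigma> \<in> Perm" by (rule Perm_comp[OF \<rho>P \<sigma>P])
    show "c (\<sigma> v) \<noteq> 0" if "v \<in> I" for v using \<rho>(2) \<sigma>I that by blast
    show "\<phi> x v = c (\<sigma> v) * x ((\<rho> \<circ> \<sigma>) v)" if "v \<in> I" "x \<in> Y" for v x
      using \<rho>(3)[of "\<sigma> v" x] \<sigma>I that \<sigma>\<tau> by (simp add: \<phi>'_def)
  qed
qed

end


section \<open>The automorphism group and the quasitorus\<close>

lemma regular_self_map_cong:
  assumes "\<And>x. x \<in> Y \<Longrightarrow> \<phi> x = \<psi> x" shows "regular_self_map I Y \<phi> \<longleftrightarrow> regular_self_map I Y \<psi>"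
proof -
  have "regular_function I Y (\<lambda>x. \<phi> x v) \<longleftrightarrow> regular_function I Y (\<lambda>x. \<psi> x v)" for v
    by (rule regular_function_cong) (simp add: assms)
  moreover have "\<phi> \<in> Y \<rightarrow> Y \<longleftrightarrow> \<psi> \<in> Y \<rightarrow> Y" using assms by (auto simp: Pi_iff)
  ultimately show ?thesis by (simp add: regular_self_map_def)
qed

text \<open>\<open>inv_into\<close> is replaced by an arbitrary regular inverse; the two agree on
  \<open>Y\<close>, which is all that regularity depends on.\<close>

lemma Aut_var_iff:
  "\<phi> \<in> carrier (Aut_var I Y) \<longleftrightarrow> \<phi> \<in> extensional Y \<and> regular_self_map I Y \<phi> \<and>
    (\<exists>\<psi>. regular_self_map I Y \<psi> \<and> (\<forall>x\<in>Y. \<phi> (\<psi> x) = x \<and> \<psi> (\<phi> x) = x))"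
proof
  assume "\<phi> \<in> carrier (Aut_var I Y)"
  then have \<phi>: "\<phi> \<in> extensional Y" "bij_betw \<phi> Y Y" "regular_self_map I Y \<phi>" "regular_self_map I Y (inv_into Y \<phi>)"
    by (auto simp: Aut_var_def Bij_def)
  then show "\<phi> \<in> extensional Y \<and> regular_self_map I Y \<phi> \<and>
    (\<exists>\<psi>. regular_self_map I Y \<psi> \<and> (\<forall>x\<in>Y. \<phi> (\<psi> x) = x \<and> \<psi> (\<phi> x) = x))"
    using bij_betw_inv_into_right[OF \<phi>(2)] bij_betw_inv_into_left[OF \<phi>(2)] by blast
next
  assume "\<phi> \<in> extensional Y \<and> regular_self_map I Y \<phi> \<and>
    (\<exists>\<psi>. regular_self_map I Y \<psi> \<and> (\<forall>x\<in>Y. \<phi> (\<psi> x) = x \<and> \<psi> (\<phi> x) = x))"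
  then obtain \<psi> where \<phi>: "\<phi> \<in> extensional Y" "regular_self_map I Y \<phi>" "regular_self_map I Y \<psi>"
    "\<And>x. x \<in> Y \<Longrightarrow> \<phi> (\<psi> x) = x" "\<And>x. x \<in> Y \<Longrightarrow> \<psi> (\<phi> x) = x" by blast
  have Y: "\<phi> \<in> Y \<rightarrow> Y" "\<psi> \<in> Y \<rightarrow> Y" using \<phi> by (auto simp: regular_self_map_def)
  have bij: "bij_betw \<phi> Y Y"
    by (rule bij_betw_byWitness[of _ \<psi>]) (use \<phi> Y in auto)
  have "inv_into Y \<phi> x = \<psi> x" if "x \<in> Y" for x
    using bij_betw_inv_into_left[OF bij, of "\<psi> x"] \<phi>(4)[OF that] Y(2) that by auto
  then have "regular_self_map I Y (inv_into Y \<phi>)" using \<phi>(3) regular_self_map_cong by blast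
  then show "\<phi> \<in> carrier (Aut_var I Y)" using \<phi> bij by (simp add: Aut_var_def Bij_def)
qed

lemma Aut_var_mult:
  "\<phi> \<in> carrier (Aut_var I Y) \<Longrightarrow> \<psi> \<in> carrier (Aut_var I Y) \<Longrightarrow> \<phi> \<otimes>\<^bsub>Aut_var I Y\<^esub> \<psi> = (\<lambda>x\<in>Y. \<phi> (\<psi> x))"
  by (simp add: Aut_var_def BijGroup_def compose_def)

lemma Aut_var_one: "\<one>\<^bsub>Aut_var I Y\<^esub> = (\<lambda>x\<in>Y. x)"
  by (simp add: Aut_var_def BijGroup_def)

lemma regular_self_map_restrict: "regular_self_map I Y (\<lambda>x\<in>Y. \<phi> x) \<longleftrightarrow> regular_self_map I Y \<phi>"
  by (rule regular_self_map_cong) simp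

lemma Aut_varI:
  assumes "regular_self_map I Y \<phi>" "regular_self_map I Y \<psi>" "\<And>x. x \<in> Y \<Longrightarrow> \<phi> (\<psi> x) = x" "\<And>x. x \<in> Y \<Longrightarrow> \<psi> (\<phi> x) = x"
  shows "(\<lambda>x\<in>Y. \<phi> x) \<in> carrier (Aut_var I Y)"
proof -
  have "\<psi> \<in> Y \<rightarrow> Y" using assms(2) by (simp add: regular_self_map_def)
  then show ?thesis unfolding Aut_var_iff regular_self_map_restrict using assms by (auto intro!: exI[of _ \<psi>])
qed

lemma regular_self_map_id: "regular_self_map I Y (\<lambda>x. x)"
  by (auto simp: regular_self_map_def intro: regular_coord)

lemma group_Aut_var: "group (Aut_var I Y)"
proof (rule groupI)
  fix \<phi> \<psi> assume a: "\<phi> \<in> carrier (Aut_var I Y)" "\<psi> \<in> carrier (Aut_var I Y)"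
  then obtain \<phi>' \<psi>' where b: "regular_self_map I Y \<phi>" "regular_self_map I Y \<psi>" "regular_self_map I Y \<phi>'" "regular_self_map I Y \<psi>'"
    "\<And>x. x \<in> Y \<Longrightarrow> \<phi> (\<phi>' x) = x \<and> \<phi>' (\<phi> x) = x" "\<And>x. x \<in> Y \<Longrightarrow> \<psi> (\<psi>' x) = x \<and> \<psi>' (\<psi> x) = x"
    unfolding Aut_var_iff by blast
  have Y: "\<psi> x \<in> Y" "\<phi>' x \<in> Y" if "x \<in> Y" for x using b that by (auto simp: regular_self_map_def)
  have "(\<lambda>x\<in>Y. \<phi> (\<psi> x)) \<in> carrier (Aut_var I Y)"
    by (rule Aut_varI[OF regular_self_map_comp[OF b(1,2)] regular_self_map_comp[OF b(4,3)]]) (simp_all add: b Y)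
  then show "\<phi> \<otimes>\<^bsub>Aut_var I Y\<^esub> \<psi> \<in> carrier (Aut_var I Y)" using Aut_var_mult[OF a] by simp
next
  show "\<one>\<^bsub>Aut_var I Y\<^esub> \<in> carrier (Aut_var I Y)" unfolding Aut_var_one
    by (rule Aut_varI[OF regular_self_map_id regular_self_map_id]) auto
next
  interpret B: group "BijGroup Y" by (rule group_BijGroup)
  have m: "\<phi> \<otimes>\<^bsub>Aut_var I Y\<^esub> \<psi> = \<phi> \<otimes>\<^bsub>BijGroup Y\<^esub> \<psi>" for \<phi> \<psi> by (simp add: Aut_var_def)
  have c: "\<phi> \<in> carrier (Aut_var I Y) \<Longrightarrow> \<phi> \<in> carrier (BijGroup Y)" for \<phi> by (simp add: Aut_var_def BijGroup_def)
  show "(\<phi> \<otimes>\<^bsub>Aut_var I Y\<^esub> \<psi>) \<otimes>\<^bsub>Aut_var I Y\<^esub> \<chi> = \<phi> \<otimes>\<^bsub>Aut_var I Y\<^esub> (\<psi> \<otimes>\<^bsub>Aut_var I Y\<^esub> \<chi>)"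
    if "\<phi> \<in> carrier (Aut_var I Y)" "\<psi> \<in> carrier (Aut_var I Y)" "\<chi> \<in> carrier (Aut_var I Y)" for \<phi> \<psi> \<chi>
    using that c by (simp add: m B.m_assoc)
  show "\<one>\<^bsub>Aut_var I Y\<^esub> \<otimes>\<^bsub>Aut_var I Y\<^esub> \<phi> = \<phi>" if "\<phi> \<in> carrier (Aut_var I Y)" for \<phi>
    using c[OF that] B.l_one[of \<phi>] by (simp add: Aut_var_def)
next
  fix \<phi> assume a: "\<phi> \<in> carrier (Aut_var I Y)"
  then obtain \<phi>' where b: "regular_self_map I Y \<phi>" "regular_self_map I Y \<phi>'"
    "\<And>x. x \<in> Y \<Longrightarrow> \<phi> (\<phi>' x) = x \<and> \<phi>' (\<phi> x) = x" unfolding Aut_var_iff by blast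
  have c: "(\<lambda>x\<in>Y. \<phi>' x) \<in> carrier (Aut_var I Y)" by (rule Aut_varI[OF b(2,1)]) (use b(3) in auto)
  have "\<phi> x \<in> Y" if "x \<in> Y" for x using b that by (auto simp: regular_self_map_def)
  then have "(\<lambda>x\<in>Y. \<phi>' x) \<otimes>\<^bsub>Aut_var I Y\<^esub> \<phi> = \<one>\<^bsub>Aut_var I Y\<^esub>"
    unfolding Aut_var_mult[OF c a] Aut_var_one using b(3) by auto
  then show "\<exists>\<psi>\<in>carrier (Aut_var I Y). \<psi> \<otimes>\<^bsub>Aut_var I Y\<^esub> \<phi> = \<one>\<^bsub>Aut_var I Y\<^esub>" using c by blast
qed

lemma Aut_var_inv:
  assumes "\<phi> \<in> carrier (Aut_var I Y)" "\<psi> \<in> carrier (Aut_var I Y)" "\<And>x. x \<in> Y \<Longrightarrow> \<psi> (\<phi> x) = x"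
  shows "inv\<^bsub>Aut_var I Y\<^esub> \<phi> = \<psi>"
  by (rule group.inv_equality[OF group_Aut_var _ assms(1,2)]) (use assms(3) in \<open>auto simp: Aut_var_mult[OF assms(2,1)] Aut_var_one\<close>)

context trinomial_data begin

section \<open>The grading group and the points of the quasitorus\<close>

abbreviation "FA \<equiv> free_Abelian_group I"
abbreviation "La \<equiv> tri_lattice_image n l"
abbreviation "K \<equiv> tri_class_group n l"
abbreviation "cs d \<equiv> La #>\<^bsub>FA\<^esub> d"
abbreviation Q :: "((idx \<Rightarrow>\<^sub>0 int) set \<Rightarrow>\<^sub>0 'a) ring" where "Q \<equiv> group_algebra K"

definition lat :: "(nat \<Rightarrow> int) \<Rightarrow> (idx \<Rightarrow>\<^sub>0 int)" where
  "lat u = (\<Sum>v\<in>I. Poly_Mapping.single v (\<Sum>r=1..2. tri_matrix l r v * u r))"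

lemma La_eq: "La = range lat"
  by (simp add: tri_lattice_image_def lat_def)

lemma lookup_lat: "Poly_Mapping.lookup (lat u) v = (if v \<in> I then tri_matrix l 1 v * u 1 + tri_matrix l 2 v * u 2 else 0)"
  unfolding lat_def lookup_sum lookup_single when_def
  by (simp add: finite_tri_idx numeral_2_eq_2)

lemma lat_add: "lat u + lat w = lat (\<lambda>r. u r + w r)"
  by (rule poly_mapping_eqI) (simp add: lookup_add lookup_lat algebra_simps)

lemma lat_uminus: "- lat u = lat (\<lambda>r. - u r)"
  by (rule poly_mapping_eqI) (simp add: lookup_lat)

lemma lat_0: "lat (\<lambda>_. 0) = 0"
  by (rule poly_mapping_eqI) (simp add: lookup_lat)

lemma zero_La: "0 \<in> La" using lat_0 by (metis La_eq rangeI)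

lemma keys_lat: "Poly_Mapping.keys (lat u) \<subseteq> I"
  by (auto simp: in_keys_iff lookup_lat split: if_splits)

lemma La_normal: "La \<lhd> FA"
proof (rule comm_group.subgroup_imp_normal[OF abelian_free_Abelian_group])
  show "subgroup La FA"
  proof (rule group.subgroupI[OF group_free_Abelian_group])
    show "La \<subseteq> carrier FA" using keys_lat by (auto simp: La_eq)
    show "La \<noteq> {}" by (simp add: La_eq)
    show "inv\<^bsub>FA\<^esub> d \<in> La" if "d \<in> La" for d using that keys_lat by (auto simp: La_eq lat_uminus)
    show "d \<otimes>\<^bsub>FA\<^esub> d' \<in> La" if "d \<in> La" "d' \<in> La" for d d' using that by (auto simp: La_eq lat_add)
  qed
qed

lemma K_carrier: "g \<in> carrier K \<longleftrightarrow> (\<exists>d. Poly_Mapping.keys d \<subseteq> I \<and> g = cs d)"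
  unfolding tri_class_group_def FactGroup_def RCOSETS_def
  by (simp only: partial_object.simps UN_iff singleton_iff Bex_def carrier_free_Abelian_group_iff)

lemma cs_K: "Poly_Mapping.keys d \<subseteq> I \<Longrightarrow> cs d \<in> carrier K"
  using K_carrier by blast

lemma K_mult: "Poly_Mapping.keys d \<subseteq> I \<Longrightarrow> Poly_Mapping.keys d' \<subseteq> I \<Longrightarrow> cs d \<otimes>\<^bsub>K\<^esub> cs d' = cs (d + d')"
  using normal.rcos_sum[OF La_normal, of d d'] by (simp add: tri_class_group_def FactGroup_def)

lemma K_one: "\<one>\<^bsub>K\<^esub> = La" by (simp add: tri_class_group_def FactGroup_def)

lemma cs_La: assumes "d \<in> La" shows "cs d = La"
  by (rule group.coset_join2[OF group_free_Abelian_group]) (use assms keys_lat La_normal in \<open>auto simp: La_eq normal_imp_subgroup\<close>)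

lemma K_group: "group K"
  unfolding tri_class_group_def by (rule normal.factorgroup_is_group[OF La_normal])

lemma weight_eq: "tri_weight n l v = cs (frag_of v)"
  by (simp add: tri_weight_def)

text \<open>For nonzero entries, the character of the free abelian group that sends the generator
  \<open>v\<close> to \<open>t v\<close>.\<close>

definition cval :: "(idx \<Rightarrow> 'a) \<Rightarrow> (idx \<Rightarrow>\<^sub>0 int) \<Rightarrow> 'a" where
  "cval t d = (\<Prod>v\<in>I. t v powi Poly_Mapping.lookup d v)"

lemma cval_add: "(\<And>v. v \<in> I \<Longrightarrow> t v \<noteq> 0) \<Longrightarrow> cval t (d + d') = cval t d * cval t d'"
  unfolding cval_def prod.distrib[symmetric] by (intro prod.cong) (auto simp: lookup_add power_int_add)

lemma cval_frag: "v \<in> I \<Longrightarrow> cval t (frag_of v) = t v"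
proof -
  assume v: "v \<in> I"
  have "cval t (frag_of v) = (\<Prod>w\<in>I. if w = v then t v else 1)"
    unfolding cval_def by (intro prod.cong) auto
  then show ?thesis using v by (simp add: finite_tri_idx)
qed

lemma cval_0: "cval t 0 = 1" by (simp add: cval_def)

text \<open>Both rows of \<open>L\<close> carry \<open>- l 0 j\<close> in block 0, whence the
  exponent \<open>- (u 1 + u 2)\<close> of that block value.\<close>

lemma cval_lat:
  assumes t: "\<And>v. v \<in> I \<Longrightarrow> t v \<noteq> 0"
  shows "cval t (lat u) = b 0 t powi (- (u 1 + u 2)) * b 1 t powi u 1 * b 2 t powi u 2"
proof -
  define w where "w i = (if i = 0 then - (u 1 + u 2) else u i)" for i :: nat
  have e: "Poly_Mapping.lookup (lat u) (i, j) = int (l i j) * w i" if "(i, j) \<in> I" for i j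
    using that unfolding lookup_lat by (auto simp: tri_matrix_def w_def in_tri_idx le2_cases algebra_simps)
  have "cval t (lat u) = (\<Prod>i\<le>2. \<Prod>j=1..n i. t (i, j) powi Poly_Mapping.lookup (lat u) (i, j))"
    unfolding cval_def tri_idx_def by (simp add: prod.Sigma atMost_atLeast0)
  also have "\<dots> = (\<Prod>i\<le>2. b i t powi w i)"
  proof (rule prod.cong[OF refl])
    fix i :: nat assume i: "i \<in> {..2}"
    have "(\<Prod>j\<in>A. (t (i, j) ^ l i j) powi w i) = (\<Prod>j\<in>A. t (i, j) ^ l i j) powi w i" for A
      by (induction A rule: infinite_finite_induct) (auto simp: power_int_mult_distrib)
    moreover have "t (i, j) powi Poly_Mapping.lookup (lat u) (i, j) = (t (i, j) ^ l i j) powi w i" if "j \<in> {1..n i}" for j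
      using i that by (subst e) (auto simp: in_tri_idx power_int_mult)
    ultimately show "(\<Prod>j=1..n i. t (i, j) powi Poly_Mapping.lookup (lat u) (i, j)) = b i t powi w i"
      by (simp add: bm_def)
  qed
  also have "\<dots> = b 0 t powi (- (u 1 + u 2)) * b 1 t powi u 1 * b 2 t powi u 2"
    by (simp add: numeral_2_eq_2 w_def)
  finally show ?thesis .
qed

lemma b_nonzero: "(\<And>v. v \<in> I \<Longrightarrow> t v \<noteq> 0) \<Longrightarrow> i \<le> 2 \<Longrightarrow> b i t \<noteq> 0"
  unfolding bm_def by (auto simp: in_tri_idx)

text \<open>By \<open>cval_lat\<close>, equal block values cancel on every lattice vector;
  conversely the two unit vectors for \<open>u\<close> compare the block values 1 and 2 with the
  block value 0.\<close>

lemma big_torus_iff: "t \<in> H \<longleftrightarrow> (\<forall>v\<in>I. t v \<noteq> 0) \<and> (\<forall>u. cval t (lat u) = 1)"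
proof
  assume t: "t \<in> H"
  then have nz: "\<And>v. v \<in> I \<Longrightarrow> t v \<noteq> 0" and eq: "b 1 t = b 0 t" "b 2 t = b 0 t" by (auto simp: big_torus_def)
  have b0: "b 0 t \<noteq> 0" using b_nonzero[of t 0, OF nz] by simp
  have "cval t (lat u) = 1" for u
  proof -
    have "cval t (lat u) = b 0 t powi (- (u 1 + u 2)) * b 1 t powi u 1 * b 2 t powi u 2"
      by (rule cval_lat) (rule nz)
    also have "\<dots> = b 0 t powi (- (u 1 + u 2) + u 1 + u 2)"
      unfolding eq using b0 by (simp only: power_int_add simp_thms)
    finally show ?thesis by simp
  qed
  then show "(\<forall>v\<in>I. t v \<noteq> 0) \<and> (\<forall>u. cval t (lat u) = 1)" using nz by blast
next
  assume a: "(\<forall>v\<in>I. t v \<noteq> 0) \<and> (\<forall>u. cval t (lat u) = 1)"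
  then have nz: "\<And>v. v \<in> I \<Longrightarrow> t v \<noteq> 0" by blast
  have b0: "b 0 t \<noteq> 0" using b_nonzero[of t 0, OF nz] by simp
  have "cval t (lat (\<lambda>r. if r = 1 then 1 else 0)) = 1" "cval t (lat (\<lambda>r. if r = 2 then 1 else 0)) = 1" using a by blast+
  moreover have "cval t (lat u) = b 0 t powi (- (u 1 + u 2)) * b 1 t powi u 1 * b 2 t powi u 2" for u
    by (rule cval_lat) (rule nz)
  ultimately show "t \<in> H" using b0 nz by (simp add: big_torus_def power_int_minus field_simps)
qed

lemma group_char_Q: "g \<in> carrier K \<Longrightarrow> (group_char g :: (idx \<Rightarrow>\<^sub>0 int) set \<Rightarrow>\<^sub>0 'a) \<in> carrier Q"
  by (simp add: group_algebra_def group_char_def)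

lemma single_Q_mult:
  "Poly_Mapping.single g c \<otimes>\<^bsub>Q\<^esub> Poly_Mapping.single h d = Poly_Mapping.single (g \<otimes>\<^bsub>K\<^esub> h) (c * d)"
  by (simp add: group_algebra_def)

lemma Q_add: "a \<oplus>\<^bsub>Q\<^esub> c = a + c" by (simp add: group_algebra_def)

context
  fixes \<phi> :: "((idx \<Rightarrow>\<^sub>0 int) set \<Rightarrow>\<^sub>0 'a) \<Rightarrow> 'a" assumes \<phi>: "\<phi> \<in> quasitorus_points K"
begin

lemma qt_mult: "a \<in> carrier Q \<Longrightarrow> c \<in> carrier Q \<Longrightarrow> \<phi> (a \<otimes>\<^bsub>Q\<^esub> c) = \<phi> a * \<phi> c"
  and qt_add: "a \<in> carrier Q \<Longrightarrow> c \<in> carrier Q \<Longrightarrow> \<phi> (a + c) = \<phi> a + \<phi> c"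
  and qt_const: "\<phi> (Poly_Mapping.single La k) = k"
  using \<phi> ring_hom_mult[of \<phi> Q ring_of_type_algebra a c] ring_hom_add[of \<phi> Q ring_of_type_algebra a c]
  by (simp_all add: quasitorus_points_def Q_add K_one) (simp_all add: ring_of_type_algebra_def)

definition qt :: "idx \<Rightarrow> 'a" where "qt v = \<phi> (group_char (tri_weight n l v))"

lemma qt_cs_add:
  assumes "Poly_Mapping.keys d \<subseteq> I" "Poly_Mapping.keys d' \<subseteq> I"
  shows "\<phi> (group_char (cs (d + d'))) = \<phi> (group_char (cs d)) * \<phi> (group_char (cs d'))"
  using qt_mult[OF group_char_Q[OF cs_K[OF assms(1)]] group_char_Q[OF cs_K[OF assms(2)]]]
  by (simp add: group_char_def single_Q_mult K_mult[OF assms])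

lemma qt_cs_La: "d \<in> La \<Longrightarrow> \<phi> (group_char (cs d)) = 1"
  by (simp add: cs_La group_char_def qt_const)

lemma qt_cs_nonzero: assumes "Poly_Mapping.keys d \<subseteq> I" shows "\<phi> (group_char (cs d)) \<noteq> 0"
  using qt_cs_add[of d "- d"] qt_cs_La[OF zero_La] assms by auto

lemma qt_nonzero: "v \<in> I \<Longrightarrow> qt v \<noteq> 0"
  unfolding qt_def weight_eq by (rule qt_cs_nonzero) simp

lemma qt_cs: assumes "Poly_Mapping.keys d \<subseteq> I" shows "\<phi> (group_char (cs d)) = cval qt d"
proof -
  have "Poly_Mapping.keys d \<subseteq> I \<and> \<phi> (group_char (cs d)) = cval qt d"
    using assms
  proof (induction rule: frag_induction)
    case zero
    then show ?case using qt_cs_La[OF zero_La] by (simp add: cval_0)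
  next
    case (one v)
    then show ?case by (simp add: cval_frag qt_def weight_eq)
  next
    case (diff a c)
    have k: "Poly_Mapping.keys (a - c) \<subseteq> I" using diff Poly_Mapping.keys_diff[of a c] by blast
    have "\<phi> (group_char (cs (a - c))) * \<phi> (group_char (cs c)) = cval qt (a - c) * cval qt c"
      using qt_cs_add[OF k, of c] cval_add[of qt "a - c" c, OF qt_nonzero] diff by simp
    moreover have "\<phi> (group_char (cs c)) = cval qt c" "\<phi> (group_char (cs c)) \<noteq> 0"
      using diff qt_cs_nonzero[of c] by auto
    ultimately show ?case using k by simp
  qed
  then show ?thesis by simp
qed

lemma qt_big_torus: "qt \<in> H"
  unfolding big_torus_iff using qt_nonzero qt_cs[OF keys_lat] qt_cs_La by (auto simp: La_eq)

text \<open>Compatibility with the structure maps makes \<open>\<phi>\<close> linear over the ground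
  field, so it is determined by its values on the group elements.\<close>

lemma qt_expand:
  assumes "a \<in> carrier Q"
  shows "\<phi> a = (\<Sum>g\<in>Poly_Mapping.keys a. Poly_Mapping.lookup a g * \<phi> (group_char g))"
proof -
  have keys: "Poly_Mapping.keys a \<subseteq> carrier K" using assms by (simp add: group_algebra_def)
  have s: "\<phi> (Poly_Mapping.single g k) = k * \<phi> (group_char g)" if "g \<in> carrier K" for g k
  proof -
    have "La \<otimes>\<^bsub>K\<^esub> g = g" using group.is_monoid[OF K_group] monoid.l_one[of K g] that by (simp add: K_one)
    moreover have "La \<in> carrier K" using monoid.one_closed[OF group.is_monoid[OF K_group]] by (simp add: K_one)
    then have "Poly_Mapping.single La k \<in> carrier Q" by (simp add: group_algebra_def)
    ultimately show ?thesis
      using qt_mult[of "Poly_Mapping.single La k" "group_char g"] group_char_Q[OF that] by (simp add: group_char_def single_Q_mult qt_const)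
  qed
  have sQ: "Poly_Mapping.single g k \<in> carrier Q" if "g \<in> carrier K" for g k
    using that by (simp add: group_algebra_def)
  have "(\<Sum>g\<in>S. Poly_Mapping.single g (Poly_Mapping.lookup a g)) \<in> carrier Q \<and>
      \<phi> (\<Sum>g\<in>S. Poly_Mapping.single g (Poly_Mapping.lookup a g)) = (\<Sum>g\<in>S. Poly_Mapping.lookup a g * \<phi> (group_char g))"
    if "finite S" "S \<subseteq> carrier K" for S
    using that
  proof (induction S)
    case empty
    have "0 \<in> carrier Q" by (simp add: group_algebra_def)
    then show ?case using qt_add[of 0 0] by simp
  next
    case (insert g S)
    let ?s = "\<Sum>g\<in>S. Poly_Mapping.single g (Poly_Mapping.lookup a g)"
    have IH: "?s \<in> carrier Q" "\<phi> ?s = (\<Sum>g\<in>S. Poly_Mapping.lookup a g * \<phi> (group_char g))" using insert by auto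
    have g: "g \<in> carrier K" using insert by simp
    have "Poly_Mapping.single g (Poly_Mapping.lookup a g) + ?s \<in> carrier Q"
      using IH(1) sQ[OF g] Poly_Mapping.keys_add[of "Poly_Mapping.single g (Poly_Mapping.lookup a g)" ?s]
      unfolding group_algebra_def by auto
    then show ?case using insert.hyps qt_add[OF sQ[OF g] IH(1)] IH(2) s[OF g] by simp
  qed
  from this[OF _ keys] show ?thesis using poly_mapping_sum_singles[of a] by simp
qed

end

lemma quasitorus_points_eqI:
  assumes \<phi>: "\<phi> \<in> quasitorus_points K" and \<psi>: "\<psi> \<in> quasitorus_points K"
    and eq: "\<And>v. v \<in> I \<Longrightarrow> qt \<phi> v = qt \<psi> v"
  shows "\<phi> = \<psi>"
proof (rule extensionalityI[of _ "carrier Q"])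
  show "\<phi> \<in> extensional (carrier Q)" "\<psi> \<in> extensional (carrier Q)" using \<phi> \<psi> by (auto simp: quasitorus_points_def)
  fix a assume a: "a \<in> carrier Q"
  have "\<phi> (group_char g) = \<psi> (group_char g)" if g: "g \<in> Poly_Mapping.keys a" for g
  proof -
    have "g \<in> carrier K" using a g by (auto simp: group_algebra_def)
    then obtain d where d: "Poly_Mapping.keys d \<subseteq> I" "g = cs d" using K_carrier by blast
    have "cval (qt \<phi>) d = cval (qt \<psi>) d" unfolding cval_def using eq by (intro prod.cong) auto
    then show ?thesis using qt_cs[OF \<phi> d(1)] qt_cs[OF \<psi> d(1)] d(2) by simp
  qed
  then show "\<phi> a = \<psi> a" unfolding qt_expand[OF \<phi> a] qt_expand[OF \<psi> a] by simp
qed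

text \<open>A vector of \<open>H\<close> gives a character of the free abelian group that is trivial
  on the lattice, hence one of \<open>K\<close>, and its linear extension is an algebra
  homomorphism.\<close>

lemma quasitorus_points_surj:
  assumes t: "t \<in> H" obtains \<phi> where "\<phi> \<in> quasitorus_points K" "\<And>v. v \<in> I \<Longrightarrow> qt \<phi> v = t v"
proof -
  have nz: "\<And>v. v \<in> I \<Longrightarrow> t v \<noteq> 0" using t by (simp add: big_torus_def)
  \<comment> \<open>Well defined because two representatives of a coset differ by a lattice vector,
    on which \<open>cval t\<close> is 1.\<close>
  define \<chi> where "\<chi> g = cval t (SOME d. Poly_Mapping.keys d \<subseteq> I \<and> g = cs d)" for g
  have \<chi>: "\<chi> (cs d) = cval t d" if d: "Poly_Mapping.keys d \<subseteq> I" for d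
  proof -
    define d' where "d' = (SOME d'. Poly_Mapping.keys d' \<subseteq> I \<and> cs d = cs d')"
    have d': "Poly_Mapping.keys d' \<subseteq> I" "cs d = cs d'"
      using someI[of "\<lambda>d'. Poly_Mapping.keys d' \<subseteq> I \<and> cs d = cs d'" d] d unfolding d'_def by auto
    have "d' \<in> cs d"
      unfolding d'(2) by (rule group.rcos_self[OF group_free_Abelian_group]) (use d' La_normal in \<open>auto simp: normal_imp_subgroup\<close>)
    then obtain u where u: "d' = lat u + d" by (auto simp: r_coset_def La_eq)
    have "cval t d' = cval t (lat u) * cval t d" unfolding u by (rule cval_add[of t, OF nz])
    then show ?thesis using t unfolding \<chi>_def d'_def[symmetric] big_torus_iff by simp
  qed
  have \<chi>mult: "\<chi> (g \<otimes>\<^bsub>K\<^esub> h) = \<chi> g * \<chi> h" if gh: "g \<in> carrier K" "h \<in> carrier K" for g h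
  proof -
    obtain d d' where d: "Poly_Mapping.keys d \<subseteq> I" "g = cs d" "Poly_Mapping.keys d' \<subseteq> I" "h = cs d'"
      using gh unfolding K_carrier by blast
    have "Poly_Mapping.keys (d + d') \<subseteq> I" using Poly_Mapping.keys_add[of d d'] d by blast
    then show ?thesis using d by (simp add: K_mult \<chi> cval_add[of t, OF nz])
  qed
  have \<chi>1: "\<chi> La = 1" using \<chi>[of 0] cs_La[OF zero_La] by (simp add: cval_0)
  define ext where "ext a = (\<Sum>g\<in>Poly_Mapping.keys a. Poly_Mapping.lookup a g * \<chi> g)" for a
  have ext_sup: "ext a = (\<Sum>g\<in>S. Poly_Mapping.lookup a g * \<chi> g)" if "finite S" "Poly_Mapping.keys a \<subseteq> S" for a S
    unfolding ext_def using that by (intro sum.mono_neutral_left) (auto simp: in_keys_iff)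
  have ext_add: "ext (a + c) = ext a + ext c" for a c
  proof -
    let ?S = "Poly_Mapping.keys a \<union> Poly_Mapping.keys c"
    have "Poly_Mapping.keys (a + c) \<subseteq> ?S" by (rule Poly_Mapping.keys_add)
    then show ?thesis by (simp add: ext_sup[of ?S] lookup_add distrib_right sum.distrib)
  qed
  have ext_0: "ext 0 = 0" by (simp add: ext_def)
  have ext_sum: "ext (sum f S) = (\<Sum>i\<in>S. ext (f i))" for f :: "(idx \<Rightarrow>\<^sub>0 int) set \<Rightarrow> _" and S
    by (induction S rule: infinite_finite_induct) (auto simp: ext_0 ext_add)
  have ext_single: "ext (Poly_Mapping.single g c) = c * \<chi> g" for g c
    by (subst ext_sup[of "{g}"]) auto
  have ext_mult: "ext (a \<otimes>\<^bsub>Q\<^esub> c) = ext a * ext c" if ac: "a \<in> carrier Q" "c \<in> carrier Q" for a c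
  proof -
    have k: "Poly_Mapping.keys a \<subseteq> carrier K" "Poly_Mapping.keys c \<subseteq> carrier K" using ac by (auto simp: group_algebra_def)
    have "ext (a \<otimes>\<^bsub>Q\<^esub> c) = (\<Sum>g\<in>Poly_Mapping.keys a. \<Sum>h\<in>Poly_Mapping.keys c. Poly_Mapping.lookup a g * Poly_Mapping.lookup c h * \<chi> (g \<otimes>\<^bsub>K\<^esub> h))"
      by (simp add: group_algebra_def ext_sum ext_single)
    also have "\<dots> = ext a * ext c"
      unfolding ext_def sum_product using k \<chi>mult by (intro sum.cong refl) (auto simp: mult_ac subset_iff)
    finally show ?thesis .
  qed
  define \<phi> where "\<phi> = restrict ext (carrier Q)"
  have Qadd: "a + c \<in> carrier Q" if "a \<in> carrier Q" "c \<in> carrier Q" for a c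
    using that Poly_Mapping.keys_add[of a c] unfolding group_algebra_def by auto
  have Qmult: "a \<otimes>\<^bsub>Q\<^esub> c \<in> carrier Q" if ac: "a \<in> carrier Q" "c \<in> carrier Q" for a c
  proof -
    have k: "Poly_Mapping.keys a \<subseteq> carrier K" "Poly_Mapping.keys c \<subseteq> carrier K" using ac by (auto simp: group_algebra_def)
    have cl: "g \<otimes>\<^bsub>K\<^esub> h \<in> carrier K" if "g \<in> carrier K" "h \<in> carrier K" for g h
      using monoid.m_closed[OF group.is_monoid[OF K_group]] that by blast
    have sumQ: "sum f S \<in> carrier Q" if "\<And>i. i \<in> S \<Longrightarrow> f i \<in> carrier Q" for f :: "(idx \<Rightarrow>\<^sub>0 int) set \<Rightarrow> _" and S
      using that
    proof (induction S rule: infinite_finite_induct)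
      case (insert i S)
      then show ?case by (simp add: Qadd)
    qed (simp_all add: group_algebra_def)
    have sQ: "Poly_Mapping.single (g \<otimes>\<^bsub>K\<^esub> h) r \<in> carrier Q" if "g \<in> Poly_Mapping.keys a" "h \<in> Poly_Mapping.keys c" for g h r
      using cl[of g h] k that by (auto simp: group_algebra_def)
    have "(\<Sum>g\<in>Poly_Mapping.keys a. \<Sum>h\<in>Poly_Mapping.keys c. Poly_Mapping.single (g \<otimes>\<^bsub>K\<^esub> h) (Poly_Mapping.lookup a g * Poly_Mapping.lookup c h)) \<in> carrier Q"
      by (intro sumQ sQ)
    then show ?thesis by (simp add: group_algebra_def)
  qed
  have LaK: "La \<in> carrier K" using monoid.one_closed[OF group.is_monoid[OF K_group]] by (simp add: K_one)
  have single_La: "Poly_Mapping.single La c \<in> carrier Q" for c using LaK by (simp add: group_algebra_def)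
  have "\<phi> \<in> ring_hom Q ring_of_type_algebra"
  proof (rule ring_hom_memI)
    show "\<phi> (a \<otimes>\<^bsub>Q\<^esub> c) = \<phi> a \<otimes>\<^bsub>ring_of_type_algebra\<^esub> \<phi> c" if "a \<in> carrier Q" "c \<in> carrier Q" for a c
      using Qmult[OF that] ext_mult[OF that] that by (simp add: \<phi>_def ring_of_type_algebra_def)
    show "\<phi> (a \<oplus>\<^bsub>Q\<^esub> c) = \<phi> a \<oplus>\<^bsub>ring_of_type_algebra\<^esub> \<phi> c" if "a \<in> carrier Q" "c \<in> carrier Q" for a c
      using Qadd[OF that] ext_add that by (simp add: \<phi>_def ring_of_type_algebra_def Q_add)
    have "\<one>\<^bsub>Q\<^esub> = Poly_Mapping.single La 1" by (simp add: group_algebra_def K_one)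
    then show "\<phi> \<one>\<^bsub>Q\<^esub> = \<one>\<^bsub>ring_of_type_algebra\<^esub>"
      using single_La ext_single \<chi>1 by (simp add: \<phi>_def ring_of_type_algebra_def)
  qed (simp add: ring_of_type_algebra_def)
  then have \<phi>: "\<phi> \<in> quasitorus_points K"
    unfolding quasitorus_points_def using single_La ext_single \<chi>1 by (simp add: \<phi>_def K_one)
  moreover have "qt \<phi> v = t v" if v: "v \<in> I" for v
  proof -
    have k: "Poly_Mapping.keys (frag_of v) \<subseteq> I" using v by simp
    have "qt \<phi> v = ext (group_char (cs (frag_of v)))"
      unfolding qt_def[OF \<phi>] weight_eq using group_char_Q[OF cs_K[OF k]] by (simp add: \<phi>_def)
    also have "\<dots> = t v" using \<chi>[OF k] v by (simp add: group_char_def ext_single cval_frag)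
    finally show ?thesis .
  qed
  ultimately show thesis using that by blast
qed


section \<open>The semidirect product\<close>


abbreviation Aut :: "((idx \<Rightarrow> 'a) \<Rightarrow> (idx \<Rightarrow> 'a)) monoid" where "Aut \<equiv> Aut_var I Y"

definition torus_action :: "(idx \<Rightarrow> 'a) \<Rightarrow> (idx \<Rightarrow> 'a) \<Rightarrow> (idx \<Rightarrow> 'a)" where
  "torus_action t = (\<lambda>x\<in>Y. diag I t x)"

lemma big_torus_inverse: "t \<in> H \<Longrightarrow> (\<lambda>v. inverse (t v)) \<in> H"
proof -
  have "bm n l i (\<lambda>v. inverse (t v)) = inverse (b i t)" for i
    by (simp add: bm_def power_inverse prod_inversef[symmetric] o_def)
  then show "t \<in> H \<Longrightarrow> ?thesis" by (simp add: big_torus_def)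
qed

lemma diag_inverse: assumes "t \<in> H" "x \<in> Y"
  shows "diag I t (diag I (\<lambda>v. inverse (t v)) x) = x" "diag I (\<lambda>v. inverse (t v)) (diag I t x) = x"
proof -
  have nz: "t v \<noteq> 0" if "v \<in> I" for v using assms(1) that by (simp add: big_torus_def)
  have x: "x v = undefined" if "v \<notin> I" for v using assms(2) that unfolding Y_iff extensional_def by blast
  show "diag I t (diag I (\<lambda>v. inverse (t v)) x) = x" "diag I (\<lambda>v. inverse (t v)) (diag I t x) = x"
    unfolding diag_diag using nz x by (auto simp: diag_def fun_eq_iff)
qed

lemma torus_action_Aut: "t \<in> H \<Longrightarrow> torus_action t \<in> carrier Aut"
  unfolding torus_action_def
  by (rule Aut_varI[OF diag_regular diag_regular[OF big_torus_inverse]]) (auto simp: diag_inverse)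

lemma torus_action_mult:
  assumes "s \<in> H" "t \<in> H" shows "torus_action s \<otimes>\<^bsub>Aut\<^esub> torus_action t = torus_action (\<lambda>v. s v * t v)"
  unfolding Aut_var_mult[OF assms[THEN torus_action_Aut]]
  by (rule ext) (simp add: torus_action_def diag_Y assms diag_diag)

lemma torus_action_eq_imp:
  assumes "torus_action s = torus_action t" "v \<in> I" shows "s v = t v"
proof -
  obtain x where x: "x \<in> Y" "\<And>v. v \<in> I \<Longrightarrow> x v \<noteq> 0" using generic_point by metis
  have "diag I s x v = diag I t x v" using fun_cong[OF assms(1), of x] x(1) by (simp add: torus_action_def)
  then show ?thesis using x(2)[OF assms(2)] assms(2) by (simp add: diag_def)
qed

lemma Perm_inv_comp:
  assumes "\<tau> \<in> Perm" shows "x \<circ> \<tau> \<circ> inv_fun \<tau> = x" "x \<circ> inv_fun \<tau> \<circ> \<tau> = x"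
  using permutes_inverses[OF Perm_permutes[OF assms]] by (auto simp: fun_eq_iff)

lemma perm_action_Aut: assumes "\<tau> \<in> Perm" shows "perm_action Y \<tau> \<in> carrier Aut"
  unfolding perm_action_def
  by (rule Aut_varI[OF Perm_regular[OF Perm_inv[OF assms]] Perm_regular[OF assms]]) (simp_all only: Perm_inv_comp[OF assms])

lemma perm_action_mult:
  assumes "\<sigma> \<in> Perm" "\<tau> \<in> Perm" shows "perm_action Y \<sigma> \<otimes>\<^bsub>Aut\<^esub> perm_action Y \<tau> = perm_action Y (\<sigma> \<circ> \<tau>)"
proof -
  have bij: "bij \<sigma>" "bij \<tau>" using assms Perm_permutes permutes_bij by blast+
  have "inv_fun (\<sigma> \<circ> \<tau>) = inv_fun \<tau> \<circ> inv_fun \<sigma>" by (rule o_inv_distrib[OF bij])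
  then show ?thesis
    unfolding Aut_var_mult[OF assms[THEN perm_action_Aut]]
    using Perm_Y[OF Perm_inv[OF assms(2)]] by (intro ext) (simp add: perm_action_def o_assoc)
qed

lemma perm_action_id: "perm_action Y id = \<one>\<^bsub>Aut\<^esub>"
  by (simp add: perm_action_def Aut_var_one inv_id)

lemma perm_action_inv:
  assumes "\<tau> \<in> Perm" shows "inv\<^bsub>Aut\<^esub> (perm_action Y \<tau>) = perm_action Y (inv_fun \<tau>)"
proof (rule Aut_var_inv[OF perm_action_Aut[OF assms] perm_action_Aut[OF Perm_inv[OF assms]]])
  fix x assume x: "x \<in> Y"
  have "inv_fun (inv_fun \<tau>) = \<tau>" using permutes_inv_inv[OF Perm_permutes[OF assms]] .
  then show "perm_action Y (inv_fun \<tau>) (perm_action Y \<tau> x) = x"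
    using x Perm_Y[OF Perm_inv[OF assms] x] by (simp add: perm_action_def Perm_inv_comp[OF assms])
qed

text \<open>A point whose only zero coordinate is \<open>inv_fun \<sigma> v\<close> separates the
  two indices. With \<open>t\<close> constantly 1 this gives faithfulness of the permutation action,
  with \<open>\<tau> = id\<close> the trivial intersection with the torus.\<close>

lemma perm_torus_action_eq:
  assumes \<sigma>: "\<sigma> \<in> Perm" and \<tau>: "\<tau> \<in> Perm" and t: "\<And>v. v \<in> I \<Longrightarrow> t v \<noteq> 0"
    and eq: "\<And>x v. x \<in> Y \<Longrightarrow> v \<in> I \<Longrightarrow> x (inv_fun \<sigma> v) = t v * x (inv_fun \<tau> v)"
  shows "\<sigma> = \<tau>"
proof -
  have p: "\<sigma> permutes I" "\<tau> permutes I" using assms Perm_permutes by auto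
  have "inv_fun \<sigma> v = inv_fun \<tau> v" for v
  proof (cases "v \<in> I")
    case True
    have i: "inv_fun \<sigma> v \<in> I" "inv_fun \<tau> v \<in> I"
      using True permutes_in_image[OF permutes_inv[OF p(1)]] permutes_in_image[OF permutes_inv[OF p(2)]] by auto
    show ?thesis
    proof (rule ccontr)
      assume ne: "inv_fun \<sigma> v \<noteq> inv_fun \<tau> v"
      obtain x where x: "x \<in> Y" "x (inv_fun \<sigma> v) = 0" "\<And>w. w \<in> I \<Longrightarrow> w \<noteq> inv_fun \<sigma> v \<Longrightarrow> x w \<noteq> 0"
        using separating_point[OF i(1)] by metis
      show False using eq[OF x(1) True] x(2) x(3)[OF i(2)] ne t[OF True] by auto
    qed
  next
    case False
    then show ?thesis using permutes_not_in[OF permutes_inv[OF p(1)]] permutes_not_in[OF permutes_inv[OF p(2)]] by simp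
  qed
  then have "inv_fun (inv_fun \<sigma>) = inv_fun (inv_fun \<tau>)" by presburger
  then show ?thesis using permutes_inv_inv[OF p(1)] permutes_inv_inv[OF p(2)] by simp
qed

lemma perm_action_inj: "inj_on (perm_action Y) Perm"
proof (rule inj_onI)
  fix \<sigma> \<tau> assume a: "\<sigma> \<in> Perm" "\<tau> \<in> Perm" "perm_action Y \<sigma> = perm_action Y \<tau>"
  have "x (inv_fun \<sigma> v) = 1 * x (inv_fun \<tau> v)" if "x \<in> Y" for x v
  proof -
    have "perm_action Y \<sigma> x v = perm_action Y \<tau> x v" by (simp only: a(3))
    then show ?thesis using that by (simp add: perm_action_def)
  qed
  then show "\<sigma> = \<tau>" using perm_torus_action_eq[OF a(1,2), of "\<lambda>_. 1"] by simp
qed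

lemma Aut_monomial:
  assumes rigid: "rigid I Y" and \<phi>: "\<phi> \<in> carrier Aut"
  obtains \<kappa> c \<psi> where "\<kappa> \<in> Perm" "\<And>v x. v \<in> I \<Longrightarrow> x \<in> Y \<Longrightarrow> \<phi> x v = c v * x (\<kappa> v)"
    "\<And>v. v \<in> I \<Longrightarrow> c v \<noteq> 0" "\<psi> \<in> carrier Aut" "inv\<^bsub>Aut\<^esub> \<phi> = \<psi>" "\<And>x. x \<in> Y \<Longrightarrow> \<phi> (\<psi> x) = x"
    "\<And>x. x \<in> Y \<Longrightarrow> \<psi> x \<in> Y" "\<And>x. x \<in> Y \<Longrightarrow> \<phi> x \<in> Y"
proof -
  obtain \<psi> where r: "regular_self_map I Y \<phi>" "regular_self_map I Y \<psi>" "\<And>x. x \<in> Y \<Longrightarrow> \<phi> (\<psi> x) = x" "\<And>x. x \<in> Y \<Longrightarrow> \<psi> (\<phi> x) = x"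
    using \<phi> unfolding Aut_var_iff by blast
  have Y: "\<And>x. x \<in> Y \<Longrightarrow> \<psi> x \<in> Y" "\<And>x. x \<in> Y \<Longrightarrow> \<phi> x \<in> Y" using r by (auto simp: regular_self_map_def)
  obtain \<kappa> c where m: "\<kappa> \<in> Perm" "\<And>v. v \<in> I \<Longrightarrow> c v \<noteq> 0" "\<And>v x. v \<in> I \<Longrightarrow> x \<in> Y \<Longrightarrow> \<phi> x v = c v * x (\<kappa> v)"
  proof (rule automorphism_monomial[OF rigid r])
    fix \<kappa> c
    assume "\<kappa> \<in> Perm" "\<And>v. v \<in> I \<Longrightarrow> c v \<noteq> 0" "\<And>v x. v \<in> I \<Longrightarrow> x \<in> Y \<Longrightarrow> \<phi> x v = c v * x (\<kappa> v)"
    then show thesis by (rule that)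
  qed
  let ?\<psi> = "\<lambda>x\<in>Y. \<psi> x"
  have A: "?\<psi> \<in> carrier Aut" by (rule Aut_varI[OF r(2,1,4,3)])
  have "inv\<^bsub>Aut\<^esub> \<phi> = ?\<psi>" by (rule Aut_var_inv[OF \<phi> A]) (simp add: r Y)
  then show thesis using that[OF m(1) m(3) m(2) A] r(3) Y by simp
qed

lemma torus_subgroup: "subgroup (torus_action ` H) Aut"
proof (rule group.subgroupI[OF group_Aut_var])
  show "torus_action ` H \<subseteq> carrier Aut" using torus_action_Aut by blast
  show "torus_action ` H \<noteq> {}" using big_torus_one by blast
  show "inv\<^bsub>Aut\<^esub> a \<in> torus_action ` H" if a: "a \<in> torus_action ` H" for a
  proof -
    obtain t where t: "t \<in> H" "a = torus_action t" using a by blast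
    have "inv\<^bsub>Aut\<^esub> a = torus_action (\<lambda>v. inverse (t v))"
      unfolding t(2)
      by (rule Aut_var_inv[OF torus_action_Aut[OF t(1)] torus_action_Aut[OF big_torus_inverse[OF t(1)]]])
        (simp add: torus_action_def diag_Y diag_inverse t(1))
    then show ?thesis using big_torus_inverse[OF t(1)] by blast
  qed
  show "a \<otimes>\<^bsub>Aut\<^esub> c \<in> torus_action ` H" if ac: "a \<in> torus_action ` H" "c \<in> torus_action ` H" for a c
  proof -
    obtain s t where st: "s \<in> H" "a = torus_action s" "t \<in> H" "c = torus_action t" using ac by blast
    show ?thesis unfolding st(2,4) torus_action_mult[OF st(1,3)] by (intro imageI big_torus_mult st)
  qed
qed

lemma Perm_subgroup: "subgroup (perm_action Y ` Perm) Aut"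
proof (rule group.subgroupI[OF group_Aut_var])
  show "perm_action Y ` Perm \<subseteq> carrier Aut" using perm_action_Aut by blast
  show "perm_action Y ` Perm \<noteq> {}" using Perm_id by blast
  show "inv\<^bsub>Aut\<^esub> a \<in> perm_action Y ` Perm" if "a \<in> perm_action Y ` Perm" for a
    using that perm_action_inv Perm_inv by blast
  show "a \<otimes>\<^bsub>Aut\<^esub> c \<in> perm_action Y ` Perm" if ac: "a \<in> perm_action Y ` Perm" "c \<in> perm_action Y ` Perm" for a c
  proof -
    obtain \<sigma> \<tau> where st: "\<sigma> \<in> Perm" "a = perm_action Y \<sigma>" "\<tau> \<in> Perm" "c = perm_action Y \<tau>" using ac by blast
    show ?thesis unfolding st(2,4) perm_action_mult[OF st(1,3)] by (intro imageI Perm_comp st)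
  qed
qed

text \<open>Conjugating by a monomial map permutes the entries of \<open>t\<close>; the permuted
  vector preserves \<open>Y\<close>, being a conjugate of a map that does, and therefore belongs to
  \<open>H\<close>.\<close>

lemma torus_normal: assumes rigid: "rigid I Y" shows "torus_action ` H \<lhd> Aut"
  unfolding group.normal_inv_iff[OF group_Aut_var]
proof (intro conjI ballI torus_subgroup)
  fix \<phi> h assume \<phi>: "\<phi> \<in> carrier Aut" and h: "h \<in> torus_action ` H"
  obtain t where t: "t \<in> H" "h = torus_action t" using h by blast
  obtain \<kappa> c \<psi> where m: "\<kappa> \<in> Perm" "\<And>v x. v \<in> I \<Longrightarrow> x \<in> Y \<Longrightarrow> \<phi> x v = c v * x (\<kappa> v)"
    "\<And>v. v \<in> I \<Longrightarrow> c v \<noteq> 0" "\<psi> \<in> carrier Aut" "inv\<^bsub>Aut\<^esub> \<phi> = \<psi>" "\<And>x. x \<in> Y \<Longrightarrow> \<phi> (\<psi> x) = x"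
    "\<And>x. x \<in> Y \<Longrightarrow> \<psi> x \<in> Y" "\<And>x. x \<in> Y \<Longrightarrow> \<phi> x \<in> Y"
  proof (rule Aut_monomial[OF rigid \<phi>])
    fix \<kappa> c \<psi>
    assume a: "\<kappa> \<in> Perm" "\<And>v x. v \<in> I \<Longrightarrow> x \<in> Y \<Longrightarrow> \<phi> x v = c v * x (\<kappa> v)"
      "\<And>v. v \<in> I \<Longrightarrow> c v \<noteq> 0" "\<psi> \<in> carrier Aut" "inv\<^bsub>Aut\<^esub> \<phi> = \<psi>" "\<And>x. x \<in> Y \<Longrightarrow> \<phi> (\<psi> x) = x"
      "\<And>x. x \<in> Y \<Longrightarrow> \<psi> x \<in> Y" "\<And>x. x \<in> Y \<Longrightarrow> \<phi> x \<in> Y"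
    show thesis by (rule that[OF a])
  qed
  have \<kappa>I: "\<kappa> v \<in> I \<longleftrightarrow> v \<in> I" for v using permutes_in_image[OF Perm_permutes[OF m(1)]] .
  have eq: "\<phi> (diag I t (\<psi> x)) = diag I (\<lambda>v. t (\<kappa> v)) x" if x: "x \<in> Y" for x
  proof (rule extensionalityI[of _ I])
    have y: "diag I t (\<psi> x) \<in> Y" by (rule diag_Y[OF t(1) m(7)[OF x]])
    show "\<phi> (diag I t (\<psi> x)) \<in> extensional I" using m(8)[OF y] by (simp add: Y_iff)
    show "diag I (\<lambda>v. t (\<kappa> v)) x \<in> extensional I" by (simp add: diag_def)
    fix v assume v: "v \<in> I"
    have "\<phi> (diag I t (\<psi> x)) v = t (\<kappa> v) * (c v * \<psi> x (\<kappa> v))"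
      using m(2)[OF v y] v \<kappa>I by (simp add: diag_def)
    also have "\<dots> = t (\<kappa> v) * x v" using m(2)[OF v m(7)[OF x]] m(6)[OF x] by simp
    finally show "\<phi> (diag I t (\<psi> x)) v = diag I (\<lambda>v. t (\<kappa> v)) x v" using v by (simp add: diag_def)
  qed
  have tH: "(\<lambda>v. t (\<kappa> v)) \<in> H"
  proof (rule diag_Y_imp_big_torus)
    show "t (\<kappa> v) \<noteq> 0" if "v \<in> I" for v using t(1) \<kappa>I that by (simp add: big_torus_def)
    show "diag I (\<lambda>v. t (\<kappa> v)) x \<in> Y" if "x \<in> Y" for x
      using eq[OF that, symmetric] m(8)[OF diag_Y[OF t(1) m(7)[OF that]]] by simp
  qed
  note tA = torus_action_Aut[OF t(1)]
  have c1: "\<phi> \<otimes>\<^bsub>Aut\<^esub> torus_action t \<in> carrier Aut"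
    by (rule monoid.m_closed[OF group.is_monoid[OF group_Aut_var] \<phi> tA])
  have "\<phi> \<otimes>\<^bsub>Aut\<^esub> torus_action t \<otimes>\<^bsub>Aut\<^esub> \<psi> = (\<lambda>x\<in>Y. (\<phi> \<otimes>\<^bsub>Aut\<^esub> torus_action t) (\<psi> x))"
    by (rule Aut_var_mult[OF c1 m(4)])
  also have "\<dots> = torus_action (\<lambda>v. t (\<kappa> v))"
    unfolding torus_action_def[of "\<lambda>v. t (\<kappa> v)"]
  proof (rule restrict_ext)
    fix x assume x: "x \<in> Y"
    have "(\<phi> \<otimes>\<^bsub>Aut\<^esub> torus_action t) (\<psi> x) = \<phi> (torus_action t (\<psi> x))"
      using m(7)[OF x] by (simp add: Aut_var_mult[OF \<phi> tA])
    also have "torus_action t (\<psi> x) = diag I t (\<psi> x)" using m(7)[OF x] by (simp add: torus_action_def)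
    finally show "(\<phi> \<otimes>\<^bsub>Aut\<^esub> torus_action t) (\<psi> x) = diag I (\<lambda>v. t (\<kappa> v)) x" using eq[OF x] by simp
  qed
  finally have "\<phi> \<otimes>\<^bsub>Aut\<^esub> h \<otimes>\<^bsub>Aut\<^esub> \<psi> = torus_action (\<lambda>v. t (\<kappa> v))" unfolding t(2) .
  then show "\<phi> \<otimes>\<^bsub>Aut\<^esub> h \<otimes>\<^bsub>Aut\<^esub> inv\<^bsub>Aut\<^esub> \<phi> \<in> torus_action ` H" using tH m(5) by simp
qed

lemma Perm_torus_product:
  assumes rigid: "rigid I Y" shows "perm_action Y ` Perm <#>\<^bsub>Aut\<^esub> torus_action ` H = carrier Aut"
proof
  show "perm_action Y ` Perm <#>\<^bsub>Aut\<^esub> torus_action ` H \<subseteq> carrier Aut"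
    unfolding set_mult_def using perm_action_Aut torus_action_Aut monoid.m_closed[OF group.is_monoid[OF group_Aut_var]] by blast
  show "carrier Aut \<subseteq> perm_action Y ` Perm <#>\<^bsub>Aut\<^esub> torus_action ` H"
  proof
    fix \<phi> assume \<phi>: "\<phi> \<in> carrier Aut"
    obtain \<kappa> c where m: "\<kappa> \<in> Perm" "\<And>v x. v \<in> I \<Longrightarrow> x \<in> Y \<Longrightarrow> \<phi> x v = c v * x (\<kappa> v)"
      "\<And>v. v \<in> I \<Longrightarrow> c v \<noteq> 0" "\<And>x. x \<in> Y \<Longrightarrow> \<phi> x \<in> Y"
    proof (rule Aut_monomial[OF rigid \<phi>])
      fix \<kappa> c \<psi>
      assume a: "\<kappa> \<in> Perm" "\<And>v x. v \<in> I \<Longrightarrow> x \<in> Y \<Longrightarrow> \<phi> x v = c v * x (\<kappa> v)"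
        "\<And>v. v \<in> I \<Longrightarrow> c v \<noteq> 0" "\<psi> \<in> carrier Aut" "inv\<^bsub>Aut\<^esub> \<phi> = \<psi>" "\<And>x. x \<in> Y \<Longrightarrow> \<phi> (\<psi> x) = x"
        "\<And>x. x \<in> Y \<Longrightarrow> \<psi> x \<in> Y" "\<And>x. x \<in> Y \<Longrightarrow> \<phi> x \<in> Y"
      show thesis by (rule that[OF a(1,2,3,8)])
    qed
    let ?\<tau> = "inv_fun \<kappa>"
    \<comment> \<open>\<open>perm_action\<close> composes with the inverse, so the permutation
      factor of \<open>\<phi>\<close> is \<open>?\<tau>\<close>, and the scalars are re-indexed
      accordingly.\<close>
    define t where "t v = c (?\<tau> v)" for v
    have p: "\<kappa> permutes I" using m(1) Perm_permutes by blast
    have \<tau>I: "?\<tau> v \<in> I \<longleftrightarrow> v \<in> I" for v using permutes_in_image[OF permutes_inv[OF p]] .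
    have inv\<kappa>: "\<kappa> (?\<tau> v) = v" "?\<tau> (\<kappa> v) = v" for v using permutes_inverses[OF p] by auto
    have ii: "inv_fun ?\<tau> = \<kappa>" by (rule permutes_inv_inv[OF p])
    have eq: "diag I t x = \<phi> x \<circ> ?\<tau>" if x: "x \<in> Y" for x
    proof (rule extensionalityI[of _ I])
      show "diag I t x \<in> extensional I" by (simp add: diag_def)
      show "\<phi> x \<circ> ?\<tau> \<in> extensional I" using Perm_Y[OF Perm_inv[OF m(1)] m(4)[OF x]] by (simp add: Y_iff)
      fix v assume v: "v \<in> I"
      then have "?\<tau> v \<in> I" using \<tau>I by simp
      then show "diag I t x v = (\<phi> x \<circ> ?\<tau>) v" using m(2)[OF _ x] v inv\<kappa>(1) by (simp add: diag_def t_def)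
    qed
    have tH: "t \<in> H"
    proof (rule diag_Y_imp_big_torus)
      show "t v \<noteq> 0" if "v \<in> I" for v using m(3) \<tau>I that by (simp add: t_def)
      show "diag I t x \<in> Y" if "x \<in> Y" for x
        unfolding eq[OF that] by (rule Perm_Y[OF Perm_inv[OF m(1)] m(4)[OF that]])
    qed
    have "perm_action Y ?\<tau> \<otimes>\<^bsub>Aut\<^esub> torus_action t = \<phi>"
    proof (rule extensionalityI[of _ Y])
      show "perm_action Y ?\<tau> \<otimes>\<^bsub>Aut\<^esub> torus_action t \<in> extensional Y" "\<phi> \<in> extensional Y"
        using \<phi> by (auto simp: Aut_var_mult[OF perm_action_Aut[OF Perm_inv[OF m(1)]] torus_action_Aut[OF tH]] Aut_var_iff)
      fix x assume x: "x \<in> Y"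
      have "(perm_action Y ?\<tau> \<otimes>\<^bsub>Aut\<^esub> torus_action t) x = perm_action Y ?\<tau> (torus_action t x)"
        using x by (simp add: Aut_var_mult[OF perm_action_Aut[OF Perm_inv[OF m(1)]] torus_action_Aut[OF tH]])
      also have "\<dots> = \<phi> x \<circ> ?\<tau> \<circ> \<kappa>"
        using x diag_Y[OF tH x] by (simp only: perm_action_def torus_action_def restrict_apply' ii eq[OF x, symmetric])
      finally show "(perm_action Y ?\<tau> \<otimes>\<^bsub>Aut\<^esub> torus_action t) x = \<phi> x"
        by (simp only: Perm_inv_comp(2)[OF m(1)])
    qed
    then show "\<phi> \<in> perm_action Y ` Perm <#>\<^bsub>Aut\<^esub> torus_action ` H"
      unfolding set_mult_def using Perm_inv[OF m(1)] tH by blast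
  qed
qed

lemma Perm_torus_disjoint: "perm_action Y ` Perm \<inter> torus_action ` H = {\<one>\<^bsub>Aut\<^esub>}"
proof
  show "{\<one>\<^bsub>Aut\<^esub>} \<subseteq> perm_action Y ` Perm \<inter> torus_action ` H"
    using subgroup.one_closed[OF Perm_subgroup] subgroup.one_closed[OF torus_subgroup] by simp
  show "perm_action Y ` Perm \<inter> torus_action ` H \<subseteq> {\<one>\<^bsub>Aut\<^esub>}"
  proof
    fix a assume "a \<in> perm_action Y ` Perm \<inter> torus_action ` H"
    then obtain \<tau> t where a: "\<tau> \<in> Perm" "t \<in> H" "a = perm_action Y \<tau>" "a = torus_action t" by blast
    have "x (inv_fun \<tau> v) = t v * x (inv_fun id v)" if x: "x \<in> Y" and v: "v \<in> I" for x v
    proof -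
      have "perm_action Y \<tau> x v = torus_action t x v" using a(3,4) by simp
      then show ?thesis using x v by (simp add: perm_action_def torus_action_def diag_def inv_id)
    qed
    then have "\<tau> = id" using perm_torus_action_eq[OF a(1) Perm_id, of t] a(2) by (simp add: big_torus_def)
    then show "a \<in> {\<one>\<^bsub>Aut\<^esub>}" using a(3) perm_action_id by simp
  qed
qed

lemma quasitorus_action_eq:
  assumes "\<phi> \<in> quasitorus_points K" shows "quasitorus_action I Y (tri_weight n l) \<phi> = torus_action (qt \<phi>)"
  by (simp add: quasitorus_action_def torus_action_def diag_def qt_def[OF assms])

lemma carrier_quasitorus: "carrier (quasitorus K) = (quasitorus_points K :: (((idx \<Rightarrow>\<^sub>0 int) set \<Rightarrow>\<^sub>0 'a) \<Rightarrow> 'a) set)"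
  by (simp add: quasitorus_def)

lemma torus_action_cong: "(\<And>v. v \<in> I \<Longrightarrow> s v = t v) \<Longrightarrow> torus_action s = torus_action t"
  unfolding torus_action_def diag_def by (intro restrict_ext) simp

lemma quasitorus_image: "quasitorus_action I Y (tri_weight n l) ` carrier (quasitorus K) = torus_action ` H"
proof
  show "quasitorus_action I Y (tri_weight n l) ` carrier (quasitorus K) \<subseteq> torus_action ` H"
    unfolding carrier_quasitorus using quasitorus_action_eq qt_big_torus by blast
  show "torus_action ` H \<subseteq> quasitorus_action I Y (tri_weight n l) ` carrier (quasitorus K)"
  proof
    fix a assume "a \<in> torus_action ` H"
    then obtain t where t: "t \<in> H" "a = torus_action t" by blast
    obtain \<phi> where \<phi>: "\<phi> \<in> quasitorus_points K" "\<And>v. v \<in> I \<Longrightarrow> qt \<phi> v = t v" using quasitorus_points_surj[OF t(1)] by metis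
    have "a = quasitorus_action I Y (tri_weight n l) \<phi>"
      unfolding quasitorus_action_eq[OF \<phi>(1)] t(2) by (rule torus_action_cong) (simp add: \<phi>(2))
    then show "a \<in> quasitorus_action I Y (tri_weight n l) ` carrier (quasitorus K)"
      unfolding carrier_quasitorus using \<phi>(1) by blast
  qed
qed

lemma quasitorus_action_mon: "quasitorus_action I Y (tri_weight n l) \<in> mon (quasitorus K) Aut"
  unfolding mon_def mem_Collect_eq
proof (intro conjI homI inj_onI; unfold carrier_quasitorus)
  show "quasitorus_action I Y (tri_weight n l) \<phi> \<in> carrier Aut" if "\<phi> \<in> quasitorus_points K" for \<phi> :: "((idx \<Rightarrow>\<^sub>0 int) set \<Rightarrow>\<^sub>0 'a) \<Rightarrow> 'a"
    unfolding quasitorus_action_eq[OF that] by (rule torus_action_Aut[OF qt_big_torus[OF that]])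
next
  fix \<phi> \<psi> :: "((idx \<Rightarrow>\<^sub>0 int) set \<Rightarrow>\<^sub>0 'a) \<Rightarrow> 'a" assume a: "\<phi> \<in> quasitorus_points K" "\<psi> \<in> quasitorus_points K"
  have m: "(\<phi> \<otimes>\<^bsub>quasitorus K\<^esub> \<psi>) (group_char (tri_weight n l v)) = qt \<phi> v * qt \<psi> v" if v: "v \<in> I" for v
  proof -
    have "(group_char (tri_weight n l v) :: (idx \<Rightarrow>\<^sub>0 int) set \<Rightarrow>\<^sub>0 'a) \<in> carrier Q"
      unfolding weight_eq using v by (intro group_char_Q cs_K) simp
    then show ?thesis using qt_def[OF a(1), of v] qt_def[OF a(2), of v] by (simp add: quasitorus_def group_char_def)
  qed
  have "quasitorus_action I Y (tri_weight n l) (\<phi> \<otimes>\<^bsub>quasitorus K\<^esub> \<psi>) = torus_action (\<lambda>v. qt \<phi> v * qt \<psi> v)"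
    unfolding quasitorus_action_def torus_action_def diag_def by (intro restrict_ext) (simp add: m)
  then show "quasitorus_action I Y (tri_weight n l) (\<phi> \<otimes>\<^bsub>quasitorus K\<^esub> \<psi>)
      = quasitorus_action I Y (tri_weight n l) \<phi> \<otimes>\<^bsub>Aut\<^esub> quasitorus_action I Y (tri_weight n l) \<psi>"
    unfolding quasitorus_action_eq[OF a(1)] quasitorus_action_eq[OF a(2)]
      torus_action_mult[OF qt_big_torus[OF a(1)] qt_big_torus[OF a(2)]] .
next
  fix \<phi> \<psi> :: "((idx \<Rightarrow>\<^sub>0 int) set \<Rightarrow>\<^sub>0 'a) \<Rightarrow> 'a"
  assume a: "\<phi> \<in> quasitorus_points K" "\<psi> \<in> quasitorus_points K"
    and eq: "quasitorus_action I Y (tri_weight n l) \<phi> = quasitorus_action I Y (tri_weight n l) \<psi>"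
  show "\<phi> = \<psi>"
    by (rule quasitorus_points_eqI[OF a], rule torus_action_eq_imp)
      (use eq in \<open>simp_all only: quasitorus_action_eq[OF a(1)] quasitorus_action_eq[OF a(2)]\<close>)
qed

lemma carrier_perm_group: "carrier (perm_group I (trinomial n l :: (idx, 'a) mp)) = Perm"
  by (simp add: perm_group_def Perm_def)

lemma perm_action_mon: "perm_action Y \<in> mon (perm_group I (trinomial n l :: (idx, 'a) mp)) Aut"
  unfolding mon_def mem_Collect_eq
proof (intro conjI homI; unfold carrier_perm_group)
  show "inj_on (perm_action Y) Perm" by (rule perm_action_inj)
  show "perm_action Y \<tau> \<in> carrier Aut" if "\<tau> \<in> Perm" for \<tau> by (rule perm_action_Aut[OF that])
  show "perm_action Y (\<sigma> \<otimes>\<^bsub>perm_group I (trinomial n l :: (idx, 'a) mp)\<^esub> \<tau>) = perm_action Y \<sigma> \<otimes>\<^bsub>Aut\<^esub> perm_action Y \<tau>"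
    if "\<sigma> \<in> Perm" "\<tau> \<in> Perm" for \<sigma> \<tau>
    using perm_action_mult[OF that] by (simp add: perm_group_def)
qed

lemma semidirect_product:
  assumes "rigid I Y"
  shows "internal_semidirect Aut (perm_action Y ` carrier (perm_group I (trinomial n l :: (idx, 'a) mp)))
    (quasitorus_action I Y (tri_weight n l) ` carrier (quasitorus K))"
  unfolding internal_semidirect_def carrier_perm_group quasitorus_image
  using group_Aut_var Perm_subgroup torus_normal[OF assms] Perm_torus_product[OF assms] Perm_torus_disjoint by blast

end

theorem theorem3:
  fixes n :: "nat \<Rightarrow> nat" and l :: "nat \<Rightarrow> nat \<Rightarrow> nat"
    and f :: "(idx, 'a::{alg_closed_field, field_char_0}) mp"
    and Y :: "(idx \<Rightarrow> 'a) set"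
    and P :: "(idx \<Rightarrow> idx) monoid"
    and H :: "(((idx \<Rightarrow>\<^sub>0 int) set \<Rightarrow>\<^sub>0 'a) \<Rightarrow> 'a) monoid"
  defines "f \<equiv> trinomial n l"
    and "Y \<equiv> trinomial_hypersurface n l"
    and "P \<equiv> perm_group (tri_idx n) f"
    and "H \<equiv> quasitorus (tri_class_group n l)"
  assumes blocks: "\<And>i. i \<le> 2 \<Longrightarrow> n i > 0"
    and exponents: "\<And>i j. (i, j) \<in> tri_idx n \<Longrightarrow> l i j > 0"
    and no_linear_term: "\<And>i. i \<le> 2 \<Longrightarrow> n i * l i 1 > 1"
    and rigid: "rigid (tri_idx n) Y"
  shows "perm_action Y \<in> mon P (Aut_var (tri_idx n) Y) \<and>
    quasitorus_action (tri_idx n) Y (tri_weight n l) \<in> mon H (Aut_var (tri_idx n) Y) \<and>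
    internal_semidirect (Aut_var (tri_idx n) Y)
      (perm_action Y ` carrier P)
      (quasitorus_action (tri_idx n) Y (tri_weight n l) ` carrier H)"
proof -
  interpret trinomial_data n l Y
    by standard (use blocks exponents no_linear_term in \<open>simp_all add: Y_def\<close>)
  show ?thesis
    unfolding P_def H_def f_def
    using perm_action_mon quasitorus_action_mon semidirect_product[OF rigid] by blast
qed

end
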